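(* Let $s\in(\frac34,1)$ and $p=2_s^{*}-1=\frac{3+2s}{3-2s}$. Suppose that either $V$ is a positive constant, or $V:\mathbb{R}^3\to\mathbb{R}$ satisfies: $(V_1)$ $V\in C^1(\mathbb{R}^3,\mathbb{R})$, the function $x\mapsto (x,\nabla V(x))$ belongs to $L^{\infty}(\mathbb{R}^3)\cup L^{\frac{2_s^{*}}{2_s^{*}-2}}(\mathbb{R}^3)$, and $2sV(x)+(x,\nabla V(x))\ge 0$ for all $x\in\mathbb{R}^3$; and $(V_2)$ $V(x)\le \liminf_{|y|\to+\infty}V(y)=V_\infty\in\mathbb{R}^{+}$ for all $x\in\mathbb{R}^3$, and the inequality is strict on a subset of positive Lebesgue measure. Then the system $$(-\Delta)^su+V(x)u+\phi u=|u|^{p-1}u\ \text{ in }\mathbb{R}^3,\qquad (-\Delta)^s\phi=u^2\ \text{ in }\mathbb{R}^3$$ has no nontrivial solution $(u,\phi)\in H^s(\mathbb{R}^3)\times\mathcal{D}^{s,2}(\mathbb{R}^3)$; that is, every solution satisfies $u=0$ and $\phi=0$.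
   Context: Functions are real-valued; $(\cdot,\cdot)$ is the usual inner product of $\mathbb{R}^3$; $2_s^{*}=\frac{6}{3-2s}$. $(-\Delta)^{s}$ is defined by $\mathcal{F}((-\Delta)^su)=|\xi|^{2s}\mathcal{F}u$, and $(-\Delta)^{s/2}$ likewise with $|\xi|^{s}$. $H^s(\mathbb{R}^3)$ is the usual fractional Sobolev space, and $\mathcal{D}^{s,2}(\mathbb{R}^3)=\{u\in L^{2_s^*}(\mathbb{R}^3): |\xi|^s\hat u\in L^2(\mathbb{R}^3)\}$, the completion of $C_0^\infty(\mathbb{R}^3)$ with respect to $\big(\int|(-\Delta)^{s/2}u|^2dx\big)^{1/2}$. A (weak) solution is a pair $(u,\phi)\in H^s(\mathbb{R}^3)\times\mathcal{D}^{s,2}(\mathbb{R}^3)$ such that $\int_{\mathbb{R}^3}(-\Delta)^{s/2}\phi(-\Delta)^{s/2}v\,dx=\int_{\mathbb{R}^3}u^2v\,dx$ for all $v\in\mathcal{D}^{s,2}(\mathbb{R}^3)$ and $\int_{\mathbb{R}^3}\big((-\Delta)^{s/2}u(-\Delta)^{s/2}v+V(x)uv+\phi uv-|u|^{p-1}uv\big)dx=0$ for all $v\in H^s(\mathbb{R}^3)$. *)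

theory Defs
  imports "HOL-Analysis.Analysis"
begin

text \<open>Elements of the function spaces below are honest functions, measurable with respect to
  \<open>lebesgue\<close>; the identification of almost everywhere equal functions is made explicit where
  it matters.\<close>

definition Lp :: "real \<Rightarrow> (real^3 \<Rightarrow> 'a::real_normed_vector) set" where
  "Lp q = {f \<in> borel_measurable lebesgue. integrable lebesgue (\<lambda>x. norm (f x) powr q)}"

definition Linfinity :: "(real^3 \<Rightarrow> 'a::real_normed_vector) set" where
  "Linfinity = {f \<in> borel_measurable lebesgue. \<exists>C. AE x in lebesgue. norm (f x) \<le> C}"

definition partial_deriv :: "3 \<Rightarrow> (real^3 \<Rightarrow> complex) \<Rightarrow> real^3 \<Rightarrow> complex" where
  "partial_deriv i f x = frechet_derivative f (at x) (axis i 1)"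

definition iter_partial :: "3 list \<Rightarrow> (real^3 \<Rightarrow> complex) \<Rightarrow> real^3 \<Rightarrow> complex" where
  "iter_partial is f = foldr partial_deriv is f"

definition schwartz :: "(real^3 \<Rightarrow> complex) set" where
  "schwartz = {f. \<forall>is. (\<forall>x. iter_partial is f differentiable (at x)) \<and>
      (\<forall>k::nat. \<exists>C. \<forall>x. norm x ^ k * norm (iter_partial is f x) \<le> C)}"

definition fourier_schwartz :: "(real^3 \<Rightarrow> complex) \<Rightarrow> real^3 \<Rightarrow> complex" where
  "fourier_schwartz \<psi> \<xi> =
     of_real ((2 * pi) powr (- 3 / 2)) * (LINT x|lebesgue. exp (- \<i> * of_real (x \<bullet> \<xi>)) * \<psi> x)"

text \<open>The Fourier transform of a real function \<open>u\<close> in the sense of tempered distributions, in the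
  case that it is again a function \<open>g\<close> (then unique almost everywhere). On \<open>L\<^sup>2\<close> this is the
  Plancherel transform. The distributional definition is needed for \<open>Dspace\<close>, whose elements lie
  in an \<open>L\<^sup>q\<close> with \<open>q > 2\<close> only.\<close>

definition is_fourier_transform :: "(real^3 \<Rightarrow> real) \<Rightarrow> (real^3 \<Rightarrow> complex) \<Rightarrow> bool" where
  "is_fourier_transform u g \<longleftrightarrow>
     u \<in> borel_measurable lebesgue \<and> g \<in> borel_measurable lebesgue \<and>
     (\<forall>\<psi>\<in>schwartz.
        integrable lebesgue (\<lambda>x. of_real (u x) * fourier_schwartz \<psi> x) \<and>
        integrable lebesgue (\<lambda>\<xi>. g \<xi> * \<psi> \<xi>) \<and>
        (LINT x|lebesgue. of_real (u x) * fourier_schwartz \<psi> x) = (LINT \<xi>|lebesgue. g \<xi> * \<psi> \<xi>))"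

text \<open>\<open>frac_laplacian \<sigma> u\<close> is \<open>(-\<Delta>)\<^sup>\<sigma> u\<close>, the real function (determined up to null sets) whose
  Fourier transform is \<open>|\<xi>|\<close> to the power \<open>2 \<sigma>\<close> times that of \<open>u\<close>. It is used below only for
  \<open>\<sigma> = s / 2\<close> and \<open>u\<close> in \<open>Hspace s\<close> or \<open>Dspace s\<close>, where such a function exists, and lies in
  \<open>L\<^sup>2\<close>, by Plancherel's theorem; it can be taken real-valued because the symbol is even.\<close>

definition frac_laplacian :: "real \<Rightarrow> (real^3 \<Rightarrow> real) \<Rightarrow> real^3 \<Rightarrow> real" where
  "frac_laplacian \<sigma> u =
     (SOME w. \<exists>g. is_fourier_transform u g \<and>
        is_fourier_transform w (\<lambda>\<xi>. of_real (norm \<xi> powr (2 * \<sigma>)) * g \<xi>))"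

definition crit_exp :: "real \<Rightarrow> real" where
  "crit_exp s = 6 / (3 - 2 * s)"

definition Hspace :: "real \<Rightarrow> (real^3 \<Rightarrow> real) set" where
  "Hspace s = {u \<in> Lp 2. \<exists>g. is_fourier_transform u g \<and>
      (\<lambda>\<xi>. of_real ((1 + (norm \<xi>)\<^sup>2) powr (s / 2)) * g \<xi>) \<in> Lp 2}"

definition Dspace :: "real \<Rightarrow> (real^3 \<Rightarrow> real) set" where
  "Dspace s = {u \<in> Lp (crit_exp s). \<exists>g. is_fourier_transform u g \<and>
      (\<lambda>\<xi>. of_real (norm \<xi> powr s) * g \<xi>) \<in> Lp 2}"

text \<open>The Bochner integral of a non-integrable function is \<open>0\<close>. This convention plays no role
  here: for \<open>s \<in> (3/4, 1)\<close>, \<open>p = crit_exp s - 1\<close> and bounded continuous \<open>V\<close>, all integrands are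
  integrable by the Sobolev and Hoelder inequalities. Every \<open>V\<close> with \<open>V1 s V\<close> and \<open>V2 V\<close> is
  bounded, since \<open>t \<mapsto> t\<^sup>2\<^sup>s V (t x)\<close> is then nondecreasing and so \<open>V \<ge> 0\<close>.\<close>

definition weak_solution ::
  "real \<Rightarrow> real \<Rightarrow> (real^3 \<Rightarrow> real) \<Rightarrow> (real^3 \<Rightarrow> real) \<Rightarrow> (real^3 \<Rightarrow> real) \<Rightarrow> bool" where
  "weak_solution s p V u \<phi> \<longleftrightarrow>
     u \<in> Hspace s \<and> \<phi> \<in> Dspace s \<and>
     (\<forall>v\<in>Dspace s.
        (LINT x|lebesgue. frac_laplacian (s / 2) \<phi> x * frac_laplacian (s / 2) v x)
          = (LINT x|lebesgue. (u x)\<^sup>2 * v x)) \<and>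
     (\<forall>v\<in>Hspace s.
        (LINT x|lebesgue. frac_laplacian (s / 2) u x * frac_laplacian (s / 2) v x
            + V x * u x * v x + \<phi> x * u x * v x - \<bar>u x\<bar> powr (p - 1) * u x * v x) = 0)"

definition grad :: "(real^3 \<Rightarrow> real) \<Rightarrow> real^3 \<Rightarrow> real^3" where
  "grad V x = (THE D. GDERIV V x :> D)"

definition C1 :: "(real^3 \<Rightarrow> real) \<Rightarrow> bool" where
  "C1 V \<longleftrightarrow> (\<forall>x. GDERIV V x :> grad V x) \<and> continuous_on UNIV (grad V)"

definition V1 :: "real \<Rightarrow> (real^3 \<Rightarrow> real) \<Rightarrow> bool" where
  "V1 s V \<longleftrightarrow> C1 V \<and>
     (\<lambda>x. x \<bullet> grad V x) \<in> Linfinity \<union> Lp (crit_exp s / (crit_exp s - 2)) \<and>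
     (\<forall>x. 2 * s * V x + x \<bullet> grad V x \<ge> 0)"

definition V2 :: "(real^3 \<Rightarrow> real) \<Rightarrow> bool" where
  "V2 V \<longleftrightarrow> (\<exists>Vinf::real. Vinf > 0 \<and>
     Liminf at_infinity (\<lambda>y. ereal (V y)) = ereal Vinf \<and>
     (\<forall>x. V x \<le> Vinf) \<and>
     emeasure lebesgue {x. V x < Vinf} > 0)"

end

theory Submission
  imports Defs "HOL-Probability.Probability"
begin

lemma borel_measurable_affine [measurable]:
  fixes t :: "'a::euclidean_space"
  shows "(\<lambda>x. t + c *\<^sub>R x) \<in> borel_measurable borel"
  by simp

lemma integrable_lborel_affine_iff:
  fixes f :: "'a::euclidean_space \<Rightarrow> 'b::{banach, second_countable_topology}"
  assumes [measurable]: "f \<in> borel_measurable borel" and c: "c \<noteq> 0"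
  shows "integrable lborel (\<lambda>x. f (t + c *\<^sub>R x)) \<longleftrightarrow> integrable lborel f"
proof -
  have "integrable lborel f \<longleftrightarrow> integrable (density (distr lborel borel (\<lambda>x. t + c *\<^sub>R x)) (\<lambda>_. ennreal (\<bar>c\<bar>^DIM('a)))) f"
    using lborel_affine[OF c, of t] by simp
  also have "\<dots> \<longleftrightarrow> integrable (distr lborel borel (\<lambda>x. t + c *\<^sub>R x)) (\<lambda>x. \<bar>c\<bar>^DIM('a) *\<^sub>R f x)"
    by (subst integrable_density) auto
  also have "\<dots> \<longleftrightarrow> integrable lborel (\<lambda>x. \<bar>c\<bar>^DIM('a) *\<^sub>R f (t + c *\<^sub>R x))"
    by (subst integrable_distr_eq) auto
  also have "\<dots> \<longleftrightarrow> integrable lborel (\<lambda>x. f (t + c *\<^sub>R x))"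
  proof
    assume "integrable lborel (\<lambda>x. \<bar>c\<bar>^DIM('a) *\<^sub>R f (t + c *\<^sub>R x))"
    from integrable_scaleR_right[OF this, of "inverse (\<bar>c\<bar>^DIM('a))"]
    show "integrable lborel (\<lambda>x. f (t + c *\<^sub>R x))" using c by simp
  qed (rule integrable_scaleR_right)
  finally show ?thesis by simp
qed

lemma integral_lborel_affine:
  fixes f :: "'a::euclidean_space \<Rightarrow> 'b::{banach, second_countable_topology}"
  assumes [measurable]: "f \<in> borel_measurable borel" and c: "c \<noteq> 0"
  shows "(LINT x|lborel. f (t + c *\<^sub>R x)) = (LINT x|lborel. f x) /\<^sub>R \<bar>c\<bar>^DIM('a)"
proof -
  have "(LINT x|lborel. f x) = (LINT x|density (distr lborel borel (\<lambda>x. t + c *\<^sub>R x)) (\<lambda>_. ennreal (\<bar>c\<bar>^DIM('a))). f x)"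
    using lborel_affine[OF c, of t] by simp
  also have "\<dots> = (LINT x|distr lborel borel (\<lambda>x. t + c *\<^sub>R x). \<bar>c\<bar>^DIM('a) *\<^sub>R f x)"
    by (subst integral_density) auto
  also have "\<dots> = (LINT x|lborel. \<bar>c\<bar>^DIM('a) *\<^sub>R f (t + c *\<^sub>R x))"
    by (subst integral_distr) auto
  finally show ?thesis using c by simp
qed

lemma integrable_lborel_dilate_iff:
  fixes f :: "real^3 \<Rightarrow> 'b::{banach, second_countable_topology}"
  assumes "f \<in> borel_measurable borel" "c \<noteq> 0"
  shows "integrable lborel (\<lambda>x. f (c *\<^sub>R x)) \<longleftrightarrow> integrable lborel f"
  using integrable_lborel_affine_iff[OF assms, of 0] by simp

lemma integral_lborel_dilate:
  fixes f :: "real^3 \<Rightarrow> 'b::{banach, second_countable_topology}"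
  assumes "f \<in> borel_measurable borel" "c > 0"
  shows "(LINT x|lborel. f (c *\<^sub>R x)) = (LINT x|lborel. f x) /\<^sub>R c^3"
  using integral_lborel_affine[OF assms(1), of c 0] assms by simp

lemma integrable_lborel_translate_iff:
  fixes f :: "'a::euclidean_space \<Rightarrow> 'b::{banach, second_countable_topology}"
  assumes "f \<in> borel_measurable borel"
  shows "integrable lborel (\<lambda>x. f (x + z)) \<longleftrightarrow> integrable lborel f"
  using integrable_lborel_affine_iff[OF assms, of 1 z] by (simp add: add.commute)

lemma integral_lborel_translate:
  fixes f :: "'a::euclidean_space \<Rightarrow> 'b::{banach, second_countable_topology}"
  assumes "f \<in> borel_measurable borel"
  shows "(LINT x|lborel. f (x + z)) = (LINT x|lborel. f x)"
  using integral_lborel_affine[OF assms, of 1 z] by (simp add: add.commute)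

lemma integrable_lborel_reflect_iff:
  fixes f :: "'a::euclidean_space \<Rightarrow> 'b::{banach, second_countable_topology}"
  assumes "f \<in> borel_measurable borel"
  shows "integrable lborel (\<lambda>x. f (- x)) \<longleftrightarrow> integrable lborel f"
  using integrable_lborel_affine_iff[OF assms, of "-1" 0] by simp

lemma integral_lborel_reflect:
  fixes f :: "'a::euclidean_space \<Rightarrow> 'b::{banach, second_countable_topology}"
  assumes "f \<in> borel_measurable borel"
  shows "(LINT x|lborel. f (- x)) = (LINT x|lborel. f x)"
  using integral_lborel_affine[OF assms, of "-1" 0] by simp

lemma AE_lborel_affine:
  fixes t :: "'a::euclidean_space"
  assumes "AE x in lborel. P x" and c: "c \<noteq> 0"
  shows "AE x in lborel. P (t + c *\<^sub>R x)"
proof -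
  from assms(1) obtain N where N: "N \<in> null_sets lborel" "{x. \<not> P x} \<subseteq> N"
    by (auto elim!: AE_E3 simp: eventually_ae_filter)
  then have [measurable]: "N \<in> sets borel" by (auto simp: null_sets_def)
  have "AE x in lborel. x \<notin> N" using N by (simp add: AE_not_in)
  then have "AE x in density (distr lborel borel (\<lambda>x. t + c *\<^sub>R x)) (\<lambda>_. ennreal (\<bar>c\<bar>^DIM('a))). x \<notin> N"
    using arg_cong[OF lborel_affine[OF c, of t], of "\<lambda>M. AE x in M. x \<notin> N"] by blast
  then have "AE x in lborel. t + c *\<^sub>R x \<notin> N"
    using c by (subst (asm) AE_density, simp, subst (asm) AE_distr_iff, auto)
  then show ?thesis by (rule AE_mp) (use N(2) in \<open>auto intro!: AE_I2\<close>)
qed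

subsection \<open>products\<close>

lemma
  fixes f :: "'a::euclidean_space \<Rightarrow> real \<Rightarrow> complex"
  assumes f: "\<And>b. b \<in> Basis \<Longrightarrow> integrable lborel (f b)"
  shows integrable_lborel_prod: "integrable lborel (\<lambda>x. \<Prod>b\<in>Basis. f b (x \<bullet> b))"
    and integral_lborel_prod: "(LINT x|lborel. (\<Prod>b\<in>Basis. f b (x \<bullet> b))) = (\<Prod>b\<in>Basis. LINT t|lborel. f b t)"
proof -
  interpret product_sigma_finite "\<lambda>b::'a. lborel :: real measure" ..
  have m[measurable]: "f b \<in> borel_measurable borel" if "b \<in> Basis" for b
    using f[OF that] by (auto dest: borel_measurable_integrable)
  have e: "(\<Prod>b\<in>Basis. f b ((\<Sum>c\<in>Basis. y c *\<^sub>R c) \<bullet> b)) = (\<Prod>b\<in>Basis. f b (y b))" for y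
    by (intro prod.cong) (auto simp: inner_sum_left inner_Basis if_distrib cong: if_cong)
  show "integrable lborel (\<lambda>x. \<Prod>b\<in>Basis. f b (x \<bullet> b))"
    by (subst lborel_eq, subst integrable_distr_eq)
       (auto simp: e intro!: product_integrable_prod f borel_measurable_prod)
  show "(LINT x|lborel. (\<Prod>b\<in>Basis. f b (x \<bullet> b))) = (\<Prod>b\<in>Basis. LINT t|lborel. f b t)"
    apply (subst (1) lborel_eq)
    apply (subst integral_distr)
      apply (auto simp: e intro!: product_integral_prod f borel_measurable_prod)
    done
qed

lemma borel_measurable_cis [measurable]: "cis \<in> borel_measurable borel"
  by (intro borel_measurable_continuous_onI continuous_intros)

lemma fourier_gaussian_real:
  fixes a \<xi> :: real
  assumes a: "a > 0"
  shows "integrable lborel (\<lambda>t. exp (- (\<i> * of_real (t * \<xi>))) * of_real (exp (- a * t\<^sup>2)))" (is "integrable lborel ?g")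
    and "(LINT t|lborel. exp (- (\<i> * of_real (t * \<xi>))) * of_real (exp (- a * t\<^sup>2)))
      = of_real (sqrt (pi / a) * exp (- \<xi>\<^sup>2 / (4 * a)))"
proof -
  define c where "c = sqrt (2 * a)"
  have c: "c > 0" "c\<^sup>2 = 2 * a" using a by (auto simp: c_def)
  define z where "z = - \<xi> / c"
  have std: "(LINT x|lborel. std_normal_density x *\<^sub>R cis (z * x)) = of_real (exp (- z\<^sup>2 / 2))"
  proof -
    have "(LINT x|lborel. std_normal_density x *\<^sub>R cis (z * x)) = char std_normal_distribution z"
      unfolding char_def by (subst integral_density) (auto simp: cis_conv_exp)
    then show ?thesis by (simp add: char_std_normal_distribution)
  qed
  have i: "integrable lborel (\<lambda>x. std_normal_density x *\<^sub>R cis (z * x))"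
    by (rule Bochner_Integration.integrable_bound[of lborel "std_normal_density"]) auto
  have g: "?g t = sqrt (2 * pi) *\<^sub>R (std_normal_density (0 + c * t) *\<^sub>R cis (z * (0 + c * t)))" for t
  proof -
    have 1: "z * (0 + c * t) = - (t * \<xi>)" using c by (simp add: z_def)
    have 2: "sqrt (2 * pi) * std_normal_density (0 + c * t) = exp (- a * t\<^sup>2)"
      using c by (simp add: std_normal_density_def power_mult_distrib)
    have 3: "exp (- (\<i> * of_real (t * \<xi>))) = cis (- (t * \<xi>))" by (simp add: cis_conv_exp)
    show ?thesis unfolding 1 3 scaleR_scaleR 2 by (simp add: scaleR_conv_of_real mult.commute)
  qed
  have "has_bochner_integral lborel (\<lambda>t. std_normal_density (0 + c * t) *\<^sub>R cis (z * (0 + c * t))) (of_real (exp (- z\<^sup>2 / 2)) /\<^sub>R \<bar>c\<bar>)"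
    by (subst lborel_has_bochner_integral_real_affine_iff[symmetric])
      (use c std i in \<open>auto simp: has_bochner_integral_iff\<close>)
  then have *: "has_bochner_integral lborel ?g (sqrt (2 * pi) *\<^sub>R (of_real (exp (- z\<^sup>2 / 2)) /\<^sub>R \<bar>c\<bar>))"
    unfolding g by (rule has_bochner_integral_scaleR_right)
  then show "integrable lborel ?g" by (auto simp: has_bochner_integral_iff)
  have 1: "sqrt (2 * pi) / c = sqrt (pi / a)" using a by (simp add: c_def real_sqrt_mult real_sqrt_divide)
  have 2: "- z\<^sup>2 / 2 = - \<xi>\<^sup>2 / (4 * a)" using c a by (simp add: z_def power_divide)
  have "sqrt (2 * pi) *\<^sub>R (complex_of_real E /\<^sub>R \<bar>c\<bar>) = of_real (sqrt (2 * pi) / c * E)" for E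
    using c by (simp add: scaleR_conv_of_real divide_inverse)
  then have "sqrt (2 * pi) *\<^sub>R (complex_of_real (exp (- z\<^sup>2 / 2)) /\<^sub>R \<bar>c\<bar>) = of_real (sqrt (pi / a) * exp (- \<xi>\<^sup>2 / (4 * a)))"
    unfolding 1 2 .
  then show "(LINT t|lborel. ?g t) = of_real (sqrt (pi / a) * exp (- \<xi>\<^sup>2 / (4 * a)))"
    using * unfolding has_bochner_integral_iff by simp
qed

lemma norm_sq_Basis: "(norm (x::'a::euclidean_space))\<^sup>2 = (\<Sum>b\<in>Basis. (x \<bullet> b)\<^sup>2)"
  by (subst power2_norm_eq_inner, subst euclidean_inner) (simp add: power2_eq_square)

lemma fourier_gaussian:
  fixes \<xi> :: "'a::euclidean_space"
  assumes a: "a > 0"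
  shows integrable_gaussian_exp: "integrable lborel (\<lambda>x. exp (- (\<i> * of_real (x \<bullet> \<xi>))) * of_real (exp (- a * (norm x)\<^sup>2)))"
    and integral_gaussian_exp: "(LINT x|lborel. exp (- (\<i> * of_real (x \<bullet> \<xi>))) * of_real (exp (- a * (norm x)\<^sup>2)))
      = of_real (sqrt (pi / a) ^ DIM('a) * exp (- (norm \<xi>)\<^sup>2 / (4 * a)))"
proof -
  define f where "f b t = exp (- (\<i> * of_real (t * (\<xi> \<bullet> b)))) * complex_of_real (exp (- a * t\<^sup>2))" for b t
  have e: "exp (- (\<i> * of_real (x \<bullet> \<xi>))) * of_real (exp (- a * (norm x)\<^sup>2)) = (\<Prod>b\<in>Basis. f b (x \<bullet> b))" for x
  proof -
    have "(\<Prod>b\<in>Basis. f b (x \<bullet> b)) = exp (\<Sum>b\<in>Basis. - (\<i> * of_real ((x \<bullet> b) * (\<xi> \<bullet> b)))) * of_real (exp (\<Sum>b\<in>Basis. - a * (x \<bullet> b)\<^sup>2))"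
      unfolding f_def prod.distrib by (subst exp_sum, simp)+ (simp only: of_real_prod)
    also have "(\<Sum>b\<in>Basis. - (\<i> * of_real ((x \<bullet> b) * (\<xi> \<bullet> b)))) = - (\<i> * of_real (x \<bullet> \<xi>))"
      unfolding euclidean_inner[of x \<xi>] of_real_sum sum_negf sum_distrib_left ..
    also have "(\<Sum>b\<in>Basis. - a * (x \<bullet> b)\<^sup>2) = - a * (norm x)\<^sup>2"
      unfolding norm_sq_Basis[of x] sum_distrib_left ..
    finally show ?thesis by simp
  qed
  have i: "integrable lborel (f b)" for b
    unfolding f_def by (rule fourier_gaussian_real(1)[OF a])
  show "integrable lborel (\<lambda>x. exp (- (\<i> * of_real (x \<bullet> \<xi>))) * of_real (exp (- a * (norm x)\<^sup>2)))"
    unfolding e by (rule integrable_lborel_prod[of f, OF i])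
  have 1: "(LINT t|lborel. f b t) = of_real (sqrt (pi / a) * exp (- (\<xi> \<bullet> b)\<^sup>2 / (4 * a)))" for b
    unfolding f_def by (rule fourier_gaussian_real(2)[OF a])
  have "(\<Prod>b\<in>(Basis::'a set). sqrt (pi / a) * exp (- (\<xi> \<bullet> b)\<^sup>2 / (4 * a)))
     = sqrt (pi / a) ^ DIM('a) * exp (\<Sum>b\<in>Basis. - (\<xi> \<bullet> b)\<^sup>2 / (4 * a))"
    by (subst exp_sum) (auto simp: prod.distrib)
  also have "(\<Sum>b\<in>Basis. - (\<xi> \<bullet> b)\<^sup>2 / (4 * a)) = - (norm \<xi>)\<^sup>2 / (4 * a)"
    unfolding norm_sq_Basis[of \<xi>] sum_divide_distrib[symmetric] sum_negf by (rule refl)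
  finally have 2: "(\<Prod>b\<in>(Basis::'a set). sqrt (pi / a) * exp (- (\<xi> \<bullet> b)\<^sup>2 / (4 * a)))
     = sqrt (pi / a) ^ DIM('a) * exp (- (norm \<xi>)\<^sup>2 / (4 * a))" .
  have "(\<Prod>b\<in>(Basis::'a set). LINT t|lborel. f b t) = (\<Prod>b\<in>(Basis::'a set). of_real (sqrt (pi / a) * exp (- (\<xi> \<bullet> b)\<^sup>2 / (4 * a))))"
    by (rule prod.cong[OF refl 1])
  also have "\<dots> = of_real (sqrt (pi / a) ^ DIM('a) * exp (- (norm \<xi>)\<^sup>2 / (4 * a)))"
    by (subst 2[symmetric]) (rule of_real_prod[symmetric])
  finally show "(LINT x|lborel. exp (- (\<i> * of_real (x \<bullet> \<xi>))) * of_real (exp (- a * (norm x)\<^sup>2)))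
      = of_real (sqrt (pi / a) ^ DIM('a) * exp (- (norm \<xi>)\<^sup>2 / (4 * a)))"
    unfolding e integral_lborel_prod[of f, OF i] .
qed

lemma
  assumes a: "a > 0"
  shows integrable_gaussian: "integrable lborel (\<lambda>x::'a::euclidean_space. exp (- a * (norm x)\<^sup>2))"
    and integral_gaussian: "(LINT x::'a|lborel. exp (- a * (norm x)\<^sup>2)) = sqrt (pi / a) ^ DIM('a)"
proof -
  have *: "exp (- (\<i> * of_real (x \<bullet> 0))) * of_real (exp (- a * (norm x)\<^sup>2)) = complex_of_real (exp (- a * (norm x)\<^sup>2))" for x :: 'a
    by (simp only: inner_zero_right of_real_0 mult_zero_right minus_zero exp_zero mult_1_left)
  have "integrable lborel (\<lambda>x::'a. complex_of_real (exp (- a * (norm x)\<^sup>2)))"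
    using integrable_gaussian_exp[OF a, of "0::'a"] unfolding * .
  then show "integrable lborel (\<lambda>x::'a. exp (- a * (norm x)\<^sup>2))" 
    by (simp only: complex_of_real_integrable_eq)
  have "complex_of_real (LINT x::'a|lborel. exp (- a * (norm x)\<^sup>2)) = of_real (sqrt (pi / a) ^ DIM('a))"
    using integral_gaussian_exp[OF a, of "0::'a"] unfolding * integral_complex_of_real by (simp only: norm_zero power_zero_numeral minus_zero div_0 exp_zero mult_1_right)
  then show "(LINT x::'a|lborel. exp (- a * (norm x)\<^sup>2)) = sqrt (pi / a) ^ DIM('a)"
    by (rule of_real_eq_iff[THEN iffD1])
qed

lemma integrable_inverse_quadratics:
  "integrable lborel (\<lambda>x::'a::euclidean_space. (\<Prod>b\<in>Basis. inverse (1 + (x \<bullet> b)\<^sup>2)))"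
proof -
  have "set_integrable lborel (einterval (-\<infinity>) \<infinity>) (\<lambda>x. inverse (1 + x\<^sup>2))"
    using integrable_inverse_1_plus_square .
  then have "integrable lborel (\<lambda>t::real. inverse (1 + t\<^sup>2))" by (simp add: set_integrable_def)
  then have "integrable lborel (\<lambda>t::real. complex_of_real (inverse (1 + t\<^sup>2)))"
    by (simp only: complex_of_real_integrable_eq)
  then have "integrable lborel (\<lambda>x::'a. \<Prod>b\<in>Basis. complex_of_real (inverse (1 + (x \<bullet> b)\<^sup>2)))"
    by (intro integrable_lborel_prod)
  then have "integrable lborel (\<lambda>x::'a. complex_of_real (\<Prod>b\<in>Basis. (inverse (1 + (x \<bullet> b)\<^sup>2))))"
    by simp
  then show ?thesis by (simp only: complex_of_real_integrable_eq)
qed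

subsection \<open>Square integrable functions\<close>

lemma integrable_mult_L2:
  fixes f g :: "'a \<Rightarrow> 'b::{real_normed_algebra, banach, second_countable_topology}"
  assumes [measurable]: "f \<in> borel_measurable M" "g \<in> borel_measurable M"
    and "integrable M (\<lambda>x. (norm (f x))\<^sup>2)" "integrable M (\<lambda>x. (norm (g x))\<^sup>2)"
  shows "integrable M (\<lambda>x. f x * g x)"
proof (rule Bochner_Integration.integrable_bound[OF Bochner_Integration.integrable_add[OF assms(3,4)]])
  show "AE x in M. norm (f x * g x) \<le> norm ((norm (f x))\<^sup>2 + (norm (g x))\<^sup>2)"
  proof (rule AE_I2)
    fix x
    have "norm (f x * g x) \<le> norm (f x) * norm (g x)" by (rule norm_mult_ineq)
    also have "\<dots> \<le> (norm (f x))\<^sup>2 + (norm (g x))\<^sup>2"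
      using sum_squares_bound[of "norm (f x)" "norm (g x)"] mult_nonneg_nonneg[OF norm_ge_zero norm_ge_zero, of "f x" "g x"]
      by linarith
    finally show "norm (f x * g x) \<le> norm ((norm (f x))\<^sup>2 + (norm (g x))\<^sup>2)" by simp
  qed
qed auto

lemma square_norm_add_le: "(norm (a + b :: 'b::real_normed_vector))\<^sup>2 \<le> 2 * (norm a)\<^sup>2 + 2 * (norm b)\<^sup>2"
proof -
  have "(norm (a + b))\<^sup>2 \<le> (norm a + norm b)\<^sup>2" by (simp add: norm_triangle_ineq power_mono)
  also have "\<dots> \<le> 2 * (norm a)\<^sup>2 + 2 * (norm b)\<^sup>2"
    using sum_squares_bound[of "norm a" "norm b"] by (simp add: power2_sum)
  finally show ?thesis .
qed

lemma integrable_add_L2: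
  fixes f g :: "'a \<Rightarrow> 'b::{banach, second_countable_topology}"
  assumes [measurable]: "f \<in> borel_measurable M" "g \<in> borel_measurable M"
    and "integrable M (\<lambda>x. (norm (f x))\<^sup>2)" "integrable M (\<lambda>x. (norm (g x))\<^sup>2)"
  shows "integrable M (\<lambda>x. (norm (f x + g x))\<^sup>2)"
proof (rule Bochner_Integration.integrable_bound[of M "\<lambda>x. 2 * (norm (f x))\<^sup>2 + 2 * (norm (g x))\<^sup>2"])
  show "integrable M (\<lambda>x. 2 * (norm (f x))\<^sup>2 + 2 * (norm (g x))\<^sup>2)" using assms by simp
  show "AE x in M. norm ((norm (f x + g x))\<^sup>2) \<le> norm (2 * (norm (f x))\<^sup>2 + 2 * (norm (g x))\<^sup>2)"
    using square_norm_add_le[of "f _" "g _"] by (intro AE_I2) simp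
qed simp

text \<open>Cauchy--Schwarz, obtained by optimising \<open>2 \<bar>a b\<bar> \<le> r a\<^sup>2 + b\<^sup>2 / r\<close> over \<open>r\<close>.\<close>

lemma Cauchy_Schwarz_integral:
  fixes f g :: "'a \<Rightarrow> 'b::{real_normed_algebra, banach, second_countable_topology}"
  assumes [measurable]: "f \<in> borel_measurable M" "g \<in> borel_measurable M"
    and f: "integrable M (\<lambda>x. (norm (f x))\<^sup>2)" and g: "integrable M (\<lambda>x. (norm (g x))\<^sup>2)"
  shows "(norm (LINT x|M. f x * g x))\<^sup>2 \<le> (LINT x|M. (norm (f x))\<^sup>2) * (LINT x|M. (norm (g x))\<^sup>2)"
proof -
  define A B C where "A = (LINT x|M. (norm (f x))\<^sup>2)" and "B = (LINT x|M. (norm (g x))\<^sup>2)"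
    and "C = (LINT x|M. norm (f x) * norm (g x))"
  have i: "integrable M (\<lambda>x. norm (f x) * norm (g x))"
    using integrable_mult_L2[of "\<lambda>x. norm (f x)" M "\<lambda>x. norm (g x)"] f g by simp
  have AB: "A \<ge> 0" "B \<ge> 0" "C \<ge> 0" by (auto simp: A_def B_def C_def)
  have 1: "norm (LINT x|M. f x * g x) \<le> C"
    unfolding C_def
    by (rule order_trans[OF integral_norm_bound integral_mono[OF integrable_norm[OF integrable_mult_L2[OF assms]] i norm_mult_ineq]])
  have key: "2 * C * r \<le> r\<^sup>2 * A + B" for r
  proof -
    have "(LINT x|M. 2 * r * (norm (f x) * norm (g x))) \<le> (LINT x|M. r\<^sup>2 * (norm (f x))\<^sup>2 + (norm (g x))\<^sup>2)"
    proof (rule integral_mono)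
      fix x
      show "2 * r * (norm (f x) * norm (g x)) \<le> r\<^sup>2 * (norm (f x))\<^sup>2 + (norm (g x))\<^sup>2"
        using sum_squares_bound[of "r * norm (f x)" "norm (g x)"] by (simp add: power_mult_distrib algebra_simps)
    qed (use i f g in auto)
    then show ?thesis using i f g by (simp add: A_def B_def C_def mult.commute mult.left_commute)
  qed
  have "C\<^sup>2 \<le> A * B"
  proof (cases "A = 0")
    case True
    have "C \<le> 0"
    proof (rule ccontr)
      assume "\<not> C \<le> 0"
      then show False using key[of "(B + 1) / (2 * C)"] True by (simp add: field_simps)
    qed
    then show ?thesis using AB True by simp
  next
    case False
    then have "A > 0" using AB by simp
    then show ?thesis using key[of "C / A"] by (simp add: field_simps power2_eq_square)
  qed
  moreover have "(norm (LINT x|M. f x * g x))\<^sup>2 \<le> C\<^sup>2" using 1 by (simp add: power_mono)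
  ultimately show ?thesis by (simp add: A_def B_def)
qed

section \<open>Schwartz functions\<close>

definition modulated_gaussian :: "real \<Rightarrow> real^3 \<Rightarrow> real^3 \<Rightarrow> real^3 \<Rightarrow> complex" where
  "modulated_gaussian a b c x = exp (of_real (b \<bullet> x - a * (x \<bullet> x)) + \<i> * of_real (c \<bullet> x))"

inductive_set polynomial_multiples :: "(real^3 \<Rightarrow> complex) \<Rightarrow> (real^3 \<Rightarrow> complex) set"
  for e :: "real^3 \<Rightarrow> complex" where
  base: "e \<in> polynomial_multiples e"
| coord: "f \<in> polynomial_multiples e \<Longrightarrow> (\<lambda>x. of_real (x $ i) * f x) \<in> polynomial_multiples e"
| const: "f \<in> polynomial_multiples e \<Longrightarrow> (\<lambda>x. k * f x) \<in> polynomial_multiples e"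
| add: "f \<in> polynomial_multiples e \<Longrightarrow> g \<in> polynomial_multiples e \<Longrightarrow> (\<lambda>x. f x + g x) \<in> polynomial_multiples e"

lemma partial_deriv_eqI:
  assumes "(f has_derivative D) (at x)"
  shows "partial_deriv i f x = D (axis i 1)"
  unfolding partial_deriv_def using frechet_derivative_at[OF assms] by simp

lemma has_derivative_modulated_gaussian:
  "(modulated_gaussian a b c has_derivative
     (\<lambda>h. (of_real (b \<bullet> h - 2 * a * (x \<bullet> h)) + \<i> * of_real (c \<bullet> h)) * modulated_gaussian a b c x)) (at x)"
proof -
  have 1: "((\<lambda>x. of_real (b \<bullet> x - a * (x \<bullet> x)) + \<i> * complex_of_real (c \<bullet> x)) has_derivative
     (\<lambda>h. of_real (b \<bullet> h - 2 * a * (x \<bullet> h)) + \<i> * of_real (c \<bullet> h))) (at x)"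
    by (rule has_derivative_eq_rhs) (auto intro!: derivative_eq_intros has_derivative_of_real simp: fun_eq_iff inner_commute algebra_simps)
  show ?thesis
    unfolding modulated_gaussian_def
    using has_derivative_compose[OF 1 DERIV_exp[unfolded has_field_derivative_def]] by (simp only: mult.commute)
qed

lemma polynomial_multiples_derivative:
  assumes "f \<in> polynomial_multiples (modulated_gaussian a b c)"
  shows "\<exists>D. (\<forall>x. (f has_derivative D x) (at x)) \<and>
    (\<forall>i. (\<lambda>x. D x (axis i 1)) \<in> polynomial_multiples (modulated_gaussian a b c))"
  using assms
proof induction
  case base
  let ?g = "modulated_gaussian a b c"
  have "(\<lambda>x. (of_real (b \<bullet> axis i 1 - 2 * a * (x \<bullet> axis i 1)) + \<i> * of_real (c \<bullet> axis i 1)) * ?g x)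
     = (\<lambda>x. (of_real (b $ i) + \<i> * of_real (c $ i)) * ?g x + (- 2 * of_real a) * (of_real (x $ i) * ?g x))" for i
    by (simp add: inner_axis fun_eq_iff algebra_simps)
  moreover have "\<dots> i \<in> polynomial_multiples ?g" for i
    by (intro polynomial_multiples.intros)
  ultimately show ?case
    by (intro exI[of _ "\<lambda>x h. (of_real (b \<bullet> h - 2 * a * (x \<bullet> h)) + \<i> * of_real (c \<bullet> h)) * ?g x"] conjI allI
        has_derivative_modulated_gaussian) simp
next
  case (coord f i)
  let ?g = "modulated_gaussian a b c"
  from coord obtain D where D: "\<And>x. (f has_derivative D x) (at x)" "\<And>i. (\<lambda>x. D x (axis i 1)) \<in> polynomial_multiples ?g"
    by auto
  have "((\<lambda>x. of_real (x $ i) * f x) has_derivative (\<lambda>h. of_real (x $ i) * D x h + of_real (h $ i) * f x)) (at x)" for x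
    by (intro has_derivative_mult D bounded_linear_imp_has_derivative
        bounded_linear_compose[OF bounded_linear_of_real bounded_linear_vec_nth])
  moreover have "(\<lambda>x. of_real (x $ i) * D x (axis j 1) + of_real (axis j 1 $ i) * f x) \<in> polynomial_multiples ?g" for j
    by (intro polynomial_multiples.intros coord D)
  ultimately show ?case by (intro exI[of _ "\<lambda>x h. of_real (x $ i) * D x h + of_real (h $ i) * f x"]) auto
next
  case (const f k)
  let ?g = "modulated_gaussian a b c"
  from const obtain D where D: "\<And>x. (f has_derivative D x) (at x)" "\<And>i. (\<lambda>x. D x (axis i 1)) \<in> polynomial_multiples ?g"
    by auto
  show ?case
    by (intro exI[of _ "\<lambda>x h. k * D x h"] conjI allI has_derivative_mult_right D polynomial_multiples.const)
next
  case (add f g')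
  let ?g = "modulated_gaussian a b c"
  from add obtain D where D: "\<And>x. (f has_derivative D x) (at x)" "\<And>i. (\<lambda>x. D x (axis i 1)) \<in> polynomial_multiples ?g"
    by auto
  from add obtain D' where D': "\<And>x. (g' has_derivative D' x) (at x)" "\<And>i. (\<lambda>x. D' x (axis i 1)) \<in> polynomial_multiples ?g"
    by auto
  show ?case
    by (intro exI[of _ "\<lambda>x h. D x h + D' x h"] conjI allI has_derivative_add D D' polynomial_multiples.add)
qed

lemma power_le_exp:
  fixes t :: real
  assumes "t \<ge> 0"
  shows "t ^ k \<le> (real k) ^ k * exp t"
proof (cases "k = 0")
  case False
  have "t / real k \<le> exp (t / real k)"
    using exp_ge_add_one_self[of "t / real k"] by linarith
  then have "(t / real k) ^ k \<le> exp (t / real k) ^ k" using assms by (intro power_mono) auto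
  also have "exp (t / real k) ^ k = exp t" using False by (simp flip: exp_of_nat_mult)
  finally show ?thesis using False by (simp add: power_divide field_simps)
qed (use assms in simp)

lemma polynomial_multiples_decay:
  assumes "f \<in> polynomial_multiples (modulated_gaussian a b c)" and a: "a > 0"
  shows "\<exists>C. \<forall>x. norm x ^ k * norm (f x) \<le> C"
  using assms(1)
proof (induction arbitrary: k)
  case base
  define M where "M = norm b + 1"
  have "norm x ^ k * norm (modulated_gaussian a b c x) \<le> real k ^ k * exp (M\<^sup>2 / (4 * a))" for x
  proof -
    define t where "t = norm x"
    have t: "t \<ge> 0" "x \<bullet> x = t\<^sup>2" by (auto simp: t_def power2_norm_eq_inner)
    have "norm (modulated_gaussian a b c x) = exp (b \<bullet> x - a * t\<^sup>2)"
      by (simp add: modulated_gaussian_def t)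
    also have "\<dots> \<le> exp (norm b * t - a * t\<^sup>2)"
      using norm_cauchy_schwarz[of b x] by (simp add: t_def)
    finally have "norm x ^ k * norm (modulated_gaussian a b c x) \<le> (real k ^ k * exp t) * exp (norm b * t - a * t\<^sup>2)"
      using power_le_exp[OF t(1), of k] by (intro mult_mono) (auto simp: t_def)
    also have "\<dots> = real k ^ k * exp (M * t - a * t\<^sup>2)" by (simp add: M_def algebra_simps flip: exp_add)
    also have "M * t - a * t\<^sup>2 \<le> M\<^sup>2 / (4 * a)"
    proof -
      have "M\<^sup>2 / (4 * a) - (M * t - a * t\<^sup>2) = (M - 2 * a * t)\<^sup>2 / (4 * a)"
        using a by (simp add: field_simps power2_eq_square)
      also have "\<dots> \<ge> 0" using a by simp
      finally show ?thesis by linarith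
    qed
    finally show ?thesis by (simp add: mult_left_mono)
  qed
  then show ?case by blast
next
  case (coord f i)
  then obtain C where C: "\<And>x. norm x ^ Suc k * norm (f x) \<le> C" by meson
  have "norm x ^ k * norm (of_real (x $ i) * f x) \<le> C" for x
  proof -
    have "norm x ^ k * norm (of_real (x $ i) * f x) = norm x ^ k * (\<bar>x $ i\<bar> * norm (f x))"
      by (simp add: norm_mult)
    also have "\<dots> \<le> norm x ^ k * (norm x * norm (f x))"
      by (intro mult_left_mono mult_right_mono component_le_norm_cart) auto
    finally show ?thesis using C[of x] by (simp add: mult_ac)
  qed
  then show ?case by blast
next
  case (const f l)
  then obtain C where C: "\<And>x. norm x ^ k * norm (f x) \<le> C" by meson
  have "norm x ^ k * norm (l * f x) \<le> norm l * C" for x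
    using mult_left_mono[OF C[of x], of "norm l"] by (simp add: norm_mult mult_ac)
  then show ?case by blast
next
  case (add f g)
  then obtain C C' where C: "\<And>x. norm x ^ k * norm (f x) \<le> C" "\<And>x. norm x ^ k * norm (g x) \<le> C'" by meson
  have "norm x ^ k * norm (f x + g x) \<le> C + C'" for x
  proof -
    have "norm x ^ k * norm (f x + g x) \<le> norm x ^ k * (norm (f x) + norm (g x))"
      by (intro mult_left_mono norm_triangle_ineq) auto
    then show ?thesis using C[of x] by (simp add: distrib_left)
  qed
  then show ?case by blast
qed

lemma polynomial_multiples_schwartz:
  assumes "f \<in> polynomial_multiples (modulated_gaussian a b c)" and "a > 0"
  shows "f \<in> schwartz"
proof -
  let ?P = "polynomial_multiples (modulated_gaussian a b c)"
  have 1: "partial_deriv i f \<in> ?P" if f: "f \<in> ?P" for i f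
  proof -
    obtain D where D: "\<And>x. (f has_derivative D x) (at x)" "\<And>i. (\<lambda>x. D x (axis i 1)) \<in> ?P"
      using polynomial_multiples_derivative[OF f] by auto
    then have "partial_deriv i f = (\<lambda>x. D x (axis i 1))" by (simp add: fun_eq_iff partial_deriv_eqI)
    then show ?thesis using D by simp
  qed
  have "iter_partial is f \<in> ?P" for "is"
    unfolding iter_partial_def using assms(1) by (induction "is") (auto intro: 1)
  then show ?thesis
    unfolding schwartz_def using polynomial_multiples_derivative polynomial_multiples_decay[OF _ assms(2)]
    by (auto simp: differentiable_def) blast+
qed

lemma translated_gaussian_schwartz:
  assumes "a > 0"
  shows "(\<lambda>x. of_real (exp (- a * (norm (x - b))\<^sup>2))) \<in> schwartz"
proof -
  have "of_real (exp (- a * (norm (x - b))\<^sup>2))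
     = of_real (exp (- a * (b \<bullet> b))) * modulated_gaussian a ((2 * a) *\<^sub>R b) 0 x" for x
  proof -
    have "- a * (norm (x - b))\<^sup>2 = - a * (b \<bullet> b) + (((2 * a) *\<^sub>R b) \<bullet> x - a * (x \<bullet> x))"
      unfolding power2_norm_eq_inner by (simp add: inner_diff_left inner_diff_right inner_commute algebra_simps)
    moreover have "modulated_gaussian a B 0 x = of_real (exp (B \<bullet> x - a * (x \<bullet> x)))" for B
      by (simp only: modulated_gaussian_def inner_zero_left of_real_0 mult_zero_right add_0_right exp_of_real)
    ultimately show ?thesis by (simp only: exp_add of_real_mult)
  qed
  then show ?thesis
    using polynomial_multiples_schwartz[OF polynomial_multiples.const[OF polynomial_multiples.base] assms] by simp
qed

lemma modulated_centred_gaussian_schwartz: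
  assumes "a > 0"
  shows "(\<lambda>\<xi>. cis (b \<bullet> \<xi>) * of_real (exp (- a * (norm \<xi>)\<^sup>2))) \<in> schwartz"
proof -
  have "cis (b \<bullet> \<xi>) * of_real (exp (- a * (norm \<xi>)\<^sup>2)) = modulated_gaussian a 0 b \<xi>" for \<xi>
  proof -
    have "0 \<bullet> \<xi> - a * (\<xi> \<bullet> \<xi>) = - a * (norm \<xi>)\<^sup>2" by (simp add: power2_norm_eq_inner)
    then show ?thesis unfolding modulated_gaussian_def exp_add exp_of_real cis_conv_exp by (simp only: mult.commute)
  qed
  then show ?thesis
    using polynomial_multiples_schwartz[OF polynomial_multiples.base assms] by simp
qed

lemma schwartz_dilate:
  assumes f: "f \<in> schwartz" and c: "c \<noteq> 0"
  shows "(\<lambda>x. f (c *\<^sub>R x)) \<in> schwartz"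
proof -
  have d: "iter_partial is f differentiable (at x)" for "is" x
    using f by (auto simp: schwartz_def)
  have h: "((\<lambda>x. of_real k * iter_partial is f (c *\<^sub>R x)) has_derivative
      (\<lambda>h. of_real k * (frechet_derivative (iter_partial is f) (at (c *\<^sub>R x)) (c *\<^sub>R h)))) (at x)" for "is" x k
  proof -
    have 1: "(iter_partial is f has_derivative frechet_derivative (iter_partial is f) (at (c *\<^sub>R x))) (at (c *\<^sub>R x))"
      using d frechet_derivative_works by blast
    have 2: "((\<lambda>x. c *\<^sub>R x) has_derivative (\<lambda>h. c *\<^sub>R h)) (at x)"
      by (auto intro!: derivative_eq_intros)
    show ?thesis
      using has_derivative_mult_right[OF has_derivative_compose[OF 2 1], of "of_real k"] by simp
  qed
  have it: "iter_partial is (\<lambda>x. f (c *\<^sub>R x)) = (\<lambda>x. of_real (c ^ length is) * iter_partial is f (c *\<^sub>R x))" for "is"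
  proof (induction "is")
    case Nil
    then show ?case by (simp add: iter_partial_def)
  next
    case (Cons i "is")
    have "iter_partial (i # is) (\<lambda>x. f (c *\<^sub>R x)) = partial_deriv i (iter_partial is (\<lambda>x. f (c *\<^sub>R x)))"
      by (simp add: iter_partial_def)
    also have "\<dots> = partial_deriv i (\<lambda>x. of_real (c ^ length is) * iter_partial is f (c *\<^sub>R x))"
      by (simp only: Cons)
    also have "\<dots> = (\<lambda>x. of_real (c ^ length is) * (frechet_derivative (iter_partial is f) (at (c *\<^sub>R x)) (c *\<^sub>R axis i 1)))"
      using h by (auto simp only: fun_eq_iff intro!: partial_deriv_eqI)
    also have "\<dots> = (\<lambda>x. of_real (c ^ length (i # is)) * iter_partial (i # is) f (c *\<^sub>R x))"
    proof
      fix x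
      have "linear (frechet_derivative (iter_partial is f) (at (c *\<^sub>R x)))"
        using d by (rule linear_frechet_derivative)
      then show "of_real (c ^ length is) * (frechet_derivative (iter_partial is f) (at (c *\<^sub>R x)) (c *\<^sub>R axis i 1))
         = of_real (c ^ length (i # is)) * iter_partial (i # is) f (c *\<^sub>R x)"
        by (simp add: linear_cmul iter_partial_def partial_deriv_def scaleR_conv_of_real[where 'a=complex])
    qed
    finally show ?case .
  qed
  have "\<exists>C. \<forall>x. norm x ^ k * norm (of_real (c ^ length is) * iter_partial is f (c *\<^sub>R x)) \<le> C" for "is" k
  proof -
    obtain C where C: "\<And>x. norm x ^ k * norm (iter_partial is f x) \<le> C"
      using f by (auto simp: schwartz_def) meson
    have "norm x ^ k * norm (of_real (c ^ length is) * iter_partial is f (c *\<^sub>R x)) \<le> (\<bar>c\<bar> ^ length is / \<bar>c\<bar> ^ k) * C" for x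
    proof -
      have "norm x ^ k * norm (of_real (c ^ length is) * iter_partial is f (c *\<^sub>R x))
         = (\<bar>c\<bar> ^ length is / \<bar>c\<bar> ^ k) * (norm (c *\<^sub>R x) ^ k * norm (iter_partial is f (c *\<^sub>R x)))"
        using c by (simp add: norm_mult norm_power power_mult_distrib power_abs)
      also have "\<dots> \<le> (\<bar>c\<bar> ^ length is / \<bar>c\<bar> ^ k) * C"
        by (intro mult_left_mono C) auto
      finally show ?thesis .
    qed
    then show ?thesis by blast
  qed
  note 1 = this
  have 2: "iter_partial is (\<lambda>x. f (c *\<^sub>R x)) differentiable (at x)" for "is" x
    unfolding it[of "is"] differentiable_def using h by blast
  have 3: "\<exists>C. \<forall>x. norm x ^ k * norm (iter_partial is (\<lambda>x. f (c *\<^sub>R x)) x) \<le> C" for "is" k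
    unfolding it[of "is"] by (rule 1)
  show ?thesis unfolding schwartz_def using 2 3 by blast
qed

definition nice :: "(real^3 \<Rightarrow> complex) set" where
  "nice = {\<psi>. continuous_on UNIV \<psi> \<and> (\<exists>B. \<forall>x. norm (\<psi> x) \<le> B) \<and> integrable lborel \<psi>}"

lemma niceI: "continuous_on UNIV \<psi> \<Longrightarrow> (\<And>x. norm (\<psi> x) \<le> B) \<Longrightarrow> integrable lborel \<psi> \<Longrightarrow> \<psi> \<in> nice"
  by (auto simp: nice_def)

lemma nice_borel: "\<psi> \<in> nice \<Longrightarrow> \<psi> \<in> borel_measurable borel"
  by (auto simp: nice_def borel_measurable_continuous_onI)

lemma nice_integrable: "\<psi> \<in> nice \<Longrightarrow> integrable lborel \<psi>"
  by (auto simp: nice_def)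

lemma nice_bounded: "\<psi> \<in> nice \<Longrightarrow> \<exists>B\<ge>0. \<forall>x. norm (\<psi> x) \<le> B"
  by (auto simp: nice_def) (meson norm_ge_zero order_trans)

lemma schwartz_nice: 
  assumes f: "f \<in> schwartz"
  shows "f \<in> nice"
proof -
  from f have "f differentiable (at x)" for x
    by (auto simp: schwartz_def iter_partial_def dest!: spec[of _ "[]"])
  then have c: "continuous_on UNIV f"
    by (auto simp: continuous_at_imp_continuous_on differentiable_imp_continuous_within)
  have b: "\<exists>C. \<forall>x. norm x ^ k * norm (f x) \<le> C" for k
    using f by (auto simp: schwartz_def iter_partial_def dest!: spec[of _ "[]"])
  obtain C0 where C0: "\<And>x. norm (f x) \<le> C0" using b[of 0] by auto
  obtain C6 where C6: "\<And>x. norm x ^ 6 * norm (f x) \<le> C6" using b[of 6] by auto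
  have "integrable lborel f"
  proof (rule Bochner_Integration.integrable_bound)
    show "integrable lborel (\<lambda>x::real^3. (4 * (C0 + C6)) * (\<Prod>b\<in>Basis. inverse (1 + (x \<bullet> b)\<^sup>2)))"
      by (intro integrable_mult_right integrable_inverse_quadratics)
    show "AE x in lborel. norm (f x) \<le> norm ((4 * (C0 + C6)) * (\<Prod>b\<in>Basis. inverse (1 + (x \<bullet> b)\<^sup>2)))"
    proof (rule AE_I2)
      fix x :: "real^3"
      define P where "P = (\<Prod>b\<in>(Basis::(real^3) set). (1 + (x \<bullet> b)\<^sup>2))"
      define y where "y = (norm x)\<^sup>2"
      have y: "y \<ge> 0" by (simp add: y_def)
      have "P \<le> (\<Prod>b\<in>(Basis::(real^3) set). (1 + y))"
        unfolding P_def y_def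
      proof (intro prod_mono conjI)
        fix b :: "real^3" assume "b \<in> Basis"
        then have "\<bar>x \<bullet> b\<bar> \<le> norm x" by (rule Basis_le_norm)
        then show "1 + (x \<bullet> b)\<^sup>2 \<le> 1 + (norm x)\<^sup>2" using abs_le_square_iff[of "x \<bullet> b" "norm x"] by simp
      qed simp
      also have "\<dots> = (1 + y) ^ 3" by simp
      also have "\<dots> \<le> 4 * (1 + y ^ 3)"
      proof -
        have "4 * (1 + y ^ 3) - (1 + y) ^ 3 = 3 * (y - 1)\<^sup>2 * (y + 1)" by (simp add: power2_eq_square power3_eq_cube algebra_simps)
        also have "\<dots> \<ge> 0" using y by simp
        finally show ?thesis by linarith
      qed
      finally have P: "P \<le> 4 * (1 + norm x ^ 6)" by (simp add: y_def flip: power_mult)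
      have P0: "P > 0" unfolding P_def by (intro prod_pos) (auto intro: add_pos_nonneg)
      have "norm (f x) * P \<le> norm (f x) * (4 * (1 + norm x ^ 6))" by (intro mult_left_mono P) auto
      also have "\<dots> \<le> 4 * (C0 + C6)" using C0[of x] C6[of x] by (simp add: algebra_simps)
      finally have "norm (f x) \<le> 4 * (C0 + C6) * inverse P" using P0 by (simp add: field_simps)
      also have "inverse P = (\<Prod>b\<in>(Basis::(real^3) set). inverse (1 + (x \<bullet> b)\<^sup>2))"
        unfolding P_def by (rule prod_inversef[unfolded comp_def, symmetric])
      finally show "norm (f x) \<le> norm ((4 * (C0 + C6)) * (\<Prod>b\<in>Basis. inverse (1 + (x \<bullet> b)\<^sup>2)))" by simp
    qed
  qed (use c in \<open>auto simp: borel_measurable_continuous_onI\<close>)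
  with c C0 show ?thesis by (intro niceI)
qed

section \<open>The Fourier transform of integrable functions\<close>

definition ft_const :: real where
  "ft_const = (2 * pi) powr (- 3 / 2)"

definition ft :: "(real^3 \<Rightarrow> complex) \<Rightarrow> real^3 \<Rightarrow> complex" where
  "ft f \<xi> = of_real ft_const * (LINT x|lborel. cis (- (x \<bullet> \<xi>)) * f x)"

lemma ft_const_pos: "ft_const > 0"
  by (simp add: ft_const_def)

lemma ft_const_sq: "ft_const\<^sup>2 = 1 / (2 * pi) ^ 3"
proof -
  have "ft_const\<^sup>2 = (2 * pi) powr (- 3)"
    by (simp add: ft_const_def power2_eq_square flip: powr_add)
  also have "\<dots> = 1 / (2 * pi) ^ 3"
    using powr_realpow[of "2 * pi" 3] by (simp add: powr_minus field_simps)
  finally show ?thesis .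
qed

lemma norm_integral_le:
  fixes f :: "'a \<Rightarrow> 'b::{banach, second_countable_topology}"
  assumes g: "integrable M g" and le: "AE x in M. norm (f x) \<le> g x"
  shows "norm (LINT x|M. f x) \<le> (LINT x|M. g x)"
proof (cases "integrable M f")
  case True
  have "norm (LINT x|M. f x) \<le> (LINT x|M. norm (f x))" by (rule integral_norm_bound)
  also have "\<dots> \<le> (LINT x|M. g x)" using True g le by (intro integral_mono_AE) auto
  finally show ?thesis .
next
  case False
  have "AE x in M. 0 \<le> g x" using le by eventually_elim (use norm_ge_zero order_trans in blast)
  then show ?thesis using False by (simp add: not_integrable_integral_eq integral_nonneg_AE)
qed

lemma exp_minus_ii: "exp (- \<i> * of_real t) = cis (- t)"
  by (simp add: cis_conv_exp)

lemma integrable_cis_mult: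
  assumes [measurable]: "g \<in> borel_measurable M" and f: "integrable M f"
  shows "integrable M (\<lambda>x. cis (g x) * f x)"
proof -
  have [measurable]: "f \<in> borel_measurable M" using f by simp
  show ?thesis by (rule Bochner_Integration.integrable_bound[OF f]) (auto simp: norm_mult)
qed

lemma fourier_schwartz_eq_ft:
  assumes [measurable]: "f \<in> borel_measurable borel"
  shows "fourier_schwartz f = ft f"
proof
  fix \<xi>
  show "fourier_schwartz f \<xi> = ft f \<xi>"
    unfolding fourier_schwartz_def ft_def ft_const_def exp_minus_ii
    by (subst integral_completion) auto
qed

lemma ft_borel [measurable]:
  assumes [measurable]: "f \<in> borel_measurable borel"
  shows "ft f \<in> borel_measurable borel"
  unfolding ft_def by measurable

lemma ft_bound:
  assumes "integrable lborel f"
  shows "norm (ft f \<xi>) \<le> ft_const * (LINT x|lborel. norm (f x))"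
proof -
  have "norm (LINT x|lborel. cis (- (x \<bullet> \<xi>)) * f x) \<le> (LINT x|lborel. norm (cis (- (x \<bullet> \<xi>)) * f x))"
    by (rule integral_norm_bound)
  also have "\<dots> = (LINT x|lborel. norm (f x))" by (simp add: norm_mult)
  finally show ?thesis using ft_const_pos by (simp add: ft_def norm_mult mult_left_mono)
qed

lemma ft_cnj: "ft (\<lambda>x. cnj (f x)) \<xi> = cnj (ft f (- \<xi>))"
proof -
  have e: "cis (- (x \<bullet> \<xi>)) * cnj (f x) = cnj (cis (- (x \<bullet> (- \<xi>))) * f x)" for x
    by (simp add: cis_cnj)
  show ?thesis unfolding ft_def e by (subst Bochner_Integration.integral_cnj) simp
qed

lemma integrable_pair_bound:
  fixes f g :: "real^3 \<Rightarrow> real" and k :: "(real^3) \<times> (real^3) \<Rightarrow> complex"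
  assumes f: "integrable lborel f" and g: "integrable lborel g"
    and [measurable]: "k \<in> borel_measurable (lborel \<Otimes>\<^sub>M lborel)"
    and k: "\<And>x y. norm (k (x, y)) \<le> f x * g y"
  shows "integrable (lborel \<Otimes>\<^sub>M lborel) k"
proof (rule Bochner_Integration.integrable_bound[of _ "\<lambda>(x, y). f x * g y"])
  have [measurable]: "f \<in> borel_measurable borel" "g \<in> borel_measurable borel"
    using f g by (auto dest: borel_measurable_integrable)
  show "integrable (lborel \<Otimes>\<^sub>M lborel) (\<lambda>(x, y). f x * g y)"
    using f g by (intro lborel_pair.Fubini_integrable) (auto simp: abs_mult)
  show "AE z in lborel \<Otimes>\<^sub>M lborel. norm (k z) \<le> norm (case z of (x, y) \<Rightarrow> f x * g y)"
  proof (rule AE_I2, clarify)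
    fix x y show "norm (k (x, y)) \<le> norm (f x * g y)" using k[of x y] by simp
  qed
qed simp

lemma ft_multiplication:
  assumes f: "integrable lborel f" and g: "integrable lborel g"
  shows "(LINT x|lborel. f x * ft g x) = (LINT x|lborel. ft f x * g x)"
proof -
  have [measurable]: "f \<in> borel_measurable borel" "g \<in> borel_measurable borel"
    using f g by (auto dest: borel_measurable_integrable)
  have i: "integrable (lborel \<Otimes>\<^sub>M lborel) (\<lambda>(x, y). f x * (cis (- (y \<bullet> x)) * g y))"
    by (rule integrable_pair_bound[OF integrable_norm[OF f] integrable_norm[OF g]]) (auto simp: norm_mult)
  have "(LINT x|lborel. f x * ft g x) = of_real ft_const * (LINT x|lborel. (LINT y|lborel. f x * (cis (- (y \<bullet> x)) * g y)))"
    by (simp add: ft_def mult.left_commute)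
  also have "(LINT x|lborel. (LINT y|lborel. f x * (cis (- (y \<bullet> x)) * g y)))
     = (LINT y|lborel. (LINT x|lborel. f x * (cis (- (y \<bullet> x)) * g y)))"
    by (rule lborel_pair.Fubini_integral[OF i, symmetric])
  also have "\<dots> = (LINT y|lborel. (LINT x|lborel. cis (- (x \<bullet> y)) * f x) * g y)"
  proof (rule Bochner_Integration.integral_cong[OF refl])
    fix y
    show "(LINT x|lborel. f x * (cis (- (y \<bullet> x)) * g y)) = (LINT x|lborel. cis (- (x \<bullet> y)) * f x) * g y"
      by (subst integral_mult_left_zero[symmetric], rule Bochner_Integration.integral_cong)
        (simp_all add: inner_commute mult_ac)
  qed
  also have "of_real ft_const * \<dots> = (LINT x|lborel. ft f x * g x)"
    by (simp add: ft_def mult.assoc)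
  finally show ?thesis .
qed

section \<open>Gaussian regularisation\<close>

definition gauss_kernel :: "real \<Rightarrow> real^3 \<Rightarrow> real" where
  "gauss_kernel c z = (1 / (sqrt pi * c)) ^ 3 * exp (- (1 / c\<^sup>2) * (norm z)\<^sup>2)"

lemma gauss_kernel_borel [measurable]: "gauss_kernel c \<in> borel_measurable borel"
  unfolding gauss_kernel_def by measurable

lemma gauss_kernel_nonneg: "c > 0 \<Longrightarrow> gauss_kernel c z \<ge> 0"
  by (simp add: gauss_kernel_def)

lemma gauss_kernel_minus: "gauss_kernel c (- z) = gauss_kernel c z"
  by (simp add: gauss_kernel_def)

lemma gauss_kernel_bounded: "c > 0 \<Longrightarrow> gauss_kernel c z \<le> (1 / (sqrt pi * c)) ^ 3"
  unfolding gauss_kernel_def by (rule mult_left_le) auto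

lemma
  assumes "c > 0"
  shows integrable_gauss_kernel: "integrable lborel (gauss_kernel c)"
    and integral_gauss_kernel: "(LINT z|lborel. gauss_kernel c z) = 1"
proof -
  have a: "1 / c\<^sup>2 > 0" using assms by simp
  show "integrable lborel (gauss_kernel c)"
    unfolding gauss_kernel_def by (intro integrable_mult_right integrable_gaussian a)
  have "sqrt (pi / (1 / c\<^sup>2)) = sqrt pi * c" using assms by (simp add: real_sqrt_mult)
  then show "(LINT z|lborel. gauss_kernel c z) = 1"
    unfolding gauss_kernel_def using assms integral_gaussian[OF a, where 'a="real^3"]
    by (simp add: power_divide)
qed

lemma
  assumes "c > 0"
  shows integrable_gauss_kernel_diff: "integrable lborel (\<lambda>y. gauss_kernel c (x - y))"
    and integral_gauss_kernel_diff: "(LINT y|lborel. gauss_kernel c (x - y)) = 1"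
  using integrable_lborel_affine_iff[of "gauss_kernel c" "-1" x] integral_lborel_affine[of "gauss_kernel c" "-1" x]
    integrable_gauss_kernel[OF assms] integral_gauss_kernel[OF assms] by auto

lemma integrable_gauss_kernel_mult:
  assumes \<psi>: "integrable lborel (\<psi> :: real^3 \<Rightarrow> complex)" and c: "c > 0"
  shows "integrable lborel (\<lambda>y. \<psi> y * of_real (gauss_kernel c (x - y)))"
proof -
  have [measurable]: "\<psi> \<in> borel_measurable borel" using \<psi> by (auto dest: borel_measurable_integrable)
  show ?thesis
  proof (rule Bochner_Integration.integrable_bound[of _ "\<lambda>y. of_real ((1 / (sqrt pi * c)) ^ 3) * \<psi> y"])
    show "AE y in lborel. norm (\<psi> y * of_real (gauss_kernel c (x - y))) \<le> norm (of_real ((1 / (sqrt pi * c)) ^ 3) * \<psi> y)"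
    proof (rule AE_I2)
      fix y
      have "norm (\<psi> y) * gauss_kernel c (x - y) \<le> norm (\<psi> y) * (1 / (sqrt pi * c)) ^ 3"
        by (intro mult_left_mono gauss_kernel_bounded c) simp
      moreover have "norm (complex_of_real ((1 / (sqrt pi * c)) ^ 3)) = (1 / (sqrt pi * c)) ^ 3"
        using c by (simp only: norm_of_real) simp
      moreover have "norm (complex_of_real (gauss_kernel c (x - y))) = gauss_kernel c (x - y)"
        using gauss_kernel_nonneg[OF c] by simp
      ultimately show "norm (\<psi> y * of_real (gauss_kernel c (x - y))) \<le> norm (of_real ((1 / (sqrt pi * c)) ^ 3) * \<psi> y)"
        unfolding norm_mult by (simp only: mult.commute)
    qed
  qed (use \<psi> in auto)
qed

definition smoothed :: "real \<Rightarrow> (real^3 \<Rightarrow> complex) \<Rightarrow> real^3 \<Rightarrow> complex" where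
  "smoothed c \<psi> x = (LINT y|lborel. \<psi> y * of_real (gauss_kernel c (x - y)))"

lemma smoothed_borel [measurable]:
  assumes [measurable]: "\<psi> \<in> borel_measurable borel"
  shows "smoothed c \<psi> \<in> borel_measurable borel"
  unfolding smoothed_def by measurable

lemma smoothed_alt:
  assumes [measurable]: "\<psi> \<in> borel_measurable borel" and c: "c > 0"
  shows "smoothed c \<psi> x = (LINT z|lborel. \<psi> (x + c *\<^sub>R z) * of_real (gauss_kernel 1 z))"
proof -
  have "gauss_kernel 1 z = c ^ 3 * gauss_kernel c (x - (x + c *\<^sub>R z))" for z
    using c by (simp add: gauss_kernel_def power_divide power_mult_distrib)
  then have "(LINT z|lborel. \<psi> (x + c *\<^sub>R z) * of_real (gauss_kernel 1 z))
     = (LINT z|lborel. of_real (c ^ 3) * (\<psi> (x + c *\<^sub>R z) * of_real (gauss_kernel c (x - (x + c *\<^sub>R z)))))"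
    by (simp only: of_real_mult mult_ac)
  also have "\<dots> = of_real (c ^ 3) * (LINT z|lborel. (\<psi> (x + c *\<^sub>R z) * of_real (gauss_kernel c (x - (x + c *\<^sub>R z)))))"
    by (rule integral_mult_right_zero)
  also have "\<dots> = smoothed c \<psi> x"
    unfolding smoothed_def
    by (subst integral_lborel_affine[of "\<lambda>y. \<psi> y * of_real (gauss_kernel c (x - y))"])
      (use c in \<open>auto simp: scaleR_conv_of_real[where 'a=complex]\<close>)
  finally show ?thesis ..
qed

lemma smoothed_bound:
  assumes [measurable]: "\<psi> \<in> borel_measurable borel" and B: "\<And>x. norm (\<psi> x) \<le> B" and c: "c > 0"
  shows "norm (smoothed c \<psi> x) \<le> B"
proof -
  have "norm (smoothed c \<psi> x) \<le> (LINT y|lborel. B * gauss_kernel c (x - y))"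
    unfolding smoothed_def
  proof (rule norm_integral_le)
    show "integrable lborel (\<lambda>y. B * gauss_kernel c (x - y))"
      by (intro integrable_mult_right integrable_gauss_kernel_diff c)
    show "AE y in lborel. norm (\<psi> y * of_real (gauss_kernel c (x - y))) \<le> B * gauss_kernel c (x - y)"
      using gauss_kernel_nonneg[OF c] B by (intro AE_I2) (auto simp: norm_mult intro!: mult_right_mono)
  qed
  then show ?thesis using integral_gauss_kernel_diff[OF c, of x] by simp
qed

lemma smoothed_tendsto:
  assumes \<psi>: "\<psi> \<in> nice"
  shows "(\<lambda>n. smoothed (1 / (1 + real n)) \<psi> x) \<longlonglongrightarrow> \<psi> x"
proof -
  have [measurable]: "\<psi> \<in> borel_measurable borel" using \<psi> by (rule nice_borel)
  obtain B where B: "\<And>x. norm (\<psi> x) \<le> B" using nice_bounded[OF \<psi>] by auto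
  have k: "\<bar>gauss_kernel 1 z\<bar> = gauss_kernel 1 z" for z using gauss_kernel_nonneg[of 1 z] by simp
  have "(\<lambda>n. LINT z|lborel. \<psi> (x + (1 / (1 + real n)) *\<^sub>R z) * of_real (gauss_kernel 1 z))
     \<longlonglongrightarrow> (LINT z|lborel. \<psi> x * of_real (gauss_kernel 1 z))"
  proof (rule integral_dominated_convergence[where w="\<lambda>z. B * gauss_kernel 1 z"])
    show "AE z in lborel. (\<lambda>n. \<psi> (x + (1 / (1 + real n)) *\<^sub>R z) * of_real (gauss_kernel 1 z))
         \<longlonglongrightarrow> \<psi> x * of_real (gauss_kernel 1 z)"
    proof (rule AE_I2)
      fix z
      have "(\<lambda>n. 1 / (1 + real n)) \<longlonglongrightarrow> 0"
        using LIMSEQ_inverse_real_of_nat by (simp add: inverse_eq_divide)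
      then have "(\<lambda>n. x + (1 / (1 + real n)) *\<^sub>R z) \<longlonglongrightarrow> x + 0 *\<^sub>R z"
        by (rule tendsto_add[OF tendsto_const tendsto_scaleR[OF _ tendsto_const]])
      note 1 = this
      have "isCont \<psi> (x + 0 *\<^sub>R z)" using \<psi> by (simp add: nice_def continuous_on_eq_continuous_at)
      from isCont_tendsto_compose[OF this 1]
      have "(\<lambda>n. \<psi> (x + (1 / (1 + real n)) *\<^sub>R z)) \<longlonglongrightarrow> \<psi> (x + 0 *\<^sub>R z)" .
      then show "(\<lambda>n. \<psi> (x + (1 / (1 + real n)) *\<^sub>R z) * of_real (gauss_kernel 1 z)) \<longlonglongrightarrow> \<psi> x * of_real (gauss_kernel 1 z)"
        by (intro tendsto_mult_right) simp
    qed
    show "AE z in lborel. norm (\<psi> (x + (1 / (1 + real n)) *\<^sub>R z) * of_real (gauss_kernel 1 z)) \<le> B * gauss_kernel 1 z" for n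
      using gauss_kernel_nonneg[of 1] B by (intro AE_I2) (auto simp: norm_mult k intro!: mult_right_mono)
    show "integrable lborel (\<lambda>z. B * gauss_kernel 1 z)"
      by (intro integrable_mult_right integrable_gauss_kernel) simp
  qed auto
  moreover have "(LINT z|lborel. \<psi> x * of_real (gauss_kernel 1 z)) = \<psi> x"
    by (simp add: integral_gauss_kernel integrable_gauss_kernel)
  ultimately show ?thesis by (subst smoothed_alt) auto
qed

lemma integral_smoothed_tendsto:
  assumes f: "integrable lborel f" and \<psi>: "\<psi> \<in> nice"
  shows "(\<lambda>n. LINT x|lborel. f x * smoothed (1 / (1 + real n)) \<psi> x) \<longlonglongrightarrow> (LINT x|lborel. f x * \<psi> x)"
proof -
  have [measurable]: "f \<in> borel_measurable borel" "\<psi> \<in> borel_measurable borel"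
    using f nice_borel[OF \<psi>] by (auto dest: borel_measurable_integrable)
  obtain B where B: "\<And>x. norm (\<psi> x) \<le> B" using nice_bounded[OF \<psi>] by auto
  show ?thesis
  proof (rule integral_dominated_convergence[where w="\<lambda>x. B * norm (f x)"])
    show "AE x in lborel. (\<lambda>n. f x * smoothed (1 / (1 + real n)) \<psi> x) \<longlonglongrightarrow> f x * \<psi> x"
      by (intro AE_I2 tendsto_mult_left smoothed_tendsto \<psi>)
    show "AE x in lborel. norm (f x * smoothed (1 / (1 + real n)) \<psi> x) \<le> B * norm (f x)" for n
      using smoothed_bound[of \<psi> B "1 / (1 + real n)"] B
      by (intro AE_I2) (auto simp: norm_mult mult.commute[of B] intro!: mult_left_mono)
  qed (use f in auto)
qed

lemma ft_gaussian_modulated: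
  assumes c: "c > 0"
  shows "integrable lborel (\<lambda>\<xi>. cis (x \<bullet> \<xi>) * of_real (exp (- (c\<^sup>2 / 4) * (norm \<xi>)\<^sup>2)))"
    and "of_real ft_const * ft (\<lambda>\<xi>. cis (x \<bullet> \<xi>) * of_real (exp (- (c\<^sup>2 / 4) * (norm \<xi>)\<^sup>2))) y = of_real (gauss_kernel c (x - y))"
proof -
  have a: "c\<^sup>2 / 4 > 0" using c by simp
  have "integrable lborel (\<lambda>\<xi>::real^3. complex_of_real (exp (- (c\<^sup>2 / 4) * (norm \<xi>)\<^sup>2)))"
    using integrable_gaussian[OF a, where 'a="real^3"] by (simp only: complex_of_real_integrable_eq)
  then show "integrable lborel (\<lambda>\<xi>. cis (x \<bullet> \<xi>) * of_real (exp (- (c\<^sup>2 / 4) * (norm \<xi>)\<^sup>2)))"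
    by (rule integrable_cis_mult[rotated]) simp
  have e: "cis (- (\<xi> \<bullet> y)) * (cis (x \<bullet> \<xi>) * of_real r) = exp (- (\<i> * of_real (\<xi> \<bullet> (y - x)))) * of_real r" for \<xi> r
  proof -
    have "cis (- (\<xi> \<bullet> y)) * cis (x \<bullet> \<xi>) = cis (- (\<xi> \<bullet> (y - x)))"
      by (simp add: cis_mult inner_diff_right inner_commute)
    then show ?thesis by (simp add: cis_conv_exp mult.assoc[symmetric])
  qed
  have s: "sqrt (pi / (c\<^sup>2 / 4)) = 2 * sqrt pi / c"
  proof -
    have "pi / (c\<^sup>2 / 4) = (2 * sqrt pi / c)\<^sup>2" by (simp add: power_divide power_mult_distrib)
    then show ?thesis using c by (simp only: real_sqrt_abs) simp
  qed
  have "ft_const * (ft_const * (sqrt (pi / (c\<^sup>2 / 4)) ^ 3 * exp (- (norm (y - x))\<^sup>2 / (4 * (c\<^sup>2 / 4))))) = gauss_kernel c (x - y)"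
  proof -
    have "ft_const * (ft_const * (2 * sqrt pi / c) ^ 3) = (1 / (sqrt pi * c)) ^ 3"
    proof -
      have "pi = sqrt pi * sqrt pi" by simp
      then have "2 * sqrt pi / c / (2 * pi) = 1 / (sqrt pi * c)" using c by (simp add: field_simps)
      moreover have "ft_const * (ft_const * X ^ 3) = (X / (2 * pi)) ^ 3" for X
      proof -
        have "ft_const * (ft_const * X ^ 3) = ft_const\<^sup>2 * X ^ 3" by (simp add: power2_eq_square)
        then show ?thesis unfolding ft_const_sq power_divide by simp
      qed
      ultimately show ?thesis by simp
    qed
    moreover have "- (norm (y - x))\<^sup>2 / (4 * (c\<^sup>2 / 4)) = - (1 / c\<^sup>2) * (norm (x - y))\<^sup>2"
      by (simp add: norm_minus_commute)
    ultimately show ?thesis unfolding s gauss_kernel_def by (simp only: mult.assoc[symmetric])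
  qed
  then have "complex_of_real (gauss_kernel c (x - y)) = of_real ft_const * (of_real ft_const * of_real (sqrt (pi / (c\<^sup>2 / 4)) ^ 3 * exp (- (norm (y - x))\<^sup>2 / (4 * (c\<^sup>2 / 4)))))"
    by (simp only: of_real_mult[symmetric])
  also have "of_real (sqrt (pi / (c\<^sup>2 / 4)) ^ 3 * exp (- (norm (y - x))\<^sup>2 / (4 * (c\<^sup>2 / 4)))) =
     (LINT \<xi>|lborel. exp (- (\<i> * of_real (\<xi> \<bullet> (y - x)))) * of_real (exp (- (c\<^sup>2 / 4) * (norm \<xi>)\<^sup>2)))"
    using integral_gaussian_exp[OF a, of "y - x"] by simp
  finally show "of_real ft_const * ft (\<lambda>\<xi>. cis (x \<bullet> \<xi>) * of_real (exp (- (c\<^sup>2 / 4) * (norm \<xi>)\<^sup>2))) y = of_real (gauss_kernel c (x - y))"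
    unfolding ft_def e by simp
qed

lemma regularised_parseval:
  assumes f: "integrable lborel f" and \<psi>: "integrable lborel \<psi>" and c: "c > 0"
  shows "(LINT \<xi>|lborel. ft f \<xi> * (ft \<psi> (- \<xi>) * of_real (exp (- (c\<^sup>2 / 4) * (norm \<xi>)\<^sup>2)))) = (LINT x|lborel. f x * smoothed c \<psi> x)"
proof -
  have [measurable]: "f \<in> borel_measurable borel" "\<psi> \<in> borel_measurable borel"
    using f \<psi> by (auto dest: borel_measurable_integrable)
  define d where "d \<xi> = complex_of_real (exp (- (c\<^sup>2 / 4) * (norm \<xi>)\<^sup>2))" for \<xi> :: "real^3"
  have [measurable]: "d \<in> borel_measurable borel" unfolding d_def by measurable
  have dm: "d (- \<xi>) = d \<xi>" for \<xi> by (simp add: d_def)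
  have "c\<^sup>2 / 4 > 0" using c by simp
  from integrable_gaussian[OF this, where 'a="real^3"]
  have di: "integrable lborel d" unfolding d_def by (simp only: complex_of_real_integrable_eq)
  define g where "g \<xi> = ft \<psi> (- \<xi>) * d \<xi>" for \<xi>
  have [measurable]: "g \<in> borel_measurable borel"
    unfolding g_def by (intro borel_measurable_times measurable_compose[OF _ ft_borel]) auto
  have gi: "integrable lborel g"
  proof (rule Bochner_Integration.integrable_bound[of _ "\<lambda>\<xi>. of_real (ft_const * (LINT x|lborel. norm (\<psi> x))) * d \<xi>"])
    show "AE x in lborel. norm (g x) \<le> norm (of_real (ft_const * (LINT x|lborel. norm (\<psi> x))) * d x)"
      using ft_bound[OF \<psi>] ft_const_pos
      by (intro AE_I2) (auto simp: g_def norm_mult simp del: of_real_mult intro!: mult_right_mono)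
  qed (use di in auto)
  have "ft g x = smoothed c \<psi> x" for x
  proof -
    have "ft g x = of_real ft_const * (LINT \<xi>|lborel. cis (- (\<xi> \<bullet> x)) * (ft \<psi> (- \<xi>) * d \<xi>))"
      by (simp add: ft_def g_def)
    also have "(LINT \<xi>|lborel. cis (- (\<xi> \<bullet> x)) * (ft \<psi> (- \<xi>) * d \<xi>)) = (LINT \<xi>|lborel. cis (- (- \<xi> \<bullet> x)) * (ft \<psi> (- (- \<xi>)) * d (- \<xi>)))"
      by (rule integral_lborel_reflect[symmetric, of "\<lambda>\<xi>. cis (- (\<xi> \<bullet> x)) * (ft \<psi> (- \<xi>) * d \<xi>)"]) simp
    also have "\<dots> = (LINT \<xi>|lborel. ft \<psi> \<xi> * (cis (x \<bullet> \<xi>) * d \<xi>))"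
      by (simp add: dm inner_commute mult_ac)
    also have "\<dots> = (LINT y|lborel. \<psi> y * ft (\<lambda>\<xi>. cis (x \<bullet> \<xi>) * d \<xi>) y)"
      unfolding d_def by (rule ft_multiplication[symmetric, OF \<psi> ft_gaussian_modulated(1)[OF c]])
    also have "of_real ft_const * \<dots> = (LINT y|lborel. \<psi> y * (of_real ft_const * ft (\<lambda>\<xi>. cis (x \<bullet> \<xi>) * d \<xi>) y))"
      by (simp add: mult.left_commute)
    also have "\<dots> = smoothed c \<psi> x"
      unfolding d_def ft_gaussian_modulated(2)[OF c] smoothed_def ..
    finally show ?thesis .
  qed
  then show ?thesis
    using ft_multiplication[OF f gi] by (simp add: g_def d_def)
qed

section \<open>Plancherel theory\<close>

lemma Fatou_bounded:
  fixes f :: "nat \<Rightarrow> 'a \<Rightarrow> real"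
  assumes i: "\<And>n. integrable M (f n)" and [measurable]: "g \<in> borel_measurable M"
    and nn: "\<And>n x. 0 \<le> f n x" and lim: "AE x in M. (\<lambda>n. f n x) \<longlonglongrightarrow> g x"
    and C: "\<And>n. (LINT x|M. f n x) \<le> C"
  shows "integrable M g" and "(LINT x|M. g x) \<le> C"
proof -
  have [measurable]: "f n \<in> borel_measurable M" for n using i by (auto dest: borel_measurable_integrable)
  have g0: "AE x in M. 0 \<le> g x"
    using lim by eventually_elim (rule LIMSEQ_le_const, auto simp: nn)
  have "(\<integral>\<^sup>+x. ennreal (g x) \<partial>M) \<le> (\<integral>\<^sup>+x. liminf (\<lambda>n. ennreal (f n x)) \<partial>M)"
  proof (rule nn_integral_mono_AE)
    show "AE x in M. ennreal (g x) \<le> liminf (\<lambda>n. ennreal (f n x))"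
      using lim
    proof eventually_elim
      case (elim x)
      then have "(\<lambda>n. ennreal (f n x)) \<longlonglongrightarrow> ennreal (g x)" by (rule tendsto_ennrealI)
      then show ?case by (simp add: lim_imp_Liminf)
    qed
  qed
  also have "\<dots> \<le> liminf (\<lambda>n. \<integral>\<^sup>+x. ennreal (f n x) \<partial>M)" by (rule nn_integral_liminf) simp
  also have "\<dots> \<le> liminf (\<lambda>n. ennreal C)"
    using i nn C by (intro Liminf_mono always_eventually allI) (auto simp: nn_integral_eq_integral intro!: ennreal_leI)
  also have "\<dots> = ennreal C" by (simp add: Liminf_const)
  finally have le: "(\<integral>\<^sup>+x. ennreal (g x) \<partial>M) \<le> ennreal C" .
  then have "(\<integral>\<^sup>+x. ennreal (g x) \<partial>M) < \<infinity>" by (simp add: le_less_trans[OF _ ennreal_less_top])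
  then show ig: "integrable M g" using g0 by (intro integrableI_nonneg) auto
  have "C \<ge> 0" using C[of 0] Bochner_Integration.integral_nonneg[of M "f 0"] nn by (meson order_trans)
  then show "(LINT x|M. g x) \<le> C"
    using le unfolding nn_integral_eq_integral[OF ig g0] by (simp add: ennreal_le_iff)
qed

lemma norm_integral_le_nn_integral: "ennreal (norm (LINT x|M. f x)) \<le> (\<integral>\<^sup>+x. ennreal (norm (f x)) \<partial>M)"
  by (cases "integrable M f") (auto simp: integral_norm_bound_ennreal not_integrable_integral_eq)

lemma nn_integral_gauss_kernel_diff:
  assumes c: "c > 0" and a: "a \<ge> 0"
  shows "(\<integral>\<^sup>+y. ennreal (a * gauss_kernel c (x - y)) \<partial>lborel) = ennreal a"
    and "(\<integral>\<^sup>+x. ennreal (a * gauss_kernel c (x - y)) \<partial>lborel) = ennreal a"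
proof -
  show 1: "(\<integral>\<^sup>+y. ennreal (a * gauss_kernel c (x - y)) \<partial>lborel) = ennreal a" for x
    using a gauss_kernel_nonneg[OF c] integral_gauss_kernel_diff[OF c, of x]
    by (subst nn_integral_eq_integral) (auto intro!: integrable_mult_right integrable_gauss_kernel_diff[OF c])
  have "gauss_kernel c (x - y) = gauss_kernel c (y - x)" for x
    using gauss_kernel_minus[of c "y - x"] by simp
  then show "(\<integral>\<^sup>+x. ennreal (a * gauss_kernel c (x - y)) \<partial>lborel) = ennreal a"
    using 1[of y] by simp
qed

lemma smoothed_pairing_bound:
  assumes f: "integrable lborel f" and f2: "integrable lborel (\<lambda>x. (norm (f x))\<^sup>2)" and c: "c > 0"
  shows "norm (LINT x|lborel. f x * smoothed c (\<lambda>x. cnj (f x)) x) \<le> (LINT x|lborel. (norm (f x))\<^sup>2)"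
proof -
  have [measurable]: "f \<in> borel_measurable borel" using f by (auto dest: borel_measurable_integrable)
  define u where "u x = norm (f x)" for x
  have u: "u x \<ge> 0" for x by (simp add: u_def)
  have [measurable]: "u \<in> borel_measurable borel" unfolding u_def by measurable
  let ?k = "gauss_kernel c"
  note k = gauss_kernel_nonneg[OF c]
  have "ennreal (norm (LINT x|lborel. f x * smoothed c (\<lambda>x. cnj (f x)) x))
     \<le> (\<integral>\<^sup>+x. ennreal (norm (f x * smoothed c (\<lambda>x. cnj (f x)) x)) \<partial>lborel)"
    by (rule norm_integral_le_nn_integral)
  also have "\<dots> \<le> (\<integral>\<^sup>+x. (\<integral>\<^sup>+y. ennreal (u x * u y * ?k (x - y)) \<partial>lborel) \<partial>lborel)"
  proof (rule nn_integral_mono)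
    fix x
    have "f x * smoothed c (\<lambda>x. cnj (f x)) x = (LINT y|lborel. f x * (cnj (f y) * of_real (?k (x - y))))"
      by (simp add: smoothed_def)
    then have "ennreal (norm (f x * smoothed c (\<lambda>x. cnj (f x)) x)) \<le> (\<integral>\<^sup>+y. ennreal (norm (f x * (cnj (f y) * of_real (?k (x - y))))) \<partial>lborel)"
      by (simp only: norm_integral_le_nn_integral)
    also have "\<dots> = (\<integral>\<^sup>+y. ennreal (u x * u y * ?k (x - y)) \<partial>lborel)"
      using k by (simp add: norm_mult u_def mult.assoc)
    finally show "ennreal (norm (f x * smoothed c (\<lambda>x. cnj (f x)) x)) \<le> \<dots>" .
  qed
  also have "\<dots> \<le> (\<integral>\<^sup>+x. (\<integral>\<^sup>+y. ennreal ((u x)\<^sup>2 / 2 * ?k (x - y)) + ennreal ((u y)\<^sup>2 / 2 * ?k (x - y)) \<partial>lborel) \<partial>lborel)"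
  proof (intro nn_integral_mono)
    fix x y
    have "u x * u y \<le> (u x)\<^sup>2 / 2 + (u y)\<^sup>2 / 2" using sum_squares_bound[of "u x" "u y"] by simp
    then have "u x * u y * ?k (x - y) \<le> ((u x)\<^sup>2 / 2 + (u y)\<^sup>2 / 2) * ?k (x - y)" by (intro mult_right_mono k)
    also have "\<dots> = (u x)\<^sup>2 / 2 * ?k (x - y) + (u y)\<^sup>2 / 2 * ?k (x - y)" by (simp add: algebra_simps)
    finally have "ennreal (u x * u y * ?k (x - y)) \<le> ennreal ((u x)\<^sup>2 / 2 * ?k (x - y) + (u y)\<^sup>2 / 2 * ?k (x - y))"
      by (rule ennreal_leI)
    also have "\<dots> = ennreal ((u x)\<^sup>2 / 2 * ?k (x - y)) + ennreal ((u y)\<^sup>2 / 2 * ?k (x - y))"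
      using k[of "x - y"] by (intro ennreal_plus) auto
    finally show "ennreal (u x * u y * ?k (x - y)) \<le> \<dots>" .
  qed
  also have "\<dots> = (\<integral>\<^sup>+x. (\<integral>\<^sup>+y. ennreal ((u x)\<^sup>2 / 2 * ?k (x - y)) \<partial>lborel) + (\<integral>\<^sup>+y. ennreal ((u y)\<^sup>2 / 2 * ?k (x - y)) \<partial>lborel) \<partial>lborel)"
    by (subst nn_integral_add) auto
  also have "\<dots> = (\<integral>\<^sup>+x. (\<integral>\<^sup>+y. ennreal ((u x)\<^sup>2 / 2 * ?k (x - y)) \<partial>lborel) \<partial>lborel) + (\<integral>\<^sup>+x. (\<integral>\<^sup>+y. ennreal ((u y)\<^sup>2 / 2 * ?k (x - y)) \<partial>lborel) \<partial>lborel)"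
    by (rule nn_integral_add) auto
  also have "(\<integral>\<^sup>+x. (\<integral>\<^sup>+y. ennreal ((u y)\<^sup>2 / 2 * ?k (x - y)) \<partial>lborel) \<partial>lborel) = (\<integral>\<^sup>+y. (\<integral>\<^sup>+x. ennreal ((u y)\<^sup>2 / 2 * ?k (x - y)) \<partial>lborel) \<partial>lborel)"
    by (rule lborel_pair.Fubini'[symmetric]) simp
  also have "\<dots> = (\<integral>\<^sup>+y. ennreal ((u y)\<^sup>2 / 2) \<partial>lborel)"
    by (simp only: nn_integral_gauss_kernel_diff(2)[OF c] zero_le_power2 divide_nonneg_nonneg zero_le_numeral)
  also have "(\<integral>\<^sup>+x. (\<integral>\<^sup>+y. ennreal ((u x)\<^sup>2 / 2 * ?k (x - y)) \<partial>lborel) \<partial>lborel) = (\<integral>\<^sup>+y. ennreal ((u y)\<^sup>2 / 2) \<partial>lborel)"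
    by (simp only: nn_integral_gauss_kernel_diff(1)[OF c] zero_le_power2 divide_nonneg_nonneg zero_le_numeral)
  also have "(\<integral>\<^sup>+y. ennreal ((u y)\<^sup>2 / 2) \<partial>lborel) = ennreal (LINT y|lborel. (u y)\<^sup>2 / 2)"
    using f2 unfolding u_def by (intro nn_integral_eq_integral) auto
  also have "ennreal (LINT y|lborel. (u y)\<^sup>2 / 2) + ennreal (LINT y|lborel. (u y)\<^sup>2 / 2) = ennreal (LINT y|lborel. (u y)\<^sup>2)"
    by (subst ennreal_plus[symmetric]) auto
  finally show ?thesis by (simp add: u_def)
qed

lemma gaussian_damping_tendsto:
  "(\<lambda>n. exp (- ((1 / (1 + real n))\<^sup>2 / 4) * r)) \<longlonglongrightarrow> 1"
proof -
  have "(\<lambda>n. 1 / (1 + real n)) \<longlonglongrightarrow> 0"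
    using LIMSEQ_inverse_real_of_nat by (simp add: inverse_eq_divide)
  then have "(\<lambda>n. exp (- ((1 / (1 + real n))\<^sup>2 / 4) * r)) \<longlonglongrightarrow> exp (- (0\<^sup>2 / 4) * r)"
    by (intro tendsto_intros) auto
  then show ?thesis by simp
qed

lemma
  assumes f: "integrable lborel f" and f2: "integrable lborel (\<lambda>x. (norm (f x))\<^sup>2)"
  shows integrable_ft_L2: "integrable lborel (\<lambda>\<xi>. (norm (ft f \<xi>))\<^sup>2)"
    and ft_L2_bound: "(LINT \<xi>|lborel. (norm (ft f \<xi>))\<^sup>2) \<le> (LINT x|lborel. (norm (f x))\<^sup>2)"
proof -
  have [measurable]: "f \<in> borel_measurable borel" using f by (auto dest: borel_measurable_integrable)
  define c where "c n = 1 / (1 + real n)" for n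
  have c: "c n > 0" for n by (simp add: c_def)
  define F where "F n \<xi> = (norm (ft f \<xi>))\<^sup>2 * exp (- ((c n)\<^sup>2 / 4) * (norm \<xi>)\<^sup>2)" for n \<xi>
  have [measurable]: "F n \<in> borel_measurable borel" for n unfolding F_def[abs_def] by measurable
  define B where "B = ft_const * (LINT x|lborel. norm (f x))"
  have B: "norm (ft f \<xi>) \<le> B" for \<xi> unfolding B_def by (rule ft_bound[OF f])
  have i: "integrable lborel (F n)" for n
  proof (rule Bochner_Integration.integrable_bound)
    show "integrable lborel (\<lambda>\<xi>::real^3. B\<^sup>2 * exp (- ((c n)\<^sup>2 / 4) * (norm \<xi>)\<^sup>2))"
      using c[of n] by (intro integrable_mult_right integrable_gaussian) simp
    show "AE \<xi> in lborel. norm (F n \<xi>) \<le> norm (B\<^sup>2 * exp (- ((c n)\<^sup>2 / 4) * (norm \<xi>)\<^sup>2))"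
      using B by (intro AE_I2) (auto simp: F_def abs_mult intro!: mult_right_mono power_mono)
  qed simp
  have "(LINT \<xi>|lborel. F n \<xi>) \<le> (LINT x|lborel. (norm (f x))\<^sup>2)" for n
  proof -
    have fc: "integrable lborel (\<lambda>x. cnj (f x))" using f by simp
    have "complex_of_real (LINT \<xi>|lborel. F n \<xi>) = (LINT \<xi>|lborel. of_real (F n \<xi>))" by simp
    also have "\<dots> = (LINT \<xi>|lborel. ft f \<xi> * (ft (\<lambda>x. cnj (f x)) (- \<xi>) * of_real (exp (- ((c n)\<^sup>2 / 4) * (norm \<xi>)\<^sup>2))))"
      by (intro Bochner_Integration.integral_cong refl)
        (simp add: ft_cnj F_def complex_norm_square mult.assoc[symmetric] del: of_real_power)
    also have "\<dots> = (LINT x|lborel. f x * smoothed (c n) (\<lambda>x. cnj (f x)) x)"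
      by (rule regularised_parseval[OF f fc c])
    finally have "(LINT \<xi>|lborel. F n \<xi>) \<le> norm (LINT x|lborel. f x * smoothed (c n) (\<lambda>x. cnj (f x)) x)"
      by (metis abs_ge_self norm_of_real)
    also have "\<dots> \<le> (LINT x|lborel. (norm (f x))\<^sup>2)" by (rule smoothed_pairing_bound[OF f f2 c])
    finally show ?thesis .
  qed
  note C = this
  have l: "AE \<xi> in lborel. (\<lambda>n. F n \<xi>) \<longlonglongrightarrow> (norm (ft f \<xi>))\<^sup>2"
  proof (rule AE_I2)
    fix \<xi>
    show "(\<lambda>n. F n \<xi>) \<longlonglongrightarrow> (norm (ft f \<xi>))\<^sup>2"
      using tendsto_mult_left[OF gaussian_damping_tendsto, of "(norm (ft f \<xi>))\<^sup>2" "(norm \<xi>)\<^sup>2"] by (simp add: F_def c_def)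
  qed
  have nn: "F n \<xi> \<ge> 0" for n \<xi> by (simp add: F_def)
  show "integrable lborel (\<lambda>\<xi>. (norm (ft f \<xi>))\<^sup>2)"
    by (rule Fatou_bounded(1)[OF i _ nn l C]) simp
  show "(LINT \<xi>|lborel. (norm (ft f \<xi>))\<^sup>2) \<le> (LINT x|lborel. (norm (f x))\<^sup>2)"
    by (rule Fatou_bounded(2)[OF i _ nn l C]) simp
qed

lemma nice_L2:
  assumes "\<psi> \<in> nice"
  shows "integrable lborel (\<lambda>x. (norm (\<psi> x))\<^sup>2)"
proof -
  obtain B where B: "B \<ge> 0" "\<And>x. norm (\<psi> x) \<le> B" using nice_bounded[OF assms] by auto
  note [measurable] = nice_borel[OF assms]
  show ?thesis
  proof (rule Bochner_Integration.integrable_bound)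
    show "integrable lborel (\<lambda>x. B * norm (\<psi> x))" using nice_integrable[OF assms] by simp
    show "AE x in lborel. norm ((norm (\<psi> x))\<^sup>2) \<le> norm (B * norm (\<psi> x))"
      using B by (intro AE_I2) (auto simp: power2_eq_square abs_mult intro!: mult_right_mono)
  qed simp
qed

lemma integrable_reflect_L2:
  fixes g :: "real^3 \<Rightarrow> complex"
  assumes "g \<in> borel_measurable borel" "integrable lborel (\<lambda>\<xi>. (norm (g \<xi>))\<^sup>2)"
  shows "integrable lborel (\<lambda>\<xi>. (norm (g (- \<xi>)))\<^sup>2)"
  using integrable_lborel_reflect_iff[of "\<lambda>\<xi>. (norm (g \<xi>))\<^sup>2"] assms by simp

lemma ft_reflect_borel:
  assumes [measurable]: "\<psi> \<in> borel_measurable borel"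
  shows "(\<lambda>\<xi>. ft \<psi> (- \<xi>)) \<in> borel_measurable borel"
  by (rule measurable_compose[OF _ ft_borel]) auto

lemma parseval_nice:
  assumes f: "integrable lborel f" and f2: "integrable lborel (\<lambda>x. (norm (f x))\<^sup>2)" and \<psi>: "\<psi> \<in> nice"
  shows "(LINT \<xi>|lborel. ft f \<xi> * ft \<psi> (- \<xi>)) = (LINT x|lborel. f x * \<psi> x)"
proof -
  note [measurable] = nice_borel[OF \<psi>] ft_reflect_borel[OF nice_borel[OF \<psi>]]
  have [measurable]: "f \<in> borel_measurable borel" using f by (auto dest: borel_measurable_integrable)
  have i: "integrable lborel (\<lambda>\<xi>. ft f \<xi> * ft \<psi> (- \<xi>))"
    by (intro integrable_mult_L2 integrable_ft_L2 integrable_reflect_L2 f f2 nice_integrable nice_L2 \<psi>) auto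
  define d where "d n \<xi> = complex_of_real (exp (- ((1 / (1 + real n))\<^sup>2 / 4) * (norm \<xi>)\<^sup>2))" for n and \<xi> :: "real^3"
  have "(\<lambda>n. LINT \<xi>|lborel. ft f \<xi> * (ft \<psi> (- \<xi>) * d n \<xi>)) \<longlonglongrightarrow> (LINT \<xi>|lborel. ft f \<xi> * ft \<psi> (- \<xi>))"
  proof (rule integral_dominated_convergence[where w="\<lambda>\<xi>. norm (ft f \<xi> * ft \<psi> (- \<xi>))"])
    show "AE \<xi> in lborel. (\<lambda>n. ft f \<xi> * (ft \<psi> (- \<xi>) * d n \<xi>)) \<longlonglongrightarrow> ft f \<xi> * ft \<psi> (- \<xi>)"
    proof (rule AE_I2)
      fix \<xi>
      have "(\<lambda>n. d n \<xi>) \<longlonglongrightarrow> of_real 1" unfolding d_def by (rule tendsto_of_real[OF gaussian_damping_tendsto])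
      then have "(\<lambda>n. ft f \<xi> * (ft \<psi> (- \<xi>) * d n \<xi>)) \<longlonglongrightarrow> ft f \<xi> * (ft \<psi> (- \<xi>) * of_real 1)"
        by (rule tendsto_mult_left[OF tendsto_mult_left])
      then show "(\<lambda>n. ft f \<xi> * (ft \<psi> (- \<xi>) * d n \<xi>)) \<longlonglongrightarrow> ft f \<xi> * ft \<psi> (- \<xi>)" by simp
    qed
    show "AE \<xi> in lborel. norm (ft f \<xi> * (ft \<psi> (- \<xi>) * d n \<xi>)) \<le> norm (ft f \<xi> * ft \<psi> (- \<xi>))" for n
    proof (rule AE_I2)
      fix \<xi>
      have "norm (d n \<xi>) \<le> 1" by (simp only: d_def norm_of_real) simp
      then show "norm (ft f \<xi> * (ft \<psi> (- \<xi>) * d n \<xi>)) \<le> norm (ft f \<xi> * ft \<psi> (- \<xi>))"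
        unfolding norm_mult mult.assoc[symmetric] by (intro mult_left_le) auto
    qed
  qed (use i in \<open>auto simp: d_def intro!: integrable_norm\<close>)
  moreover have "(LINT \<xi>|lborel. ft f \<xi> * (ft \<psi> (- \<xi>) * d n \<xi>)) = (LINT x|lborel. f x * smoothed (1 / (1 + real n)) \<psi> x)" for n
    unfolding d_def by (rule regularised_parseval[OF f nice_integrable[OF \<psi>]]) simp
  ultimately show ?thesis
    using integral_smoothed_tendsto[OF f \<psi>] LIMSEQ_unique by auto
qed

subsection \<open>Gaussians separate functions\<close>

lemma smoothed_pairing_swap:
  assumes F: "integrable lborel F" and \<psi>: "integrable lborel \<psi>" and c: "c > 0"
  shows "(LINT x|lborel. F x * smoothed c \<psi> x) = (LINT y|lborel. \<psi> y * (LINT x|lborel. F x * of_real (gauss_kernel c (x - y))))"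
proof -
  have [measurable]: "F \<in> borel_measurable borel" "\<psi> \<in> borel_measurable borel"
    using F \<psi> by (auto dest: borel_measurable_integrable)
  define K where "K = (1 / (sqrt pi * c)) ^ 3"
  have K: "gauss_kernel c z \<le> K" for z unfolding K_def by (rule gauss_kernel_bounded[OF c])
  have i: "integrable (lborel \<Otimes>\<^sub>M lborel) (\<lambda>(x, y). F x * (\<psi> y * of_real (gauss_kernel c (x - y))))"
  proof (rule integrable_pair_bound[OF integrable_norm[OF F] integrable_mult_left[OF integrable_norm[OF \<psi>], of K]])
    fix x y
    have "norm (F x) * (norm (\<psi> y) * gauss_kernel c (x - y)) \<le> norm (F x) * (norm (\<psi> y) * K)"
      by (intro mult_left_mono K) auto
    then show "norm (case (x, y) of (x, y) \<Rightarrow> F x * (\<psi> y * of_real (gauss_kernel c (x - y)))) \<le> norm (F x) * (norm (\<psi> y) * K)"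
      using gauss_kernel_nonneg[OF c, of "x - y"] by (simp add: norm_mult)
  qed simp
  have "(LINT x|lborel. F x * smoothed c \<psi> x) = (LINT x|lborel. (LINT y|lborel. F x * (\<psi> y * of_real (gauss_kernel c (x - y)))))"
    by (simp add: smoothed_def)
  also have "\<dots> = (LINT y|lborel. (LINT x|lborel. F x * (\<psi> y * of_real (gauss_kernel c (x - y)))))"
    by (rule lborel_pair.Fubini_integral[OF i, symmetric])
  also have "\<dots> = (LINT y|lborel. \<psi> y * (LINT x|lborel. F x * of_real (gauss_kernel c (x - y))))"
  proof (rule Bochner_Integration.integral_cong[OF refl])
    fix y
    show "(LINT x|lborel. F x * (\<psi> y * of_real (gauss_kernel c (x - y)))) = \<psi> y * (LINT x|lborel. F x * of_real (gauss_kernel c (x - y)))"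
      by (subst integral_mult_right_zero[symmetric]) (simp add: mult.left_commute)
  qed
  finally show ?thesis .
qed

lemma nice_orthogonal_Re_null:
  assumes F: "integrable lborel F" and orth: "\<And>\<psi>. \<psi> \<in> nice \<Longrightarrow> (LINT x|lborel. F x * \<psi> x) = 0"
  shows "AE x in lborel. Re (F x) \<le> 0"
proof -
  have Fm[measurable]: "F \<in> borel_measurable borel" using F by (auto dest: borel_measurable_integrable)
  define S where "S = {x. Re (F x) > 0}"
  have Sm[measurable]: "S \<in> sets borel" unfolding S_def by measurable
  have closed_null: "emeasure lborel T = 0" if T: "closed T" "T \<subseteq> S" for T
  proof (cases "T = {}")
    case False
    define \<psi> where "\<psi> n x = complex_of_real (max 0 (1 - real n * infdist x T) * exp (- 1 * (norm x)\<^sup>2))" for n and x :: "real^3"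
    define \<eta> where "\<eta> x = complex_of_real (indicator T x * exp (- 1 * (norm x)\<^sup>2))" for x :: "real^3"
    have Tm[measurable]: "T \<in> sets borel" using T by simp
    have g1: "integrable lborel (\<lambda>x::real^3. complex_of_real (exp (- 1 * (norm x)\<^sup>2)))"
      using integrable_gaussian[of 1, where 'a="real^3"] by (simp only: complex_of_real_integrable_eq) 
    have c: "continuous_on UNIV (\<psi> n)" for n
      unfolding \<psi>_def by (intro continuous_intros)
    have m0: "\<bar>max 0 (1 - real n * infdist x T)\<bar> \<le> 1" for n x by (simp add: infdist_nonneg)
    have le: "norm (\<psi> n x) \<le> exp (- 1 * (norm x)\<^sup>2)" for n x
      unfolding \<psi>_def norm_of_real abs_mult using mult_right_mono[OF m0, of "\<bar>exp (- 1 * (norm x)\<^sup>2)\<bar>"] by simp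
    have \<psi>m[measurable]: "\<psi> n \<in> borel_measurable borel" for n by (rule borel_measurable_continuous_onI[OF c])
    have nice: "\<psi> n \<in> nice" for n
    proof (rule niceI[OF c])
      show "norm (\<psi> n x) \<le> 1" for x by (rule order_trans[OF le]) simp
      show "integrable lborel (\<psi> n)"
        by (rule Bochner_Integration.integrable_bound[OF g1]) (use le in auto)
    qed
    have "(\<lambda>n. LINT x|lborel. F x * \<psi> n x) \<longlonglongrightarrow> (LINT x|lborel. F x * \<eta> x)"
    proof (rule integral_dominated_convergence[where w="\<lambda>x. norm (F x)"])
      show "AE x in lborel. norm (F x * \<psi> n x) \<le> norm (F x)" for n
      proof (rule AE_I2)
        fix x have "norm (\<psi> n x) \<le> 1" by (rule order_trans[OF le]) simp
        then show "norm (F x * \<psi> n x) \<le> norm (F x)" unfolding norm_mult by (intro mult_left_le) auto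
      qed
      show "AE x in lborel. (\<lambda>n. F x * \<psi> n x) \<longlonglongrightarrow> F x * \<eta> x"
      proof (intro AE_I2 tendsto_mult_left)
        fix x :: "real^3"
        have "(\<lambda>n. max 0 (1 - real n * infdist x T)) \<longlonglongrightarrow> indicator T x"
        proof (cases "x \<in> T")
          case False
          then have d: "infdist x T > 0" using infdist_pos_not_in_closed T \<open>T \<noteq> {}\<close> by blast
          obtain N where N: "real N > 1 / infdist x T" using reals_Archimedean2 by blast
          have "max 0 (1 - real n * infdist x T) = 0" if "n \<ge> N" for n
          proof -
            have "real n > 1 / infdist x T" using N that by linarith
            then show ?thesis using d by (simp add: field_simps)
          qed
          then have "eventually (\<lambda>n. max 0 (1 - real n * infdist x T) = 0) sequentially"
            by (auto simp: eventually_sequentially)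
          then show ?thesis using False by (simp add: tendsto_eventually)
        qed simp
        then show "(\<lambda>n. \<psi> n x) \<longlonglongrightarrow> \<eta> x"
          unfolding \<psi>_def \<eta>_def by (intro tendsto_of_real tendsto_mult_right)
      qed
    qed (use F in \<open>auto simp: \<eta>_def\<close>)
    then have "(LINT x|lborel. F x * \<eta> x) = 0" using orth[OF nice] by (simp add: LIMSEQ_const_iff)
    moreover have Fi: "integrable lborel (\<lambda>x. F x * \<eta> x)"
    proof (rule Bochner_Integration.integrable_bound[OF F])
      show "AE x in lborel. norm (F x * \<eta> x) \<le> norm (F x)"
      proof (rule AE_I2)
        fix x have "norm (\<eta> x) \<le> 1" unfolding \<eta>_def norm_of_real by (simp add: indicator_def)
        then show "norm (F x * \<eta> x) \<le> norm (F x)" unfolding norm_mult by (intro mult_left_le) auto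
      qed
    qed (simp add: \<eta>_def)
    ultimately have z: "(LINT x|lborel. Re (F x * \<eta> x)) = 0" by (subst integral_Re) simp_all
    have e: "Re (F x * \<eta> x) = Re (F x) * (indicator T x * exp (- 1 * (norm x)\<^sup>2))" for x
      unfolding \<eta>_def by (simp only: Re_complex_of_real Im_complex_of_real times_complex.sel mult_zero_right diff_zero)
    have "AE x in lborel. Re (F x * \<eta> x) = 0"
    proof (subst integral_nonneg_eq_0_iff_AE[symmetric])
      show "integrable lborel (\<lambda>x. Re (F x * \<eta> x))" using Fi by (rule integrable_Re)
      show "AE x in lborel. 0 \<le> Re (F x * \<eta> x)"
        using T unfolding e by (intro AE_I2) (auto simp: S_def indicator_def subset_iff intro: less_imp_le)
    qed (rule z)
    then have "AE x in lborel. x \<notin> T"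
    proof eventually_elim
      case (elim x)
      then have "Re (F x) * (indicator T x * exp (- 1 * (norm x)\<^sup>2)) = 0" unfolding e .
      then show ?case using T by (auto simp: S_def indicator_def subset_iff)
    qed
    then show ?thesis using Tm by (subst (asm) AE_iff_null) (auto simp: null_sets_def)
  qed simp
  have "emeasure lborel S \<le> ennreal e" if e: "e > 0" for e
  proof -
    have "S \<in> sets lebesgue" by simp
    from sets_lebesgue_inner_closed[OF this e] obtain T where
      T: "closed T" "T \<subseteq> S" "S - T \<in> lmeasurable" "emeasure lebesgue (S - T) < ennreal e" by blast
    have Tm[measurable]: "T \<in> sets borel" using T by simp
    have "emeasure lborel S \<le> emeasure lborel T + emeasure lborel (S - T)"
      using T by (subst plus_emeasure) (auto intro!: emeasure_mono)
    also have "emeasure lborel (S - T) = emeasure lebesgue (S - T)" by simp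
    finally show ?thesis using closed_null[OF T(1,2)] T(4) by simp
  qed
  note le = this
  have "emeasure lborel S \<le> 0"
    by (rule ennreal_le_epsilon) (simp add: le)
  then have "AE x in lborel. x \<notin> S" by (intro AE_not_in) (auto simp: null_sets_def)
  then show ?thesis by eventually_elim (auto simp: S_def)
qed

lemma gaussian_orthogonal_AE_zero:
  fixes f :: "real^3 \<Rightarrow> complex"
  assumes [measurable]: "f \<in> borel_measurable borel"
    and i: "\<And>a b. a > 0 \<Longrightarrow> integrable lborel (\<lambda>x. f x * of_real (exp (- a * (norm (x - b))\<^sup>2)))"
    and z: "\<And>a b. a > 0 \<Longrightarrow> (LINT x|lborel. f x * of_real (exp (- a * (norm (x - b))\<^sup>2))) = 0"
  shows "AE x in lborel. f x = 0"
proof -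
  define F where "F x = f x * of_real (exp (- 1 * (norm x)\<^sup>2))" for x
  have F: "integrable lborel F" using i[of 1 0] by (simp add: F_def[abs_def])
  have k: "(LINT x|lborel. F x * of_real (gauss_kernel c (x - y))) = 0" if c: "c > 0" for c y
  proof -
    define A where "A = 1 / c\<^sup>2"
    have A: "A > 0" using c by (simp add: A_def)
    define b where "b = (A / (1 + A)) *\<^sub>R y"
    define K where "K = (1 / (sqrt pi * c)) ^ 3 * exp (- (A / (1 + A)) * (norm y)\<^sup>2)"
    have q: "(norm x)\<^sup>2 + A * (norm (x - y))\<^sup>2 = (1 + A) * (norm (x - b))\<^sup>2 + (A / (1 + A)) * (norm y)\<^sup>2" for x
    proof -
      have "A / (1 + A) * (1 + A) = A" using A by simp
      then have B: "\<exists>B. A = B * (1 + A) \<and> b = B *\<^sub>R y \<and> A / (1 + A) = B" by (intro exI[of _ "A / (1 + A)"]) (auto simp: b_def)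
      then obtain B where B: "A = B * (1 + A)" "b = B *\<^sub>R y" "A / (1 + A) = B" by blast
      have "(1 + A) * (norm (x - b))\<^sup>2 + B * (norm y)\<^sup>2
         = (1 + A) * (x \<bullet> x) - 2 * (B * (1 + A)) * (x \<bullet> y) + (B * (B * (1 + A)) + B) * (y \<bullet> y)"
        unfolding B(2) power2_norm_eq_inner by (simp add: inner_diff_left inner_diff_right inner_commute algebra_simps)
      also have "\<dots> = (1 + A) * (x \<bullet> x) - 2 * A * (x \<bullet> y) + (B * A + B) * (y \<bullet> y)"
        using B(1) by simp
      also have "B * A + B = A" using B(1) by (simp add: algebra_simps)
      also have "(1 + A) * (x \<bullet> x) - 2 * A * (x \<bullet> y) + A * (y \<bullet> y) = (norm x)\<^sup>2 + A * (norm (x - y))\<^sup>2"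
        unfolding power2_norm_eq_inner by (simp add: inner_diff_left inner_diff_right inner_commute algebra_simps)
      finally show ?thesis using B(3) by simp
    qed
    have "exp (- 1 * (norm x)\<^sup>2) * gauss_kernel c (x - y) = K * exp (- (1 + A) * (norm (x - b))\<^sup>2)" for x
    proof -
      have "exp (- 1 * (norm x)\<^sup>2) * gauss_kernel c (x - y) = (1 / (sqrt pi * c)) ^ 3 * exp (- ((norm x)\<^sup>2 + A * (norm (x - y))\<^sup>2))"
        by (simp add: gauss_kernel_def A_def exp_add[symmetric] exp_diff[symmetric] exp_minus[symmetric])
      also have "\<dots> = K * exp (- (1 + A) * (norm (x - b))\<^sup>2)"
        unfolding q K_def by (simp add: algebra_simps flip: exp_add)
      finally show ?thesis .
    qed
    then have "F x * of_real (gauss_kernel c (x - y)) = of_real K * (f x * of_real (exp (- (1 + A) * (norm (x - b))\<^sup>2)))" for x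
      unfolding F_def by (simp only: mult.assoc of_real_mult[symmetric] mult.left_commute[of "complex_of_real K"])
    moreover have "1 + A > 0" using A by simp
    ultimately show ?thesis using z[of "1 + A" b] by (simp only: integral_mult_right_zero mult_zero_right)
  qed
  have orth: "(LINT x|lborel. F x * \<psi> x) = 0" if \<psi>: "\<psi> \<in> nice" for \<psi>
  proof -
    have "(LINT x|lborel. F x * smoothed (1 / (1 + real n)) \<psi> x) = 0" for n
      using smoothed_pairing_swap[OF F nice_integrable[OF \<psi>], of "1 / (1 + real n)"] by (simp add: k)
    then show ?thesis using integral_smoothed_tendsto[OF F \<psi>] by (simp add: LIMSEQ_const_iff)
  qed
  have *: "AE x in lborel. Re (w * F x) \<le> 0" for w
    by (rule nice_orthogonal_Re_null) (use F orth in \<open>auto simp: mult.assoc\<close>)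
  have "AE x in lborel. F x = 0"
    using *[of 1] *[of "-1"] *[of "\<i>"] *[of "-\<i>"] by eventually_elim (auto simp: complex_eq_iff)
  then show ?thesis by eventually_elim (simp add: F_def)
qed

subsection \<open>Square integrable functions\<close>

lemma L2_limit:
  fixes F :: "nat \<Rightarrow> 'a \<Rightarrow> complex"
  assumes m: "\<And>n. F n \<in> borel_measurable M"
    and i: "\<And>n k. integrable M (\<lambda>x. (norm (F (n + k) x - F n x))\<^sup>2)"
    and le: "\<And>n k. (LINT x|M. (norm (F (n + k) x - F n x))\<^sup>2) \<le> (1 / 4) ^ n"
  obtains G where "G \<in> borel_measurable M" "AE x in M. (\<lambda>n. F n x) \<longlonglongrightarrow> G x"
    "\<And>n. integrable M (\<lambda>x. (norm (G x - F n x))\<^sup>2)" "\<And>n. (LINT x|M. (norm (G x - F n x))\<^sup>2) \<le> (1 / 4) ^ n"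
proof -
  note [measurable] = m
  define d where "d n x = norm (F (Suc n) x - F n x)" for n x
  have d0: "d n x \<ge> 0" for n x by (simp add: d_def)
  have [measurable]: "d n \<in> borel_measurable M" for n unfolding d_def[abs_def] by measurable
  have di: "integrable M (\<lambda>x. (d n x)\<^sup>2)" and dle: "(LINT x|M. (d n x)\<^sup>2) \<le> (1 / 4) ^ n" for n
    using i[of n 1] le[of n 1] by (simp_all add: d_def)
  have "(\<integral>\<^sup>+x. (\<Sum>n. ennreal (2 ^ n * (d n x)\<^sup>2)) \<partial>M) = (\<Sum>n. \<integral>\<^sup>+x. ennreal (2 ^ n * (d n x)\<^sup>2) \<partial>M)"
    by (rule nn_integral_suminf) simp
  also have "\<dots> \<le> (\<Sum>n. ennreal ((1 / 2) ^ n))"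
  proof (intro suminf_le summableI)
    fix n
    have "(\<integral>\<^sup>+x. ennreal (2 ^ n * (d n x)\<^sup>2) \<partial>M) = ennreal (LINT x|M. 2 ^ n * (d n x)\<^sup>2)"
      using di by (intro nn_integral_eq_integral) auto
    also have "(LINT x|M. 2 ^ n * (d n x)\<^sup>2) \<le> 2 ^ n * (1 / 4) ^ n"
      using dle[of n] by simp
    also have "2 ^ n * (1 / 4) ^ n = (1 / 2 :: real) ^ n" by (simp flip: power_mult_distrib)
    finally show "(\<integral>\<^sup>+x. ennreal (2 ^ n * (d n x)\<^sup>2) \<partial>M) \<le> ennreal ((1 / 2) ^ n)" by (simp add: ennreal_leI)
  qed
  also have "\<dots> = ennreal (\<Sum>n. (1 / 2) ^ n)" by (rule suminf_ennreal2) (auto simp: summable_geometric)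
  finally have "(\<integral>\<^sup>+x. (\<Sum>n. ennreal (2 ^ n * (d n x)\<^sup>2)) \<partial>M) \<noteq> \<infinity>"
    using ennreal_less_top by (metis infinity_ennreal_def leD)
  then have "AE x in M. (\<Sum>n. ennreal (2 ^ n * (d n x)\<^sup>2)) \<noteq> \<infinity>"
    by (rule nn_integral_noteq_infinite[rotated]) simp
  then have conv: "AE x in M. convergent (\<lambda>n. F n x)"
  proof eventually_elim
    case (elim x)
    then have s: "summable (\<lambda>n. 2 ^ n * (d n x)\<^sup>2)"
      by (intro summable_suminf_not_top) auto
    have "summable (\<lambda>n. F (Suc n) x - F n x)"
    proof (rule summable_comparison_test'[OF summable_add[OF s summable_geometric[of "1 / 2 :: real"]]])
      fix n
      have "d n x \<le> 2 ^ n * (d n x)\<^sup>2 + (1 / 2) ^ n"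
      proof -
        have "0 \<le> 2 ^ n * (d n x - (1 / 2) ^ n / 2)\<^sup>2" by simp
        also have "\<dots> = 2 ^ n * (d n x)\<^sup>2 - (2 * (1 / 2)) ^ n * d n x + (2 * (1 / 2)) ^ n * (1 / 2) ^ n / 4"
          unfolding power_mult_distrib by (simp add: power2_eq_square algebra_simps)
        finally show ?thesis by (simp add: field_simps)
      qed
      then show "norm (F (Suc n) x - F n x) \<le> 2 ^ n * (d n x)\<^sup>2 + (1 / 2) ^ n" by (simp add: d_def)
    qed simp
    then have "convergent (\<lambda>n. \<Sum>k<n. F (Suc k) x - F k x)" by (simp add: summable_iff_convergent)
    moreover have "(\<Sum>k<n. F (Suc k) x - F k x) = F n x - F 0 x" for n
      by (rule sum_lessThan_telescope)
    ultimately have "convergent (\<lambda>n. F n x - F 0 x)" by simp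
    from convergent_add[OF this convergent_const[of "F 0 x"]] show ?case by simp
  qed
  define G where "G x = lim (\<lambda>n. F n x)" for x
  have G[measurable]: "G \<in> borel_measurable M" unfolding G_def[abs_def] by measurable
  have lim: "AE x in M. (\<lambda>n. F n x) \<longlonglongrightarrow> G x"
    using conv by eventually_elim (simp add: G_def convergent_LIMSEQ_iff)
  have l: "AE x in M. (\<lambda>k. (norm (F (n + k) x - F n x))\<^sup>2) \<longlonglongrightarrow> (norm (G x - F n x))\<^sup>2" for n
    using lim
  proof eventually_elim
    case (elim x)
    then have "(\<lambda>k. F (k + n) x) \<longlonglongrightarrow> G x" by (rule LIMSEQ_ignore_initial_segment)
    then show ?case by (auto simp: add.commute intro!: tendsto_intros)
  qed
  show thesis
  proof (rule that[OF G lim])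
    show "integrable M (\<lambda>x. (norm (G x - F n x))\<^sup>2)" for n
      by (rule Fatou_bounded(1)[OF i _ _ l le]) auto
    show "(LINT x|M. (norm (G x - F n x))\<^sup>2) \<le> (1 / 4) ^ n" for n
      by (rule Fatou_bounded(2)[OF i _ _ l le]) auto
  qed
qed

lemma L2_pairing_tendsto:
  fixes F :: "nat \<Rightarrow> 'a \<Rightarrow> complex"
  assumes [measurable]: "\<And>n. F n \<in> borel_measurable M" "G \<in> borel_measurable M" "g \<in> borel_measurable M"
    and i: "\<And>n. integrable M (\<lambda>x. (norm (G x - F n x))\<^sup>2)"
    and le: "\<And>n. (LINT x|M. (norm (G x - F n x))\<^sup>2) \<le> (1 / 4) ^ n"
    and G: "integrable M (\<lambda>x. (norm (G x))\<^sup>2)" and g: "integrable M (\<lambda>x. (norm (g x))\<^sup>2)"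
  shows "(\<lambda>n. LINT x|M. F n x * g x) \<longlonglongrightarrow> (LINT x|M. G x * g x)"
proof -
  define B where "B = (LINT x|M. (norm (g x))\<^sup>2)"
  have B: "B \<ge> 0" by (simp add: B_def)
  have d: "(LINT x|M. F n x * g x) = (LINT x|M. G x * g x) - (LINT x|M. (G x - F n x) * g x)" for n
  proof -
    have 1: "integrable M (\<lambda>x. G x * g x)" "integrable M (\<lambda>x. (G x - F n x) * g x)"
      by (intro integrable_mult_L2 G g i; measurable)+
    have "(LINT x|M. G x * g x) - (LINT x|M. (G x - F n x) * g x) = (LINT x|M. G x * g x - (G x - F n x) * g x)"
      using 1 by (rule Bochner_Integration.integral_diff[symmetric])
    then show ?thesis by (simp add: algebra_simps)
  qed
  have "(\<lambda>n. LINT x|M. (G x - F n x) * g x) \<longlonglongrightarrow> 0"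
  proof (rule Lim_null_comparison[of _ "\<lambda>n. (1 / 2) ^ n * sqrt B"])
    show "\<forall>\<^sub>F n in sequentially. norm (LINT x|M. (G x - F n x) * g x) \<le> (1 / 2) ^ n * sqrt B"
    proof (intro always_eventually allI)
      fix n
      have "(norm (LINT x|M. (G x - F n x) * g x))\<^sup>2 \<le> (LINT x|M. (norm (G x - F n x))\<^sup>2) * B"
        unfolding B_def by (rule Cauchy_Schwarz_integral) (use i g in auto)
      also have "\<dots> \<le> (1 / 4) ^ n * B" by (intro mult_right_mono le B)
      also have "\<dots> = ((1 / 2) ^ n * sqrt B)\<^sup>2"
      proof -
        have "(1 / 4 :: real) ^ n = (1 / 2) ^ n * (1 / 2) ^ n" by (simp flip: power_mult_distrib)
        then show ?thesis using B unfolding power_mult_distrib by (simp add: power2_eq_square)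
      qed
      finally show "norm (LINT x|M. (G x - F n x) * g x) \<le> (1 / 2) ^ n * sqrt B"
        by (rule power2_le_imp_le) (use B in simp)
    qed
    show "(\<lambda>n. (1 / 2) ^ n * sqrt B) \<longlonglongrightarrow> 0"
      using tendsto_mult_left_zero[OF LIMSEQ_power_zero[of "1 / 2 :: real"]] by simp
  qed
  then have "(\<lambda>n. (LINT x|M. G x * g x) - (LINT x|M. (G x - F n x) * g x)) \<longlonglongrightarrow> (LINT x|M. G x * g x) - 0"
    by (intro tendsto_intros)
  then show ?thesis unfolding d by simp
qed

lemma ft_diff:
  assumes "integrable lborel f" "integrable lborel g"
  shows "ft (\<lambda>x. f x - g x) \<xi> = ft f \<xi> - ft g \<xi>"
proof -
  have "integrable lborel (\<lambda>x. cis (- (x \<bullet> \<xi>)) * f x)" "integrable lborel (\<lambda>x. cis (- (x \<bullet> \<xi>)) * g x)"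
    using assms by (auto intro: integrable_cis_mult)
  then show ?thesis by (simp add: ft_def right_diff_distrib)
qed

lemma fourier_L2:
  assumes fm[measurable]: "f \<in> borel_measurable borel" and f2: "integrable lborel (\<lambda>x. (norm (f x))\<^sup>2)"
  obtains F where "F \<in> borel_measurable borel" "integrable lborel (\<lambda>x. (norm (F x))\<^sup>2)"
    "(LINT x|lborel. (norm (F x))\<^sup>2) \<le> (LINT x|lborel. (norm (f x))\<^sup>2)"
    "\<forall>\<psi>\<in>nice. (LINT x|lborel. f x * ft \<psi> x) = (LINT \<xi>|lborel. F \<xi> * \<psi> \<xi>)"
    "\<forall>\<psi>\<in>nice. (LINT \<xi>|lborel. F \<xi> * ft \<psi> (- \<xi>)) = (LINT x|lborel. f x * \<psi> x)"
proof -
  have "(\<lambda>R::nat. LINT x|lborel. (norm (f x))\<^sup>2 * indicator (- ball 0 (real R)) x) \<longlonglongrightarrow> (LINT x|(lborel::(real^3) measure). 0)"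
  proof (rule integral_dominated_convergence[where w="\<lambda>x. (norm (f x))\<^sup>2"])
    show "AE x in lborel. (\<lambda>R. (norm (f x))\<^sup>2 * indicator (- ball 0 (real R)) x) \<longlonglongrightarrow> 0"
    proof (rule AE_I2)
      fix x :: "real^3"
      obtain N where N: "real N > norm x" using reals_Archimedean2 by blast
      then have "(norm (f x))\<^sup>2 * indicator (- ball 0 (real R)) x = 0" if "R \<ge> N" for R
        using that by (auto simp: indicator_def)
      then show "(\<lambda>R. (norm (f x))\<^sup>2 * indicator (- ball 0 (real R)) x) \<longlonglongrightarrow> 0"
        by (intro tendsto_eventually) (auto simp: eventually_sequentially)
    qed
    show "AE x in lborel. norm ((norm (f x))\<^sup>2 * indicator (- ball 0 (real R)) x) \<le> (norm (f x))\<^sup>2" for R :: nat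
      by (intro AE_I2) (auto simp: indicator_def)
  qed (use f2 in auto)
  then have tail: "(\<lambda>R::nat. LINT x|lborel. (norm (f x))\<^sup>2 * indicator (- ball 0 (real R)) x) \<longlonglongrightarrow> 0" by simp
  have "\<exists>R::nat. (LINT x|lborel. (norm (f x))\<^sup>2 * indicator (- ball 0 (real R)) x) \<le> (1 / 4) ^ n" for n
    using order_tendstoD(2)[OF tail, of "(1 / 4) ^ n"] by (auto simp: eventually_sequentially intro: less_imp_le)
  then obtain N :: "nat \<Rightarrow> nat" where N: "\<And>n. (LINT x|lborel. (norm (f x))\<^sup>2 * indicator (- ball 0 (real (N n))) x) \<le> (1 / 4) ^ n"
    by metis
  define R where "R n = real (\<Sum>k\<le>n. N k)" for n
  have Rmono: "R n \<le> R (n + k)" for n k unfolding R_def by (intro of_nat_mono sum_mono2) auto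
  have RN: "real (N n) \<le> R n" for n unfolding R_def by (intro of_nat_mono member_le_sum) auto
  have Ri: "integrable lborel (\<lambda>x. (norm (f x))\<^sup>2 * indicator (- ball 0 r) x)" for r
    by (rule Bochner_Integration.integrable_bound[OF f2]) (auto simp: indicator_def)
  have Rle: "(LINT x|lborel. (norm (f x))\<^sup>2 * indicator (- ball 0 (R n)) x) \<le> (1 / 4) ^ n" for n
  proof (rule order_trans[OF integral_mono N])
    show "(norm (f x))\<^sup>2 * indicator (- ball 0 (R n)) x \<le> (norm (f x))\<^sup>2 * indicator (- ball 0 (real (N n))) x" for x
      using RN[of n] by (auto simp: indicator_def)
  qed (rule Ri)+
  define fn where "fn n x = f x * indicator (ball 0 (R n)) x" for n x
  have fnm[measurable]: "fn n \<in> borel_measurable borel" for n unfolding fn_def[abs_def]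
    by (intro borel_measurable_times fm borel_measurable_indicator) simp
  have fn2: "integrable lborel (\<lambda>x. (norm (fn n x))\<^sup>2)" for n
    by (rule Bochner_Integration.integrable_bound[OF f2]) (auto simp: fn_def indicator_def)
  have fn2le: "(LINT x|lborel. (norm (fn n x))\<^sup>2) \<le> (LINT x|lborel. (norm (f x))\<^sup>2)" for n
    by (rule integral_mono[OF fn2 f2]) (auto simp: fn_def indicator_def)
  have fni: "integrable lborel (fn n)" for n
  proof (rule Bochner_Integration.integrable_bound)
    have "integrable lborel (indicator (ball 0 (R n)) :: real^3 \<Rightarrow> real)"
      by (rule integrable_real_indicator) (use emeasure_lborel_ball_finite[of "0::real^3" "R n"] in auto)
    then show "integrable lborel (\<lambda>x. indicator (ball 0 (R n)) x + (norm (f x))\<^sup>2)" using f2 by simp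
    show "AE x in lborel. norm (fn n x) \<le> norm (indicator (ball 0 (R n)) x + (norm (f x))\<^sup>2)"
    proof (rule AE_I2)
      fix x
      have "norm (f x) \<le> 1 + (norm (f x))\<^sup>2"
        using sum_squares_bound[of "norm (f x)" 1] norm_ge_zero[of "f x"] by (simp, linarith)
      then show "norm (fn n x) \<le> norm (indicator (ball 0 (R n)) x + (norm (f x))\<^sup>2)"
        by (auto simp: fn_def indicator_def)
    qed
  qed simp
  have f_fn: "integrable lborel (\<lambda>x. (norm (f x - fn n x))\<^sup>2)" "(LINT x|lborel. (norm (f x - fn n x))\<^sup>2) \<le> (1 / 4) ^ n" for n
  proof -
    have e: "(norm (f x - fn n x))\<^sup>2 = (norm (f x))\<^sup>2 * indicator (- ball 0 (R n)) x" for x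
      by (simp add: fn_def indicator_def)
    show "integrable lborel (\<lambda>x. (norm (f x - fn n x))\<^sup>2)" "(LINT x|lborel. (norm (f x - fn n x))\<^sup>2) \<le> (1 / 4) ^ n"
      unfolding e by (rule Ri, rule Rle)
  qed
  have fnd: "integrable lborel (\<lambda>x. (norm (fn (n + k) x - fn n x))\<^sup>2)" "(LINT x|lborel. (norm (fn (n + k) x - fn n x))\<^sup>2) \<le> (1 / 4) ^ n" for n k
  proof -
    have e: "(norm (fn (n + k) x - fn n x))\<^sup>2 \<le> (norm (f x - fn n x))\<^sup>2" for x
      using Rmono[of n k] by (auto simp: fn_def indicator_def)
    show 1: "integrable lborel (\<lambda>x. (norm (fn (n + k) x - fn n x))\<^sup>2)"
      by (rule Bochner_Integration.integrable_bound[OF f_fn(1)[of n]]) (use e in auto)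
    show "(LINT x|lborel. (norm (fn (n + k) x - fn n x))\<^sup>2) \<le> (1 / 4) ^ n"
      by (rule order_trans[OF integral_mono[OF 1 f_fn(1)[of n] e] f_fn(2)])
  qed
  have Fe: "ft (\<lambda>x. fn (n + k) x - fn n x) \<xi> = ft (fn (n + k)) \<xi> - ft (fn n) \<xi>" for n k \<xi>
    by (rule ft_diff[OF fni fni])
  have Fd: "integrable lborel (\<lambda>\<xi>. (norm (ft (fn (n + k)) \<xi> - ft (fn n) \<xi>))\<^sup>2)" for n k
    using integrable_ft_L2[OF Bochner_Integration.integrable_diff[OF fni fni] fnd(1)] unfolding Fe .
  have Fdle: "(LINT \<xi>|lborel. (norm (ft (fn (n + k)) \<xi> - ft (fn n) \<xi>))\<^sup>2) \<le> (1 / 4) ^ n" for n k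
    using order_trans[OF ft_L2_bound[OF Bochner_Integration.integrable_diff[OF fni fni] fnd(1)] fnd(2)] unfolding Fe .
  have Fm: "ft (fn n) \<in> borel_measurable lborel" for n by simp
  obtain F where F[measurable]: "F \<in> borel_measurable lborel" and lim: "AE \<xi> in lborel. (\<lambda>n. ft (fn n) \<xi>) \<longlonglongrightarrow> F \<xi>"
    and FF: "\<And>n. integrable lborel (\<lambda>\<xi>. (norm (F \<xi> - ft (fn n) \<xi>))\<^sup>2)" "\<And>n. (LINT \<xi>|lborel. (norm (F \<xi> - ft (fn n) \<xi>))\<^sup>2) \<le> (1 / 4) ^ n"
    using L2_limit[OF Fm Fd Fdle] by blast
  have lim2: "AE \<xi> in lborel. (\<lambda>n. (norm (ft (fn n) \<xi>))\<^sup>2) \<longlonglongrightarrow> (norm (F \<xi>))\<^sup>2"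
    using lim by eventually_elim (intro tendsto_intros)
  have F2: "integrable lborel (\<lambda>\<xi>. (norm (F \<xi>))\<^sup>2)"
    by (rule Fatou_bounded(1)[OF integrable_ft_L2[OF fni fn2] _ _ lim2 order_trans[OF ft_L2_bound[OF fni fn2] fn2le]]) auto
  have F2le: "(LINT \<xi>|lborel. (norm (F \<xi>))\<^sup>2) \<le> (LINT x|lborel. (norm (f x))\<^sup>2)"
    by (rule Fatou_bounded(2)[OF integrable_ft_L2[OF fni fn2] _ _ lim2 order_trans[OF ft_L2_bound[OF fni fn2] fn2le]]) auto
  have f_lim: "(\<lambda>n. LINT x|lborel. fn n x * g x) \<longlonglongrightarrow> (LINT x|lborel. f x * g x)"
    if "g \<in> borel_measurable borel" "integrable lborel (\<lambda>x. (norm (g x))\<^sup>2)" for g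
    by (rule L2_pairing_tendsto[OF _ _ _ f_fn f2 that(2)]) (use that in auto)
  have F_lim: "(\<lambda>n. LINT \<xi>|lborel. ft (fn n) \<xi> * g \<xi>) \<longlonglongrightarrow> (LINT \<xi>|lborel. F \<xi> * g \<xi>)"
    if "g \<in> borel_measurable borel" "integrable lborel (\<lambda>x. (norm (g x))\<^sup>2)" for g
    by (rule L2_pairing_tendsto[OF _ _ _ FF F2 that(2)]) (use that in auto)
  show thesis
  proof (rule that[OF _ F2 F2le ballI ballI])
    fix \<psi> assume \<psi>: "\<psi> \<in> nice"
    note p = nice_borel[OF \<psi>] nice_integrable[OF \<psi>] nice_L2[OF \<psi>]
    have ft2: "integrable lborel (\<lambda>x. (norm (ft \<psi> x))\<^sup>2)" by (rule integrable_ft_L2[OF p(2,3)])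
    show "(LINT x|lborel. f x * ft \<psi> x) = (LINT \<xi>|lborel. F \<xi> * \<psi> \<xi>)"
      using f_lim[OF ft_borel[OF p(1)] ft2] F_lim[OF p(1,3)]
      unfolding ft_multiplication[OF fni p(2)] by (rule LIMSEQ_unique)
    show "(LINT \<xi>|lborel. F \<xi> * ft \<psi> (- \<xi>)) = (LINT x|lborel. f x * \<psi> x)"
      using F_lim[OF ft_reflect_borel[OF p(1)] integrable_reflect_L2[OF ft_borel[OF p(1)] ft2]] f_lim[OF p(1,3)]
      unfolding parseval_nice[OF fni fn2 \<psi>] by (rule LIMSEQ_unique)
  qed (use F in simp)
qed

section \<open>Pairs of a function and its Fourier transform\<close>

definition fourier_pair :: "(real^3 \<Rightarrow> complex) set \<Rightarrow> (real^3 \<Rightarrow> complex) \<Rightarrow> (real^3 \<Rightarrow> complex) \<Rightarrow> bool" where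
  "fourier_pair T f F \<longleftrightarrow> f \<in> borel_measurable borel \<and> F \<in> borel_measurable borel \<and>
     (\<forall>\<psi>\<in>T. integrable lborel (\<lambda>x. f x * ft \<psi> x) \<and> integrable lborel (\<lambda>\<xi>. F \<xi> * \<psi> \<xi>) \<and>
        (LINT x|lborel. f x * ft \<psi> x) = (LINT \<xi>|lborel. F \<xi> * \<psi> \<xi>))"

lemma fourier_pair_borel:
  assumes "fourier_pair T f F"
  shows "f \<in> borel_measurable borel" "F \<in> borel_measurable borel"
  using assms by (auto simp: fourier_pair_def)

lemma fourier_pairD:
  assumes "fourier_pair T f F" "\<psi> \<in> T"
  shows "integrable lborel (\<lambda>x. f x * ft \<psi> x)" "integrable lborel (\<lambda>\<xi>. F \<xi> * \<psi> \<xi>)"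
    "(LINT x|lborel. f x * ft \<psi> x) = (LINT \<xi>|lborel. F \<xi> * \<psi> \<xi>)"
  using assms by (auto simp: fourier_pair_def)

lemma fourier_pair_mono: "fourier_pair T f F \<Longrightarrow> S \<subseteq> T \<Longrightarrow> fourier_pair S f F"
  by (auto simp: fourier_pair_def)

lemma fourier_pair_nice_schwartz: "fourier_pair nice f F \<Longrightarrow> fourier_pair schwartz f F"
  by (erule fourier_pair_mono) (auto intro: schwartz_nice)

lemma fourier_pair_cong_AE:
  assumes p: "fourier_pair T f F" and T: "T \<subseteq> nice"
    and m[measurable]: "f' \<in> borel_measurable borel" "F' \<in> borel_measurable borel"
    and ae: "AE x in lborel. f x = f' x" "AE x in lborel. F x = F' x"
  shows "fourier_pair T f' F'"
  unfolding fourier_pair_def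
proof (intro conjI ballI m)
  fix \<psi> assume \<psi>: "\<psi> \<in> T"
  then have [measurable]: "\<psi> \<in> borel_measurable borel" using T nice_borel by blast
  note [measurable] = fourier_pair_borel[OF p]
  have 1: "AE x in lborel. f x * ft \<psi> x = f' x * ft \<psi> x" using ae(1) by eventually_elim simp
  have 2: "AE x in lborel. F x * \<psi> x = F' x * \<psi> x" using ae(2) by eventually_elim simp
  have "integrable lborel (\<lambda>x. f x * ft \<psi> x) \<longleftrightarrow> integrable lborel (\<lambda>x. f' x * ft \<psi> x)"
    by (rule integrable_cong_AE[OF _ _ 1]) auto
  then show "integrable lborel (\<lambda>x. f' x * ft \<psi> x)" using fourier_pairD(1)[OF p \<psi>] by simp
  have "integrable lborel (\<lambda>x. F x * \<psi> x) \<longleftrightarrow> integrable lborel (\<lambda>x. F' x * \<psi> x)"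
    by (rule integrable_cong_AE[OF _ _ 2]) auto
  then show "integrable lborel (\<lambda>x. F' x * \<psi> x)" using fourier_pairD(2)[OF p \<psi>] by simp
  have "(LINT x|lborel. f x * ft \<psi> x) = (LINT x|lborel. f' x * ft \<psi> x)"
    by (rule integral_cong_AE[OF _ _ 1]) auto
  moreover have "(LINT x|lborel. F x * \<psi> x) = (LINT x|lborel. F' x * \<psi> x)"
    by (rule integral_cong_AE[OF _ _ 2]) auto
  ultimately show "(LINT x|lborel. f' x * ft \<psi> x) = (LINT x|lborel. F' x * \<psi> x)"
    using fourier_pairD(3)[OF p \<psi>] by simp
qed

lemma fourier_pair_lincomb:
  assumes p: "fourier_pair T f F" and q: "fourier_pair T g G"
  shows "fourier_pair T (\<lambda>x. a * f x + b * g x) (\<lambda>x. a * F x + b * G x)"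
  unfolding fourier_pair_def
proof (intro conjI ballI)
  note [measurable] = fourier_pair_borel[OF p] fourier_pair_borel[OF q]
  show "(\<lambda>x. a * f x + b * g x) \<in> borel_measurable borel" "(\<lambda>x. a * F x + b * G x) \<in> borel_measurable borel"
    by measurable
  fix \<psi> assume \<psi>: "\<psi> \<in> T"
  note P = fourier_pairD[OF p \<psi>] and Q = fourier_pairD[OF q \<psi>]
  have e1: "(a * f x + b * g x) * ft \<psi> x = a * (f x * ft \<psi> x) + b * (g x * ft \<psi> x)" for x by (simp add: algebra_simps)
  have e2: "(a * F x + b * G x) * \<psi> x = a * (F x * \<psi> x) + b * (G x * \<psi> x)" for x by (simp add: algebra_simps)
  show "integrable lborel (\<lambda>x. (a * f x + b * g x) * ft \<psi> x)" unfolding e1 using P Q by simp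
  show "integrable lborel (\<lambda>x. (a * F x + b * G x) * \<psi> x)" unfolding e2 using P Q by simp
  show "(LINT x|lborel. (a * f x + b * g x) * ft \<psi> x) = (LINT x|lborel. (a * F x + b * G x) * \<psi> x)"
    unfolding e1 e2 using P Q by simp
qed

lemma fourier_pair_unique_right:
  assumes p: "fourier_pair schwartz f F" and q: "fourier_pair schwartz f G"
  shows "AE x in lborel. F x = G x"
proof -
  note [measurable] = fourier_pair_borel[OF p] fourier_pair_borel[OF q]
  have "AE x in lborel. F x - G x = 0"
  proof (rule gaussian_orthogonal_AE_zero)
    fix a :: real and b :: "real^3" assume "a > 0"
    note \<psi> = translated_gaussian_schwartz[OF this, of b]
    note P = fourier_pairD[OF p \<psi>] and Q = fourier_pairD[OF q \<psi>]
    show "integrable lborel (\<lambda>x. (F x - G x) * complex_of_real (exp (- a * (norm (x - b))\<^sup>2)))"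
      unfolding left_diff_distrib by (rule Bochner_Integration.integrable_diff[OF P(2) Q(2)])
    show "(LINT x|lborel. (F x - G x) * complex_of_real (exp (- a * (norm (x - b))\<^sup>2))) = 0"
      unfolding left_diff_distrib
      by (subst Bochner_Integration.integral_diff[OF P(2) Q(2)]) (simp only: P(3)[symmetric] Q(3)[symmetric] diff_self)
  qed simp
  then show ?thesis by eventually_elim simp
qed

lemma gaussian_as_ft:
  assumes a: "a > 0"
  obtains \<psi> K where "\<psi> \<in> schwartz" "\<And>x. complex_of_real (exp (- a * (norm (x - b))\<^sup>2)) = K * ft \<psi> x"
proof -
  define c where "c = 1 / sqrt a"
  have c: "c > 0" "1 / c\<^sup>2 = a" using a by (auto simp: c_def power_divide)
  define \<psi> where "\<psi> \<xi> = cis (b \<bullet> \<xi>) * complex_of_real (exp (- (c\<^sup>2 / 4) * (norm \<xi>)\<^sup>2))" for \<xi>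
  have 1: "\<psi> \<in> schwartz" unfolding \<psi>_def[abs_def] using c by (intro modulated_centred_gaussian_schwartz) simp
  define k where "k = (1 / (sqrt pi * c)) ^ 3"
  have k: "k > 0" using c by (simp add: k_def)
  have "gauss_kernel c (b - x) = k * exp (- a * (norm (x - b))\<^sup>2)" for x
    unfolding gauss_kernel_def c(2) k_def norm_minus_commute[of b x] ..
  then have "complex_of_real k * of_real (exp (- a * (norm (x - b))\<^sup>2)) = of_real ft_const * ft \<psi> x" for x
    using ft_gaussian_modulated(2)[OF c(1), of b x] unfolding \<psi>_def[abs_def] by (simp only: of_real_mult)
  then have "complex_of_real (exp (- a * (norm (x - b))\<^sup>2)) = (of_real ft_const / of_real k) * ft \<psi> x" for x
    using k by (simp add: field_simps)
  with 1 show thesis by (rule that)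
qed

lemma fourier_pair_unique_left:
  assumes p: "fourier_pair schwartz f F" and q: "fourier_pair schwartz g F"
  shows "AE x in lborel. f x = g x"
proof -
  note [measurable] = fourier_pair_borel[OF p] fourier_pair_borel[OF q]
  have "AE x in lborel. f x - g x = 0"
  proof (rule gaussian_orthogonal_AE_zero)
    fix a :: real and b :: "real^3" assume "a > 0"
    then obtain \<psi> K where \<psi>: "\<psi> \<in> schwartz" "\<And>x. complex_of_real (exp (- a * (norm (x - b))\<^sup>2)) = K * ft \<psi> x"
      using gaussian_as_ft[where b=b] by metis
    note P = fourier_pairD[OF p \<psi>(1)] and Q = fourier_pairD[OF q \<psi>(1)]
    have e: "(f x - g x) * complex_of_real (exp (- a * (norm (x - b))\<^sup>2)) = K * (f x * ft \<psi> x - g x * ft \<psi> x)" for x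
      unfolding \<psi>(2) by (simp add: algebra_simps)
    show "integrable lborel (\<lambda>x. (f x - g x) * complex_of_real (exp (- a * (norm (x - b))\<^sup>2)))"
      unfolding e by (rule integrable_mult_right[OF Bochner_Integration.integrable_diff[OF P(1) Q(1)]])
    show "(LINT x|lborel. (f x - g x) * complex_of_real (exp (- a * (norm (x - b))\<^sup>2))) = 0"
      unfolding e integral_mult_right_zero
      by (subst Bochner_Integration.integral_diff[OF P(1) Q(1)]) (simp only: P(3) Q(3) diff_self mult_zero_right)
  qed simp
  then show ?thesis by eventually_elim simp
qed

lemma fourier_pair_L2I:
  assumes m[measurable]: "f \<in> borel_measurable borel" "F \<in> borel_measurable borel"
    and f: "integrable lborel (\<lambda>x. (norm (f x))\<^sup>2)" and F: "integrable lborel (\<lambda>x. (norm (F x))\<^sup>2)"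
    and e: "\<And>\<psi>. \<psi> \<in> nice \<Longrightarrow> (LINT x|lborel. f x * ft \<psi> x) = (LINT \<xi>|lborel. F \<xi> * \<psi> \<xi>)"
  shows "fourier_pair nice f F"
  unfolding fourier_pair_def
proof (intro conjI ballI m)
  fix \<psi> assume \<psi>: "\<psi> \<in> nice"
  note p[measurable] = nice_borel[OF \<psi>] 
  note q = nice_integrable[OF \<psi>] nice_L2[OF \<psi>]
  show "integrable lborel (\<lambda>x. f x * ft \<psi> x)" by (intro integrable_mult_L2 f integrable_ft_L2 q) auto
  show "integrable lborel (\<lambda>x. F x * \<psi> x)" by (intro integrable_mult_L2 F q) auto
  show "(LINT x|lborel. f x * ft \<psi> x) = (LINT \<xi>|lborel. F \<xi> * \<psi> \<xi>)" by (rule e[OF \<psi>])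
qed

lemma plancherel_right:
  assumes p: "fourier_pair schwartz f F" and f: "integrable lborel (\<lambda>x. (norm (f x))\<^sup>2)"
  shows "integrable lborel (\<lambda>x. (norm (F x))\<^sup>2)" "(LINT x|lborel. (norm (F x))\<^sup>2) \<le> (LINT x|lborel. (norm (f x))\<^sup>2)"
    "fourier_pair nice f F"
proof -
  note m[measurable] = fourier_pair_borel[OF p]
  obtain G where G[measurable]: "G \<in> borel_measurable borel" and G2: "integrable lborel (\<lambda>x. (norm (G x))\<^sup>2)"
    "(LINT x|lborel. (norm (G x))\<^sup>2) \<le> (LINT x|lborel. (norm (f x))\<^sup>2)"
    and e: "\<forall>\<psi>\<in>nice. (LINT x|lborel. f x * ft \<psi> x) = (LINT \<xi>|lborel. G \<xi> * \<psi> \<xi>)"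
    and "\<forall>\<psi>\<in>nice. (LINT \<xi>|lborel. G \<xi> * ft \<psi> (- \<xi>)) = (LINT x|lborel. f x * \<psi> x)"
    by (rule fourier_L2[OF m(1) f])
  have q: "fourier_pair nice f G" by (rule fourier_pair_L2I[OF m(1) G f G2(1) bspec[OF e]])
  have ae: "AE x in lborel. G x = F x"
    by (rule fourier_pair_unique_right[OF fourier_pair_nice_schwartz[OF q] p])
  show "fourier_pair nice f F"
    by (rule fourier_pair_cong_AE[OF q order_refl m _ ae]) simp
  have ae2: "AE x in lborel. (norm (G x))\<^sup>2 = (norm (F x))\<^sup>2" using ae by eventually_elim simp
  have "integrable lborel (\<lambda>x. (norm (G x))\<^sup>2) \<longleftrightarrow> integrable lborel (\<lambda>x. (norm (F x))\<^sup>2)"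
    by (rule integrable_cong_AE[OF _ _ ae2]) auto
  then show "integrable lborel (\<lambda>x. (norm (F x))\<^sup>2)" using G2 by simp
  have "(LINT x|lborel. (norm (G x))\<^sup>2) = (LINT x|lborel. (norm (F x))\<^sup>2)"
    by (rule integral_cong_AE[OF _ _ ae2]) auto
  then show "(LINT x|lborel. (norm (F x))\<^sup>2) \<le> (LINT x|lborel. (norm (f x))\<^sup>2)" using G2 by simp
qed

lemma fourier_pair_exists_left:
  assumes m[measurable]: "F \<in> borel_measurable borel" and F: "integrable lborel (\<lambda>x. (norm (F x))\<^sup>2)"
  obtains f where "fourier_pair nice f F" "integrable lborel (\<lambda>x. (norm (f x))\<^sup>2)"
    "(LINT x|lborel. (norm (f x))\<^sup>2) \<le> (LINT x|lborel. (norm (F x))\<^sup>2)"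
proof -
  obtain G where G: "G \<in> borel_measurable borel" and G2: "integrable lborel (\<lambda>x. (norm (G x))\<^sup>2)"
    "(LINT x|lborel. (norm (G x))\<^sup>2) \<le> (LINT x|lborel. (norm (F x))\<^sup>2)"
    and "\<forall>\<psi>\<in>nice. (LINT x|lborel. F x * ft \<psi> x) = (LINT \<xi>|lborel. G \<xi> * \<psi> \<xi>)"
    and e: "\<forall>\<psi>\<in>nice. (LINT \<xi>|lborel. G \<xi> * ft \<psi> (- \<xi>)) = (LINT x|lborel. F x * \<psi> x)"
    by (rule fourier_L2[OF m F])
  define f where "f x = G (- x)" for x
  have fm[measurable]: "f \<in> borel_measurable borel"
    unfolding f_def[abs_def] by (rule measurable_compose[OF _ G]) simp
  have f2: "integrable lborel (\<lambda>x. (norm (f x))\<^sup>2)"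
    unfolding f_def by (rule integrable_reflect_L2[OF G G2(1)])
  have "(LINT x|lborel. (norm (f x))\<^sup>2) = (LINT x|lborel. (norm (G x))\<^sup>2)"
    unfolding f_def using G by (intro integral_lborel_reflect[of "\<lambda>x. (norm (G x))\<^sup>2"]) simp
  then have le: "(LINT x|lborel. (norm (f x))\<^sup>2) \<le> (LINT x|lborel. (norm (F x))\<^sup>2)" using G2(2) by simp
  have "fourier_pair nice f F"
  proof (rule fourier_pair_L2I[OF fm m f2 F])
    fix \<psi> assume \<psi>: "\<psi> \<in> nice"
    have "(LINT x|lborel. f x * ft \<psi> x) = (LINT x|lborel. G (- x) * ft \<psi> (- (- x)))" by (simp add: f_def)
    also have "\<dots> = (LINT x|lborel. G x * ft \<psi> (- x))"
      using G ft_reflect_borel[OF nice_borel[OF \<psi>]] by (intro integral_lborel_reflect[of "\<lambda>x. G x * ft \<psi> (- x)"]) simp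
    finally show "(LINT x|lborel. f x * ft \<psi> x) = (LINT \<xi>|lborel. F \<xi> * \<psi> \<xi>)" by (simp add: bspec[OF e \<psi>])
  qed
  then show thesis by (rule that[OF _ f2 le])
qed

lemma plancherel_left:
  assumes p: "fourier_pair schwartz f F" and F: "integrable lborel (\<lambda>x. (norm (F x))\<^sup>2)"
  shows "integrable lborel (\<lambda>x. (norm (f x))\<^sup>2)" "(LINT x|lborel. (norm (f x))\<^sup>2) \<le> (LINT x|lborel. (norm (F x))\<^sup>2)"
proof -
  note m[measurable] = fourier_pair_borel[OF p]
  obtain g where q: "fourier_pair nice g F" and g2: "integrable lborel (\<lambda>x. (norm (g x))\<^sup>2)"
    "(LINT x|lborel. (norm (g x))\<^sup>2) \<le> (LINT x|lborel. (norm (F x))\<^sup>2)"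
    by (rule fourier_pair_exists_left[OF m(2) F])
  note [measurable] = fourier_pair_borel[OF q]
  have "AE x in lborel. g x = f x"
    by (rule fourier_pair_unique_left[OF fourier_pair_nice_schwartz[OF q] p])
  then have ae2: "AE x in lborel. (norm (g x))\<^sup>2 = (norm (f x))\<^sup>2" by eventually_elim simp
  have "integrable lborel (\<lambda>x. (norm (g x))\<^sup>2) \<longleftrightarrow> integrable lborel (\<lambda>x. (norm (f x))\<^sup>2)"
    by (rule integrable_cong_AE[OF _ _ ae2]) auto
  then show "integrable lborel (\<lambda>x. (norm (f x))\<^sup>2)" using g2 by simp
  have "(LINT x|lborel. (norm (g x))\<^sup>2) = (LINT x|lborel. (norm (f x))\<^sup>2)"
    by (rule integral_cong_AE[OF _ _ ae2]) auto
  then show "(LINT x|lborel. (norm (f x))\<^sup>2) \<le> (LINT x|lborel. (norm (F x))\<^sup>2)" using g2 by simp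
qed

lemma borel_measurable_cnj [measurable]: "cnj \<in> borel_measurable borel"
  by (intro borel_measurable_continuous_onI continuous_on_cnj continuous_on_id)

lemma ft_reflect:
  assumes [measurable]: "\<psi> \<in> borel_measurable borel"
  shows "ft (\<lambda>x. \<psi> (- x)) \<xi> = ft \<psi> (- \<xi>)"
  using integral_lborel_reflect[of "\<lambda>x. cis (x \<bullet> \<xi>) * \<psi> x"] by (simp add: ft_def)

lemma fourier_pair_hermitian:
  assumes p: "fourier_pair schwartz (\<lambda>x. of_real (u x)) g"
  shows "AE \<xi> in lborel. cnj (g (- \<xi>)) = g \<xi>"
proof -
  note gm[measurable] = fourier_pair_borel(2)[OF p]
  have [measurable]: "(\<lambda>\<xi>. g (- \<xi>)) \<in> borel_measurable borel" by (rule measurable_compose[OF _ gm]) simp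
  have "AE \<xi> in lborel. cnj (g (- \<xi>)) - g \<xi> = 0"
  proof (rule gaussian_orthogonal_AE_zero)
    fix a :: real and b :: "real^3" assume a: "a > 0"
    define e where "e b x = complex_of_real (exp (- a * (norm (x - b))\<^sup>2))" for b x :: "real^3"
    have es: "e b \<in> schwartz" for b unfolding e_def[abs_def] by (rule translated_gaussian_schwartz[OF a])
    note [measurable] = nice_borel[OF schwartz_nice[OF es]]
    have er: "e (- b) (- x) = e b x" for b x
    proof -
      have "norm (- x - - b) = norm (x - b)" by (metis minus_diff_eq minus_diff_minus norm_minus_cancel)
      then show ?thesis by (simp add: e_def)
    qed
    have ec: "cnj (e b x) = e b x" for b x unfolding e_def by (rule complex_cnj_complex_of_real)
    have fe: "cnj (ft (e (- b)) x) = ft (e b) x" for x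
    proof -
      have "ft (e b) x = ft (\<lambda>x. e (- b) (- x)) x" by (simp only: er)
      also have "\<dots> = ft (e (- b)) (- x)" by (rule ft_reflect) simp
      also have "\<dots> = ft (\<lambda>x. cnj (e (- b) x)) (- x)" by (simp only: ec)
      also have "\<dots> = cnj (ft (e (- b)) x)" by (subst ft_cnj) simp
      finally show ?thesis ..
    qed
    have er': "cnj (g (- \<xi>)) * e b \<xi> = cnj (g (- \<xi>) * e (- b) (- \<xi>))" for \<xi> by (simp add: er ec)
    have i1: "integrable lborel (\<lambda>\<xi>. cnj (g (- \<xi>)) * e b \<xi>)"
      unfolding er' using fourier_pairD(2)[OF p es[of "- b"]]
        integrable_lborel_reflect_iff[of "\<lambda>\<xi>. g \<xi> * e (- b) \<xi>"] by (intro integrable_cnj) simp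
    have "(LINT \<xi>|lborel. cnj (g (- \<xi>)) * e b \<xi>) = cnj (LINT \<xi>|lborel. g (- \<xi>) * e (- b) (- \<xi>))"
      unfolding er' by (rule Bochner_Integration.integral_cnj)
    also have "(LINT \<xi>|lborel. g (- \<xi>) * e (- b) (- \<xi>)) = (LINT \<xi>|lborel. g \<xi> * e (- b) \<xi>)"
      by (rule integral_lborel_reflect[of "\<lambda>\<xi>. g \<xi> * e (- b) \<xi>"]) simp
    also have "\<dots> = (LINT x|lborel. of_real (u x) * ft (e (- b)) x)" by (rule fourier_pairD(3)[OF p es, symmetric])
    also have "cnj \<dots> = (LINT x|lborel. cnj (of_real (u x) * ft (e (- b)) x))" by (rule Bochner_Integration.integral_cnj[symmetric])
    also have "\<dots> = (LINT x|lborel. of_real (u x) * ft (e b) x)" by (simp only: complex_cnj_mult complex_cnj_complex_of_real fe)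
    also have "\<dots> = (LINT \<xi>|lborel. g \<xi> * e b \<xi>)" by (rule fourier_pairD(3)[OF p es])
    finally have eq: "(LINT \<xi>|lborel. cnj (g (- \<xi>)) * e b \<xi>) = (LINT \<xi>|lborel. g \<xi> * e b \<xi>)" .
    note i2 = fourier_pairD(2)[OF p es[of b]]
    have "integrable lborel (\<lambda>\<xi>. (cnj (g (- \<xi>)) - g \<xi>) * e b \<xi>)"
      unfolding left_diff_distrib by (rule Bochner_Integration.integrable_diff[OF i1 i2])
    then show "integrable lborel (\<lambda>\<xi>. (cnj (g (- \<xi>)) - g \<xi>) * complex_of_real (exp (- a * (norm (\<xi> - b))\<^sup>2)))"
      unfolding e_def .
    have "(LINT \<xi>|lborel. (cnj (g (- \<xi>)) - g \<xi>) * e b \<xi>) = 0"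
      unfolding left_diff_distrib by (subst Bochner_Integration.integral_diff[OF i1 i2]) (simp only: eq diff_self)
    then show "(LINT \<xi>|lborel. (cnj (g (- \<xi>)) - g \<xi>) * complex_of_real (exp (- a * (norm (\<xi> - b))\<^sup>2))) = 0"
      unfolding e_def .
  qed simp
  then show ?thesis by eventually_elim simp
qed

lemma fourier_pair_exists_real:
  assumes m[measurable]: "G \<in> borel_measurable borel" and G: "integrable lborel (\<lambda>x. (norm (G x))\<^sup>2)"
    and herm: "AE \<xi> in lborel. cnj (G (- \<xi>)) = G \<xi>"
  obtains w where "w \<in> borel_measurable borel" "integrable lborel (\<lambda>x. (w x)\<^sup>2)" "fourier_pair nice (\<lambda>x. of_real (w x)) G"
proof -
  obtain f where p: "fourier_pair nice f G" and f2: "integrable lborel (\<lambda>x. (norm (f x))\<^sup>2)"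
    using fourier_pair_exists_left[OF m G] by blast
  note fm[measurable] = fourier_pair_borel(1)[OF p]
  have q: "fourier_pair nice (\<lambda>x. cnj (f x)) G"
  proof (rule fourier_pair_L2I[OF _ m _ G])
    show "(\<lambda>x. cnj (f x)) \<in> borel_measurable borel" by simp
    show "integrable lborel (\<lambda>x. (norm (cnj (f x)))\<^sup>2)" using f2 by simp
    fix \<psi> assume \<psi>: "\<psi> \<in> nice"
    note \<psi>m[measurable] = nice_borel[OF \<psi>]
    define \<phi> where "\<phi> x = cnj (\<psi> (- x))" for x
    obtain B where B: "\<And>x. norm (\<psi> x) \<le> B" using nice_bounded[OF \<psi>] by auto
    have [measurable]: "(\<lambda>x. \<psi> (- x)) \<in> borel_measurable borel" by (rule measurable_compose[OF _ \<psi>m]) simp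
    have \<phi>: "\<phi> \<in> nice"
    proof (rule niceI[of _ B])
      have "continuous_on UNIV \<psi>" using \<psi> by (simp add: nice_def)
      then show "continuous_on UNIV \<phi>" unfolding \<phi>_def[abs_def]
        by (intro continuous_on_cnj continuous_on_compose2[of UNIV \<psi> UNIV uminus] continuous_intros) auto
      show "integrable lborel \<phi>" unfolding \<phi>_def[abs_def]
        using nice_integrable[OF \<psi>] integrable_lborel_reflect_iff[of \<psi>] by (intro integrable_cnj) simp
    qed (simp add: \<phi>_def B)
    have "ft \<phi> x = cnj (ft \<psi> x)" for x
    proof -
      have "ft \<phi> x = cnj (ft (\<lambda>x. \<psi> (- x)) (- x))" unfolding \<phi>_def by (rule ft_cnj)
      then show ?thesis by (simp add: ft_reflect)
    qed
    then have "cnj (f x) * ft \<psi> x = cnj (f x * ft \<phi> x)" for x by simp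
    then have "(LINT x|lborel. cnj (f x) * ft \<psi> x) = cnj (LINT x|lborel. f x * ft \<phi> x)" by (simp only: Bochner_Integration.integral_cnj)
    also have "(LINT x|lborel. f x * ft \<phi> x) = (LINT x|lborel. G x * \<phi> x)" by (rule fourier_pairD(3)[OF p \<phi>])
    also have "cnj \<dots> = (LINT x|lborel. cnj (G x * \<phi> x))" by (rule Bochner_Integration.integral_cnj[symmetric])
    also have "\<dots> = (LINT x|lborel. cnj (G (- (- x))) * \<psi> (- x))" by (simp add: \<phi>_def)
    also have "\<dots> = (LINT x|lborel. cnj (G (- x)) * \<psi> x)"
    proof (rule integral_lborel_reflect[of "\<lambda>x. cnj (G (- x)) * \<psi> x"])
      have "(\<lambda>x. G (- x)) \<in> borel_measurable borel" by (rule measurable_compose[OF _ m]) simp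
      then show "(\<lambda>x. cnj (G (- x)) * \<psi> x) \<in> borel_measurable borel" by simp
    qed
    also have "\<dots> = (LINT x|lborel. G x * \<psi> x)"
    proof (rule integral_cong_AE)
      have "(\<lambda>x. G (- x)) \<in> borel_measurable borel" by (rule measurable_compose[OF _ m]) simp
      then show "(\<lambda>x. cnj (G (- x)) * \<psi> x) \<in> borel_measurable lborel" by simp
      show "AE x in lborel. cnj (G (- x)) * \<psi> x = G x * \<psi> x" using herm by eventually_elim simp
    qed simp
    finally show "(LINT x|lborel. cnj (f x) * ft \<psi> x) = (LINT x|lborel. G x * \<psi> x)" .
  qed
  have "(\<lambda>x. (1 / 2) * f x + (1 / 2) * cnj (f x)) = (\<lambda>x. complex_of_real (Re (f x)))"
    by (simp add: fun_eq_iff complex_eq_iff)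
  moreover have "(\<lambda>x. (1 / 2) * G x + (1 / 2) * G x) = G" by (simp add: fun_eq_iff)
  ultimately have r: "fourier_pair nice (\<lambda>x. of_real (Re (f x))) G"
    using fourier_pair_lincomb[OF p q, of "1/2" "1/2"] by simp
  have "integrable lborel (\<lambda>x. (Re (f x))\<^sup>2)"
  proof (rule Bochner_Integration.integrable_bound[OF f2])
    show "AE x in lborel. norm ((Re (f x))\<^sup>2) \<le> norm ((norm (f x))\<^sup>2)"
      using abs_Re_le_cmod by (intro AE_I2) (simp add: abs_le_square_iff[symmetric])
  qed simp
  with r show thesis by (intro that[of "\<lambda>x. Re (f x)"]) auto
qed

lemma fourier_pair_dilate:
  assumes p: "fourier_pair schwartz f F" and c: "c > 0"
  shows "fourier_pair schwartz (\<lambda>x. f (c *\<^sub>R x)) (\<lambda>\<xi>. of_real (1 / c ^ 3) * F ((1 / c) *\<^sub>R \<xi>))"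
  unfolding fourier_pair_def
proof (intro conjI ballI)
  note m[measurable] = fourier_pair_borel[OF p]
  show "(\<lambda>x. f (c *\<^sub>R x)) \<in> borel_measurable borel" "(\<lambda>\<xi>. of_real (1 / c ^ 3) * F ((1 / c) *\<^sub>R \<xi>)) \<in> borel_measurable borel"
    by (auto intro!: borel_measurable_times measurable_compose[OF _ m(1)] measurable_compose[OF _ m(2)])
  fix \<psi> assume \<psi>: "\<psi> \<in> schwartz"
  note \<psi>m[measurable] = nice_borel[OF schwartz_nice[OF \<psi>]]
  define \<phi> where "\<phi> x = \<psi> (c *\<^sub>R x)" for x
  have \<phi>: "\<phi> \<in> schwartz" unfolding \<phi>_def[abs_def] using c by (intro schwartz_dilate \<psi>) simp
  note [measurable] = nice_borel[OF schwartz_nice[OF \<phi>]]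
  have ft: "ft \<psi> x = of_real (c ^ 3) * ft \<phi> (c *\<^sub>R x)" for x
  proof -
    have "(LINT y|lborel. cis (- (c *\<^sub>R y \<bullet> x)) * \<psi> (c *\<^sub>R y)) = (LINT y|lborel. cis (- (y \<bullet> x)) * \<psi> y) /\<^sub>R c ^ 3"
      using c by (intro integral_lborel_dilate[of "\<lambda>y. cis (- (y \<bullet> x)) * \<psi> y"]) auto
    then show ?thesis using c by (simp add: ft_def \<phi>_def scaleR_conv_of_real[where 'a=complex])
  qed
  have c0: "complex_of_real c \<noteq> 0" using c by simp
  have e1: "f (c *\<^sub>R x) * ft \<psi> x = of_real (c ^ 3) * (f (c *\<^sub>R x) * ft \<phi> (c *\<^sub>R x))" for x unfolding ft by (simp add: mult_ac)
  have e2: "of_real (1 / c ^ 3) * F ((1 / c) *\<^sub>R x) * \<psi> x = of_real (1 / c ^ 3) * (F ((1 / c) *\<^sub>R x) * \<phi> ((1 / c) *\<^sub>R x))" for x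
    using c by (simp add: \<phi>_def)
  note P = fourier_pairD[OF p \<phi>]
  have 1: "integrable lborel (\<lambda>x. f (c *\<^sub>R x) * ft \<phi> (c *\<^sub>R x))"
    using integrable_lborel_dilate_iff[of "\<lambda>x. f x * ft \<phi> x" c] P(1) c by simp
  have 2: "integrable lborel (\<lambda>x. F ((1 / c) *\<^sub>R x) * \<phi> ((1 / c) *\<^sub>R x))"
    using integrable_lborel_dilate_iff[of "\<lambda>x. F x * \<phi> x" "1 / c"] P(2) c by simp
  show "integrable lborel (\<lambda>x. f (c *\<^sub>R x) * ft \<psi> x)" unfolding e1 by (rule integrable_mult_right[OF 1])
  show "integrable lborel (\<lambda>x. of_real (1 / c ^ 3) * F ((1 / c) *\<^sub>R x) * \<psi> x)" unfolding e2 by (rule integrable_mult_right[OF 2])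
  have 3: "(LINT x|lborel. f (c *\<^sub>R x) * ft \<phi> (c *\<^sub>R x)) = (LINT x|lborel. f x * ft \<phi> x) /\<^sub>R c ^ 3"
    using c by (intro integral_lborel_dilate[of "\<lambda>x. f x * ft \<phi> x"]) auto
  have 4: "(LINT x|lborel. F ((1 / c) *\<^sub>R x) * \<phi> ((1 / c) *\<^sub>R x)) = (LINT x|lborel. F x * \<phi> x) /\<^sub>R (1 / c) ^ 3"
    using c by (intro integral_lborel_dilate[of "\<lambda>x. F x * \<phi> x"]) auto
  show "(LINT x|lborel. f (c *\<^sub>R x) * ft \<psi> x) = (LINT x|lborel. of_real (1 / c ^ 3) * F ((1 / c) *\<^sub>R x) * \<psi> x)"
    unfolding e1 e2 integral_mult_right_zero 3 4 P(3) using c0 by (simp add: scaleR_conv_of_real[where 'a=complex] field_simps)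
qed

section \<open>Fractional derivatives\<close>

lemma borel_version_real:
  fixes f :: "real^3 \<Rightarrow> real"
  assumes "f \<in> borel_measurable lebesgue"
  obtains f' where "f' \<in> borel_measurable borel" "AE x in lborel. f x = f' x"
  using completion_ex_borel_measurable_real[OF assms] by auto

lemma borel_version_complex:
  fixes f :: "real^3 \<Rightarrow> complex"
  assumes [measurable]: "f \<in> borel_measurable lebesgue"
  obtains f' where "f' \<in> borel_measurable borel" "AE x in lborel. f x = f' x"
proof -
  have m: "(\<lambda>x. Re (f x)) \<in> borel_measurable lebesgue" "(\<lambda>x. Im (f x)) \<in> borel_measurable lebesgue" by measurable
  obtain r where [measurable]: "r \<in> borel_measurable borel" and r: "AE x in lborel. Re (f x) = r x"
    by (rule borel_version_real[OF m(1)])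
  obtain i where [measurable]: "i \<in> borel_measurable borel" and i: "AE x in lborel. Im (f x) = i x"
    by (rule borel_version_real[OF m(2)])
  note ae = r i
  show thesis
  proof (rule that[of "\<lambda>x. of_real (r x) + \<i> * of_real (i x)"])
    show "AE x in lborel. f x = of_real (r x) + \<i> * of_real (i x)"
      using ae by eventually_elim (simp add: complex_eq_iff)
  qed simp
qed

lemma borel_imp_lebesgue: "f \<in> borel_measurable borel \<Longrightarrow> f \<in> borel_measurable lebesgue"
  by (simp add: measurable_completion)

lemma is_fourier_transform_imp_pair:
  assumes ft: "is_fourier_transform u g"
    and m[measurable]: "u' \<in> borel_measurable borel" "g' \<in> borel_measurable borel"
    and ae: "AE x in lborel. u x = u' x" "AE x in lborel. g x = g' x"
  shows "fourier_pair schwartz (\<lambda>x. of_real (u' x)) g'"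
  unfolding fourier_pair_def
proof (intro conjI ballI)
  fix \<psi> assume \<psi>: "\<psi> \<in> schwartz"
  note \<psi>m[measurable] = nice_borel[OF schwartz_nice[OF \<psi>]]
  have [measurable]: "u \<in> borel_measurable lebesgue" "g \<in> borel_measurable lebesgue"
    using ft by (auto simp: is_fourier_transform_def)
  note [measurable] = borel_imp_lebesgue[OF m(1)] borel_imp_lebesgue[OF m(2)] borel_imp_lebesgue[OF \<psi>m]
    borel_imp_lebesgue[OF ft_borel[OF \<psi>m]]
  have 1: "AE x in lebesgue. complex_of_real (u x) * ft \<psi> x = of_real (u' x) * ft \<psi> x"
    using AE_completion[OF ae(1)] by eventually_elim simp
  have 2: "AE x in lebesgue. g x * \<psi> x = g' x * \<psi> x"
    using AE_completion[OF ae(2)] by eventually_elim simp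
  have I: "integrable lebesgue (\<lambda>x. of_real (u x) * ft \<psi> x)" "integrable lebesgue (\<lambda>\<xi>. g \<xi> * \<psi> \<xi>)"
    "(LINT x|lebesgue. of_real (u x) * ft \<psi> x) = (LINT \<xi>|lebesgue. g \<xi> * \<psi> \<xi>)"
    using ft \<psi> unfolding is_fourier_transform_def fourier_schwartz_eq_ft[OF \<psi>m, symmetric] by auto
  have "integrable lebesgue (\<lambda>x. complex_of_real (u x) * ft \<psi> x) \<longleftrightarrow> integrable lebesgue (\<lambda>x. complex_of_real (u' x) * ft \<psi> x)"
    by (rule integrable_cong_AE[OF _ _ 1]; measurable)
  then show "integrable lborel (\<lambda>x. of_real (u' x) * ft \<psi> x)" using I by (subst (asm) integrable_completion) auto
  have "integrable lebesgue (\<lambda>x. g x * \<psi> x) \<longleftrightarrow> integrable lebesgue (\<lambda>x. g' x * \<psi> x)"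
    by (rule integrable_cong_AE[OF _ _ 2]; measurable)
  then show "integrable lborel (\<lambda>x. g' x * \<psi> x)" using I by (subst (asm) integrable_completion) auto
  have "(LINT x|lborel. of_real (u' x) * ft \<psi> x) = (LINT x|lebesgue. of_real (u' x) * ft \<psi> x)"
    by (subst integral_completion) auto
  also have "\<dots> = (LINT x|lebesgue. of_real (u x) * ft \<psi> x)"
    by (rule integral_cong_AE[OF _ _ 1, symmetric]; measurable)
  also have "\<dots> = (LINT x|lebesgue. g x * \<psi> x)" by (rule I)
  also have "\<dots> = (LINT x|lebesgue. g' x * \<psi> x)"
    by (rule integral_cong_AE[OF _ _ 2]; measurable)
  also have "\<dots> = (LINT x|lborel. g' x * \<psi> x)" by (subst integral_completion) auto
  finally show "(LINT x|lborel. of_real (u' x) * ft \<psi> x) = (LINT x|lborel. g' x * \<psi> x)" .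
qed (use m in auto)

lemma fourier_pair_imp_is_fourier_transform:
  assumes p: "fourier_pair schwartz (\<lambda>x. of_real (u x)) g" and um[measurable]: "u \<in> borel_measurable borel"
  shows "is_fourier_transform u g"
  unfolding is_fourier_transform_def
proof (intro conjI ballI)
  note [measurable] = fourier_pair_borel(2)[OF p]
  show "u \<in> borel_measurable lebesgue" "g \<in> borel_measurable lebesgue" by (auto intro: borel_imp_lebesgue)
  fix \<psi> assume \<psi>: "\<psi> \<in> schwartz"
  note \<psi>m[measurable] = nice_borel[OF schwartz_nice[OF \<psi>]]
  note P = fourier_pairD[OF p \<psi>]
  show "integrable lebesgue (\<lambda>x. of_real (u x) * fourier_schwartz \<psi> x)"
    unfolding fourier_schwartz_eq_ft[OF \<psi>m] using P by (subst integrable_completion) auto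
  show "integrable lebesgue (\<lambda>\<xi>. g \<xi> * \<psi> \<xi>)" using P by (subst integrable_completion) auto
  show "(LINT x|lebesgue. of_real (u x) * fourier_schwartz \<psi> x) = (LINT \<xi>|lebesgue. g \<xi> * \<psi> \<xi>)"
    unfolding fourier_schwartz_eq_ft[OF \<psi>m] using P(3) by (subst (1 2) integral_completion) auto
qed

definition frac_deriv :: "real \<Rightarrow> (real^3 \<Rightarrow> real) \<Rightarrow> (real^3 \<Rightarrow> real) \<Rightarrow> bool" where
  "frac_deriv s u W \<longleftrightarrow> u \<in> borel_measurable borel \<and> W \<in> borel_measurable borel \<and>
     integrable lborel (\<lambda>x. (W x)\<^sup>2) \<and>
     (\<exists>g. fourier_pair schwartz (\<lambda>x. of_real (u x)) g \<and>
          fourier_pair schwartz (\<lambda>x. of_real (W x)) (\<lambda>\<xi>. of_real (norm \<xi> powr s) * g \<xi>))"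

lemma frac_deriv_borel:
  assumes "frac_deriv s u W"
  shows "u \<in> borel_measurable borel" "W \<in> borel_measurable borel" "integrable lborel (\<lambda>x. (W x)\<^sup>2)"
  using assms by (auto simp: frac_deriv_def)

lemma norm_powr_mult_borel:
  assumes [measurable]: "g \<in> borel_measurable borel"
  shows "(\<lambda>\<xi>::real^3. complex_of_real (norm \<xi> powr s) * g \<xi>) \<in> borel_measurable borel"
  by measurable

lemma frac_laplacian_AE:
  assumes W: "frac_deriv s u W"
  shows "frac_laplacian (s / 2) u \<in> borel_measurable lebesgue" "AE x in lborel. frac_laplacian (s / 2) u x = W x"
proof -
  obtain g where p: "fourier_pair schwartz (\<lambda>x. of_real (u x)) g"
    and q: "fourier_pair schwartz (\<lambda>x. of_real (W x)) (\<lambda>\<xi>. of_real (norm \<xi> powr s) * g \<xi>)"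
    using W by (auto simp: frac_deriv_def)
  note um[measurable] = frac_deriv_borel(1,2)[OF W]
  have "\<exists>w g. is_fourier_transform u g \<and> is_fourier_transform w (\<lambda>\<xi>. of_real (norm \<xi> powr (2 * (s / 2))) * g \<xi>)"
    using fourier_pair_imp_is_fourier_transform[OF p um(1)] fourier_pair_imp_is_fourier_transform[OF q um(2)] by auto
  then have "\<exists>g. is_fourier_transform u g \<and> is_fourier_transform (frac_laplacian (s / 2) u) (\<lambda>\<xi>. of_real (norm \<xi> powr (2 * (s / 2))) * g \<xi>)"
    unfolding frac_laplacian_def by (rule someI_ex)
  then obtain h where h: "is_fourier_transform u h"
    "is_fourier_transform (frac_laplacian (s / 2) u) (\<lambda>\<xi>. of_real (norm \<xi> powr s) * h \<xi>)" by auto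
  then show Lm: "frac_laplacian (s / 2) u \<in> borel_measurable lebesgue" by (simp add: is_fourier_transform_def)
  obtain L where [measurable]: "L \<in> borel_measurable borel" and L: "AE x in lborel. frac_laplacian (s / 2) u x = L x"
    by (rule borel_version_real[OF Lm])
  have "h \<in> borel_measurable lebesgue" using h by (simp add: is_fourier_transform_def)
  then obtain k where k[measurable]: "k \<in> borel_measurable borel" "AE x in lborel. h x = k x"
    by (rule borel_version_complex)
  have k2: "AE \<xi> in lborel. of_real (norm \<xi> powr s) * h \<xi> = of_real (norm \<xi> powr s) * k \<xi>"
    using k(2) by eventually_elim simp
  have pk: "fourier_pair schwartz (\<lambda>x. of_real (u x)) k"
    by (rule is_fourier_transform_imp_pair[OF h(1) um(1) k(1) _ k(2)]) simp
  have qk: "fourier_pair schwartz (\<lambda>x. of_real (L x)) (\<lambda>\<xi>. of_real (norm \<xi> powr s) * k \<xi>)"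
    by (rule is_fourier_transform_imp_pair[OF h(2) _ norm_powr_mult_borel[OF k(1)] L k2]) simp
  have "AE \<xi> in lborel. k \<xi> = g \<xi>" by (rule fourier_pair_unique_right[OF pk p])
  then have "AE \<xi> in lborel. of_real (norm \<xi> powr s) * k \<xi> = of_real (norm \<xi> powr s) * g \<xi>"
    by eventually_elim simp
  note ae = this
  have sn: "schwartz \<subseteq> nice" using schwartz_nice by auto
  have "fourier_pair schwartz (\<lambda>x. of_real (L x)) (\<lambda>\<xi>. of_real (norm \<xi> powr s) * g \<xi>)"
    by (rule fourier_pair_cong_AE[OF qk sn fourier_pair_borel(1)[OF qk] fourier_pair_borel(2)[OF q] _ ae]) simp
  from fourier_pair_unique_left[OF this q] have "AE x in lborel. complex_of_real (L x) = of_real (W x)" .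
  then show "AE x in lborel. frac_laplacian (s / 2) u x = W x"
    using L by eventually_elim simp
qed

lemma fourier_pair_lincomb_real:
  assumes "fourier_pair T (\<lambda>x. of_real (u x)) g" "fourier_pair T (\<lambda>x. of_real (v x)) h"
  shows "fourier_pair T (\<lambda>x. of_real (a * u x + b * v x)) (\<lambda>\<xi>. of_real a * g \<xi> + of_real b * h \<xi>)"
  unfolding of_real_add of_real_mult by (rule fourier_pair_lincomb[OF assms])

lemma integrable_lincomb_L2:
  fixes U W :: "'a \<Rightarrow> real"
  assumes m[measurable]: "U \<in> borel_measurable M" "W \<in> borel_measurable M"
    and i: "integrable M (\<lambda>x. (U x)\<^sup>2)" "integrable M (\<lambda>x. (W x)\<^sup>2)"
  shows "integrable M (\<lambda>x. (a * U x + b * W x)\<^sup>2)"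
proof -
  have "integrable M (\<lambda>x. (norm (a * U x))\<^sup>2)" "integrable M (\<lambda>x. (norm (b * W x))\<^sup>2)"
    unfolding real_norm_def power2_abs power_mult_distrib using i by (auto intro: integrable_mult_right)
  from integrable_add_L2[OF _ _ this] show ?thesis by simp
qed

lemma frac_deriv_lincomb:
  assumes u: "frac_deriv s u U" and w: "frac_deriv s w W"
  shows "frac_deriv s (\<lambda>x. a * u x + b * w x) (\<lambda>x. a * U x + b * W x)"
proof -
  note m = frac_deriv_borel[OF u] frac_deriv_borel[OF w]
  note [measurable] = m(1,2,4,5)
  obtain g h where p: "fourier_pair schwartz (\<lambda>x. of_real (u x)) g"
    "fourier_pair schwartz (\<lambda>x. of_real (U x)) (\<lambda>\<xi>. of_real (norm \<xi> powr s) * g \<xi>)"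
    and q: "fourier_pair schwartz (\<lambda>x. of_real (w x)) h"
    "fourier_pair schwartz (\<lambda>x. of_real (W x)) (\<lambda>\<xi>. of_real (norm \<xi> powr s) * h \<xi>)"
    using u w unfolding frac_deriv_def by blast
  have 1: "fourier_pair schwartz (\<lambda>x. of_real (a * U x + b * W x)) (\<lambda>\<xi>. of_real (norm \<xi> powr s) * (of_real a * g \<xi> + of_real b * h \<xi>))"
    using fourier_pair_lincomb_real[OF p(2) q(2), of a b] by (simp only: distrib_left mult.left_commute)
  note 2 = fourier_pair_lincomb_real[OF p(1) q(1), of a b]
  have 3: "integrable lborel (\<lambda>x. (a * U x + b * W x)\<^sup>2)"
    using m by (intro integrable_lincomb_L2) auto
  have 4: "(\<lambda>x. a * u x + b * w x) \<in> borel_measurable borel" "(\<lambda>x. a * U x + b * W x) \<in> borel_measurable borel"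
    by measurable
  show ?thesis unfolding frac_deriv_def using 1 2 3 4 by blast
qed

lemma frac_deriv_dilate:
  assumes u: "frac_deriv s u U" and c: "c > 0"
  shows "frac_deriv s (\<lambda>x. a * u (c *\<^sub>R x)) (\<lambda>x. a * c powr s * U (c *\<^sub>R x))"
proof -
  note m = frac_deriv_borel[OF u]
  obtain g where p: "fourier_pair schwartz (\<lambda>x. of_real (u x)) g"
    "fourier_pair schwartz (\<lambda>x. of_real (U x)) (\<lambda>\<xi>. of_real (norm \<xi> powr s) * g \<xi>)"
    using u by (auto simp: frac_deriv_def)
  define G where "G \<xi> = of_real (1 / c ^ 3) * g ((1 / c) *\<^sub>R \<xi>)" for \<xi>
  have 1: "fourier_pair schwartz (\<lambda>x. of_real (u (c *\<^sub>R x))) G"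
    unfolding G_def by (rule fourier_pair_dilate[OF p(1) c])
  have 2: "fourier_pair schwartz (\<lambda>x. of_real (U (c *\<^sub>R x))) (\<lambda>\<xi>. of_real (c powr (- s)) * (of_real (norm \<xi> powr s) * G \<xi>))"
  proof -
    have "norm ((1 / c) *\<^sub>R \<xi>) powr s = c powr (- s) * norm \<xi> powr s" for \<xi> :: "real^3"
      using c by (simp add: powr_divide powr_minus field_simps)
    then have "(\<lambda>\<xi>. of_real (1 / c ^ 3) * (of_real (norm ((1 / c) *\<^sub>R \<xi>) powr s) * g ((1 / c) *\<^sub>R \<xi>)))
       = (\<lambda>\<xi>. of_real (c powr (- s)) * (of_real (norm \<xi> powr s) * G \<xi>))"
      by (simp add: G_def fun_eq_iff mult_ac)
    then show ?thesis using fourier_pair_dilate[OF p(2) c] by simp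
  qed
  have z: "fourier_pair schwartz (\<lambda>x. of_real (a * u (c *\<^sub>R x))) (\<lambda>\<xi>. of_real a * G \<xi>)"
    using fourier_pair_lincomb_real[OF 1 1, of a 0] by (simp only: of_real_0 mult_zero_left add_0_right)
  have "of_real (a * c powr s) * (of_real (c powr (- s)) * (of_real (norm \<xi> powr s) * G \<xi>)) = of_real (norm \<xi> powr s) * (of_real a * G \<xi>)" for \<xi> :: "real^3"
  proof -
    have "c powr s * c powr (- s) = 1" using c by (simp add: powr_minus)
    then have "complex_of_real (c powr s) * of_real (c powr (- s)) = 1" by (metis of_real_1 of_real_mult)
    then show ?thesis by (simp add: mult_ac)
  qed
  then have w: "fourier_pair schwartz (\<lambda>x. of_real (a * c powr s * U (c *\<^sub>R x))) (\<lambda>\<xi>. of_real (norm \<xi> powr s) * (of_real a * G \<xi>))"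
    using fourier_pair_lincomb_real[OF 2 2, of "a * c powr s" 0] by (simp only: of_real_0 mult_zero_left add_0_right)
  have [measurable]: "(\<lambda>x. u (c *\<^sub>R x)) \<in> borel_measurable borel" by (rule measurable_compose[OF _ m(1)]) simp
  have [measurable]: "(\<lambda>x. U (c *\<^sub>R x)) \<in> borel_measurable borel" by (rule measurable_compose[OF _ m(2)]) simp
  have b: "(\<lambda>x. a * u (c *\<^sub>R x)) \<in> borel_measurable borel" "(\<lambda>x. a * c powr s * U (c *\<^sub>R x)) \<in> borel_measurable borel"
    by measurable
  have "integrable lborel (\<lambda>x. (U (c *\<^sub>R x))\<^sup>2)"
    using integrable_lborel_dilate_iff[of "\<lambda>x. (U x)\<^sup>2" c] m c by simp
  then have i: "integrable lborel (\<lambda>x. (a * c powr s * U (c *\<^sub>R x))\<^sup>2)"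
    unfolding power_mult_distrib by (intro integrable_mult_right)
  show ?thesis unfolding frac_deriv_def
    using b i w z by blast
qed

lemma frac_deriv_zero:
  assumes u: "frac_deriv s u W" and W: "AE x in lborel. W x = 0"
  shows "AE x in lborel. u x = 0"
proof -
  obtain g where p: "fourier_pair schwartz (\<lambda>x. of_real (u x)) g"
    and q: "fourier_pair schwartz (\<lambda>x. of_real (W x)) (\<lambda>\<xi>. of_real (norm \<xi> powr s) * g \<xi>)"
    using u by (auto simp: frac_deriv_def)
  have sn: "schwartz \<subseteq> nice" using schwartz_nice by auto
  have z: "fourier_pair schwartz (\<lambda>x. 0) (\<lambda>x. 0)" by (simp add: fourier_pair_def)
  have W': "AE x in lborel. complex_of_real (W x) = 0" using W by eventually_elim simp
  have "fourier_pair schwartz (\<lambda>x. 0) (\<lambda>\<xi>. of_real (norm \<xi> powr s) * g \<xi>)"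
    by (rule fourier_pair_cong_AE[OF q sn _ fourier_pair_borel(2)[OF q] W']) simp_all
  from fourier_pair_unique_right[OF this z] have "AE \<xi> in lborel. of_real (norm \<xi> powr s) * g \<xi> = 0" .
  moreover have "AE \<xi> in lborel. \<xi> \<noteq> (0 :: real^3)" by (rule AE_lborel_singleton)
  ultimately have g: "AE \<xi> in lborel. g \<xi> = 0" by eventually_elim auto
  have "fourier_pair schwartz (\<lambda>x. of_real (u x)) (\<lambda>x. 0)"
    by (rule fourier_pair_cong_AE[OF p sn fourier_pair_borel(1)[OF p] _ _ g]) simp_all
  from fourier_pair_unique_left[OF this z] show ?thesis by eventually_elim simp
qed

lemma norm_powr_2: "norm x powr 2 = (norm x)\<^sup>2"
  by (rule powr_numeral) simp

lemma Lp_iff_borel: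
  fixes f :: "real^3 \<Rightarrow> 'b::{real_normed_vector, second_countable_topology}"
  assumes [measurable]: "f \<in> borel_measurable borel"
  shows "f \<in> Lp q \<longleftrightarrow> integrable lborel (\<lambda>x. norm (f x) powr q)"
proof -
  have "f \<in> borel_measurable lebesgue" by (rule borel_imp_lebesgue) simp
  moreover have "integrable lebesgue (\<lambda>x. norm (f x) powr q) \<longleftrightarrow> integrable lborel (\<lambda>x. norm (f x) powr q)"
    by (rule integrable_completion) simp
  ultimately show ?thesis by (simp add: Lp_def)
qed

lemma Lp_AE:
  fixes f g :: "real^3 \<Rightarrow> complex"
  assumes f: "f \<in> Lp 2" and [measurable]: "g \<in> borel_measurable borel" and ae: "AE x in lborel. f x = g x"
  shows "integrable lborel (\<lambda>x. (norm (g x))\<^sup>2)"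
proof -
  have [measurable]: "f \<in> borel_measurable lebesgue" and i: "integrable lebesgue (\<lambda>x. norm (f x) powr 2)"
    using f by (auto simp: Lp_def)
  have [measurable]: "g \<in> borel_measurable lebesgue" by (rule borel_imp_lebesgue) simp
  have "AE x in lebesgue. norm (f x) powr 2 = (norm (g x))\<^sup>2"
    using AE_completion[OF ae] by eventually_elim (simp add: norm_powr_2)
  from integrable_cong_AE[OF _ _ this] i have "integrable lebesgue (\<lambda>x. (norm (g x))\<^sup>2)" by simp
  then show ?thesis by (subst (asm) integrable_completion) auto
qed

lemma frac_deriv_exists:
  assumes um[measurable]: "u \<in> borel_measurable borel" and s: "s > 0" and u: "u \<in> Hspace s \<or> u \<in> Dspace s"
  obtains W where "frac_deriv s u W"
proof -
  have "\<exists>g. is_fourier_transform u g \<and> (\<exists>m\<in>borel_measurable borel. (\<forall>\<xi>. norm \<xi> powr s \<le> m \<xi>) \<and> (\<lambda>\<xi>. of_real (m \<xi>) * g \<xi>) \<in> Lp 2)"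
    using u
  proof
    assume "u \<in> Hspace s"
    then obtain g where g: "is_fourier_transform u g" "(\<lambda>\<xi>. of_real ((1 + (norm \<xi>)\<^sup>2) powr (s / 2)) * g \<xi>) \<in> Lp 2"
      by (auto simp: Hspace_def)
    have "norm \<xi> powr s \<le> (1 + (norm \<xi>)\<^sup>2) powr (s / 2)" for \<xi> :: "real^3"
    proof -
      have "norm \<xi> powr s = ((norm \<xi>)\<^sup>2) powr (s / 2)"
        unfolding norm_powr_2[of \<xi>, symmetric] powr_powr by simp
      also have "\<dots> \<le> (1 + (norm \<xi>)\<^sup>2) powr (s / 2)" using s by (intro powr_mono2) auto
      finally show ?thesis .
    qed
    with g show ?thesis by (intro exI[of _ g] conjI bexI[of _ "\<lambda>\<xi>. (1 + (norm \<xi>)\<^sup>2) powr (s / 2)"]) auto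
  next
    assume "u \<in> Dspace s"
    then obtain g where g: "is_fourier_transform u g" "(\<lambda>\<xi>. of_real (norm \<xi> powr s) * g \<xi>) \<in> Lp 2"
      by (auto simp: Dspace_def)
    then show ?thesis by (intro exI[of _ g] conjI bexI[of _ "\<lambda>\<xi>. norm \<xi> powr s"]) auto
  qed
  then obtain g m where g: "is_fourier_transform u g" and [measurable]: "m \<in> borel_measurable borel"
    and m: "\<And>\<xi>. norm \<xi> powr s \<le> m \<xi>" "(\<lambda>\<xi>. of_real (m \<xi>) * g \<xi>) \<in> Lp 2" by auto
  have "g \<in> borel_measurable lebesgue" using g by (simp add: is_fourier_transform_def)
  then obtain k where k[measurable]: "k \<in> borel_measurable borel" "AE x in lborel. g x = k x"
    by (rule borel_version_complex)
  have p: "fourier_pair schwartz (\<lambda>x. of_real (u x)) k"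
    by (rule is_fourier_transform_imp_pair[OF g um k(1) _ k(2)]) simp
  have ae: "AE \<xi> in lborel. of_real (m \<xi>) * g \<xi> = of_real (m \<xi>) * k \<xi>" using k(2) by eventually_elim simp
  have mk: "integrable lborel (\<lambda>\<xi>. (norm (of_real (m \<xi>) * k \<xi>))\<^sup>2)"
    by (rule Lp_AE[OF m(2) _ ae]) simp
  define G where "G \<xi> = of_real (norm \<xi> powr s) * k \<xi>" for \<xi>
  have G[measurable]: "G \<in> borel_measurable borel" unfolding G_def[abs_def] by (rule norm_powr_mult_borel[OF k(1)])
  have G2: "integrable lborel (\<lambda>\<xi>. (norm (G \<xi>))\<^sup>2)"
  proof (rule Bochner_Integration.integrable_bound[OF mk])
    show "AE \<xi> in lborel. norm ((norm (G \<xi>))\<^sup>2) \<le> norm ((norm (of_real (m \<xi>) * k \<xi>))\<^sup>2)"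
    proof (rule AE_I2)
      fix \<xi> :: "real^3"
      have "norm (G \<xi>) \<le> norm (of_real (m \<xi>) * k \<xi>)"
        using m(1)[of \<xi>] unfolding G_def norm_mult by (intro mult_right_mono) auto
      then show "norm ((norm (G \<xi>))\<^sup>2) \<le> norm ((norm (of_real (m \<xi>) * k \<xi>))\<^sup>2)" by (simp add: power_mono)
    qed
  qed simp
  have herm: "AE \<xi> in lborel. cnj (G (- \<xi>)) = G \<xi>"
    using fourier_pair_hermitian[OF p] by eventually_elim (simp add: G_def)
  obtain w where w: "w \<in> borel_measurable borel" "integrable lborel (\<lambda>x. (w x)\<^sup>2)" "fourier_pair nice (\<lambda>x. of_real (w x)) G"
    by (rule fourier_pair_exists_real[OF G G2 herm])
  have "frac_deriv s u w"
    unfolding frac_deriv_def using w p fourier_pair_nice_schwartz[OF w(3)] um unfolding G_def by auto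
  then show thesis by (rule that)
qed

lemma frac_deriv_L2:
  assumes u: "frac_deriv s u W" and u2: "integrable lborel (\<lambda>x. (u x)\<^sup>2)"
  obtains g where "fourier_pair nice (\<lambda>x. of_real (u x)) g" "integrable lborel (\<lambda>\<xi>. (norm (g \<xi>))\<^sup>2)"
    "integrable lborel (\<lambda>\<xi>. (norm \<xi> powr s * norm (g \<xi>))\<^sup>2)"
    "(LINT \<xi>|lborel. (norm \<xi> powr s * norm (g \<xi>))\<^sup>2) \<le> (LINT x|lborel. (W x)\<^sup>2)"
proof -
  obtain g where p: "fourier_pair schwartz (\<lambda>x. of_real (u x)) g"
    and q: "fourier_pair schwartz (\<lambda>x. of_real (W x)) (\<lambda>\<xi>. of_real (norm \<xi> powr s) * g \<xi>)"
    using u by (auto simp: frac_deriv_def)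
  have u2': "integrable lborel (\<lambda>x. (norm (complex_of_real (u x)))\<^sup>2)"
    unfolding norm_of_real power2_abs by (rule u2)
  have W2': "integrable lborel (\<lambda>x. (norm (complex_of_real (W x)))\<^sup>2)"
    unfolding norm_of_real power2_abs by (rule frac_deriv_borel(3)[OF u])
  have e: "norm (complex_of_real (norm \<xi> powr s) * g \<xi>) = norm \<xi> powr s * norm (g \<xi>)" for \<xi>
    unfolding norm_mult norm_of_real by simp
  show thesis
    by (rule that[OF plancherel_right(3)[OF p u2'] plancherel_right(1)[OF p u2']
          plancherel_right(1)[OF q W2', unfolded e] plancherel_right(2)[OF q W2', unfolded e norm_of_real power2_abs]])
qed

lemma Bessel_weight_le:
  fixes s t :: real
  assumes "0 < s" "s < 2"
  shows "(1 + t\<^sup>2) powr (s / 2) \<le> 2 * (1 + \<bar>t\<bar> powr s)"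
proof -
  have 2: "2 powr (s / 2) \<le> (2 :: real)" using powr_mono[of "s / 2" 1 2] assms by simp
  have ts: "(t\<^sup>2) powr (s / 2) = \<bar>t\<bar> powr s"
  proof -
    have e: "t\<^sup>2 = \<bar>t\<bar> powr 2" using powr_numeral[of "\<bar>t\<bar>"] by simp
    show ?thesis unfolding e powr_powr by simp
  qed
  show ?thesis
  proof (cases "t\<^sup>2 \<le> 1")
    case True
    have "(1 + t\<^sup>2) powr (s / 2) \<le> 2 powr (s / 2)" using True assms by (intro powr_mono2) auto
    also have "\<dots> \<le> 2 * 1" using 2 by simp
    also have "\<dots> \<le> 2 * (1 + \<bar>t\<bar> powr s)" by (intro mult_left_mono) auto
    finally show ?thesis .
  next
    case False
    have "(1 + t\<^sup>2) powr (s / 2) \<le> (2 * t\<^sup>2) powr (s / 2)" using False assms by (intro powr_mono2) auto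
    also have "\<dots> = 2 powr (s / 2) * \<bar>t\<bar> powr s" by (simp add: powr_mult ts)
    also have "\<dots> \<le> 2 * \<bar>t\<bar> powr s" by (intro mult_right_mono 2) simp
    finally show ?thesis by simp
  qed
qed

lemma frac_deriv_Hspace:
  assumes u: "frac_deriv s u W" and u2: "integrable lborel (\<lambda>x. (u x)\<^sup>2)" and s: "0 < s" "s < 2"
  shows "u \<in> Hspace s"
proof -
  obtain g where p: "fourier_pair nice (\<lambda>x. of_real (u x)) g" and g: "integrable lborel (\<lambda>\<xi>. (norm (g \<xi>))\<^sup>2)"
    "integrable lborel (\<lambda>\<xi>. (norm \<xi> powr s * norm (g \<xi>))\<^sup>2)"
    and "(LINT \<xi>|lborel. (norm \<xi> powr s * norm (g \<xi>))\<^sup>2) \<le> (LINT x|lborel. (W x)\<^sup>2)"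
    by (rule frac_deriv_L2[OF u u2])
  note [measurable] = fourier_pair_borel(2)[OF p] and um[measurable] = frac_deriv_borel(1)[OF u]
  have "integrable lborel (\<lambda>\<xi>. (norm (of_real ((1 + (norm \<xi>)\<^sup>2) powr (s / 2)) * g \<xi>))\<^sup>2)"
  proof (rule Bochner_Integration.integrable_bound[of _ "\<lambda>\<xi>. 8 * (norm (g \<xi>))\<^sup>2 + 8 * (norm \<xi> powr s * norm (g \<xi>))\<^sup>2"])
    show "AE \<xi> in lborel. norm ((norm (of_real ((1 + (norm \<xi>)\<^sup>2) powr (s / 2)) * g \<xi>))\<^sup>2) \<le> norm (8 * (norm (g \<xi>))\<^sup>2 + 8 * (norm \<xi> powr s * norm (g \<xi>))\<^sup>2)"
    proof (rule AE_I2)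
      fix \<xi> :: "real^3"
      have "norm (of_real ((1 + (norm \<xi>)\<^sup>2) powr (s / 2)) * g \<xi>) \<le> (2 * (1 + norm \<xi> powr s)) * norm (g \<xi>)"
        using Bessel_weight_le[OF s, of "norm \<xi>"] by (simp add: norm_mult mult_right_mono)
      also have "\<dots> = norm (2 * norm (g \<xi>) + 2 * (norm \<xi> powr s * norm (g \<xi>)))" by (simp add: algebra_simps)
      finally have "(norm (of_real ((1 + (norm \<xi>)\<^sup>2) powr (s / 2)) * g \<xi>))\<^sup>2 \<le> (norm (2 * norm (g \<xi>) + 2 * (norm \<xi> powr s * norm (g \<xi>))))\<^sup>2"
        by (intro power_mono) auto
      also have "\<dots> \<le> 2 * (norm (2 * norm (g \<xi>)))\<^sup>2 + 2 * (norm (2 * (norm \<xi> powr s * norm (g \<xi>))))\<^sup>2" by (rule square_norm_add_le)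
      also have "\<dots> = 8 * (norm (g \<xi>))\<^sup>2 + 8 * (norm \<xi> powr s * norm (g \<xi>))\<^sup>2" by (simp add: power_mult_distrib)
      finally show "norm ((norm (of_real ((1 + (norm \<xi>)\<^sup>2) powr (s / 2)) * g \<xi>))\<^sup>2) \<le> norm (8 * (norm (g \<xi>))\<^sup>2 + 8 * (norm \<xi> powr s * norm (g \<xi>))\<^sup>2)"
        by simp
    qed
  qed (use g in auto)
  then have "(\<lambda>\<xi>. of_real ((1 + (norm \<xi>)\<^sup>2) powr (s / 2)) * g \<xi>) \<in> Lp 2"
    by (subst Lp_iff_borel) (auto simp: norm_powr_2)
  moreover have "u \<in> Lp 2" using u2 by (subst Lp_iff_borel) (auto simp: norm_powr_2)
  moreover have "is_fourier_transform u g"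
    by (rule fourier_pair_imp_is_fourier_transform[OF fourier_pair_nice_schwartz[OF p] um])
  ultimately show ?thesis by (auto simp: Hspace_def)
qed

lemma frac_deriv_Dspace:
  assumes u: "frac_deriv s u W" and uq: "integrable lborel (\<lambda>x. \<bar>u x\<bar> powr crit_exp s)"
  shows "u \<in> Dspace s"
proof -
  obtain g where p: "fourier_pair schwartz (\<lambda>x. of_real (u x)) g"
    and q: "fourier_pair schwartz (\<lambda>x. of_real (W x)) (\<lambda>\<xi>. of_real (norm \<xi> powr s) * g \<xi>)"
    using u by (auto simp: frac_deriv_def)
  note [measurable] = fourier_pair_borel(2)[OF p] and um[measurable] = frac_deriv_borel(1)[OF u]
  have "integrable lborel (\<lambda>x. (norm (complex_of_real (W x)))\<^sup>2)"
    unfolding norm_of_real power2_abs by (rule frac_deriv_borel(3)[OF u])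
  from plancherel_right(1)[OF q this]
  have "(\<lambda>\<xi>. of_real (norm \<xi> powr s) * g \<xi>) \<in> Lp 2"
    by (subst Lp_iff_borel) (simp_all only: norm_powr_2 fourier_pair_borel(2)[OF q])
  moreover have "u \<in> Lp (crit_exp s)" using uq by (subst Lp_iff_borel) auto
  moreover have "is_fourier_transform u g"
    by (rule fourier_pair_imp_is_fourier_transform[OF p um])
  ultimately show ?thesis by (auto simp: Dspace_def)
qed

section \<open>Translation estimate\<close>

lemma cis_minus_1_le:
  assumes "0 < s" "s \<le> 1"
  shows "(norm (cis t - 1))\<^sup>2 \<le> 4 * \<bar>t\<bar> powr (2 * s)"
proof -
  have e: "(norm (cis t - 1))\<^sup>2 = 4 * (sin (t / 2))\<^sup>2"
  proof -
    have "(norm (cis t - 1))\<^sup>2 = (cos t - 1)\<^sup>2 + (sin t)\<^sup>2" by (simp add: cmod_power2)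
    also have "\<dots> = ((sin t)\<^sup>2 + (cos t)\<^sup>2) + 1 - 2 * cos t" by (simp add: power2_eq_square algebra_simps)
    also have "\<dots> = 2 - 2 * cos (2 * (t / 2))" by (simp only: sin_cos_squared_add) simp
    also have "\<dots> = 4 * (sin (t / 2))\<^sup>2" by (simp only: cos_double_sin) simp
    finally show ?thesis .
  qed
  show ?thesis
  proof (cases "\<bar>t\<bar> \<le> 1")
    case True
    have "\<bar>sin (t / 2)\<bar> \<le> \<bar>t / 2\<bar>" by (rule abs_sin_x_le_abs_x)
    then have "(sin (t / 2))\<^sup>2 \<le> (t / 2)\<^sup>2" by (simp only: abs_le_square_iff)
    then have "(norm (cis t - 1))\<^sup>2 \<le> \<bar>t\<bar>\<^sup>2" unfolding e by (simp add: power_divide)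
    also have "\<bar>t\<bar>\<^sup>2 = \<bar>t\<bar> powr 2" using powr_numeral[of "\<bar>t\<bar>" "num.Bit0 num.One"] by simp
    also have "\<bar>t\<bar> powr 2 \<le> \<bar>t\<bar> powr (2 * s)" using assms True by (intro powr_mono') auto
    also have "\<dots> \<le> 4 * \<bar>t\<bar> powr (2 * s)" by simp
    finally show ?thesis .
  next
    case False
    have "(sin (t / 2))\<^sup>2 \<le> 1" by (simp add: abs_square_le_1)
    then have "(norm (cis t - 1))\<^sup>2 \<le> 4 * 1" unfolding e by simp
    also have "\<dots> \<le> 4 * \<bar>t\<bar> powr (2 * s)" using False assms by (intro mult_left_mono ge_one_powr_ge_zero) auto
    finally show ?thesis .
  qed
qed

lemma
  assumes u: "frac_deriv s u W" and u2: "integrable lborel (\<lambda>x. (u x)\<^sup>2)" and s: "0 < s" "s \<le> 1"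
  shows integrable_translate_diff: "integrable lborel (\<lambda>x. (u (x + z) - u x)\<^sup>2)"
    and translation_estimate: "(LINT x|lborel. (u (x + z) - u x)\<^sup>2) \<le> 4 * norm z powr (2 * s) * (LINT x|lborel. (W x)\<^sup>2)"
proof -
  obtain g where p: "fourier_pair nice (\<lambda>x. of_real (u x)) g" and g: "integrable lborel (\<lambda>\<xi>. (norm (g \<xi>))\<^sup>2)"
    and gs: "integrable lborel (\<lambda>\<xi>. (norm \<xi> powr s * norm (g \<xi>))\<^sup>2)"
    and gW: "(LINT \<xi>|lborel. (norm \<xi> powr s * norm (g \<xi>))\<^sup>2) \<le> (LINT x|lborel. (W x)\<^sup>2)"
    by (rule frac_deriv_L2[OF u u2])
  note um = frac_deriv_borel(1)[OF u]
  note gm[measurable] = fourier_pair_borel(2)[OF p]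
  have uz[measurable]: "(\<lambda>x. u (x + z)) \<in> borel_measurable borel" by (rule measurable_compose[OF _ um]) simp
  note um[measurable]
  have uz2: "integrable lborel (\<lambda>x. (u (x + z))\<^sup>2)"
    using integrable_lborel_translate_iff[of "\<lambda>x. (u x)\<^sup>2" z] u2 um by simp
  have pz: "fourier_pair nice (\<lambda>x. of_real (u (x + z))) (\<lambda>\<xi>. cis (z \<bullet> \<xi>) * g \<xi>)"
  proof (rule fourier_pair_L2I)
    show "integrable lborel (\<lambda>x. (norm (complex_of_real (u (x + z))))\<^sup>2)" using uz2 by simp
    show "integrable lborel (\<lambda>\<xi>. (norm (cis (z \<bullet> \<xi>) * g \<xi>))\<^sup>2)" using g by (simp add: norm_mult)
    fix \<psi> assume \<psi>: "\<psi> \<in> nice"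
    note \<psi>m[measurable] = nice_borel[OF \<psi>]
    define \<phi> where "\<phi> x = cis (z \<bullet> x) * \<psi> x" for x
    obtain B where B: "\<And>x. norm (\<psi> x) \<le> B" using nice_bounded[OF \<psi>] by auto
    have \<phi>: "\<phi> \<in> nice"
    proof (rule niceI[of _ B])
      have "continuous_on UNIV \<psi>" using \<psi> by (simp add: nice_def)
      then show "continuous_on UNIV \<phi>" unfolding \<phi>_def[abs_def] by (intro continuous_intros)
      show "integrable lborel \<phi>" unfolding \<phi>_def[abs_def]
        by (rule integrable_cis_mult[OF _ nice_integrable[OF \<psi>]]) simp
    qed (simp add: \<phi>_def norm_mult B)
    have f\<phi>: "ft \<phi> (x + z) = ft \<psi> x" for x
    proof -
      have "cis (- (y \<bullet> (x + z))) * \<phi> y = cis (- (y \<bullet> x)) * \<psi> y" for y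
      proof -
        have "cis (- (y \<bullet> (x + z))) * cis (z \<bullet> y) = cis (- (y \<bullet> x))"
          by (simp add: cis_mult inner_add_right inner_commute)
        then show ?thesis unfolding \<phi>_def by (simp add: mult.assoc[symmetric])
      qed
      then show ?thesis by (simp add: ft_def)
    qed
    have "(LINT x|lborel. of_real (u (x + z)) * ft \<psi> x) = (LINT x|lborel. of_real (u (x + z)) * ft \<phi> (x + z))"
      by (simp only: f\<phi>)
    also have "\<dots> = (LINT x|lborel. of_real (u x) * ft \<phi> x)"
      using nice_borel[OF \<phi>] by (intro integral_lborel_translate[of "\<lambda>x. of_real (u x) * ft \<phi> x"]) simp
    also have "\<dots> = (LINT \<xi>|lborel. g \<xi> * \<phi> \<xi>)" by (rule fourier_pairD(3)[OF p \<phi>])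
    also have "\<dots> = (LINT \<xi>|lborel. cis (z \<bullet> \<xi>) * g \<xi> * \<psi> \<xi>)" by (simp add: \<phi>_def mult_ac)
    finally show "(LINT x|lborel. of_real (u (x + z)) * ft \<psi> x) = (LINT \<xi>|lborel. cis (z \<bullet> \<xi>) * g \<xi> * \<psi> \<xi>)" .
  qed simp_all
  have q: "fourier_pair nice (\<lambda>x. of_real (u (x + z) - u x)) (\<lambda>\<xi>. (cis (z \<bullet> \<xi>) - 1) * g \<xi>)"
    using fourier_pair_lincomb[OF pz p, of 1 "-1"] by (simp add: left_diff_distrib)
  have le: "(norm ((cis (z \<bullet> \<xi>) - 1) * g \<xi>))\<^sup>2 \<le> 4 * norm z powr (2 * s) * (norm \<xi> powr s * norm (g \<xi>))\<^sup>2" for \<xi>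
  proof -
    have "(norm (cis (z \<bullet> \<xi>) - 1))\<^sup>2 \<le> 4 * \<bar>z \<bullet> \<xi>\<bar> powr (2 * s)" by (rule cis_minus_1_le[OF s])
    also have "\<dots> \<le> 4 * (norm z * norm \<xi>) powr (2 * s)"
      using s Cauchy_Schwarz_ineq2[of z \<xi>] by (intro mult_left_mono powr_mono2) auto
    also have "\<dots> = 4 * norm z powr (2 * s) * (norm \<xi> powr s)\<^sup>2"
      by (simp add: powr_mult power2_eq_square flip: powr_add)
    finally show ?thesis
      unfolding norm_mult power_mult_distrib by (simp only: mult_right_mono zero_le_power2 mult.assoc[symmetric])
  qed
  have i: "integrable lborel (\<lambda>\<xi>. 4 * norm z powr (2 * s) * (norm \<xi> powr s * norm (g \<xi>))\<^sup>2)"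
    using gs by (rule integrable_mult_right)
  have i2: "integrable lborel (\<lambda>\<xi>. (norm ((cis (z \<bullet> \<xi>) - 1) * g \<xi>))\<^sup>2)"
    by (rule Bochner_Integration.integrable_bound[OF i]) (use le in auto)
  note P = plancherel_left[OF fourier_pair_nice_schwartz[OF q] i2, unfolded norm_of_real power2_abs]
  show "integrable lborel (\<lambda>x. (u (x + z) - u x)\<^sup>2)" by (rule P(1))
  note P(2)
  also have "(LINT \<xi>|lborel. (norm ((cis (z \<bullet> \<xi>) - 1) * g \<xi>))\<^sup>2) \<le> (LINT \<xi>|lborel. 4 * norm z powr (2 * s) * (norm \<xi> powr s * norm (g \<xi>))\<^sup>2)"
    by (rule integral_mono[OF i2 i le])
  also have "\<dots> = 4 * norm z powr (2 * s) * (LINT \<xi>|lborel. (norm \<xi> powr s * norm (g \<xi>))\<^sup>2)" by simp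
  also have "\<dots> \<le> 4 * norm z powr (2 * s) * (LINT x|lborel. (W x)\<^sup>2)" by (intro mult_left_mono gW) simp
  finally show "(LINT x|lborel. (u (x + z) - u x)\<^sup>2) \<le> 4 * norm z powr (2 * s) * (LINT x|lborel. (W x)\<^sup>2)" .
qed

lemma ball_in_borel [measurable]: "ball c r \<in> sets borel"
  by simp

lemma nn_integral_lborel_affine:
  fixes f :: "'a::euclidean_space \<Rightarrow> ennreal"
  assumes f[measurable]: "f \<in> borel_measurable borel" and c: "c \<noteq> 0"
  shows "(\<integral>\<^sup>+x. f x \<partial>lborel) = ennreal (\<bar>c\<bar> ^ DIM('a)) * (\<integral>\<^sup>+x. f (t + c *\<^sub>R x) \<partial>lborel)"
  by (subst lborel_affine[OF c, of t])
    (simp add: nn_integral_density nn_integral_distr nn_integral_cmult)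

text \<open>The shift \<open>x \<mapsto> \<lambda> x\<close> depends on \<open>x\<close>, so the translation estimate does not apply directly;
  averaging over an auxiliary shift \<open>z\<close> in a ball of radius \<open>(\<lambda> - 1) R\<close> decouples the two points.\<close>

lemma dilation_estimate:
  assumes u: "frac_deriv s u W" and u2: "integrable lborel (\<lambda>x. (u x)\<^sup>2)" and s: "0 < s" "s \<le> 1"
    and R: "R > 0" and l: "1 < l"
  shows "(LINT x|lborel. indicator (ball 0 R) x * (u (l *\<^sub>R x) - u x)\<^sup>2) \<le> 264 * ((l - 1) * R) powr (2 * s) * (LINT x|lborel. (W x)\<^sup>2)"
proof -
  define E where "E = (LINT x|lborel. (W x)\<^sup>2)"
  have E: "E \<ge> 0" by (simp add: E_def)
  define d where "d = (l - 1) * R"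
  have d: "d > 0" using R l by (simp add: d_def)
  note um[measurable] = frac_deriv_borel(1)[OF u]
  have ul[measurable]: "(\<lambda>x. u (l *\<^sub>R x)) \<in> borel_measurable borel" by (rule measurable_compose[OF _ um]) simp
  have ulm: "(\<lambda>(x, y). u (l *\<^sub>R x + y)) \<in> borel_measurable (lborel \<Otimes>\<^sub>M lborel)"
    unfolding split_beta by (rule measurable_compose[OF _ um]) (auto intro!: borel_measurable_add borel_measurable_scaleR)
  have uxm: "(\<lambda>(x, y). u (x + y)) \<in> borel_measurable (lborel \<Otimes>\<^sub>M lborel)"
    unfolding split_beta by (rule measurable_compose[OF _ um]) (auto intro!: borel_measurable_add)
  have uym: "(\<lambda>z. u (x + z)) \<in> borel_measurable borel" for x by (rule measurable_compose[OF _ um]) simp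
  note [measurable] = ulm[unfolded split_beta] uxm[unfolded split_beta] uym
  have tr: "(\<integral>\<^sup>+x. ennreal ((u (x + z) - u x)\<^sup>2) \<partial>lborel) \<le> ennreal (4 * r powr (2 * s) * E)" if "norm z < r" for z r
  proof -
    have "(\<integral>\<^sup>+x. ennreal ((u (x + z) - u x)\<^sup>2) \<partial>lborel) = ennreal (LINT x|lborel. (u (x + z) - u x)\<^sup>2)"
      by (rule nn_integral_eq_integral[OF integrable_translate_diff[OF u u2 s]]) simp
    also have "\<dots> \<le> ennreal (4 * norm z powr (2 * s) * E)"
      unfolding E_def by (rule ennreal_leI[OF translation_estimate[OF u u2 s]])
    also have "\<dots> \<le> ennreal (4 * r powr (2 * s) * E)"
      using that s E by (intro ennreal_leI mult_right_mono mult_left_mono powr_mono2) auto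
    finally show ?thesis .
  qed
  define v where "v = emeasure lborel (ball (0::real^3) d)"
  have v2: "emeasure lborel (ball (0::real^3) (2 * d)) = 8 * v"
  proof -
    have "v = (\<integral>\<^sup>+x. indicator (ball (0::real^3) d) x \<partial>lborel)" unfolding v_def by simp
    have "emeasure lborel (ball (0::real^3) (2 * d)) = (\<integral>\<^sup>+x. indicator (ball (0::real^3) (2 * d)) x \<partial>lborel)" by simp
    also have "\<dots> = ennreal (\<bar>2\<bar> ^ DIM(real^3)) * (\<integral>\<^sup>+x. indicator (ball (0::real^3) (2 * d)) (0 + 2 *\<^sub>R x) \<partial>lborel)"
      by (rule nn_integral_lborel_affine, rule borel_measurable_indicator) auto
    also have "(\<integral>\<^sup>+x. indicator (ball (0::real^3) (2 * d)) (0 + 2 *\<^sub>R x) \<partial>lborel) = (\<integral>\<^sup>+x. indicator (ball (0::real^3) d) x \<partial>lborel)"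
      by (intro nn_integral_cong) (auto simp: indicator_def)
    finally show ?thesis by (simp add: v_def)
  qed
  have vpos: "v \<noteq> 0" "v \<noteq> \<infinity>"
  proof -
    have "measure lborel (ball (0::real^3) d) > 0" using d by (simp add: content_ball_gt_0_iff)
    then show "v \<noteq> 0" unfolding v_def by (auto simp: measure_def)
    show "v \<noteq> \<infinity>" unfolding v_def using emeasure_lborel_ball_finite[of "0::real^3" d] by simp
  qed
  define I where "I = (\<integral>\<^sup>+x. ennreal (indicator (ball 0 R) x * (u (l *\<^sub>R x) - u x)\<^sup>2) \<partial>lborel)"
  define a where "a x z = ennreal (indicator (ball 0 R) x * indicator (ball 0 d) z * (2 * (u (l *\<^sub>R x) - u (x + z))\<^sup>2))" for x z :: "real^3"
  define b where "b x z = ennreal (indicator (ball 0 d) z * (2 * (u (x + z) - u x)\<^sup>2))" for x z :: "real^3"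
  have am: "case_prod a \<in> borel_measurable (lborel \<Otimes>\<^sub>M lborel)" unfolding a_def[abs_def] split_beta by measurable
  have bm: "case_prod b \<in> borel_measurable (lborel \<Otimes>\<^sub>M lborel)" unfolding b_def[abs_def] split_beta by measurable
  have am1: "a x \<in> borel_measurable lborel" "b x \<in> borel_measurable lborel" for x
    unfolding a_def[abs_def] b_def[abs_def] by measurable
  have "v * I = (\<integral>\<^sup>+x. (\<integral>\<^sup>+z. ennreal (indicator (ball 0 R) x * (u (l *\<^sub>R x) - u x)\<^sup>2) * indicator (ball (0::real^3) d) z \<partial>lborel) \<partial>lborel)"
    unfolding I_def v_def by (subst nn_integral_cmult_indicator, simp, subst nn_integral_multc) (simp_all add: mult.commute)
  also have "\<dots> \<le> (\<integral>\<^sup>+x. (\<integral>\<^sup>+z. a x z + b x z \<partial>lborel) \<partial>lborel)"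
  proof (intro nn_integral_mono)
    fix x z :: "real^3"
    have "(u (l *\<^sub>R x) - u x)\<^sup>2 \<le> 2 * (u (l *\<^sub>R x) - u (x + z))\<^sup>2 + 2 * (u (x + z) - u x)\<^sup>2"
      using square_norm_add_le[of "u (l *\<^sub>R x) - u (x + z)" "u (x + z) - u x"] by simp
    then show "ennreal (indicator (ball 0 R) x * (u (l *\<^sub>R x) - u x)\<^sup>2) * indicator (ball 0 d) z \<le> a x z + b x z"
      unfolding a_def b_def by (auto simp: indicator_def ennreal_plus[symmetric] simp del: ennreal_plus intro!: ennreal_leI)
  qed
  also have "\<dots> = (\<integral>\<^sup>+x. (\<integral>\<^sup>+z. a x z \<partial>lborel) \<partial>lborel) + (\<integral>\<^sup>+x. (\<integral>\<^sup>+z. b x z \<partial>lborel) \<partial>lborel)"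
    using am1 lborel.borel_measurable_nn_integral[OF am] lborel.borel_measurable_nn_integral[OF bm]
    by (subst nn_integral_add[symmetric]) (auto simp: nn_integral_add intro!: nn_integral_cong)
  also have "(\<integral>\<^sup>+x. (\<integral>\<^sup>+z. b x z \<partial>lborel) \<partial>lborel) \<le> v * ennreal (8 * d powr (2 * s) * E)"
  proof -
    have "(\<integral>\<^sup>+x. (\<integral>\<^sup>+z. b x z \<partial>lborel) \<partial>lborel) = (\<integral>\<^sup>+z. (\<integral>\<^sup>+x. b x z \<partial>lborel) \<partial>lborel)"
      by (rule lborel_pair.Fubini'[OF bm, symmetric])
    also have "\<dots> \<le> (\<integral>\<^sup>+z. ennreal (8 * d powr (2 * s) * E) * indicator (ball (0::real^3) d) z \<partial>lborel)"
    proof (rule nn_integral_mono)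
      fix z :: "real^3"
      have uz: "(\<lambda>x. u (x + z)) \<in> borel_measurable borel" by (rule measurable_compose[OF _ um]) simp
      have "(\<integral>\<^sup>+x. b x z \<partial>lborel) = (\<integral>\<^sup>+x. (2 * indicator (ball 0 d) z) * ennreal ((u (x + z) - u x)\<^sup>2) \<partial>lborel)"
        unfolding b_def by (intro nn_integral_cong) (auto simp: indicator_def ennreal_mult')
      also have "\<dots> = (2 * indicator (ball 0 d) z) * (\<integral>\<^sup>+x. ennreal ((u (x + z) - u x)\<^sup>2) \<partial>lborel)"
        using uz by (intro nn_integral_cmult) auto
      also have "\<dots> \<le> ennreal (8 * d powr (2 * s) * E) * indicator (ball 0 d) z"
      proof (cases "norm z < d")
        case True
        have "2 * (\<integral>\<^sup>+x. ennreal ((u (x + z) - u x)\<^sup>2) \<partial>lborel) \<le> 2 * ennreal (4 * d powr (2 * s) * E)"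
          by (intro mult_left_mono tr True) simp
        also have "\<dots> = ennreal (2 * (4 * d powr (2 * s) * E))" using E by (subst ennreal_mult) auto
        finally show ?thesis using True by (simp add: mult.assoc)
      qed simp
      finally show "(\<integral>\<^sup>+x. b x z \<partial>lborel) \<le> ennreal (8 * d powr (2 * s) * E) * indicator (ball 0 d) z" .
    qed
    also have "\<dots> = v * ennreal (8 * d powr (2 * s) * E)"
      unfolding v_def by (subst nn_integral_cmult_indicator) (auto simp: mult.commute)
    finally show ?thesis .
  qed
  also have "(\<integral>\<^sup>+x. (\<integral>\<^sup>+z. a x z \<partial>lborel) \<partial>lborel) \<le> (8 * v) * ennreal (32 * d powr (2 * s) * E)"
  proof -
    define k where "k x y = 2 * indicator (ball 0 (2 * d)) y * ennreal ((u (l *\<^sub>R x + y) - u (l *\<^sub>R x))\<^sup>2)" for x y :: "real^3"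
    have km: "case_prod k \<in> borel_measurable (lborel \<Otimes>\<^sub>M lborel)" unfolding k_def[abs_def] split_beta by measurable
    have "(\<integral>\<^sup>+x. (\<integral>\<^sup>+z. a x z \<partial>lborel) \<partial>lborel) \<le> (\<integral>\<^sup>+x. (\<integral>\<^sup>+y. k x y \<partial>lborel) \<partial>lborel)"
    proof (rule nn_integral_mono)
      fix x :: "real^3"
      have "(\<integral>\<^sup>+z. a x z \<partial>lborel) = ennreal (\<bar>1\<bar> ^ DIM(real^3)) * (\<integral>\<^sup>+y. a x ((l - 1) *\<^sub>R x + 1 *\<^sub>R y) \<partial>lborel)"
        using am1(1)[of x] by (intro nn_integral_lborel_affine) auto
      also have "\<dots> = (\<integral>\<^sup>+y. a x ((l - 1) *\<^sub>R x + y) \<partial>lborel)" by simp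
      also have "\<dots> \<le> (\<integral>\<^sup>+y. k x y \<partial>lborel)"
      proof (rule nn_integral_mono)
        fix y :: "real^3"
        have e: "x + ((l - 1) *\<^sub>R x + y) = l *\<^sub>R x + y" by (simp add: algebra_simps)
        show "a x ((l - 1) *\<^sub>R x + y) \<le> k x y"
        proof (cases "norm x < R \<and> norm ((l - 1) *\<^sub>R x + y) < d")
          case True
          have "norm y \<le> norm ((l - 1) *\<^sub>R x + y) + norm ((l - 1) *\<^sub>R x)" by (metis add_diff_cancel_left' norm_triangle_ineq4 add.commute)
          also have "norm ((l - 1) *\<^sub>R x) \<le> d" unfolding d_def using True l by (simp add: mult_left_mono)
          finally have "norm y < 2 * d" using True by simp
          then show ?thesis using True
            by (simp add: a_def k_def e ennreal_mult' power2_commute[of "u (l *\<^sub>R x)"])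
        qed (auto simp: a_def indicator_def)
      qed
      finally show "(\<integral>\<^sup>+z. a x z \<partial>lborel) \<le> (\<integral>\<^sup>+y. k x y \<partial>lborel)" .
    qed
    also have "\<dots> = (\<integral>\<^sup>+y. (\<integral>\<^sup>+x. k x y \<partial>lborel) \<partial>lborel)" by (rule lborel_pair.Fubini'[OF km, symmetric])
    also have "\<dots> \<le> (\<integral>\<^sup>+y. ennreal (32 * d powr (2 * s) * E) * indicator (ball (0::real^3) (2 * d)) y \<partial>lborel)"
    proof (rule nn_integral_mono)
      fix y :: "real^3"
      have uy: "(\<lambda>x. u (x + y)) \<in> borel_measurable borel" by (rule measurable_compose[OF _ um]) simp
      have uly: "(\<lambda>x. u (l *\<^sub>R x + y)) \<in> borel_measurable borel" by (rule measurable_compose[OF _ um]) simp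
      have "(\<integral>\<^sup>+x. ennreal ((u (l *\<^sub>R x + y) - u (l *\<^sub>R x))\<^sup>2) \<partial>lborel)
         \<le> ennreal (\<bar>l\<bar> ^ DIM(real^3)) * (\<integral>\<^sup>+x. ennreal ((u ((0 + l *\<^sub>R x) + y) - u (0 + l *\<^sub>R x))\<^sup>2) \<partial>lborel)"
        using l mult_right_mono[of 1 "ennreal (\<bar>l\<bar> ^ DIM(real^3))" "\<integral>\<^sup>+x. ennreal ((u (l *\<^sub>R x + y) - u (l *\<^sub>R x))\<^sup>2) \<partial>lborel"]
        by (simp add: one_le_power)
      also have "\<dots> = (\<integral>\<^sup>+x. ennreal ((u (x + y) - u x)\<^sup>2) \<partial>lborel)"
        using uy l by (intro nn_integral_lborel_affine[of "\<lambda>x. ennreal ((u (x + y) - u x)\<^sup>2)", symmetric]) auto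
      finally have 1: "(\<integral>\<^sup>+x. ennreal ((u (l *\<^sub>R x + y) - u (l *\<^sub>R x))\<^sup>2) \<partial>lborel) \<le> (\<integral>\<^sup>+x. ennreal ((u (x + y) - u x)\<^sup>2) \<partial>lborel)" .
      have "(\<integral>\<^sup>+x. k x y \<partial>lborel) = (2 * indicator (ball 0 (2 * d)) y) * (\<integral>\<^sup>+x. ennreal ((u (l *\<^sub>R x + y) - u (l *\<^sub>R x))\<^sup>2) \<partial>lborel)"
        unfolding k_def using uly by (intro nn_integral_cmult) auto
      also have "\<dots> \<le> ennreal (32 * d powr (2 * s) * E) * indicator (ball 0 (2 * d)) y"
      proof (cases "norm y < 2 * d")
        case True
        have "2 * (\<integral>\<^sup>+x. ennreal ((u (l *\<^sub>R x + y) - u (l *\<^sub>R x))\<^sup>2) \<partial>lborel) \<le> 2 * ennreal (4 * (2 * d) powr (2 * s) * E)"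
          by (intro mult_left_mono order_trans[OF 1] tr True) simp
        also have "\<dots> = ennreal (2 * (4 * (2 * d) powr (2 * s) * E))" using E by (subst ennreal_mult) auto
        also have "\<dots> \<le> ennreal (32 * d powr (2 * s) * E)"
        proof (rule ennreal_leI)
          have "(2 * d) powr (2 * s) = 2 powr (2 * s) * d powr (2 * s)" using d by (simp add: powr_mult)
          also have "\<dots> \<le> 2 powr (2 :: real) * d powr (2 * s)" using s by (intro mult_right_mono powr_mono) auto
          finally have "(2 * d) powr (2 * s) \<le> 4 * d powr (2 * s)" by simp
          then have "8 * ((2 * d) powr (2 * s) * E) \<le> 8 * ((4 * d powr (2 * s)) * E)" using E by (intro mult_left_mono mult_right_mono) auto
          then show "2 * (4 * (2 * d) powr (2 * s) * E) \<le> 32 * d powr (2 * s) * E" by simp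
        qed
        finally show ?thesis using True by simp
      qed simp
      finally show "(\<integral>\<^sup>+x. k x y \<partial>lborel) \<le> ennreal (32 * d powr (2 * s) * E) * indicator (ball 0 (2 * d)) y" .
    qed
    also have "\<dots> = (8 * v) * ennreal (32 * d powr (2 * s) * E)"
      unfolding v2[symmetric] by (subst nn_integral_cmult_indicator) (auto simp: mult.commute)
    finally show ?thesis .
  qed
  finally have "v * I \<le> (8 * v) * ennreal (32 * d powr (2 * s) * E) + v * ennreal (8 * d powr (2 * s) * E)"
    by (simp add: add_mono)
  also have "\<dots> = v * ennreal (264 * d powr (2 * s) * E)"
  proof -
    have "(8 * v) * ennreal (32 * d powr (2 * s) * E) = v * (ennreal 8 * ennreal (32 * d powr (2 * s) * E))" by (simp add: mult_ac)
    also have "ennreal 8 * ennreal (32 * d powr (2 * s) * E) = ennreal (8 * (32 * d powr (2 * s) * E))" using E by (subst ennreal_mult) auto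
    finally show ?thesis using E by (simp add: distrib_left[symmetric] ennreal_plus[symmetric] algebra_simps del: ennreal_plus)
  qed
  finally have "I \<le> ennreal (264 * d powr (2 * s) * E)"
    using vpos by (subst (asm) ennreal_mult_le_mult_iff) auto
  moreover have "I = ennreal (LINT x|lborel. indicator (ball 0 R) x * (u (l *\<^sub>R x) - u x)\<^sup>2)"
    unfolding I_def
  proof (rule nn_integral_eq_integral)
    have "integrable lborel (\<lambda>x. (u (l *\<^sub>R x))\<^sup>2)"
      using integrable_lborel_dilate_iff[of "\<lambda>x. (u x)\<^sup>2" l] u2 l by simp
    from integrable_lincomb_L2[OF _ _ this u2, of 1 "-1"]
    have i: "integrable lborel (\<lambda>x. (u (l *\<^sub>R x) - u x)\<^sup>2)" by simp
    show "integrable lborel (\<lambda>x. indicator (ball 0 R) x * (u (l *\<^sub>R x) - u x)\<^sup>2)"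
      by (rule Bochner_Integration.integrable_bound[OF i]) (auto simp: indicator_def)
  qed simp
  ultimately show ?thesis
    using E by (simp add: d_def E_def ennreal_le_iff)
qed

section \<open>The Sobolev inequality\<close>

lemma integrable_abs_powr_interval:
  fixes \<gamma> :: real
  assumes "\<gamma> < 1"
  shows "integrable lborel (\<lambda>t::real. indicator {-1..1} t * \<bar>t\<bar> powr (- \<gamma>))"
proof -
  have "(\<integral>\<^sup>+t. ennreal (t powr (- \<gamma>)) * indicator {0..1} t \<partial>lborel) = ennreal (1 powr (- \<gamma> + 1) / (- \<gamma> + 1))"
    by (rule nn_integral_has_integral_lebesgue'[OF _ has_integral_powr_from_0]) (use assms in auto)
  moreover have "(\<integral>\<^sup>+t. ennreal (norm (indicator {0..1} t * \<bar>t\<bar> powr (- \<gamma>))) \<partial>lborel) = (\<integral>\<^sup>+t. ennreal (t powr (- \<gamma>)) * indicator {0..1} t \<partial>lborel)"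
    by (intro nn_integral_cong) (auto simp: indicator_def)
  ultimately have 1: "integrable lborel (\<lambda>t::real. indicator {0..1} t * \<bar>t\<bar> powr (- \<gamma>))"
    by (intro integrableI_bounded) auto
  then have "integrable lborel (\<lambda>t::real. indicator {0..1} (- t) * \<bar>- t\<bar> powr (- \<gamma>))"
    using integrable_lborel_reflect_iff[of "\<lambda>t::real. indicator {0..1} t * \<bar>t\<bar> powr (- \<gamma>)"] by simp
  from Bochner_Integration.integrable_add[OF 1 this] show ?thesis
    by (rule Bochner_Integration.integrable_bound) (auto simp: indicator_def)
qed

lemma AE_coordinate_nonzero:
  assumes "b \<in> Basis"
  shows "AE x in lborel. x \<bullet> b \<noteq> (0::real)"
proof -
  have "negligible {x. x \<bullet> b = 0}" by (rule negligible_standard_hyperplane[OF assms])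
  then have "{x. x \<bullet> b = 0} \<in> null_sets lborel"
    by (simp add: negligible_iff_null_sets null_sets_completion_iff)
  from AE_not_in[OF this] show ?thesis by simp
qed

lemma integrable_norm_powr_cball:
  fixes \<beta> :: real
  assumes "0 \<le> \<beta>" "\<beta> < 3"
  shows "integrable lborel (\<lambda>\<xi>::real^3. indicator (cball 0 1) \<xi> * norm \<xi> powr (- \<beta>))"
proof -
  define f where "f t = indicator {-1..1} t * \<bar>t\<bar> powr (- (\<beta> / 3))" for t :: real
  have "integrable lborel f" unfolding f_def[abs_def] by (rule integrable_abs_powr_interval) (use assms in simp)
  then have "integrable lborel (\<lambda>t. complex_of_real (f t))" by (simp only: complex_of_real_integrable_eq)
  then have "integrable lborel (\<lambda>x::real^3. \<Prod>b\<in>Basis. complex_of_real (f (x \<bullet> b)))"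
    by (intro integrable_lborel_prod)
  then have "integrable lborel (\<lambda>x::real^3. complex_of_real (\<Prod>b\<in>Basis. f (x \<bullet> b)))" by simp
  then have i: "integrable lborel (\<lambda>x::real^3. \<Prod>b\<in>Basis. f (x \<bullet> b))" by (simp only: complex_of_real_integrable_eq)
  have nz: "AE x in lborel. \<forall>b\<in>(Basis::(real^3) set). x \<bullet> b \<noteq> 0"
    by (intro AE_finite_allI finite_Basis AE_coordinate_nonzero)
  show ?thesis
  proof (rule Bochner_Integration.integrable_bound[OF i])
    have [measurable]: "cball (0::real^3) 1 \<in> sets borel" by simp
    show "(\<lambda>\<xi>::real^3. indicator (cball 0 1) \<xi> * norm \<xi> powr (- \<beta>)) \<in> borel_measurable lborel" by measurable
    show "AE x in (lborel :: (real^3) measure). norm (indicator (cball 0 1) x * norm x powr (- \<beta>)) \<le> norm (\<Prod>b\<in>Basis. f (x \<bullet> b))"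
      using nz
    proof eventually_elim
      case (elim x)
      show ?case
      proof (cases "norm x \<le> 1")
        case True
        have "x \<noteq> 0" using elim nonempty_Basis by auto
        then have n: "norm x > 0" by simp
        have "norm x powr (- \<beta>) = (\<Prod>b\<in>(Basis::(real^3) set). norm x powr (- (\<beta> / 3)))"
          using n by (simp add: powr_realpow[symmetric] powr_powr)
        also have "\<dots> \<le> (\<Prod>b\<in>Basis. f (x \<bullet> b))"
        proof (intro prod_mono conjI)
          fix b :: "real^3" assume b: "b \<in> Basis"
          have le: "\<bar>x \<bullet> b\<bar> \<le> norm x" by (rule Basis_le_norm[OF b])
          moreover have "\<bar>x \<bullet> b\<bar> > 0" using elim b by simp
          ultimately have "norm x powr (- (\<beta> / 3)) \<le> \<bar>x \<bullet> b\<bar> powr (- (\<beta> / 3))"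
            using assms by (intro powr_mono2') auto
          moreover have "x \<bullet> b \<in> {-1..1}" using le True by auto
          ultimately show "norm x powr (- (\<beta> / 3)) \<le> f (x \<bullet> b)" by (simp add: f_def)
        qed simp
        also have "\<dots> \<le> norm (\<Prod>b\<in>Basis. f (x \<bullet> b))" by simp
        finally show ?thesis using True by simp
      qed (simp add: indicator_def)
    qed
  qed
qed

lemma
  fixes s :: real
  assumes s: "0 \<le> s" "s < 3 / 2" and A: "A > 0"
  shows integrable_Riesz_cball: "integrable lborel (\<lambda>\<xi>::real^3. indicator (cball 0 A) \<xi> * norm \<xi> powr (- (2 * s)))"
    and integral_Riesz_cball: "(LINT \<xi>::real^3|lborel. indicator (cball 0 A) \<xi> * norm \<xi> powr (- (2 * s)))
      = A powr (3 - 2 * s) * (LINT \<xi>::real^3|lborel. indicator (cball 0 1) \<xi> * norm \<xi> powr (- (2 * s)))"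
proof -
  define f where "f \<xi> = indicator (cball 0 1) \<xi> * norm \<xi> powr (- (2 * s))" for \<xi> :: "real^3"
  have i: "integrable lborel f" unfolding f_def[abs_def] by (rule integrable_norm_powr_cball) (use s in auto)
  have m: "f \<in> borel_measurable borel" using i by (auto dest: borel_measurable_integrable)
  have e: "indicator (cball 0 A) \<xi> * norm \<xi> powr (- (2 * s)) = A powr (- (2 * s)) * f ((1 / A) *\<^sub>R \<xi>)" for \<xi> :: "real^3"
  proof -
    have n: "norm ((1 / A) *\<^sub>R \<xi>) = norm \<xi> / A" using A by simp
    have m: "norm \<xi> / A \<le> 1 \<longleftrightarrow> norm \<xi> \<le> A" using A by (simp add: field_simps)
    have "A powr (- (2 * s)) * (norm \<xi> / A) powr (- (2 * s)) = norm \<xi> powr (- (2 * s))"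
      using A by (simp flip: powr_mult)
    then show ?thesis
      unfolding f_def n by (simp only: indicator_def mem_cball_0 n m mult.left_commute[of "A powr (- (2 * s))"])
  qed
  show "integrable lborel (\<lambda>\<xi>::real^3. indicator (cball 0 A) \<xi> * norm \<xi> powr (- (2 * s)))"
    unfolding e using integrable_lborel_dilate_iff[OF m, of "1 / A"] i A by (intro integrable_mult_right) simp
  have "(LINT \<xi>|lborel. A powr (- (2 * s)) * f ((1 / A) *\<^sub>R \<xi>)) = A powr (- (2 * s)) * ((LINT \<xi>|lborel. f \<xi>) /\<^sub>R (1 / A) ^ 3)"
    using integral_lborel_dilate[OF m, of "1 / A"] A by simp
  also have "\<dots> = (A powr (- (2 * s)) * A powr 3) * (LINT \<xi>|lborel. f \<xi>)"
    using A powr_realpow[OF A, of 3] by (simp add: power_one_over)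
  also have "A powr (- (2 * s)) * A powr 3 = A powr (3 - 2 * s)" unfolding powr_add[symmetric] by simp
  finally show "(LINT \<xi>::real^3|lborel. indicator (cball 0 A) \<xi> * norm \<xi> powr (- (2 * s)))
      = A powr (3 - 2 * s) * (LINT \<xi>::real^3|lborel. indicator (cball 0 1) \<xi> * norm \<xi> powr (- (2 * s)))"
    unfolding e unfolding f_def .
qed

text \<open>The distribution function of \<open>u\<close> at height \<open>t\<close> is controlled by the frequencies above the
  threshold \<open>A\<close> at which the low-frequency part is bounded by \<open>t / 2\<close>.\<close>

lemma level_set_estimate:
  fixes s :: real
  assumes u: "frac_deriv s u W" and u2: "integrable lborel (\<lambda>x. (u x)\<^sup>2)" and s: "0 < s" "s < 3 / 2"
    and p: "fourier_pair nice (\<lambda>x. of_real (u x)) g" and g2: "integrable lborel (\<lambda>\<xi>. (norm (g \<xi>))\<^sup>2)"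
    and gs: "integrable lborel (\<lambda>\<xi>. (norm \<xi> powr s * norm (g \<xi>))\<^sup>2)"
    and gE: "(LINT \<xi>|lborel. (norm \<xi> powr s * norm (g \<xi>))\<^sup>2) \<le> E"
    and J: "(LINT \<xi>::real^3|lborel. indicator (cball 0 1) \<xi> * norm \<xi> powr (- (2 * s))) \<le> J"
    and A: "A > 0" and t: "t > 0" "ft_const * sqrt (J * E) * A powr (3 / 2 - s) \<le> t / 2"
  shows "ennreal (t\<^sup>2 / 4) * emeasure lborel {x. t \<le> \<bar>u x\<bar>} \<le> (\<integral>\<^sup>+\<xi>. ennreal ((norm (g \<xi>))\<^sup>2 * indicator (- cball 0 A) \<xi>) \<partial>lborel)"
proof -
  note um[measurable] = frac_deriv_borel(1)[OF u]
  note pm[measurable] = fourier_pair_borel[OF p]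
  have cb[measurable]: "cball (0::real^3) A \<in> sets borel" by simp
  define k where "k \<xi> = indicator (cball 0 A) \<xi> * norm \<xi> powr (- s)" for \<xi> :: "real^3"
  define h where "h \<xi> = norm \<xi> powr s * norm (g \<xi>)" for \<xi>
  have km[measurable]: "k \<in> borel_measurable borel" "h \<in> borel_measurable borel"
    unfolding k_def[abs_def] h_def[abs_def] by measurable
  have k2e: "(norm (k \<xi>))\<^sup>2 = indicator (cball 0 A) \<xi> * norm \<xi> powr (- (2 * s))" for \<xi>
    by (simp add: k_def power_mult_distrib power2_eq_square indicator_def flip: powr_add)
  have k2: "integrable lborel (\<lambda>\<xi>. (norm (k \<xi>))\<^sup>2)" unfolding k2e by (rule integrable_Riesz_cball) (use s A in auto)
  have h2: "integrable lborel (\<lambda>\<xi>. (norm (h \<xi>))\<^sup>2)" using gs by (simp add: h_def)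
  define gl where "gl \<xi> = indicator (cball 0 A) \<xi> * g \<xi>" for \<xi>
  have glm[measurable]: "gl \<in> borel_measurable borel" unfolding gl_def[abs_def]
    by (intro borel_measurable_times borel_measurable_indicator cb pm)
  have gl_le: "norm (gl \<xi>) \<le> norm (g \<xi>)" for \<xi> by (simp add: gl_def indicator_def norm_mult)
  have gl2: "integrable lborel (\<lambda>\<xi>. (norm (gl \<xi>))\<^sup>2)"
    by (rule Bochner_Integration.integrable_bound[OF g2]) (use gl_le in \<open>auto intro!: power_mono\<close>)
  have ae: "AE \<xi> in lborel. norm (gl \<xi>) = k \<xi> * h \<xi>"
  proof -
    have "AE \<xi> in lborel. \<xi> \<noteq> (0 :: real^3)" by (rule AE_lborel_singleton)
    then show ?thesis
    proof eventually_elim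
      case (elim \<xi>)
      then have "norm \<xi> powr (- s) * norm \<xi> powr s = 1" by (simp add: powr_minus)
      then show ?case by (simp add: gl_def k_def h_def norm_mult indicator_def)
    qed
  qed
  have kh: "integrable lborel (\<lambda>\<xi>. k \<xi> * h \<xi>)" by (rule integrable_mult_L2[OF _ _ k2 h2]) auto
  have gln: "integrable lborel (\<lambda>\<xi>. norm (gl \<xi>))" by (rule integrable_cong_AE_imp[OF kh _ AE_symmetric[OF ae]]) simp
  have gl1: "integrable lborel gl" by (rule Bochner_Integration.integrable_bound[OF gln]) auto
  have "(LINT \<xi>|lborel. norm (gl \<xi>)) = (LINT \<xi>|lborel. k \<xi> * h \<xi>)" by (rule integral_cong_AE[OF _ _ ae]) auto
  moreover have "(norm (LINT \<xi>|lborel. k \<xi> * h \<xi>))\<^sup>2 \<le> (LINT \<xi>|lborel. (norm (k \<xi>))\<^sup>2) * (LINT \<xi>|lborel. (norm (h \<xi>))\<^sup>2)"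
    by (rule Cauchy_Schwarz_integral[OF _ _ k2 h2]) auto
  ultimately have "(LINT \<xi>|lborel. norm (gl \<xi>))\<^sup>2 \<le> (LINT \<xi>|lborel. (norm (k \<xi>))\<^sup>2) * (LINT \<xi>|lborel. (norm (h \<xi>))\<^sup>2)" by simp
  also have "\<dots> \<le> (A powr (3 - 2 * s) * J) * E"
  proof (intro mult_mono)
    show "(LINT \<xi>|lborel. (norm (k \<xi>))\<^sup>2) \<le> A powr (3 - 2 * s) * J"
      unfolding k2e using s A J by (subst integral_Riesz_cball) (auto intro!: mult_left_mono)
    show "(LINT \<xi>|lborel. (norm (h \<xi>))\<^sup>2) \<le> E" using gE by (simp add: h_def)
    have "0 \<le> J" by (rule order_trans[OF _ J]) simp
    then show "0 \<le> A powr (3 - 2 * s) * J" by simp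
  qed simp
  also have "\<dots> = (sqrt (J * E) * A powr (3 / 2 - s))\<^sup>2"
  proof -
    have J0: "0 \<le> J" by (rule order_trans[OF _ J]) simp
    have E0: "0 \<le> E" by (rule order_trans[OF _ gE]) simp
    have "(A powr (3 / 2 - s))\<^sup>2 = A powr (3 - 2 * s)" by (simp add: power2_eq_square flip: powr_add)
    then show ?thesis using J0 E0 by (simp add: power_mult_distrib)
  qed
  finally have "(LINT \<xi>|lborel. norm (gl \<xi>)) \<le> sqrt (J * E) * A powr (3 / 2 - s)"
  proof (rule power2_le_imp_le)
    have "0 \<le> J" by (rule order_trans[OF _ J]) simp
    moreover have "0 \<le> E" by (rule order_trans[OF _ gE]) simp
    ultimately show "0 \<le> sqrt (J * E) * A powr (3 / 2 - s)" by simp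
  qed
  then have gl_int: "ft_const * (LINT \<xi>|lborel. norm (gl \<xi>)) \<le> t / 2"
    using t(2) mult_left_mono[OF _ less_imp_le[OF ft_const_pos]] by (fastforce simp: mult.assoc)
  define ul where "ul x = ft gl (- x)" for x
  have ulm[measurable]: "ul \<in> borel_measurable borel" unfolding ul_def[abs_def] by (rule ft_reflect_borel[OF glm])
  have ul_le: "norm (ul x) \<le> t / 2" for x
    unfolding ul_def by (rule order_trans[OF ft_bound[OF gl1] gl_int])
  have pl: "fourier_pair nice ul gl"
  proof (rule fourier_pair_L2I[OF ulm glm _ gl2])
    show "integrable lborel (\<lambda>x. (norm (ul x))\<^sup>2)"
      unfolding ul_def by (rule integrable_reflect_L2[OF ft_borel[OF glm] integrable_ft_L2[OF gl1 gl2]])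
    fix \<psi> assume \<psi>: "\<psi> \<in> nice"
    have "(LINT x|lborel. ul x * ft \<psi> x) = (LINT x|lborel. ft gl (- x) * ft \<psi> (- (- x)))" by (simp add: ul_def)
    also have "\<dots> = (LINT x|lborel. ft gl x * ft \<psi> (- x))"
      using ft_reflect_borel[OF nice_borel[OF \<psi>]] by (intro integral_lborel_reflect[of "\<lambda>x. ft gl x * ft \<psi> (- x)"]) simp
    also have "\<dots> = (LINT x|lborel. gl x * \<psi> x)" by (rule parseval_nice[OF gl1 gl2 \<psi>])
    finally show "(LINT x|lborel. ul x * ft \<psi> x) = (LINT x|lborel. gl x * \<psi> x)" .
  qed
  define uh where "uh x = 1 * complex_of_real (u x) + (-1) * ul x" for x
  define gh where "gh \<xi> = 1 * g \<xi> + (-1) * gl \<xi>" for \<xi>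
  have ph: "fourier_pair nice uh gh" unfolding uh_def gh_def by (rule fourier_pair_lincomb[OF p pl])
  have ghe: "(norm (gh \<xi>))\<^sup>2 = (norm (g \<xi>))\<^sup>2 * indicator (- cball 0 A) \<xi>" for \<xi>
    by (simp add: gh_def gl_def indicator_def)
  have gh2: "integrable lborel (\<lambda>\<xi>. (norm (gh \<xi>))\<^sup>2)"
    unfolding ghe by (rule Bochner_Integration.integrable_bound[OF g2]) (auto simp: indicator_def)
  note P = plancherel_left[OF fourier_pair_nice_schwartz[OF ph] gh2]
  have "ennreal (t\<^sup>2 / 4) * emeasure lborel {x. t \<le> \<bar>u x\<bar>} = (\<integral>\<^sup>+x. ennreal (t\<^sup>2 / 4) * indicator {x. t \<le> \<bar>u x\<bar>} x \<partial>lborel)"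
    by (rule nn_integral_cmult_indicator[symmetric]) simp
  also have "\<dots> \<le> (\<integral>\<^sup>+x. ennreal ((norm (uh x))\<^sup>2) \<partial>lborel)"
  proof (rule nn_integral_mono)
    fix x
    show "ennreal (t\<^sup>2 / 4) * indicator {x. t \<le> \<bar>u x\<bar>} x \<le> ennreal ((norm (uh x))\<^sup>2)"
    proof (cases "t \<le> \<bar>u x\<bar>")
      case True
      have "norm (complex_of_real (u x)) \<le> norm (uh x) + norm (ul x)"
        using norm_triangle_ineq[of "uh x" "ul x"] by (simp add: uh_def)
      then have "t / 2 \<le> norm (uh x)" using ul_le[of x] True by simp
      then have "(t / 2)\<^sup>2 \<le> (norm (uh x))\<^sup>2" using t by (intro power_mono) auto
      then show ?thesis using True by (simp add: power_divide ennreal_leI)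
    qed simp
  qed
  also have "\<dots> = ennreal (LINT x|lborel. (norm (uh x))\<^sup>2)" by (rule nn_integral_eq_integral[OF P(1)]) simp
  also have "\<dots> \<le> ennreal (LINT \<xi>|lborel. (norm (gh \<xi>))\<^sup>2)" by (rule ennreal_leI[OF P(2)])
  also have "\<dots> = (\<integral>\<^sup>+\<xi>. ennreal ((norm (gh \<xi>))\<^sup>2) \<partial>lborel)" by (rule nn_integral_eq_integral[OF gh2, symmetric]) simp
  finally show ?thesis unfolding ghe .
qed

lemma nn_integral_powr_upto:
  fixes c a :: real
  assumes "c \<ge> 0" "a > -1"
  shows "(\<integral>\<^sup>+t. ennreal (t powr a) * indicator {0..c} t \<partial>lborel) = ennreal (c powr (a + 1) / (a + 1))"
  by (rule nn_integral_has_integral_lebesgue'[OF _ has_integral_powr_from_0]) (use assms in auto)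

lemma sobolev_inequality:
  fixes s :: real
  assumes s: "0 < s" "s < 3 / 2"
  obtains C where "C > 0" "\<And>u W. frac_deriv s u W \<Longrightarrow> integrable lborel (\<lambda>x. (u x)\<^sup>2) \<Longrightarrow>
    integrable lborel (\<lambda>x. \<bar>u x\<bar> powr crit_exp s) \<and>
    (LINT x|lborel. \<bar>u x\<bar> powr crit_exp s) \<le> C * (LINT x|lborel. (W x)\<^sup>2) powr (crit_exp s / 2)"
proof -
  define q where "q = crit_exp s"
  define a where "a = 3 / 2 - s"
  have a: "a > 0" using s by (simp add: a_def)
  have qa: "q = 3 / a" by (simp add: q_def crit_exp_def a_def field_simps)
  have q: "q > 2" using s by (simp add: q_def crit_exp_def field_simps)
  have q2: "a * (q - 2) = 2 * s" unfolding qa using a by (simp add: right_diff_distrib) (simp add: a_def)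
  define J where "J = (LINT \<xi>::real^3|lborel. indicator (cball 0 1) \<xi> * norm \<xi> powr (- (2 * s))) + 1"
  have J0: "J > 0" unfolding J_def by (intro add_nonneg_pos) auto
  define C where "C = 4 * q / (q - 2) * (2 * (ft_const * sqrt J)) powr (q - 2)"
  have C: "C > 0" using q J0 ft_const_pos by (simp add: C_def)
  show thesis
  proof (rule that[OF C])
    fix u W assume u: "frac_deriv s u W" and u2: "integrable lborel (\<lambda>x. (u x)\<^sup>2)"
    define E where "E = (LINT x|lborel. (W x)\<^sup>2)"
    note W = frac_deriv_borel[OF u]
    note um[measurable] = W(1)
    have "(\<integral>\<^sup>+x. ennreal (\<bar>u x\<bar> powr q) \<partial>lborel) \<le> ennreal (C * E powr (q / 2))"
    proof (cases "E = 0")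
      case True
      have "AE x in lborel. (W x)\<^sup>2 = 0"
        using True W(3) by (subst (asm) E_def, subst (asm) integral_nonneg_eq_0_iff_AE) auto
      then have "AE x in lborel. W x = 0" by eventually_elim simp
      then have "AE x in lborel. u x = 0" by (rule frac_deriv_zero[OF u])
      then have "AE x in lborel. ennreal (\<bar>u x\<bar> powr q) = 0" by eventually_elim simp
      then have "(\<integral>\<^sup>+x. ennreal (\<bar>u x\<bar> powr q) \<partial>lborel) = (\<integral>\<^sup>+x. 0 \<partial>(lborel::(real^3) measure))" by (rule nn_integral_cong_AE)
      then show ?thesis by simp
    next
      case False
      have "E \<ge> 0" by (simp add: E_def)
      with False have E: "E > 0" by simp
      obtain g where p: "fourier_pair nice (\<lambda>x. of_real (u x)) g" and g2: "integrable lborel (\<lambda>\<xi>. (norm (g \<xi>))\<^sup>2)"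
        and gs: "integrable lborel (\<lambda>\<xi>. (norm \<xi> powr s * norm (g \<xi>))\<^sup>2)"
        and gE: "(LINT \<xi>|lborel. (norm \<xi> powr s * norm (g \<xi>))\<^sup>2) \<le> (LINT x|lborel. (W x)\<^sup>2)"
        by (rule frac_deriv_L2[OF u u2])
      note gm[measurable] = fourier_pair_borel(2)[OF p]
      define M where "M = ft_const * sqrt (J * E)"
      have M: "M > 0" using ft_const_pos J0 E by (simp add: M_def)
      define A where "A t = (t / (2 * M)) powr (1 / a)" for t
      have Am[measurable]: "A \<in> borel_measurable borel" unfolding A_def[abs_def] by measurable
      define T where "T \<xi> = 2 * M * norm \<xi> powr a" for \<xi> :: "real^3"
      have T0: "T \<xi> \<ge> 0" for \<xi> using M by (simp add: T_def)
      have AT: "t \<le> T \<xi>" if "t > 0" "A t < norm \<xi>" for t \<xi>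
      proof -
        have "(A t) powr a \<le> norm \<xi> powr a" using that a by (intro powr_mono2) (auto simp: A_def)
        moreover have "(A t) powr a = t / (2 * M)" using that a M by (simp add: A_def powr_powr)
        ultimately show ?thesis using M by (simp add: T_def field_simps)
      qed
      define k where "k t x = ennreal (q * t powr (q - 1)) * indicator {(t, x). 0 \<le> t \<and> t \<le> \<bar>u x\<bar>} (t, x)" for t x
      define l where "l t \<xi> = ennreal (4 * q * t powr (q - 3)) * ennreal ((norm (g \<xi>))\<^sup>2) * indicator {(t, \<xi>). 0 < t \<and> A t < norm \<xi>} (t, \<xi>)" for t \<xi>
      have km: "(\<lambda>(x, t). k t x) \<in> borel_measurable (lborel \<Otimes>\<^sub>M lborel)"
      proof -
        have "(\<lambda>z. ennreal (q * snd z powr (q - 1)) * (if 0 \<le> snd z \<and> snd z \<le> \<bar>u (fst z)\<bar> then 1 else 0)) \<in> borel_measurable (lborel \<Otimes>\<^sub>M lborel)"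
          by measurable
        then show ?thesis by (simp add: k_def indicator_def split_beta)
      qed
      have lm: "(\<lambda>(t, \<xi>). l t \<xi>) \<in> borel_measurable (lborel \<Otimes>\<^sub>M lborel)"
      proof -
        have "(\<lambda>z. ennreal (4 * q * fst z powr (q - 3)) * ennreal ((norm (g (snd z)))\<^sup>2) * (if 0 < fst z \<and> A (fst z) < norm (snd z) then 1 else 0)) \<in> borel_measurable (lborel \<Otimes>\<^sub>M lborel)"
          by measurable
        then show ?thesis by (simp add: l_def indicator_def split_beta)
      qed
      have "(\<integral>\<^sup>+x. ennreal (\<bar>u x\<bar> powr q) \<partial>lborel) = (\<integral>\<^sup>+x. (\<integral>\<^sup>+t. k t x \<partial>lborel) \<partial>lborel)"
      proof (rule nn_integral_cong)
        fix x
        have "(\<integral>\<^sup>+t. k t x \<partial>lborel) = (\<integral>\<^sup>+t. ennreal q * (ennreal (t powr (q - 1)) * indicator {0..\<bar>u x\<bar>} t) \<partial>lborel)"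
          using q by (intro nn_integral_cong) (auto simp: k_def indicator_def ennreal_mult')
        also have "\<dots> = ennreal q * ennreal (\<bar>u x\<bar> powr (q - 1 + 1) / (q - 1 + 1))"
          using q by (subst nn_integral_cmult) (auto simp: nn_integral_powr_upto)
        also have "\<dots> = ennreal (\<bar>u x\<bar> powr q)" using q by (simp flip: ennreal_mult')
        finally show "ennreal (\<bar>u x\<bar> powr q) = (\<integral>\<^sup>+t. k t x \<partial>lborel)" ..
      qed
      also have "\<dots> = (\<integral>\<^sup>+t. (\<integral>\<^sup>+x. k t x \<partial>lborel) \<partial>lborel)"
        by (rule lborel_pair.Fubini'[OF km, symmetric])
      also have "\<dots> \<le> (\<integral>\<^sup>+t. (\<integral>\<^sup>+\<xi>. l t \<xi> \<partial>lborel) \<partial>lborel)"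
      proof (rule nn_integral_mono)
        fix t :: real
        show "(\<integral>\<^sup>+x. k t x \<partial>lborel) \<le> (\<integral>\<^sup>+\<xi>. l t \<xi> \<partial>lborel)"
        proof (cases "t > 0")
          case True
          have At: "A t > 0" using True M by (simp add: A_def)
          have "(A t) powr a = t / (2 * M)" using True a M by (simp add: A_def powr_powr)
          then have "ft_const * sqrt (J * E) * A t powr (3 / 2 - s) \<le> t / 2"
            using M True by (simp add: M_def[symmetric] a_def[symmetric])
          note lev = level_set_estimate[OF u u2 s p g2 gs gE[folded E_def] _ At True this]
          have "(\<integral>\<^sup>+x. k t x \<partial>lborel) = (\<integral>\<^sup>+x. ennreal (q * t powr (q - 1)) * indicator {x. t \<le> \<bar>u x\<bar>} x \<partial>lborel)"
            using True by (intro nn_integral_cong) (auto simp: k_def indicator_def)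
          also have "\<dots> = ennreal (q * t powr (q - 1)) * emeasure lborel {x. t \<le> \<bar>u x\<bar>}"
            by (rule nn_integral_cmult_indicator) simp
          also have "q * t powr (q - 1) = (4 * q * t powr (q - 3)) * (t\<^sup>2 / 4)"
          proof -
            have "t powr (q - 1) = t powr (q - 3) * t powr 2" by (simp flip: powr_add)
            then show ?thesis using True by simp
          qed
          also have "ennreal ((4 * q * t powr (q - 3)) * (t\<^sup>2 / 4)) * emeasure lborel {x. t \<le> \<bar>u x\<bar>}
             = ennreal (4 * q * t powr (q - 3)) * (ennreal (t\<^sup>2 / 4) * emeasure lborel {x. t \<le> \<bar>u x\<bar>})"
            using q by (subst ennreal_mult) (auto simp: mult.assoc)
          also have "\<dots> \<le> ennreal (4 * q * t powr (q - 3)) * (\<integral>\<^sup>+\<xi>. ennreal ((norm (g \<xi>))\<^sup>2 * indicator (- cball 0 (A t)) \<xi>) \<partial>lborel)"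
            by (intro mult_left_mono lev) (auto simp: J_def)
          also have "\<dots> = (\<integral>\<^sup>+\<xi>. ennreal (4 * q * t powr (q - 3)) * ennreal ((norm (g \<xi>))\<^sup>2 * indicator (- cball 0 (A t)) \<xi>) \<partial>lborel)"
          proof (rule nn_integral_cmult[symmetric])
            have [measurable]: "- cball (0::real^3) (A t) \<in> sets borel" by simp
            show "(\<lambda>\<xi>. ennreal ((norm (g \<xi>))\<^sup>2 * indicator (- cball 0 (A t)) \<xi>)) \<in> borel_measurable lborel" by measurable
          qed
          also have "\<dots> = (\<integral>\<^sup>+\<xi>. l t \<xi> \<partial>lborel)"
            using True by (intro nn_integral_cong) (auto simp: l_def indicator_def)
          finally show ?thesis .
        next
          case False
          have "k t x = 0" for x using False q by (cases "t = 0") (auto simp: k_def indicator_def)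
          then show ?thesis by simp
        qed
      qed
      also have "\<dots> = (\<integral>\<^sup>+\<xi>. (\<integral>\<^sup>+t. l t \<xi> \<partial>lborel) \<partial>lborel)"
        by (rule lborel_pair.Fubini'[OF lm, symmetric])
      also have "\<dots> \<le> (\<integral>\<^sup>+\<xi>. ennreal (C * E powr ((q - 2) / 2) * (norm \<xi> powr s * norm (g \<xi>))\<^sup>2) \<partial>lborel)"
      proof (rule nn_integral_mono)
        fix \<xi> :: "real^3"
        have "(\<integral>\<^sup>+t. l t \<xi> \<partial>lborel) \<le> (\<integral>\<^sup>+t. ennreal (4 * q * (norm (g \<xi>))\<^sup>2) * (ennreal (t powr (q - 3)) * indicator {0..T \<xi>} t) \<partial>lborel)"
        proof (rule nn_integral_mono)
          fix t :: real
          show "l t \<xi> \<le> ennreal (4 * q * (norm (g \<xi>))\<^sup>2) * (ennreal (t powr (q - 3)) * indicator {0..T \<xi>} t)"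
          proof (cases "0 < t \<and> A t < norm \<xi>")
            case True
            then have "t \<in> {0..T \<xi>}" using AT by auto
            then show ?thesis using True q
              by (simp add: l_def ennreal_mult'[symmetric] mult_ac)
          qed (auto simp: l_def indicator_def)
        qed
        also have "\<dots> = ennreal (4 * q * (norm (g \<xi>))\<^sup>2) * ennreal (T \<xi> powr (q - 3 + 1) / (q - 3 + 1))"
          using q T0 by (subst nn_integral_cmult) (auto simp: nn_integral_powr_upto)
        also have "\<dots> = ennreal (4 * q * (norm (g \<xi>))\<^sup>2 * (T \<xi> powr (q - 2) / (q - 2)))"
          using q T0 by (subst ennreal_mult) auto
        also have "4 * q * (norm (g \<xi>))\<^sup>2 * (T \<xi> powr (q - 2) / (q - 2)) = C * E powr ((q - 2) / 2) * (norm \<xi> powr s * norm (g \<xi>))\<^sup>2"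
        proof -
          have "2 * M = 2 * (ft_const * sqrt J) * sqrt E" by (simp add: M_def real_sqrt_mult)
          then have "T \<xi> powr (q - 2) = (2 * (ft_const * sqrt J)) powr (q - 2) * sqrt E powr (q - 2) * (norm \<xi> powr a) powr (q - 2)"
            using ft_const_pos J0 E unfolding T_def by (simp add: powr_mult)
          also have "sqrt E powr (q - 2) = E powr ((q - 2) / 2)" using E by (simp add: powr_half_sqrt[symmetric] powr_powr)
          also have "(norm \<xi> powr a) powr (q - 2) = (norm \<xi> powr s)\<^sup>2"
            unfolding powr_powr q2 by (simp add: power2_eq_square flip: powr_add)
          finally show ?thesis by (simp add: C_def power_mult_distrib mult_ac)
        qed
        finally show "(\<integral>\<^sup>+t. l t \<xi> \<partial>lborel) \<le> ennreal (C * E powr ((q - 2) / 2) * (norm \<xi> powr s * norm (g \<xi>))\<^sup>2)" .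
      qed
      also have "\<dots> = ennreal (LINT \<xi>|lborel. C * E powr ((q - 2) / 2) * (norm \<xi> powr s * norm (g \<xi>))\<^sup>2)"
        using C by (intro nn_integral_eq_integral integrable_mult_right gs) auto
      also have "\<dots> \<le> ennreal (C * E powr ((q - 2) / 2) * E)"
        using C gE by (intro ennreal_leI) (auto simp: E_def intro!: mult_left_mono)
      also have "C * E powr ((q - 2) / 2) * E = C * E powr (q / 2)"
      proof -
        have "E powr ((q - 2) / 2) * E powr 1 = E powr (q / 2)" unfolding powr_add[symmetric] by (simp add: field_simps)
        then show ?thesis using E by simp
      qed
      finally show ?thesis .
    qed
    note le = this
    have i: "integrable lborel (\<lambda>x. \<bar>u x\<bar> powr q)"
      using le by (intro integrableI_bounded) (auto intro: le_less_trans)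
    have "ennreal (LINT x|lborel. \<bar>u x\<bar> powr q) \<le> ennreal (C * E powr (q / 2))"
      using le by (subst nn_integral_eq_integral[OF i, symmetric]) auto
    then have "(LINT x|lborel. \<bar>u x\<bar> powr q) \<le> C * E powr (q / 2)"
      using C by (subst (asm) ennreal_le_iff) auto
    with i show "integrable lborel (\<lambda>x. \<bar>u x\<bar> powr crit_exp s) \<and>
      (LINT x|lborel. \<bar>u x\<bar> powr crit_exp s) \<le> C * (LINT x|lborel. (W x)\<^sup>2) powr (crit_exp s / 2)"
      by (simp add: q_def E_def)
  qed
qed

section \<open>Gaussians are admissible test functions\<close>

lemma gaussian_Dspace:
  assumes s: "0 < s" "s < 3 / 2"  and s1: "s \<le> 1"
  shows "(\<lambda>x. exp (- 1 * (norm x)\<^sup>2)) \<in> Dspace s"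
proof -
  define v :: "real^3 \<Rightarrow> real" where "v x = exp (- 1 * (norm x)\<^sup>2)" for x
  have vm[measurable]: "v \<in> borel_measurable borel" unfolding v_def[abs_def] by measurable
  have vi: "integrable lborel v" unfolding v_def[abs_def] by (rule integrable_gaussian) simp
  then have vci: "integrable lborel (\<lambda>x. complex_of_real (v x))" by (simp only: complex_of_real_integrable_eq)
  let ?g = "ft (\<lambda>x. complex_of_real (v x))"
  have p: "fourier_pair schwartz (\<lambda>x. of_real (v x)) ?g"
    unfolding fourier_pair_def
  proof (intro conjI ballI)
    fix \<psi> assume "\<psi> \<in> schwartz"
    then have \<psi>: "\<psi> \<in> nice" by (rule schwartz_nice)
    note [measurable] = nice_borel[OF \<psi>]
    show "integrable lborel (\<lambda>x. of_real (v x) * ft \<psi> x)"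
    proof (rule Bochner_Integration.integrable_bound[OF integrable_mult_right[OF vi, of "ft_const * (LINT x|lborel. norm (\<psi> x))"]])
      show "AE x in lborel. norm (of_real (v x) * ft \<psi> x) \<le> norm ((ft_const * (LINT x|lborel. norm (\<psi> x))) * v x)"
        using ft_bound[OF nice_integrable[OF \<psi>]] ft_const_pos
        by (intro AE_I2) (simp add: norm_mult abs_mult mult.commute mult_left_mono)
    qed simp
    show "integrable lborel (\<lambda>x. ?g x * \<psi> x)"
    proof (rule Bochner_Integration.integrable_bound[OF integrable_mult_right[OF nice_integrable[OF \<psi>], of "of_real (ft_const * (LINT x|lborel. norm (complex_of_real (v x))))"]])
      show "AE x in lborel. norm (?g x * \<psi> x) \<le> norm (of_real (ft_const * (LINT x|lborel. norm (complex_of_real (v x)))) * \<psi> x)"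
        using ft_bound[OF vci] ft_const_pos
        by (intro AE_I2) (simp add: norm_mult abs_mult mult_right_mono)
    qed simp
    show "(LINT x|lborel. of_real (v x) * ft \<psi> x) = (LINT x|lborel. ?g x * \<psi> x)"
      by (rule ft_multiplication[OF vci nice_integrable[OF \<psi>]])
  qed simp_all
  define K where "K = (1 / (sqrt pi * 2)) ^ 3 / ft_const"
  have K: "K > 0" using ft_const_pos by (simp add: K_def)
  have gn: "norm (?g y) = K * exp (- (1 / 4) * (norm y)\<^sup>2)" for y
  proof -
    have "(\<lambda>\<xi>::real^3. cis (0 \<bullet> \<xi>) * complex_of_real (exp (- (2\<^sup>2 / 4) * (norm \<xi>)\<^sup>2))) = (\<lambda>x. complex_of_real (v x))"
      by (simp add: v_def)
    then have "of_real ft_const * ?g y = of_real (gauss_kernel 2 (0 - y))"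
      using ft_gaussian_modulated(2)[of 2 0 y] by simp
    then have "norm (complex_of_real ft_const * ?g y) = \<bar>gauss_kernel 2 (0 - y)\<bar>" by (simp only: norm_of_real)
    then have "ft_const * norm (?g y) = gauss_kernel 2 (0 - y)"
      using ft_const_pos gauss_kernel_nonneg[of 2 "0 - y"] by (simp add: norm_mult)
    also have "\<dots> = (1 / (sqrt pi * 2)) ^ 3 * exp (- (1 / 4) * (norm y)\<^sup>2)" by (simp add: gauss_kernel_def)
    finally show ?thesis using ft_const_pos by (simp add: K_def field_simps)
  qed
  have "integrable lborel (\<lambda>\<xi>. (norm (of_real (norm \<xi> powr s) * ?g \<xi>))\<^sup>2)"
  proof (rule Bochner_Integration.integrable_bound)
    show "integrable lborel (\<lambda>\<xi>::real^3. (4 * K\<^sup>2) * exp (- (1 / 4) * (norm \<xi>)\<^sup>2))"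
      by (intro integrable_mult_right integrable_gaussian) simp
    show "AE \<xi> in lborel. norm ((norm (of_real (norm \<xi> powr s) * ?g \<xi>))\<^sup>2) \<le> norm ((4 * K\<^sup>2) * exp (- (1 / 4) * (norm \<xi>)\<^sup>2))"
    proof (rule AE_I2)
      fix \<xi> :: "real^3"
      define r where "r = (norm \<xi>)\<^sup>2"
      have r0: "r \<ge> 0" by (simp add: r_def)
      have "(norm \<xi> powr s)\<^sup>2 = norm \<xi> powr (2 * s)" by (simp add: power2_eq_square flip: powr_add)
      also have "\<dots> \<le> 1 + r"
      proof (cases "norm \<xi> \<le> 1")
        case True
        then have "norm \<xi> powr (2 * s) \<le> 1" using s by (intro powr_le1) auto
        then show ?thesis using r0 by simp
      next
        case False
        then have "norm \<xi> powr (2 * s) \<le> norm \<xi> powr 2" using s1 by (intro powr_mono) auto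
        then show ?thesis by (simp add: r_def norm_powr_2)
      qed
      also have "\<dots> \<le> 4 * exp (r / 4)" using exp_ge_add_one_self[of "r / 4"] by linarith
      finally have 1: "(norm \<xi> powr s)\<^sup>2 \<le> 4 * exp (r / 4)" .
      have "(norm (of_real (norm \<xi> powr s) * ?g \<xi>))\<^sup>2 = (norm \<xi> powr s)\<^sup>2 * (K\<^sup>2 * exp (- r / 2))"
        unfolding norm_mult gn power_mult_distrib by (simp add: r_def flip: exp_double)
      also have "\<dots> \<le> (4 * exp (r / 4)) * (K\<^sup>2 * exp (- r / 2))" by (intro mult_right_mono 1) simp
      also have "\<dots> = (4 * K\<^sup>2) * (exp (r / 4) * exp (- r / 2))" by simp
      also have "exp (r / 4) * exp (- r / 2) = exp (- (1 / 4) * r)" by (simp flip: exp_add)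
      finally show "norm ((norm (of_real (norm \<xi> powr s) * ?g \<xi>))\<^sup>2) \<le> norm ((4 * K\<^sup>2) * exp (- (1 / 4) * (norm \<xi>)\<^sup>2))"
        by (simp add: r_def)
    qed
  qed simp
  then have "(\<lambda>\<xi>. of_real (norm \<xi> powr s) * ?g \<xi>) \<in> Lp 2"
    by (subst Lp_iff_borel) (simp_all add: norm_powr_2)
  moreover have "v \<in> Lp (crit_exp s)"
  proof (subst Lp_iff_borel)
    have q: "crit_exp s > 0" using s by (simp add: crit_exp_def)
    have e: "norm (v x) powr crit_exp s = exp (- crit_exp s * (norm x)\<^sup>2)" for x
      by (simp add: v_def powr_def)
    show "integrable lborel (\<lambda>x. norm (v x) powr crit_exp s)"
      unfolding e by (rule integrable_gaussian[OF q])
  qed simp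
  moreover have "is_fourier_transform v ?g"
    by (rule fourier_pair_imp_is_fourier_transform[OF p vm])
  ultimately have "v \<in> Dspace s" by (auto simp: Dspace_def)
  then show ?thesis by (simp add: v_def[abs_def])
qed

section \<open>Potentials\<close>

lemma Hoelder_integral:
  fixes f g :: "'a \<Rightarrow> real" and a b :: real
  assumes m[measurable]: "f \<in> borel_measurable M" "g \<in> borel_measurable M"
    and nn: "\<And>x. 0 \<le> f x" "\<And>x. 0 \<le> g x" and ab: "a > 1" "b > 1" "1 / a + 1 / b = 1"
    and f: "integrable M (\<lambda>x. f x powr a)" and g: "integrable M (\<lambda>x. g x powr b)"
  shows "integrable M (\<lambda>x. f x * g x) \<and>
    (LINT x|M. f x * g x) \<le> (LINT x|M. f x powr a) powr (1 / a) * (LINT x|M. g x powr b) powr (1 / b)"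
proof -
  define X Y where "X = (LINT x|M. f x powr a)" and "Y = (LINT x|M. g x powr b)"
  have XY: "X \<ge> 0" "Y \<ge> 0" by (auto simp: X_def Y_def)
  have le: "f x * g x \<le> f x powr a / a + g x powr b / b" for x
    by (rule Youngs_inequality[OF ab nn])
  have i: "integrable M (\<lambda>x. f x * g x)"
  proof (rule Bochner_Integration.integrable_bound)
    show "integrable M (\<lambda>x. f x powr a / a + g x powr b / b)" using f g by simp
    show "AE x in M. norm (f x * g x) \<le> norm (f x powr a / a + g x powr b / b)"
      using le nn by (intro AE_I2) (auto intro: order_trans[OF _ abs_ge_self])
  qed simp
  have "(LINT x|M. f x * g x) \<le> X powr (1 / a) * Y powr (1 / b)"
  proof (cases "X = 0 \<or> Y = 0")
    case True
    then have "AE x in M. f x * g x = 0"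
    proof
      assume "X = 0"
      then have "AE x in M. f x powr a = 0"
        unfolding X_def using f by (subst (asm) integral_nonneg_eq_0_iff_AE) auto
      then show ?thesis by eventually_elim simp
    next
      assume "Y = 0"
      then have "AE x in M. g x powr b = 0"
        unfolding Y_def using g by (subst (asm) integral_nonneg_eq_0_iff_AE) auto
      then show ?thesis by eventually_elim simp
    qed
    then have "(LINT x|M. f x * g x) = 0" by (rule integral_eq_zero_AE)
    then show ?thesis by simp
  next
    case False
    with XY have XY: "X > 0" "Y > 0" by auto
    define c d where "c = X powr (1 / a)" and "d = Y powr (1 / b)"
    have cd: "c > 0" "d > 0" "c powr a = X" "d powr b = Y" using XY ab by (auto simp: c_def d_def powr_powr)
    have "(f x / c) * (g x / d) \<le> f x powr a / (a * X) + g x powr b / (b * Y)" for x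
      using Youngs_inequality[OF ab, of "f x / c" "g x / d"] nn[of x] cd by (simp add: powr_divide mult.commute)
    then have "(LINT x|M. (f x / c) * (g x / d)) \<le> (LINT x|M. f x powr a / (a * X) + g x powr b / (b * Y))"
      using f g i by (intro integral_mono) auto
    also have "\<dots> = X / (a * X) + Y / (b * Y)" using f g by (simp add: X_def Y_def)
    also have "\<dots> = 1" using XY ab by simp
    finally show ?thesis using cd by (simp add: c_def[symmetric] d_def[symmetric] field_simps)
  qed
  with i show ?thesis by (simp add: X_def Y_def)
qed

lemma indicator_ball_integrable:
  assumes "integrable lborel (f :: real^3 \<Rightarrow> real)"
  shows "integrable lborel (\<lambda>x. indicator (ball 0 R) x * f x)"
  by (rule Bochner_Integration.integrable_bound[OF assms])
    (use assms in \<open>auto simp: indicator_def\<close>)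

lemma potential_bound_unscaled:
  fixes s \<kappa> :: real and P :: "real^3 \<Rightarrow> real"
  assumes s: "0 < s" "s < 3 / 2" and \<kappa>: "\<kappa> \<ge> 3 / (2 * s)"
    and Pm[measurable]: "P \<in> borel_measurable borel" and P0: "\<And>x. 0 \<le> P x"
    and Pi: "integrable lborel (\<lambda>x. P x powr \<kappa>)" and e: "e > 0"
  obtains K R where "K \<ge> 0" "R > 0" "\<And>f. f \<in> borel_measurable borel \<Longrightarrow> integrable lborel (\<lambda>x. (f x)\<^sup>2) \<Longrightarrow>
      integrable lborel (\<lambda>x. \<bar>f x\<bar> powr crit_exp s) \<Longrightarrow>
      integrable lborel (\<lambda>x. P x * (f x)\<^sup>2) \<and>
      (LINT x|lborel. P x * (f x)\<^sup>2) \<le> e * ((LINT x|lborel. (f x)\<^sup>2) + (LINT x|lborel. \<bar>f x\<bar> powr crit_exp s) powr (2 / crit_exp s))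
        + K * (LINT x|lborel. indicator (ball 0 R) x * (f x)\<^sup>2)"
proof -
  define k where "k = 3 / (2 * s)"
  define q where "q = crit_exp s"
  have k: "k > 1" "k \<le> \<kappa>" using s \<kappa> by (auto simp: k_def field_simps)
  have q: "q > 2" using s by (simp add: q_def crit_exp_def field_simps)
  have kq: "1 / k + 1 / (q / 2) = 1" using s by (simp add: k_def q_def crit_exp_def field_simps)
  define T where "T n x = (if e < P x \<and> (real n < P x \<or> real n \<le> norm x) then P x else 0)" for n :: nat and x :: "real^3"
  have Tm[measurable]: "T n \<in> borel_measurable borel" for n unfolding T_def[abs_def] by measurable
  have T0: "T n x \<ge> 0" for n x using P0 by (simp add: T_def)
  have Tk: "T n x powr k \<le> e powr (k - \<kappa>) * P x powr \<kappa>" for n x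
  proof (cases "e < P x")
    case True
    have "P x powr k = P x powr (k - \<kappa>) * P x powr \<kappa>" by (simp flip: powr_add)
    also have "\<dots> \<le> e powr (k - \<kappa>) * P x powr \<kappa>"
      using True e k by (intro mult_right_mono powr_mono2') auto
    finally show ?thesis by (simp add: T_def)
  qed (simp add: T_def)
  have di: "integrable lborel (\<lambda>x. e powr (k - \<kappa>) * P x powr \<kappa>)" by (intro integrable_mult_right Pi)
  have Ti: "integrable lborel (\<lambda>x. T n x powr k)" for n
    by (rule Bochner_Integration.integrable_bound[OF di]) (use Tk in auto)
  have "(\<lambda>n. LINT x|lborel. T n x powr k) \<longlonglongrightarrow> (LINT x|(lborel::(real^3) measure). 0)"
  proof (rule integral_dominated_convergence[OF _ _ di])
    show "AE x in lborel. (\<lambda>n. T n x powr k) \<longlonglongrightarrow> 0"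
    proof (rule AE_I2)
      fix x
      obtain N where N: "real N > max (P x) (norm x)" using reals_Archimedean2 by blast
      then have "T n x powr k = 0" if "n \<ge> N" for n
        using that by (auto simp: T_def)
      then show "(\<lambda>n. T n x powr k) \<longlonglongrightarrow> 0"
        by (intro tendsto_eventually) (auto simp: eventually_sequentially)
    qed
    show "AE x in lborel. norm (T n x powr k) \<le> e powr (k - \<kappa>) * P x powr \<kappa>" for n using Tk by simp
  qed auto
  then have "(\<lambda>n. LINT x|lborel. T n x powr k) \<longlonglongrightarrow> 0" by simp
  from order_tendstoD(2)[OF this, of "e powr k"] e obtain n where n: "(LINT x|lborel. T n x powr k) < e powr k"
    by (auto simp: eventually_sequentially)
  have Tn: "(LINT x|lborel. T n x powr k) powr (1 / k) \<le> e"
  proof -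
    have "(LINT x|lborel. T n x powr k) powr (1 / k) \<le> (e powr k) powr (1 / k)"
      using n k by (intro powr_mono2) auto
    then show ?thesis using e k by (simp add: powr_powr)
  qed
  show thesis
  proof (rule that[of "real n" "real n + 1"])
    fix f :: "real^3 \<Rightarrow> real"
    assume fm[measurable]: "f \<in> borel_measurable borel" and f2: "integrable lborel (\<lambda>x. (f x)\<^sup>2)"
      and fq: "integrable lborel (\<lambda>x. \<bar>f x\<bar> powr crit_exp s)"
    have fe: "((f x)\<^sup>2) powr (q / 2) = \<bar>f x\<bar> powr q" for x
    proof -
      have e: "(f x)\<^sup>2 = \<bar>f x\<bar> powr 2" using norm_powr_2[of "f x"] by simp
      show ?thesis unfolding e powr_powr by simp
    qed
    have H: "integrable lborel (\<lambda>x. T n x * (f x)\<^sup>2) \<and>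
      (LINT x|lborel. T n x * (f x)\<^sup>2) \<le> (LINT x|lborel. T n x powr k) powr (1 / k) * (LINT x|lborel. ((f x)\<^sup>2) powr (q / 2)) powr (1 / (q / 2))"
      by (rule Hoelder_integral) (use k q kq Ti T0 fq in \<open>auto simp: fe q_def[symmetric]\<close>)
    define N where "N = (LINT x|lborel. \<bar>f x\<bar> powr q) powr (2 / q)"
    have "N \<ge> 0" by (simp add: N_def)
    have H2: "(LINT x|lborel. T n x * (f x)\<^sup>2) \<le> e * N"
    proof -
      have "(LINT x|lborel. T n x * (f x)\<^sup>2) \<le> (LINT x|lborel. T n x powr k) powr (1 / k) * N"
        using H by (simp add: fe N_def)
      also have "\<dots> \<le> e * N" by (intro mult_right_mono Tn \<open>N \<ge> 0\<close>)
      finally show ?thesis .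
    qed
    have bi: "integrable lborel (\<lambda>x. indicator (ball 0 (real n + 1)) x * (f x)\<^sup>2)" by (rule indicator_ball_integrable[OF f2])
    have pw: "P x * (f x)\<^sup>2 \<le> e * (f x)\<^sup>2 + real n * (indicator (ball 0 (real n + 1)) x * (f x)\<^sup>2) + T n x * (f x)\<^sup>2" for x
    proof -
      have "P x \<le> e + real n * indicator (ball 0 (real n + 1)) x + T n x"
        using e P0[of x] by (auto simp: T_def indicator_def)
      from mult_right_mono[OF this, of "(f x)\<^sup>2"] show ?thesis by (simp add: algebra_simps)
    qed
    have ri: "integrable lborel (\<lambda>x. e * (f x)\<^sup>2 + real n * (indicator (ball 0 (real n + 1)) x * (f x)\<^sup>2) + T n x * (f x)\<^sup>2)"
      using f2 bi H by (intro Bochner_Integration.integrable_add integrable_mult_right) auto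
    have i: "integrable lborel (\<lambda>x. P x * (f x)\<^sup>2)"
    proof (rule Bochner_Integration.integrable_bound[OF ri])
      show "AE x in lborel. norm (P x * (f x)\<^sup>2) \<le> norm (e * (f x)\<^sup>2 + real n * (indicator (ball 0 (real n + 1)) x * (f x)\<^sup>2) + T n x * (f x)\<^sup>2)"
        using pw P0 by (intro AE_I2) (auto simp: abs_mult intro: order_trans[OF _ abs_ge_self])
    qed simp
    have "(LINT x|lborel. P x * (f x)\<^sup>2) \<le> (LINT x|lborel. e * (f x)\<^sup>2 + real n * (indicator (ball 0 (real n + 1)) x * (f x)\<^sup>2) + T n x * (f x)\<^sup>2)"
      by (rule integral_mono[OF i ri pw])
    also have "\<dots> = e * (LINT x|lborel. (f x)\<^sup>2) + real n * (LINT x|lborel. indicator (ball 0 (real n + 1)) x * (f x)\<^sup>2) + (LINT x|lborel. T n x * (f x)\<^sup>2)"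
      using f2 bi H by simp
    also have "\<dots> \<le> e * (LINT x|lborel. (f x)\<^sup>2) + real n * (LINT x|lborel. indicator (ball 0 (real n + 1)) x * (f x)\<^sup>2) + e * N"
      using H2 by simp
    finally show "integrable lborel (\<lambda>x. P x * (f x)\<^sup>2) \<and>
      (LINT x|lborel. P x * (f x)\<^sup>2) \<le> e * ((LINT x|lborel. (f x)\<^sup>2) + (LINT x|lborel. \<bar>f x\<bar> powr crit_exp s) powr (2 / crit_exp s))
        + real n * (LINT x|lborel. indicator (ball 0 (real n + 1)) x * (f x)\<^sup>2)"
      using i by (simp add: N_def q_def algebra_simps)
  qed auto
qed

lemma potential_bound:
  fixes s \<kappa> :: real and P :: "real^3 \<Rightarrow> real"
  assumes s: "0 < s" "s < 3 / 2" and \<kappa>: "\<kappa> \<ge> 3 / (2 * s)"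
    and Pm[measurable]: "P \<in> borel_measurable borel" and P0: "\<And>x. 0 \<le> P x"
    and Pi: "integrable lborel (\<lambda>x. P x powr \<kappa>)" and e: "e > 0"
  obtains K R where "K \<ge> 0" "R > 0" "\<And>f l. f \<in> borel_measurable borel \<Longrightarrow> integrable lborel (\<lambda>x. (f x)\<^sup>2) \<Longrightarrow>
      integrable lborel (\<lambda>x. \<bar>f x\<bar> powr crit_exp s) \<Longrightarrow> l \<ge> 1 \<Longrightarrow>
      integrable lborel (\<lambda>x. P (l *\<^sub>R x) * (f x)\<^sup>2) \<and>
      (LINT x|lborel. P (l *\<^sub>R x) * (f x)\<^sup>2) \<le> e * ((LINT x|lborel. (f x)\<^sup>2) + (LINT x|lborel. \<bar>f x\<bar> powr crit_exp s) powr (2 / crit_exp s))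
        + K * (LINT x|lborel. indicator (ball 0 R) x * (f x)\<^sup>2)"
proof -
  define q where "q = crit_exp s"
  have q: "q > 2" using s by (simp add: q_def crit_exp_def field_simps)
  obtain K R where K: "K \<ge> 0" "R > 0" and bound: "\<And>f. f \<in> borel_measurable borel \<Longrightarrow> integrable lborel (\<lambda>x. (f x)\<^sup>2) \<Longrightarrow>
      integrable lborel (\<lambda>x. \<bar>f x\<bar> powr crit_exp s) \<Longrightarrow>
      integrable lborel (\<lambda>x. P x * (f x)\<^sup>2) \<and>
      (LINT x|lborel. P x * (f x)\<^sup>2) \<le> e * ((LINT x|lborel. (f x)\<^sup>2) + (LINT x|lborel. \<bar>f x\<bar> powr crit_exp s) powr (2 / crit_exp s))
        + K * (LINT x|lborel. indicator (ball 0 R) x * (f x)\<^sup>2)"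
    using potential_bound_unscaled[OF assms] by blast
  show thesis
  proof (rule that[OF K])
    fix f :: "real^3 \<Rightarrow> real" and l :: real
    assume fm[measurable]: "f \<in> borel_measurable borel" and f2: "integrable lborel (\<lambda>x. (f x)\<^sup>2)"
      and fq: "integrable lborel (\<lambda>x. \<bar>f x\<bar> powr crit_exp s)" and l: "l \<ge> 1"
    define h where "h x = f ((1 / l) *\<^sub>R x)" for x
    have hm[measurable]: "h \<in> borel_measurable borel" unfolding h_def[abs_def] by (rule measurable_compose[OF _ fm]) simp
    have hl: "h (l *\<^sub>R x) = f x" for x using l by (simp add: h_def)
    have l3: "l ^ 3 \<ge> 1" using l by (rule one_le_power)
    have h2: "integrable lborel (\<lambda>x. (h x)\<^sup>2)" "(LINT x|lborel. (h x)\<^sup>2) = l ^ 3 * (LINT x|lborel. (f x)\<^sup>2)"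
      unfolding h_def using integrable_lborel_dilate_iff[of "\<lambda>x. (f x)\<^sup>2" "1 / l"] integral_lborel_dilate[of "\<lambda>x. (f x)\<^sup>2" "1 / l"] f2 l
      by (simp_all add: power_one_over)
    have hq: "integrable lborel (\<lambda>x. \<bar>h x\<bar> powr crit_exp s)" "(LINT x|lborel. \<bar>h x\<bar> powr crit_exp s) = l ^ 3 * (LINT x|lborel. \<bar>f x\<bar> powr crit_exp s)"
      unfolding h_def using integrable_lborel_dilate_iff[of "\<lambda>x. \<bar>f x\<bar> powr crit_exp s" "1 / l"] integral_lborel_dilate[of "\<lambda>x. \<bar>f x\<bar> powr crit_exp s" "1 / l"] fq l
      by (simp_all add: power_one_over)
    have hb: "(LINT x|lborel. indicator (ball 0 R) x * (h x)\<^sup>2) \<le> l ^ 3 * (LINT x|lborel. indicator (ball 0 R) x * (f x)\<^sup>2)"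
    proof -
      have "(LINT x|lborel. indicator (ball 0 R) (l *\<^sub>R x) * (h (l *\<^sub>R x))\<^sup>2) = (LINT x|lborel. indicator (ball 0 R) x * (h x)\<^sup>2) /\<^sub>R l ^ 3"
        using l by (intro integral_lborel_dilate[of "\<lambda>x. indicator (ball 0 R) x * (h x)\<^sup>2"]) auto
      then have "(LINT x|lborel. indicator (ball 0 R) x * (h x)\<^sup>2) = l ^ 3 * (LINT x|lborel. indicator (ball 0 R) (l *\<^sub>R x) * (f x)\<^sup>2)"
        using l by (simp add: hl)
      also have "\<dots> \<le> l ^ 3 * (LINT x|lborel. indicator (ball 0 R) x * (f x)\<^sup>2)"
      proof (intro mult_left_mono integral_mono)
        have "(\<lambda>x. indicator (ball 0 R) (l *\<^sub>R x)) \<in> (borel_measurable borel :: (real^3 \<Rightarrow> real) set)"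
          by (rule measurable_compose[of "\<lambda>x. l *\<^sub>R x" borel borel]) simp_all
        then show "integrable lborel (\<lambda>x. indicator (ball 0 R) (l *\<^sub>R x) * (f x)\<^sup>2)"
          by (intro Bochner_Integration.integrable_bound[OF f2]) (auto simp: indicator_def)
        show "integrable lborel (\<lambda>x. indicator (ball 0 R) x * (f x)\<^sup>2)" by (rule indicator_ball_integrable[OF f2])
        fix x :: "real^3"
        have "norm x \<le> \<bar>l\<bar> * norm x" using l mult_right_mono[of 1 "\<bar>l\<bar>" "norm x"] by simp
        then show "indicator (ball 0 R) (l *\<^sub>R x) * (f x)\<^sup>2 \<le> indicator (ball 0 R) x * (f x)\<^sup>2"
          by (auto simp: indicator_def)
      qed (use l in simp)
      finally show ?thesis .
    qed
    have P: "integrable lborel (\<lambda>x. P x * (h x)\<^sup>2)"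
      "(LINT x|lborel. P x * (h x)\<^sup>2) \<le> e * ((LINT x|lborel. (h x)\<^sup>2) + (LINT x|lborel. \<bar>h x\<bar> powr crit_exp s) powr (2 / crit_exp s))
        + K * (LINT x|lborel. indicator (ball 0 R) x * (h x)\<^sup>2)"
      using bound[OF hm h2(1) hq(1)] by auto
    have i: "integrable lborel (\<lambda>x. P (l *\<^sub>R x) * (f x)\<^sup>2)"
      using integrable_lborel_dilate_iff[of "\<lambda>x. P x * (h x)\<^sup>2" l] P(1) l by (simp add: hl)
    define N where "N = (LINT x|lborel. \<bar>f x\<bar> powr crit_exp s) powr (2 / crit_exp s)"
    have "(LINT x|lborel. \<bar>h x\<bar> powr crit_exp s) powr (2 / crit_exp s) = (l ^ 3) powr (2 / q) * N"
      unfolding hq(2) N_def q_def using l by (subst powr_mult) auto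
    also have "\<dots> \<le> l ^ 3 * N"
    proof -
      have "(l ^ 3) powr (2 / q) \<le> (l ^ 3) powr 1" using l3 q by (intro powr_mono) auto
      then show ?thesis using l by (intro mult_right_mono) (auto simp: N_def)
    qed
    finally have N: "(LINT x|lborel. \<bar>h x\<bar> powr crit_exp s) powr (2 / crit_exp s) \<le> l ^ 3 * N" .
    have "(LINT x|lborel. P (l *\<^sub>R x) * (h (l *\<^sub>R x))\<^sup>2) = (LINT x|lborel. P x * (h x)\<^sup>2) /\<^sub>R l ^ 3"
      using l by (intro integral_lborel_dilate[of "\<lambda>x. P x * (h x)\<^sup>2"]) auto
    then have "l ^ 3 * (LINT x|lborel. P (l *\<^sub>R x) * (f x)\<^sup>2) = (LINT x|lborel. P x * (h x)\<^sup>2)" using l by (simp add: hl)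
    also have "\<dots> \<le> e * (l ^ 3 * (LINT x|lborel. (f x)\<^sup>2) + l ^ 3 * N) + K * (l ^ 3 * (LINT x|lborel. indicator (ball 0 R) x * (f x)\<^sup>2))"
    proof (rule order_trans[OF P(2)], rule add_mono)
      show "e * ((LINT x|lborel. (h x)\<^sup>2) + (LINT x|lborel. \<bar>h x\<bar> powr crit_exp s) powr (2 / crit_exp s)) \<le> e * (l ^ 3 * (LINT x|lborel. (f x)\<^sup>2) + l ^ 3 * N)"
        unfolding h2(2) using N e by (intro mult_left_mono) auto
      show "K * (LINT x|lborel. indicator (ball 0 R) x * (h x)\<^sup>2) \<le> K * (l ^ 3 * (LINT x|lborel. indicator (ball 0 R) x * (f x)\<^sup>2))"
        by (rule mult_left_mono[OF hb K(1)])
    qed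
    also have "\<dots> = l ^ 3 * (e * ((LINT x|lborel. (f x)\<^sup>2) + N) + K * (LINT x|lborel. indicator (ball 0 R) x * (f x)\<^sup>2))"
      by (simp add: algebra_simps)
    finally have "(LINT x|lborel. P (l *\<^sub>R x) * (f x)\<^sup>2) \<le> e * ((LINT x|lborel. (f x)\<^sup>2) + N) + K * (LINT x|lborel. indicator (ball 0 R) x * (f x)\<^sup>2)"
      using l by (simp only: mult_le_cancel_left_pos zero_less_power order_less_le_trans[OF zero_less_one])
    then show "integrable lborel (\<lambda>x. P (l *\<^sub>R x) * (f x)\<^sup>2) \<and>
      (LINT x|lborel. P (l *\<^sub>R x) * (f x)\<^sup>2) \<le> e * ((LINT x|lborel. (f x)\<^sup>2) + (LINT x|lborel. \<bar>f x\<bar> powr crit_exp s) powr (2 / crit_exp s))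
        + K * (LINT x|lborel. indicator (ball 0 R) x * (f x)\<^sup>2)"
      using i by (simp add: N_def)
  qed
qed

section \<open>Pointwise inequalities for the power nonlinearity\<close>

lemma MVT_interior:
  fixes f f' :: "real \<Rightarrow> real"
  assumes "a < b" "continuous_on {a..b} f" "\<And>z. a < z \<Longrightarrow> z < b \<Longrightarrow> (f has_real_derivative f' z) (at z)"
  shows "\<exists>z>a. z < b \<and> f b - f a = (b - a) * f' z"
proof -
  have "f differentiable (at z)" if "a < z" "z < b" for z
    using assms(3)[OF that] real_differentiable_def by blast
  from MVT[OF assms(1,2) this] obtain l z where z: "a < z" "z < b" "DERIV f z :> l" "f b - f a = (b - a) * l" by blast
  then have "l = f' z" using assms(3) DERIV_unique by blast
  with z show ?thesis by blast
qed

lemma powr_diff_le: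
  fixes a b m :: real
  assumes "0 \<le> a" "a \<le> b" "1 \<le> m"
  shows "b powr m - a powr m \<le> m * b powr (m - 1) * (b - a)"
proof (cases "a = b")
  case False
  with assms have ab: "a < b" by simp
  have "\<exists>z>a. z < b \<and> b powr m - a powr m = (b - a) * (m * z powr (m - 1))"
  proof (rule MVT_interior)
    show "a < b" by (rule ab)
    show "continuous_on {a..b} (\<lambda>t. t powr m)" using assms by (intro continuous_on_powr' continuous_intros) auto
    fix z assume "a < z" "z < b"
    then show "((\<lambda>t. t powr m) has_real_derivative m * z powr (m - 1)) (at z)"
      using assms by (intro has_real_derivative_powr) auto
  qed
  then obtain z where z: "a < z" "z < b" "b powr m - a powr m = (b - a) * (m * z powr (m - 1))" by blast
  have "z powr (m - 1) \<le> b powr (m - 1)" using z assms by (intro powr_mono2) auto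
  then have "(b - a) * (m * z powr (m - 1)) \<le> (b - a) * (m * b powr (m - 1))"
    using assms by (intro mult_left_mono) auto
  then show ?thesis using z(3) by (simp add: mult_ac)
qed simp

lemma power_nonlinearity_diff_le:
  fixes a b r :: real
  assumes r: "r \<ge> 1"
  shows "(\<bar>b\<bar> powr r * b - \<bar>a\<bar> powr r * a) * (b - a) \<le> (r + 1) * ((\<bar>b\<bar> powr r + \<bar>a\<bar> powr r) * (b - a)\<^sup>2)"
proof -
  have P: "t \<ge> 0 \<Longrightarrow> t powr (r + 1) = t powr r * t" for t :: real
    using powr_add[of t r 1] by simp
  have nonneg: "(\<bar>b\<bar> powr r * b - \<bar>a\<bar> powr r * a) * (b - a) \<le> (r + 1) * ((\<bar>b\<bar> powr r + \<bar>a\<bar> powr r) * (b - a)\<^sup>2)"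
    if ab: "0 \<le> a" "a \<le> b" for a b :: real
  proof -
    have "b powr (r + 1) - a powr (r + 1) \<le> (r + 1) * b powr r * (b - a)"
      using powr_diff_le[of a b "r + 1"] ab r by simp
    then have "(b powr r * b - a powr r * a) * (b - a) \<le> (r + 1) * b powr r * (b - a) * (b - a)"
      using ab P by (intro mult_right_mono) auto
    also have "\<dots> = (r + 1) * (b powr r * (b - a)\<^sup>2)" by (simp add: power2_eq_square)
    also have "\<dots> \<le> (r + 1) * ((b powr r + a powr r) * (b - a)\<^sup>2)"
      using r by (intro mult_left_mono mult_right_mono) auto
    finally show ?thesis using ab by simp
  qed
  have sym: "(\<bar>b\<bar> powr r * b - \<bar>a\<bar> powr r * a) * (b - a) \<le> (r + 1) * ((\<bar>b\<bar> powr r + \<bar>a\<bar> powr r) * (b - a)\<^sup>2)"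
    if ab: "0 \<le> a" "0 \<le> b" for a b :: real
  proof (cases "a \<le> b")
    case False
    then have "(\<bar>a\<bar> powr r * a - \<bar>b\<bar> powr r * b) * (a - b) \<le> (r + 1) * ((\<bar>a\<bar> powr r + \<bar>b\<bar> powr r) * (a - b)\<^sup>2)"
      using ab by (intro nonneg) auto
    then show ?thesis by (simp add: power2_commute[of a b] add.commute algebra_simps)
  qed (use ab nonneg in auto)
  have opp: "(\<bar>b\<bar> powr r * b - \<bar>a\<bar> powr r * a) * (b - a) \<le> (r + 1) * ((\<bar>b\<bar> powr r + \<bar>a\<bar> powr r) * (b - a)\<^sup>2)"
    if ab: "a \<le> 0" "0 \<le> b" for a b :: real
  proof -
    have "(\<bar>b\<bar> powr r * b - \<bar>a\<bar> powr r * a) \<le> \<bar>b\<bar> powr r * (b - a) + \<bar>a\<bar> powr r * (b - a)"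
    proof -
      have "\<bar>b\<bar> powr r * b \<le> \<bar>b\<bar> powr r * (b - a)" using ab by (intro mult_left_mono) auto
      moreover have "\<bar>a\<bar> powr r * (- a) \<le> \<bar>a\<bar> powr r * (b - a)" using ab by (intro mult_left_mono) auto
      ultimately show ?thesis by simp
    qed
    then have "(\<bar>b\<bar> powr r * b - \<bar>a\<bar> powr r * a) * (b - a) \<le> (\<bar>b\<bar> powr r * (b - a) + \<bar>a\<bar> powr r * (b - a)) * (b - a)"
      using ab by (intro mult_right_mono) auto
    also have "\<dots> = 1 * ((\<bar>b\<bar> powr r + \<bar>a\<bar> powr r) * (b - a)\<^sup>2)" by (simp add: power2_eq_square algebra_simps)
    also have "\<dots> \<le> (r + 1) * ((\<bar>b\<bar> powr r + \<bar>a\<bar> powr r) * (b - a)\<^sup>2)" using r by (intro mult_right_mono) auto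
    finally show ?thesis .
  qed
  have reflect: "\<bar>- c\<bar> = \<bar>c\<bar>" "(X * (- b) - Y * (- a)) * (- b - - a) = (X * b - Y * a) * (b - a)" "(- b - - a)\<^sup>2 = (b - a)\<^sup>2" for c X Y :: real
    by (simp_all add: power2_commute algebra_simps)
  consider "0 \<le> a \<and> 0 \<le> b" | "a \<le> 0 \<and> b \<le> 0" | "a \<le> 0 \<and> 0 \<le> b" | "0 \<le> a \<and> b \<le> 0" by linarith
  then show ?thesis
  proof cases
    case 1 then show ?thesis by (intro sym) auto
  next
    case 2
    then have "(\<bar>- b\<bar> powr r * (- b) - \<bar>- a\<bar> powr r * (- a)) * (- b - - a) \<le> (r + 1) * ((\<bar>- b\<bar> powr r + \<bar>- a\<bar> powr r) * (- b - - a)\<^sup>2)"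
      by (intro sym) auto
    then show ?thesis unfolding reflect .
  next
    case 3 then show ?thesis by (intro opp) auto
  next
    case 4
    then have "(\<bar>- b\<bar> powr r * (- b) - \<bar>- a\<bar> powr r * (- a)) * (- b - - a) \<le> (r + 1) * ((\<bar>- b\<bar> powr r + \<bar>- a\<bar> powr r) * (- b - - a)\<^sup>2)"
      by (intro opp) auto
    then show ?thesis unfolding reflect .
  qed
qed

text \<open>The left-hand side without the correction term is antisymmetric in \<open>a\<close> and \<open>b\<close>; subtracting the
  multiple of \<open>\<bar>b\<bar>\<close> to the power \<open>r + 2\<close> minus that of \<open>\<bar>a\<bar>\<close> with the same derivative at \<open>a = b\<close> makes
  it quadratic in \<open>b - a\<close>.\<close>

lemma power_nonlinearity_antisym_le:
  fixes a b r :: real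
  assumes r: "r \<ge> 1"
  shows "\<bar>\<bar>b\<bar> powr r * b * a - \<bar>a\<bar> powr r * a * b - r / (r + 2) * (\<bar>b\<bar> powr (r + 2) - \<bar>a\<bar> powr (r + 2))\<bar>
    \<le> (r + 2) * ((\<bar>b\<bar> powr r + \<bar>a\<bar> powr r) * (b - a)\<^sup>2)"
    (is "\<bar>?D b a\<bar> \<le> ?B b a")
proof -
  have P: "t \<ge> 0 \<Longrightarrow> t powr (r + 1) = t powr r * t" for t :: real
    using powr_add[of t r 1] by simp
  have P2: "t powr (r + 2) = t powr r * t\<^sup>2" if "t \<ge> 0" for t :: real
    using that powr_add[of t r 2] by simp
  have asym: "?D a b = - ?D b a" "?B a b = ?B b a" for a b :: real
    by (simp_all add: algebra_simps power2_commute[of a b] minus_divide_left[symmetric]) 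
  have nonneg: "\<bar>?D b a\<bar> \<le> ?B b a" if ab: "0 \<le> a" "a \<le> b" for a b :: real
  proof (cases "a = b")
    case False
    with ab have l: "a < b" by simp
    define F where "F t = t powr (r + 1) * a - a powr (r + 1) * t - r / (r + 2) * (t powr (r + 2) - a powr (r + 2))" for t
    have "\<exists>z>a. z < b \<and> F b - F a = (b - a) * ((r + 1) * z powr r * a - a powr (r + 1) - r * z powr (r + 1))"
    proof (rule MVT_interior[OF l])
      show "continuous_on {a..b} F" unfolding F_def[abs_def]
        using ab r by (intro continuous_intros continuous_on_powr') auto
      fix z assume z: "a < z" "z < b"
      have "(F has_real_derivative ((r + 1) * z powr (r + 1 - 1) * a - a powr (r + 1) * 1 - r / (r + 2) * ((r + 2) * z powr (r + 2 - 1) - 0))) (at z)"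
        unfolding F_def[abs_def]
        by (intro DERIV_diff DERIV_cmult DERIV_cmult_right has_real_derivative_powr DERIV_ident DERIV_const) (use z ab in auto)
      moreover have "r / (r + 2) * ((r + 2) * z powr (r + 2 - 1) - 0) = r * z powr (r + 1)"
      proof -
        have "r + 2 - 1 = r + 1" by simp
        then show ?thesis using r by (simp add: add.commute)
      qed
      ultimately show "(F has_real_derivative (r + 1) * z powr r * a - a powr (r + 1) - r * z powr (r + 1)) (at z)" by simp
    qed
    then obtain z where z: "a < z" "z < b"
      and Fz: "F b - F a = (b - a) * ((r + 1) * z powr r * a - a powr (r + 1) - r * z powr (r + 1))" by blast
    have e: "(r + 1) * z powr r * a - a powr (r + 1) - r * z powr (r + 1) = a * (z powr r - a powr r) - r * z powr r * (z - a)"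
      using P[of z] P[of a] z ab by (simp add: algebra_simps)
    have bb: "r * z powr r * (z - a) \<le> r * b powr r * (b - a)"
      using z ab r by (intro mult_mono mult_left_mono powr_mono2) auto
    have up: "a * (z powr r - a powr r) \<le> r * b powr r * (b - a)"
    proof -
      have "a * (z powr r - a powr r) \<le> z * (r * z powr (r - 1) * (z - a))"
        using powr_diff_le[of a z r] z ab r by (intro mult_mono) (auto intro: powr_mono2)
      also have "\<dots> = r * z powr r * (z - a)"
        using z ab powr_add[of z "r - 1" 1] by simp
      finally show ?thesis using bb by simp
    qed
    have lo: "0 \<le> a * (z powr r - a powr r)" "0 \<le> r * z powr r * (z - a)"
      using z ab r by (auto intro!: mult_nonneg_nonneg powr_mono2)
    have "\<bar>a * (z powr r - a powr r) - r * z powr r * (z - a)\<bar> \<le> r * b powr r * (b - a)"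
      using up bb lo by linarith
    then have "\<bar>F b - F a\<bar> \<le> (b - a) * (r * b powr r * (b - a))"
      unfolding Fz e abs_mult using l by (intro mult_mono) auto
    also have "\<dots> = r * (b powr r * (b - a)\<^sup>2)" by (simp add: power2_eq_square)
    also have "\<dots> \<le> (r + 2) * ((b powr r + a powr r) * (b - a)\<^sup>2)"
      using r by (intro mult_mono mult_right_mono) auto
    finally have "\<bar>F b - F a\<bar> \<le> (r + 2) * ((b powr r + a powr r) * (b - a)\<^sup>2)" .
    moreover have "F b - F a = ?D b a" using ab P by (simp add: F_def algebra_simps)
    ultimately show ?thesis using ab by simp
  qed simp
  have sym: "\<bar>?D b a\<bar> \<le> ?B b a" if ab: "0 \<le> a" "0 \<le> b" for a b :: real
  proof (cases "a \<le> b")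
    case False
    then have "\<bar>?D a b\<bar> \<le> ?B a b" using ab by (intro nonneg) auto
    then show ?thesis unfolding asym(1)[of a b] asym(2)[of a b] abs_minus_cancel .
  qed (use ab nonneg in auto)
  have opp: "\<bar>?D b a\<bar> \<le> ?B b a" if ab: "a \<le> 0" "0 \<le> b" for a b :: real
  proof -
    define A where "A = - a"
    have A: "A \<ge> 0" "a = - A" using ab by (auto simp: A_def)
    define X Y where "X = b powr r" and "Y = A powr r"
    have XY: "X \<ge> 0" "Y \<ge> 0" by (auto simp: X_def Y_def)
    have "\<bar>?D b a\<bar> = \<bar>Y * A * b - X * b * A - r / (r + 2) * (X * b\<^sup>2 - Y * A\<^sup>2)\<bar>"
      using ab A P2 by (simp add: X_def Y_def)
    also have "\<dots> \<le> \<bar>Y * A * b\<bar> + \<bar>X * b * A\<bar> + r / (r + 2) * (\<bar>X * b\<^sup>2\<bar> + \<bar>Y * A\<^sup>2\<bar>)"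
    proof -
      have "\<bar>r / (r + 2) * (X * b\<^sup>2 - Y * A\<^sup>2)\<bar> \<le> r / (r + 2) * (\<bar>X * b\<^sup>2\<bar> + \<bar>Y * A\<^sup>2\<bar>)"
        unfolding abs_mult[of "r / (r + 2)"] using r by (intro mult_mono abs_triangle_ineq4) auto
      moreover have "\<bar>p - q - t\<bar> \<le> \<bar>p\<bar> + \<bar>q\<bar> + T" if "\<bar>t\<bar> \<le> T" for p q t T :: real
        using that by linarith
      ultimately show ?thesis by blast
    qed
    also have "\<dots> \<le> \<bar>Y * A * b\<bar> + \<bar>X * b * A\<bar> + 1 * (\<bar>X * b\<^sup>2\<bar> + \<bar>Y * A\<^sup>2\<bar>)"
      using r by (intro add_left_mono mult_right_mono) auto
    also have "\<dots> = (X + Y) * (A * b) + (X * b\<^sup>2 + Y * A\<^sup>2)"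
      using XY A ab by (simp add: abs_mult algebra_simps)
    also have "\<dots> \<le> (X + Y) * (b + A)\<^sup>2 + (X + Y) * (b + A)\<^sup>2"
    proof (intro add_mono mult_left_mono)
      have "A * b \<ge> 0" using A ab by simp
      moreover have "(b + A)\<^sup>2 = A * b + (b\<^sup>2 + A\<^sup>2 + A * b)" by (simp add: power2_eq_square algebra_simps)
      ultimately show "A * b \<le> (b + A)\<^sup>2" by simp
      have "b\<^sup>2 \<le> (b + A)\<^sup>2" "A\<^sup>2 \<le> (b + A)\<^sup>2" using A ab by (auto intro!: power_mono)
      then have "X * b\<^sup>2 + Y * A\<^sup>2 \<le> X * (b + A)\<^sup>2 + Y * (b + A)\<^sup>2" using XY by (intro add_mono mult_left_mono)
      then show "X * b\<^sup>2 + Y * A\<^sup>2 \<le> (X + Y) * (b + A)\<^sup>2" by (simp add: distrib_right)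
    qed (use XY in auto)
    also have "\<dots> = 2 * ((X + Y) * (b + A)\<^sup>2)" by simp
    also have "\<dots> \<le> (r + 2) * ((X + Y) * (b + A)\<^sup>2)" using r XY by (intro mult_right_mono) auto
    also have "\<dots> = ?B b a" using ab A by (simp add: X_def Y_def)
    finally show ?thesis .
  qed
  have reflect: "\<bar>- c\<bar> = \<bar>c\<bar>" "X * (- b) * (- a) = X * b * a" "X * (- a) * (- b) = X * a * b" "(- b - - a)\<^sup>2 = (b - a)\<^sup>2" for c X :: real
    by (simp_all add: power2_commute)
  consider "0 \<le> a \<and> 0 \<le> b" | "a \<le> 0 \<and> b \<le> 0" | "a \<le> 0 \<and> 0 \<le> b" | "0 \<le> a \<and> b \<le> 0" by linarith
  then show ?thesis
  proof cases
    case 1 then show ?thesis by (intro sym) auto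
  next
    case 2
    then have "\<bar>?D (- b) (- a)\<bar> \<le> ?B (- b) (- a)" by (intro sym) auto
    then show ?thesis unfolding reflect .
  next
    case 3 then show ?thesis by (intro opp) auto
  next
    case 4
    then have "\<bar>?D (- b) (- a)\<bar> \<le> ?B (- b) (- a)" by (intro opp) auto
    then show ?thesis unfolding reflect .
  qed
qed

section \<open>The potential under dilation\<close>

lemma GDERIV_const_grad: "grad (\<lambda>_. c) x = 0"
proof -
  have 1: "GDERIV (\<lambda>_. c :: real) x :> 0" by (simp add: gderiv_def)
  show ?thesis unfolding grad_def
  proof (rule the_equality[where P="\<lambda>D. GDERIV (\<lambda>_. c) x :> D", OF 1])
    fix D assume "GDERIV (\<lambda>_. c) x :> D"
    then have "(\<lambda>h. h \<bullet> D) = (\<lambda>h. h \<bullet> 0)"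
      using 1 unfolding gderiv_def by (rule has_derivative_unique)
    then show "D = 0" by (metis inner_eq_zero_iff inner_zero_right)
  qed
qed

lemma potential_facts:
  fixes s :: real
  assumes s: "3 / 4 < s" "s < 1" and V: "(\<exists>c>0. V = (\<lambda>_. c)) \<or> (V1 s V \<and> V2 V)"
  shows "V1 s V" "continuous_on UNIV V" "\<exists>C. \<forall>x. \<bar>V x\<bar> \<le> C" "\<exists>c0>0. \<exists>R0>0. \<forall>x. R0 \<le> norm x \<longrightarrow> c0 \<le> V x"
proof -
  show V1: "V1 s V"
    using V
  proof
    assume "\<exists>c>0. V = (\<lambda>_. c)"
    then obtain c where c: "c > 0" "V = (\<lambda>_. c)" by auto
    have "C1 V" unfolding C1_def c(2) GDERIV_const_grad by (simp add: gderiv_def)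
    moreover have "(\<lambda>x. x \<bullet> grad V x) \<in> Linfinity" unfolding c(2) GDERIV_const_grad
      by (auto simp: Linfinity_def)
    ultimately show ?thesis using c s unfolding V1_def c(2) GDERIV_const_grad by auto
  qed simp
  have d: "GDERIV V x :> grad V x" for x using V1 by (simp add: V1_def C1_def)
  show cont: "continuous_on UNIV V"
  proof (intro continuous_at_imp_continuous_on ballI)
    fix x show "isCont V x"
      using d[of x] unfolding gderiv_def by (rule has_derivative_continuous)
  qed
  show lower: "\<exists>c0>0. \<exists>R0>0. \<forall>x. R0 \<le> norm x \<longrightarrow> c0 \<le> V x"
    using V
  proof
    assume "\<exists>c>0. V = (\<lambda>_. c)"
    then obtain c where "c > 0" "V = (\<lambda>_. c)" by blast
    then show ?thesis by (intro exI[of _ c] conjI exI[of _ 1]) auto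
  next
    assume "V1 s V \<and> V2 V"
    then obtain Vi where Vi: "Vi > 0" "Liminf at_infinity (\<lambda>y. ereal (V y)) = ereal Vi" by (auto simp: V2_def)
    have "ereal (Vi / 2) < Liminf at_infinity (\<lambda>y. ereal (V y))" unfolding Vi(2) using Vi(1) by simp
    then have "eventually (\<lambda>y. ereal (Vi / 2) < ereal (V y)) at_infinity" by (rule less_LiminfD)
    then obtain b where b: "\<And>x. b \<le> norm x \<Longrightarrow> Vi / 2 < V x" by (auto simp: eventually_at_infinity)
    show ?thesis
      by (rule exI[of _ "Vi / 2"], rule conjI, use Vi in simp, rule exI[of _ "max b 1"]) (use b in \<open>auto intro: less_imp_le\<close>)
  qed
  show "\<exists>C. \<forall>x. \<bar>V x\<bar> \<le> C"
    using V
  proof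
    assume "\<exists>c>0. V = (\<lambda>_. c)"
    then show ?thesis by auto
  next
    assume "V1 s V \<and> V2 V"
    then obtain Vi where Vi: "\<And>x. V x \<le> Vi" by (auto simp: V2_def)
    from lower obtain c0 R0 where R: "c0 > 0" "\<And>x. R0 \<le> norm x \<Longrightarrow> c0 \<le> V x" by auto
    have "compact (V ` cball 0 R0)"
      by (intro compact_continuous_image continuous_on_subset[OF cont]) auto
    then have "bounded (V ` cball 0 R0)" by (rule compact_imp_bounded)
    then obtain B where "\<forall>y\<in>V ` cball 0 R0. norm y \<le> B" unfolding bounded_iff ..
    then have B: "\<bar>V x\<bar> \<le> B" if "norm x \<le> R0" for x using that by simp
    have "\<bar>V x\<bar> \<le> max B \<bar>Vi\<bar>" for x
    proof (cases "norm x \<le> R0")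
      case False
      then have "0 < V x" using R(1) R(2)[of x] by simp
      then show ?thesis using Vi[of x] by simp
    qed (use B[of x] in simp)
    then show ?thesis by blast
  qed
qed

text \<open>The derivative of \<open>t \<mapsto> t\<^sup>2\<^sup>s V (t x)\<close> is \<open>t\<^sup>2\<^sup>s\<^sup>-\<^sup>1 F (t x)\<close> with \<open>F y = 2 s V y + (y, \<nabla>V y) \<ge> 0\<close>.\<close>

lemma dilated_potential:
  fixes s :: real
  assumes s: "3 / 4 < s" "s < 1" and V1: "V1 s V" and cont: "continuous_on UNIV V" and C: "\<And>x. \<bar>V x\<bar> \<le> C"
  shows "\<And>x l. l \<ge> 1 \<Longrightarrow> V x \<le> l powr (2 * s) * V (l *\<^sub>R x)"
    and "\<exists>M\<ge>0. \<forall>f l. f \<in> borel_measurable borel \<longrightarrow> integrable lborel (\<lambda>x. (f x)\<^sup>2) \<longrightarrow>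
      integrable lborel (\<lambda>x. \<bar>f x\<bar> powr crit_exp s) \<longrightarrow> 1 \<le> l \<longrightarrow> l \<le> 2 \<longrightarrow>
      (LINT x|lborel. (l powr (2 * s) * V (l *\<^sub>R x) - V x) * (f x)\<^sup>2)
        \<le> (l - 1) * (M * ((LINT x|lborel. (f x)\<^sup>2) + (LINT x|lborel. \<bar>f x\<bar> powr crit_exp s) powr (2 / crit_exp s)))"
proof -
  have s32: "0 < s" "s < 3 / 2" using s by auto
  define k where "k y = y \<bullet> grad V y" for y
  define F where "F y = 2 * s * V y + k y" for y
  have F0: "F y \<ge> 0" for y using V1 by (simp add: F_def k_def V1_def)
  have gc: "continuous_on UNIV (grad V)" using V1 by (simp add: V1_def C1_def)
  have kc: "continuous_on UNIV k" unfolding k_def[abs_def] by (intro continuous_intros gc)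
  have Fc: "continuous_on UNIV F" unfolding F_def[abs_def] by (intro continuous_intros cont kc)
  have [measurable]: "V \<in> borel_measurable borel" "k \<in> borel_measurable borel" and Fm[measurable]: "F \<in> borel_measurable borel"
    using cont kc Fc by (auto intro: borel_measurable_continuous_onI)
  have ftc: "(\<integral>\<^sup>+t. ennreal (t powr (2 * s - 1) * F (t *\<^sub>R x)) * indicator {1..l} t \<partial>lborel) = ennreal (l powr (2 * s) * V (l *\<^sub>R x) - V x)"
    if l: "l \<ge> 1" for x l
  proof -
    have "(\<lambda>t. F (t *\<^sub>R x)) \<in> borel_measurable borel" by (rule measurable_compose[OF _ Fm]) simp
    then have "(\<lambda>t. t powr (2 * s - 1) * F (t *\<^sub>R x)) \<in> borel_measurable borel" by simp
    moreover have deriv: "((\<lambda>t. t powr (2 * s) * V (t *\<^sub>R x)) has_real_derivative t powr (2 * s - 1) * F (t *\<^sub>R x)) (at t)"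
      if "t \<in> {1..l}" for t
    proof -
      have t: "t > 0" using that by simp
      have gV: "(V has_derivative (\<lambda>h. h \<bullet> grad V (t *\<^sub>R x))) (at (t *\<^sub>R x))"
        using V1 by (simp add: V1_def C1_def gderiv_def)
      have "((\<lambda>t. t *\<^sub>R x) has_derivative (\<lambda>h. h *\<^sub>R x)) (at t)" by (auto intro!: derivative_eq_intros)
      from has_derivative_compose[OF this gV]
      have "((\<lambda>t. V (t *\<^sub>R x)) has_real_derivative (x \<bullet> grad V (t *\<^sub>R x))) (at t)"
        unfolding has_field_derivative_def by (rule has_derivative_eq_rhs) (auto simp: fun_eq_iff)
      from DERIV_mult[OF has_real_derivative_powr[OF t, of "2 * s"] this]
      have "((\<lambda>t. t powr (2 * s) * V (t *\<^sub>R x)) has_real_derivative (2 * s * t powr (2 * s - 1) * V (t *\<^sub>R x) + (x \<bullet> grad V (t *\<^sub>R x)) * t powr (2 * s))) (at t)" .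
      moreover have "t powr (2 * s) = t powr (2 * s - 1) * t" using t powr_add[of t "2 * s - 1" 1] by simp
      then have "2 * s * t powr (2 * s - 1) * V (t *\<^sub>R x) + (x \<bullet> grad V (t *\<^sub>R x)) * t powr (2 * s) = t powr (2 * s - 1) * F (t *\<^sub>R x)"
        by (simp add: F_def k_def algebra_simps)
      ultimately show ?thesis by simp
    qed
    ultimately have "(\<integral>\<^sup>+t. ennreal (t powr (2 * s - 1) * F (t *\<^sub>R x)) * indicator {1..l} t \<partial>lborel)
        = ennreal (l powr (2 * s) * V (l *\<^sub>R x) - 1 powr (2 * s) * V (1 *\<^sub>R x))"
      using l F0 by (intro nn_integral_FTC_Icc[where F="\<lambda>t. t powr (2 * s) * V (t *\<^sub>R x)"] mult_nonneg_nonneg powr_ge_zero deriv) auto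
    then show ?thesis by simp
  qed
  show mono: "V x \<le> l powr (2 * s) * V (l *\<^sub>R x)" if l: "l \<ge> 1" for x l
  proof -
    define G where "G t = t powr (2 * s) * V (t *\<^sub>R x)" for t
    show ?thesis
    proof (cases "l = 1")
      case False
      have "\<exists>z. 1 < z \<and> z < l \<and> G l - G 1 = (l - 1) * (z powr (2 * s - 1) * F (z *\<^sub>R x))"
      proof (rule MVT2)
        show "1 < l" using l False by simp
        fix t :: real assume "1 \<le> t" "t \<le> l"
        then have t: "t > 0" by simp
        have gV: "(V has_derivative (\<lambda>h. h \<bullet> grad V (t *\<^sub>R x))) (at (t *\<^sub>R x))"
          using V1 by (simp add: V1_def C1_def gderiv_def)
        have "((\<lambda>t. t *\<^sub>R x) has_derivative (\<lambda>h. h *\<^sub>R x)) (at t)" by (auto intro!: derivative_eq_intros)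
        from has_derivative_compose[OF this gV]
        have "((\<lambda>t. V (t *\<^sub>R x)) has_real_derivative (x \<bullet> grad V (t *\<^sub>R x))) (at t)"
          unfolding has_field_derivative_def by (rule has_derivative_eq_rhs) (auto simp: fun_eq_iff)
        from DERIV_mult[OF has_real_derivative_powr[OF t, of "2 * s"] this]
        have "(G has_real_derivative (2 * s * t powr (2 * s - 1) * V (t *\<^sub>R x) + (x \<bullet> grad V (t *\<^sub>R x)) * t powr (2 * s))) (at t)"
          unfolding G_def[abs_def] .
        moreover have "t powr (2 * s) = t powr (2 * s - 1) * t" using t powr_add[of t "2 * s - 1" 1] by simp
        then have "2 * s * t powr (2 * s - 1) * V (t *\<^sub>R x) + (x \<bullet> grad V (t *\<^sub>R x)) * t powr (2 * s) = t powr (2 * s - 1) * F (t *\<^sub>R x)"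
          by (simp add: F_def k_def algebra_simps)
        ultimately show "(G has_real_derivative t powr (2 * s - 1) * F (t *\<^sub>R x)) (at t)" by simp
      qed
      then obtain z where "G l - G 1 = (l - 1) * (z powr (2 * s - 1) * F (z *\<^sub>R x))" by blast
      moreover have "(l - 1) * (z powr (2 * s - 1) * F (z *\<^sub>R x)) \<ge> 0" using l F0 by simp
      ultimately show ?thesis by (simp add: G_def)
    qed simp
  qed
  let ?Y = "\<lambda>f::real^3 \<Rightarrow> real. (LINT x|lborel. (f x)\<^sup>2) + (LINT x|lborel. \<bar>f x\<bar> powr crit_exp s) powr (2 / crit_exp s)"
  have "\<exists>M\<ge>0. \<forall>f t. f \<in> borel_measurable borel \<longrightarrow> integrable lborel (\<lambda>x. (f x)\<^sup>2) \<longrightarrow>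
      integrable lborel (\<lambda>x. \<bar>f x\<bar> powr crit_exp s) \<longrightarrow> 1 \<le> t \<longrightarrow>
      integrable lborel (\<lambda>x. \<bar>k (t *\<^sub>R x)\<bar> * (f x)\<^sup>2) \<and> (LINT x|lborel. \<bar>k (t *\<^sub>R x)\<bar> * (f x)\<^sup>2) \<le> M * ?Y f"
  proof (cases "(\<lambda>x. x \<bullet> grad V x) \<in> Linfinity")
    case True
    then obtain B where "AE x in lebesgue. norm (k x) \<le> B" by (auto simp: Linfinity_def k_def)
    then have B: "AE x in lborel. \<bar>k x\<bar> \<le> B" by (simp add: AE_completion_iff)
    show ?thesis
    proof (intro exI[of _ "\<bar>B\<bar>"] conjI allI impI)
      fix f :: "real^3 \<Rightarrow> real" and t :: real
      assume fm[measurable]: "f \<in> borel_measurable borel" and f2: "integrable lborel (\<lambda>x. (f x)\<^sup>2)" and t: "1 \<le> t"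
      have "AE x in lborel. \<bar>k (0 + t *\<^sub>R x)\<bar> \<le> B" by (rule AE_lborel_affine[OF B]) (use t in simp)
      then have ae: "AE x in lborel. \<bar>k (t *\<^sub>R x)\<bar> * (f x)\<^sup>2 \<le> \<bar>B\<bar> * (f x)\<^sup>2"
        by eventually_elim (auto intro!: mult_right_mono)
      have km: "(\<lambda>x. k (t *\<^sub>R x)) \<in> borel_measurable borel" by (rule measurable_compose[of "\<lambda>x. t *\<^sub>R x" borel borel]) simp_all
      have bi: "integrable lborel (\<lambda>x. \<bar>B\<bar> * (f x)\<^sup>2)" using f2 by simp
      show i: "integrable lborel (\<lambda>x. \<bar>k (t *\<^sub>R x)\<bar> * (f x)\<^sup>2)"
        by (rule Bochner_Integration.integrable_bound[OF bi]) (use ae km in \<open>auto simp: abs_mult\<close>)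
      have "(LINT x|lborel. \<bar>k (t *\<^sub>R x)\<bar> * (f x)\<^sup>2) \<le> (LINT x|lborel. \<bar>B\<bar> * (f x)\<^sup>2)"
        by (rule integral_mono_AE[OF i bi ae])
      also have "\<dots> \<le> \<bar>B\<bar> * ?Y f" by (simp add: mult_left_mono)
      finally show "(LINT x|lborel. \<bar>k (t *\<^sub>R x)\<bar> * (f x)\<^sup>2) \<le> \<bar>B\<bar> * ?Y f" .
    qed simp
  next
    case False
    define \<kappa> where "\<kappa> = crit_exp s / (crit_exp s - 2)"
    have \<kappa>: "\<kappa> = 3 / (2 * s)" using s by (simp add: \<kappa>_def crit_exp_def field_simps)
    have "k \<in> Lp \<kappa>" using V1 False by (auto simp: V1_def k_def[abs_def] \<kappa>_def)
    then have ki: "integrable lborel (\<lambda>x. \<bar>k x\<bar> powr \<kappa>)" by (subst (asm) Lp_iff_borel) auto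
    obtain K R where K: "K \<ge> 0" and "R > 0" and bound: "\<And>f l. f \<in> borel_measurable borel \<Longrightarrow> integrable lborel (\<lambda>x. (f x)\<^sup>2) \<Longrightarrow>
      integrable lborel (\<lambda>x. \<bar>f x\<bar> powr crit_exp s) \<Longrightarrow> l \<ge> 1 \<Longrightarrow>
      integrable lborel (\<lambda>x. \<bar>k (l *\<^sub>R x)\<bar> * (f x)\<^sup>2) \<and>
      (LINT x|lborel. \<bar>k (l *\<^sub>R x)\<bar> * (f x)\<^sup>2) \<le> 1 * ?Y f + K * (LINT x|lborel. indicator (ball 0 R) x * (f x)\<^sup>2)"
      by (rule potential_bound[OF s32 _ _ _ ki, of 1]) (auto simp: \<kappa>)
    show ?thesis
    proof (intro exI[of _ "1 + K"] conjI allI impI)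
      show "0 \<le> 1 + K" using K by simp
      fix f :: "real^3 \<Rightarrow> real" and t :: real
      assume f: "f \<in> borel_measurable borel" and f2: "integrable lborel (\<lambda>x. (f x)\<^sup>2)"
        and fq: "integrable lborel (\<lambda>x. \<bar>f x\<bar> powr crit_exp s)" and t: "1 \<le> t"
      note b = bound[OF f f2 fq t]
      from b show "integrable lborel (\<lambda>x. \<bar>k (t *\<^sub>R x)\<bar> * (f x)\<^sup>2)" by simp
      have "(LINT x|lborel. indicator (ball 0 R) x * (f x)\<^sup>2) \<le> (LINT x|lborel. (f x)\<^sup>2)"
        by (rule integral_mono[OF indicator_ball_integrable[OF f2] f2]) (auto simp: indicator_def)
      also have "\<dots> \<le> ?Y f" by simp
      finally have "K * (LINT x|lborel. indicator (ball 0 R) x * (f x)\<^sup>2) \<le> K * ?Y f" by (rule mult_left_mono[OF _ K])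
      then show "(LINT x|lborel. \<bar>k (t *\<^sub>R x)\<bar> * (f x)\<^sup>2) \<le> (1 + K) * ?Y f"
        using b by (simp only: distrib_right) linarith
    qed
  qed
  then obtain M where M: "M \<ge> 0" and Mb: "\<And>f t. f \<in> borel_measurable borel \<Longrightarrow> integrable lborel (\<lambda>x. (f x)\<^sup>2) \<Longrightarrow>
      integrable lborel (\<lambda>x. \<bar>f x\<bar> powr crit_exp s) \<Longrightarrow> 1 \<le> t \<Longrightarrow>
      integrable lborel (\<lambda>x. \<bar>k (t *\<^sub>R x)\<bar> * (f x)\<^sup>2) \<and> (LINT x|lborel. \<bar>k (t *\<^sub>R x)\<bar> * (f x)\<^sup>2) \<le> M * ?Y f"
    by blast
  have C0: "C \<ge> 0" using C[of 0] abs_ge_zero order_trans by blast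
  define M' where "M' = 2 * (2 * s * C + M)"
  have M': "M' \<ge> 0" using M C0 s by (simp add: M'_def)
  show "\<exists>M\<ge>0. \<forall>f l. f \<in> borel_measurable borel \<longrightarrow> integrable lborel (\<lambda>x. (f x)\<^sup>2) \<longrightarrow>
      integrable lborel (\<lambda>x. \<bar>f x\<bar> powr crit_exp s) \<longrightarrow> 1 \<le> l \<longrightarrow> l \<le> 2 \<longrightarrow>
      (LINT x|lborel. (l powr (2 * s) * V (l *\<^sub>R x) - V x) * (f x)\<^sup>2) \<le> (l - 1) * (M * ?Y f)"
  proof (intro exI[of _ M'] conjI allI impI M')
    fix f :: "real^3 \<Rightarrow> real" and l :: real
    assume fm[measurable]: "f \<in> borel_measurable borel" and f2: "integrable lborel (\<lambda>x. (f x)\<^sup>2)"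
      and fq: "integrable lborel (\<lambda>x. \<bar>f x\<bar> powr crit_exp s)" and l: "1 \<le> l" "l \<le> 2"
    have Y0: "?Y f \<ge> 0" by simp
    define d where "d x = l powr (2 * s) * V (l *\<^sub>R x) - V x" for x
    have d0: "d x \<ge> 0" for x using mono[OF l(1), of x] by (simp add: d_def)
    have Vl: "(\<lambda>x. V (l *\<^sub>R x)) \<in> borel_measurable borel" by (rule measurable_compose[of "\<lambda>x. l *\<^sub>R x" borel borel]) simp_all
    then have dm[measurable]: "d \<in> borel_measurable borel" unfolding d_def[abs_def] by simp
    have dle: "\<bar>d x\<bar> \<le> (l powr (2 * s) + 1) * C" for x
    proof -
      have "\<bar>d x\<bar> \<le> \<bar>l powr (2 * s) * V (l *\<^sub>R x)\<bar> + \<bar>V x\<bar>" unfolding d_def by (rule abs_triangle_ineq4)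
      also have "\<dots> \<le> l powr (2 * s) * C + C" using C by (intro add_mono) (auto simp: abs_mult intro!: mult_left_mono)
      finally show ?thesis by (simp add: algebra_simps)
    qed
    have di: "integrable lborel (\<lambda>x. d x * (f x)\<^sup>2)"
      by (rule Bochner_Integration.integrable_bound[OF integrable_mult_right[OF f2, of "(l powr (2 * s) + 1) * C"]])
        (use dle C0 in \<open>auto simp: abs_mult intro!: mult_right_mono\<close>)
    define g where "g x t = ennreal (t powr (2 * s - 1) * F (t *\<^sub>R x)) * indicator {1..l} t * ennreal ((f x)\<^sup>2)" for x :: "real^3" and t :: real
    have gm: "(\<lambda>(x, t). g x t) \<in> borel_measurable (lborel \<Otimes>\<^sub>M lborel)"
    proof -
      have "(\<lambda>z. F (snd z *\<^sub>R fst z)) \<in> borel_measurable ((lborel :: (real^3) measure) \<Otimes>\<^sub>M lborel)"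
        by (rule measurable_compose[OF _ Fm]) (auto intro!: borel_measurable_scaleR)
      then show ?thesis unfolding g_def split_beta by simp
    qed
    have "ennreal (LINT x|lborel. d x * (f x)\<^sup>2) = (\<integral>\<^sup>+x. ennreal (d x * (f x)\<^sup>2) \<partial>lborel)"
      by (rule nn_integral_eq_integral[OF di, symmetric]) (use d0 in auto)
    also have "\<dots> = (\<integral>\<^sup>+x. (\<integral>\<^sup>+t. g x t \<partial>lborel) \<partial>lborel)"
    proof (rule nn_integral_cong)
      fix x
      have "(\<lambda>t. F (t *\<^sub>R x)) \<in> borel_measurable borel" by (rule measurable_compose[OF _ Fm]) simp
      then have "(\<integral>\<^sup>+t. g x t \<partial>lborel) = (\<integral>\<^sup>+t. ennreal (t powr (2 * s - 1) * F (t *\<^sub>R x)) * indicator {1..l} t \<partial>lborel) * ennreal ((f x)\<^sup>2)"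
        unfolding g_def by (intro nn_integral_multc) simp
      also have "\<dots> = ennreal (d x * (f x)\<^sup>2)" unfolding ftc[OF l(1)] d_def[symmetric] using d0 by (simp add: ennreal_mult)
      finally show "ennreal (d x * (f x)\<^sup>2) = (\<integral>\<^sup>+t. g x t \<partial>lborel)" ..
    qed
    also have "\<dots> = (\<integral>\<^sup>+t. (\<integral>\<^sup>+x. g x t \<partial>lborel) \<partial>lborel)"
      by (rule lborel_pair.Fubini'[OF gm, symmetric])
    also have "\<dots> \<le> (\<integral>\<^sup>+t. ennreal (M' * ?Y f) * indicator {1..l} t \<partial>lborel)"
    proof (rule nn_integral_mono)
      fix t :: real
      show "(\<integral>\<^sup>+x. g x t \<partial>lborel) \<le> ennreal (M' * ?Y f) * indicator {1..l} t"
      proof (cases "t \<in> {1..l}")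
        case True
        then have t: "1 \<le> t" "t \<le> 2" using l by auto
        have Ft: "(\<lambda>x. F (t *\<^sub>R x)) \<in> borel_measurable borel" by (rule measurable_compose[OF _ Fm]) simp
        note kb = Mb[OF fm f2 fq t(1)]
        have ri: "integrable lborel (\<lambda>x. 2 * ((2 * s * C) * (f x)\<^sup>2 + \<bar>k (t *\<^sub>R x)\<bar> * (f x)\<^sup>2))"
          using kb f2 by simp
        have tp: "t powr (2 * s - 1) \<le> 2"
        proof -
          have "t powr (2 * s - 1) \<le> t powr 1" using s t by (intro powr_mono) auto
          then show ?thesis using t by simp
        qed
        have "(\<integral>\<^sup>+x. g x t \<partial>lborel) \<le> (\<integral>\<^sup>+x. ennreal (2 * ((2 * s * C) * (f x)\<^sup>2 + \<bar>k (t *\<^sub>R x)\<bar> * (f x)\<^sup>2)) \<partial>lborel)"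
        proof (rule nn_integral_mono)
          fix x
          have "F (t *\<^sub>R x) \<le> 2 * s * C + \<bar>k (t *\<^sub>R x)\<bar>"
            unfolding F_def using C[of "t *\<^sub>R x"] s by (intro add_mono mult_left_mono) auto
          then have "t powr (2 * s - 1) * F (t *\<^sub>R x) \<le> 2 * (2 * s * C + \<bar>k (t *\<^sub>R x)\<bar>)"
            using tp F0 by (intro mult_mono) auto
          then have "t powr (2 * s - 1) * F (t *\<^sub>R x) * (f x)\<^sup>2 \<le> 2 * (2 * s * C + \<bar>k (t *\<^sub>R x)\<bar>) * (f x)\<^sup>2"
            by (rule mult_right_mono) simp
          also have "\<dots> = 2 * ((2 * s * C) * (f x)\<^sup>2 + \<bar>k (t *\<^sub>R x)\<bar> * (f x)\<^sup>2)" by (simp add: algebra_simps)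
          finally have "ennreal (t powr (2 * s - 1) * F (t *\<^sub>R x) * (f x)\<^sup>2) \<le> ennreal \<dots>" by (rule ennreal_leI)
          moreover have "g x t = ennreal (t powr (2 * s - 1) * F (t *\<^sub>R x) * (f x)\<^sup>2)"
            unfolding g_def using True F0 by (simp add: ennreal_mult)
          ultimately show "g x t \<le> ennreal (2 * ((2 * s * C) * (f x)\<^sup>2 + \<bar>k (t *\<^sub>R x)\<bar> * (f x)\<^sup>2))" by simp
        qed
        also have "\<dots> = ennreal (LINT x|lborel. 2 * ((2 * s * C) * (f x)\<^sup>2 + \<bar>k (t *\<^sub>R x)\<bar> * (f x)\<^sup>2))"
          using s C0 by (intro nn_integral_eq_integral[OF ri] AE_I2) simp
        also have "(LINT x|lborel. 2 * ((2 * s * C) * (f x)\<^sup>2 + \<bar>k (t *\<^sub>R x)\<bar> * (f x)\<^sup>2))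
           = 2 * ((2 * s * C) * (LINT x|lborel. (f x)\<^sup>2) + (LINT x|lborel. \<bar>k (t *\<^sub>R x)\<bar> * (f x)\<^sup>2))"
          using kb f2 by simp
        also have "ennreal \<dots> \<le> ennreal (M' * ?Y f)"
        proof (rule ennreal_leI)
          have le: "(2 * s * C) * (LINT x|lborel. (f x)\<^sup>2) \<le> (2 * s * C) * ?Y f" using s C0 by (intro mult_left_mono) auto
          then have "2 * ((2 * s * C) * (LINT x|lborel. (f x)\<^sup>2) + (LINT x|lborel. \<bar>k (t *\<^sub>R x)\<bar> * (f x)\<^sup>2)) \<le> 2 * ((2 * s * C) * ?Y f + M * ?Y f)"
            by (intro mult_left_mono add_mono le) (use kb in auto)
          also have "\<dots> = M' * ?Y f" unfolding M'_def by (simp only: distrib_right mult.assoc)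
          finally show "2 * ((2 * s * C) * (LINT x|lborel. (f x)\<^sup>2) + (LINT x|lborel. \<bar>k (t *\<^sub>R x)\<bar> * (f x)\<^sup>2)) \<le> M' * ?Y f" .
        qed
        finally show ?thesis using True by simp
      qed (simp add: g_def)
    qed
    also have "\<dots> = ennreal (M' * ?Y f) * ennreal (l - 1)"
      using l by (subst nn_integral_cmult_indicator) auto
    also have "\<dots> = ennreal ((l - 1) * (M' * ?Y f))"
      using M' Y0 l by (subst ennreal_mult[symmetric]) (auto simp: mult.commute)
    finally show "(LINT x|lborel. (l powr (2 * s) * V (l *\<^sub>R x) - V x) * (f x)\<^sup>2) \<le> (l - 1) * (M' * ?Y f)"
      unfolding d_def[symmetric] using M' Y0 l by (subst (asm) ennreal_le_iff) (auto intro!: mult_nonneg_nonneg)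
  qed
qed

section \<open>Weak solutions and their dilates\<close>

definition mixed_size :: "real \<Rightarrow> (real^3 \<Rightarrow> real) \<Rightarrow> real" where
  "mixed_size s f = (LINT x|lborel. (f x)\<^sup>2) + (LINT x|lborel. \<bar>f x\<bar> powr crit_exp s) powr (2 / crit_exp s)"

definition admissible :: "real \<Rightarrow> (real^3 \<Rightarrow> real) \<Rightarrow> bool" where
  "admissible s f \<longleftrightarrow> f \<in> borel_measurable borel \<and> integrable lborel (\<lambda>x. (f x)\<^sup>2) \<and>
     integrable lborel (\<lambda>x. \<bar>f x\<bar> powr crit_exp s)"

lemma mixed_size_nonneg: "0 \<le> mixed_size s f"
  by (simp add: mixed_size_def)

lemma mixed_size_Sobolev:
  fixes s :: real
  assumes s: "0 < s" "s < 3 / 2"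
  obtains S where "S \<ge> 1" "\<And>f F. frac_deriv s f F \<Longrightarrow> integrable lborel (\<lambda>x. (f x)\<^sup>2) \<Longrightarrow>
    admissible s f \<and> mixed_size s f \<le> S * ((LINT x|lborel. (f x)\<^sup>2) + (LINT x|lborel. (F x)\<^sup>2))"
proof -
  define q where "q = crit_exp s"
  have q: "q > 2" using s by (simp add: q_def crit_exp_def field_simps)
  obtain C where C: "C > 0" and Sob: "\<And>u W. frac_deriv s u W \<Longrightarrow> integrable lborel (\<lambda>x. (u x)\<^sup>2) \<Longrightarrow>
    integrable lborel (\<lambda>x. \<bar>u x\<bar> powr crit_exp s) \<and>
    (LINT x|lborel. \<bar>u x\<bar> powr crit_exp s) \<le> C * (LINT x|lborel. (W x)\<^sup>2) powr (crit_exp s / 2)"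
    by (rule sobolev_inequality[OF s]) (rule that)
  show thesis
  proof (rule that[of "1 + C powr (2 / q)"])
    show "1 \<le> 1 + C powr (2 / q)" by simp
    fix f F assume f: "frac_deriv s f F" and f2: "integrable lborel (\<lambda>x. (f x)\<^sup>2)"
    define A B where "A = (LINT x|lborel. (f x)\<^sup>2)" and "B = (LINT x|lborel. (F x)\<^sup>2)"
    have AB: "A \<ge> 0" "B \<ge> 0" by (simp_all add: A_def B_def)
    note S = Sob[OF f f2, folded q_def B_def]
    have "(LINT x|lborel. \<bar>f x\<bar> powr q) powr (2 / q) \<le> (C * B powr (q / 2)) powr (2 / q)"
      using S q by (intro powr_mono2) auto
    also have "\<dots> = C powr (2 / q) * B"
      using q C AB by (simp add: powr_mult powr_powr powr_one_gt_zero_iff)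
    finally have "mixed_size s f \<le> A + C powr (2 / q) * B" by (simp add: mixed_size_def A_def q_def)
    also have "\<dots> \<le> (1 + C powr (2 / q)) * (A + B)" using AB by (simp add: distrib_left distrib_right)
    finally show "admissible s f \<and> mixed_size s f \<le> (1 + C powr (2 / q)) * ((LINT x|lborel. (f x)\<^sup>2) + (LINT x|lborel. (F x)\<^sup>2))"
      using S f2 frac_deriv_borel(1)[OF f] by (simp add: admissible_def q_def A_def B_def)
  qed
qed

text \<open>A weak solution given by Borel functions \<open>u\<close> and \<open>\<phi>\<close> with fractional derivatives \<open>U\<close> and \<open>\<Phi>\<close>.\<close>

locale weak_pair =
  fixes s :: real and V u \<phi> U \<Phi> :: "real^3 \<Rightarrow> real"
  assumes s: "3 / 4 < s" "s < 1"
    and V: "(\<exists>c>0. V = (\<lambda>_. c)) \<or> (V1 s V \<and> V2 V)"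
    and u: "frac_deriv s u U" and u2: "integrable lborel (\<lambda>x. (u x)\<^sup>2)"
    and \<phi>: "frac_deriv s \<phi> \<Phi>" and \<phi>q: "integrable lborel (\<lambda>x. \<bar>\<phi> x\<bar> powr crit_exp s)"
    and eq_\<phi>: "\<And>v Z. frac_deriv s v Z \<Longrightarrow> integrable lborel (\<lambda>x. \<bar>v x\<bar> powr crit_exp s) \<Longrightarrow>
      (LINT x|lborel. \<Phi> x * Z x) = (LINT x|lborel. (u x)\<^sup>2 * v x)"
    and eq_u: "\<And>v Z. frac_deriv s v Z \<Longrightarrow> integrable lborel (\<lambda>x. (v x)\<^sup>2) \<Longrightarrow>
      (LINT x|lborel. U x * Z x + V x * u x * v x + \<phi> x * u x * v x
        - \<bar>u x\<bar> powr (crit_exp s - 2) * u x * v x) = 0"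
begin

text \<open>The exponent of \<open>w\<close> makes the critical nonlinearity scale like \<open>(-\<Delta>)\<^sup>s\<close>; that of \<open>\<psi>\<close> makes
  \<open>\<psi>\<close> the potential generated by \<open>w\<^sup>2\<close>.\<close>

definition w where "w l x = l powr ((3 - 2 * s) / 2) * u (l *\<^sub>R x)"
definition W where "W l x = l powr ((3 - 2 * s) / 2) * l powr s * U (l *\<^sub>R x)"
definition \<psi> where "\<psi> l x = l powr (3 - 4 * s) * \<phi> (l *\<^sub>R x)"
definition \<Psi> where "\<Psi> l x = l powr (3 - 4 * s) * l powr s * \<Phi> (l *\<^sub>R x)"
definition weight where
  "weight l x = \<bar>\<phi> x\<bar> + \<bar>\<phi> (l *\<^sub>R x)\<bar> + \<bar>u x\<bar> powr (crit_exp s - 2) + \<bar>u (l *\<^sub>R x)\<bar> powr (crit_exp s - 2)"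

lemma s_range: "0 < s" "s < 3 / 2" "s \<le> 1"
  using s by auto

lemma crit_exp_bounds: "4 < crit_exp s" "crit_exp s < 6" "(3 - 2 * s) / 2 * (crit_exp s - 2) = 2 * s" "(3 - 2 * s) / 2 * crit_exp s = 3"
  using s by (auto simp: crit_exp_def field_simps)

lemma borel [measurable]:
  "u \<in> borel_measurable borel" "U \<in> borel_measurable borel" "\<phi> \<in> borel_measurable borel" "\<Phi> \<in> borel_measurable borel"
  using frac_deriv_borel[OF u] frac_deriv_borel[OF \<phi>] by auto

lemma dilate_borel [measurable]: "f \<in> borel_measurable borel \<Longrightarrow> (\<lambda>x. f (l *\<^sub>R x)) \<in> borel_measurable borel" for f :: "real^3 \<Rightarrow> real"
  by (rule measurable_compose[of "\<lambda>x. l *\<^sub>R x" borel borel]) simp_all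

lemma V_borel [measurable]: "V \<in> borel_measurable borel"
  using potential_facts(2)[OF s V] by (rule borel_measurable_continuous_onI)

lemma dilated_borel [measurable]:
  "w l \<in> borel_measurable borel" "W l \<in> borel_measurable borel" "\<psi> l \<in> borel_measurable borel" "\<Psi> l \<in> borel_measurable borel"
  "weight l \<in> borel_measurable borel"
  unfolding w_def[abs_def] W_def[abs_def] \<psi>_def[abs_def] \<Psi>_def[abs_def] weight_def[abs_def] by simp_all

lemma w_deriv: "l > 0 \<Longrightarrow> frac_deriv s (w l) (W l)"
  unfolding w_def[abs_def] W_def[abs_def] by (rule frac_deriv_dilate[OF u])

lemma \<psi>_deriv: "l > 0 \<Longrightarrow> frac_deriv s (\<psi> l) (\<Psi> l)"
  unfolding \<psi>_def[abs_def] \<Psi>_def[abs_def] by (rule frac_deriv_dilate[OF \<phi>])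

lemma w_square_integrable: "l > 0 \<Longrightarrow> integrable lborel (\<lambda>x. (w l x)\<^sup>2)"
  using integrable_lborel_dilate_iff[of "\<lambda>x. (u x)\<^sup>2" l] u2 by (simp add: w_def power_mult_distrib)

lemma \<psi>_integrable: "l > 0 \<Longrightarrow> integrable lborel (\<lambda>x. \<bar>\<psi> l x\<bar> powr crit_exp s)"
  using integrable_lborel_dilate_iff[of "\<lambda>x. \<bar>\<phi> x\<bar> powr crit_exp s" l] \<phi>q
  by (simp add: \<psi>_def abs_mult powr_mult)

lemma w_powr: "l > 0 \<Longrightarrow> \<bar>w l x\<bar> powr (crit_exp s - 2) = l powr (2 * s) * \<bar>u (l *\<^sub>R x)\<bar> powr (crit_exp s - 2)"
  by (simp only: w_def abs_mult powr_mult abs_ge_zero abs_of_nonneg[OF powr_ge_zero] powr_ge_zero powr_powr crit_exp_bounds(3))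

lemma integral_w_crit: 
  assumes "l > 0"
  shows "(LINT x|lborel. \<bar>w l x\<bar> powr crit_exp s) = (LINT x|lborel. \<bar>u x\<bar> powr crit_exp s)"
proof -
  have "\<bar>w l x\<bar> powr crit_exp s = l powr 3 * \<bar>u (l *\<^sub>R x)\<bar> powr crit_exp s" for x
    by (simp only: w_def abs_mult powr_mult abs_ge_zero abs_of_nonneg[OF powr_ge_zero] powr_ge_zero powr_powr crit_exp_bounds(4))
  then show ?thesis
    using assms integral_lborel_dilate[of "\<lambda>x. \<bar>u x\<bar> powr crit_exp s" l] by (simp add: powr_numeral)
qed

lemma energy_w_le:
  assumes "l \<ge> 1"
  shows "(LINT x|lborel. (w l x)\<^sup>2) + (LINT x|lborel. (W l x)\<^sup>2) \<le> (LINT x|lborel. (u x)\<^sup>2) + (LINT x|lborel. (U x)\<^sup>2)"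
proof -
  have l: "l > 0" using assms by simp
  have sq: "(l powr c)\<^sup>2 = l powr (2 * c)" for c unfolding power2_eq_square powr_add[symmetric] by simp
  have two: "2 * ((3 - 2 * s) / 2) = 3 - 2 * s" by simp
  have "(w l x)\<^sup>2 = l powr (3 - 2 * s) * (u (l *\<^sub>R x))\<^sup>2" for x
    unfolding w_def power_mult_distrib sq two ..
  then have "(LINT x|lborel. (w l x)\<^sup>2) = l powr (3 - 2 * s) * ((LINT x|lborel. (u x)\<^sup>2) / l^3)"
    using integral_lborel_dilate[of "\<lambda>x. (u x)\<^sup>2" l] l by (simp add: divide_inverse)
  also have "\<dots> = l powr (- 2 * s) * (LINT x|lborel. (u x)\<^sup>2)"
  proof -
    have "l powr (3 - 2 * s) = l^3 * l powr (- 2 * s)" using powr_add[of l 3 "- 2 * s"] l by (simp add: powr_numeral)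
    then show ?thesis using l by simp
  qed
  also have "\<dots> \<le> 1 * (LINT x|lborel. (u x)\<^sup>2)"
  proof (rule mult_right_mono)
    have "l powr (- 2 * s) \<le> l powr 0" using assms s by (intro powr_mono) auto
    then show "l powr (- 2 * s) \<le> 1" using l by simp
  qed simp
  finally have 1: "(LINT x|lborel. (w l x)\<^sup>2) \<le> (LINT x|lborel. (u x)\<^sup>2)" by simp
  have "(l powr ((3 - 2 * s) / 2) * l powr s)\<^sup>2 = l^3"
  proof -
    have "(l powr ((3 - 2 * s) / 2) * l powr s)\<^sup>2 = l powr (3 - 2 * s + 2 * s)" unfolding power_mult_distrib sq powr_add two ..
    then show ?thesis using l by (simp add: powr_numeral)
  qed
  then have "(LINT x|lborel. (W l x)\<^sup>2) = (LINT x|lborel. (U x)\<^sup>2)"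
    using integral_lborel_dilate[of "\<lambda>x. (U x)\<^sup>2" l] l by (simp add: W_def power_mult_distrib)
  with 1 show ?thesis by simp
qed

lemma energy_\<psi>:
  assumes l: "l > 0"
  shows "l powr (6 * s - 3) * (LINT x|lborel. (\<Psi> l x)\<^sup>2) = (LINT x|lborel. (\<Phi> x)\<^sup>2)"
proof -
  have sq: "(l powr c)\<^sup>2 = l powr (2 * c)" for c unfolding power2_eq_square powr_add[symmetric] by simp
  have "l powr (6 * s - 3) * (l powr (3 - 4 * s) * l powr s)\<^sup>2 = l powr (6 * s - 3 + (2 * (3 - 4 * s) + 2 * s))"
    unfolding power_mult_distrib sq powr_add by simp
  also have "\<dots> = l^3" using l by (simp add: powr_numeral)
  finally have "l powr (6 * s - 3) * (l powr (3 - 4 * s) * l powr s)\<^sup>2 / l^3 = 1" using l by simp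
  then show ?thesis
    using integral_lborel_dilate[of "\<lambda>x. (\<Phi> x)\<^sup>2" l] l by (simp add: \<Psi>_def power_mult_distrib divide_inverse mult_ac)
qed

text \<open>Testing the equation with \<open>x \<mapsto> v (x / l)\<close> and substituting.\<close>

lemma eq_w:
  assumes l: "l > 0" and v: "frac_deriv s v Z" and v2: "integrable lborel (\<lambda>x. (v x)\<^sup>2)"
  shows "(LINT x|lborel. W l x * Z x + l powr (2 * s) * V (l *\<^sub>R x) * w l x * v x + l powr (6 * s - 3) * \<psi> l x * w l x * v x
      - \<bar>w l x\<bar> powr (crit_exp s - 2) * w l x * v x) = 0"
proof -
  define a where "a = (3 - 2 * s) / 2"
  define v' where "v' x = 1 * v ((1 / l) *\<^sub>R x)" for x
  define Z' where "Z' x = 1 * (1 / l) powr s * Z ((1 / l) *\<^sub>R x)" for x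
  have [measurable]: "v \<in> borel_measurable borel" "Z \<in> borel_measurable borel" using frac_deriv_borel[OF v] by auto
  have v': "frac_deriv s v' Z'" unfolding v'_def[abs_def] Z'_def[abs_def] using l by (intro frac_deriv_dilate[OF v]) simp
  have [measurable]: "v' \<in> borel_measurable borel" "Z' \<in> borel_measurable borel" using frac_deriv_borel[OF v'] by auto
  have "integrable lborel (\<lambda>x. (v' x)\<^sup>2)"
    using integrable_lborel_dilate_iff[of "\<lambda>x. (v x)\<^sup>2" "1 / l"] v2 l by (simp add: v'_def)
  note e = eq_u[OF v' this]
  define G where "G x = U x * Z' x + V x * u x * v' x + \<phi> x * u x * v' x - \<bar>u x\<bar> powr (crit_exp s - 2) * u x * v' x" for x
  have Gm: "G \<in> borel_measurable borel" unfolding G_def[abs_def] by measurable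
  have "(LINT x|lborel. G (l *\<^sub>R x)) = 0"
    unfolding integral_lborel_dilate[OF Gm l] using e unfolding G_def[symmetric] by simp
  then have "(LINT x|lborel. l powr (a + 2 * s) * G (l *\<^sub>R x)) = 0" by simp
  moreover have "l powr (a + 2 * s) * G (l *\<^sub>R x) = W l x * Z x + l powr (2 * s) * V (l *\<^sub>R x) * w l x * v x
      + l powr (6 * s - 3) * \<psi> l x * w l x * v x - \<bar>w l x\<bar> powr (crit_exp s - 2) * w l x * v x" for x
  proof -
    have "(1 / l) powr s = l powr (- s)" using l by (simp add: powr_minus powr_divide inverse_eq_divide)
    then have "l powr (a + 2 * s) * (1 / l) powr s = l powr (a + 2 * s + - s)" unfolding powr_add by simp
    also have "a + 2 * s + - s = a + s" by simp
    finally have e1: "l powr (a + 2 * s) * (1 / l) powr s = l powr a * l powr s" unfolding powr_add .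
    have e2: "l powr (a + 2 * s) = l powr (2 * s) * l powr a" unfolding powr_add by (rule mult.commute)
    have "6 * s - 3 + (3 - 4 * s) + a = a + 2 * s" by simp
    then have e3: "l powr (a + 2 * s) = l powr (6 * s - 3) * l powr (3 - 4 * s) * l powr a" unfolding powr_add[symmetric] by (simp add: add.commute)
    have x: "v' (l *\<^sub>R x) = v x" "Z' (l *\<^sub>R x) = (1 / l) powr s * Z x" using l by (simp_all add: v'_def Z'_def)
    have "l powr (a + 2 * s) * G (l *\<^sub>R x) = (l powr (a + 2 * s) * (1 / l) powr s) * U (l *\<^sub>R x) * Z x
        + l powr (a + 2 * s) * (V (l *\<^sub>R x) * u (l *\<^sub>R x) * v x) + l powr (a + 2 * s) * (\<phi> (l *\<^sub>R x) * u (l *\<^sub>R x) * v x)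
        - l powr (a + 2 * s) * (\<bar>u (l *\<^sub>R x)\<bar> powr (crit_exp s - 2) * u (l *\<^sub>R x) * v x)"
      unfolding G_def x by (simp add: algebra_simps)
    moreover have "(l powr (a + 2 * s) * (1 / l) powr s) * U (l *\<^sub>R x) * Z x = W l x * Z x"
      unfolding e1 W_def a_def[symmetric] by simp
    moreover have "l powr (a + 2 * s) * (V (l *\<^sub>R x) * u (l *\<^sub>R x) * v x) = l powr (2 * s) * V (l *\<^sub>R x) * w l x * v x"
      unfolding e2 w_def a_def[symmetric] by simp
    moreover have "l powr (a + 2 * s) * (\<phi> (l *\<^sub>R x) * u (l *\<^sub>R x) * v x) = l powr (6 * s - 3) * \<psi> l x * w l x * v x"
      unfolding e3 w_def \<psi>_def a_def[symmetric] by simp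
    moreover have "l powr (a + 2 * s) * (\<bar>u (l *\<^sub>R x)\<bar> powr (crit_exp s - 2) * u (l *\<^sub>R x) * v x) = \<bar>w l x\<bar> powr (crit_exp s - 2) * w l x * v x"
      unfolding e2 w_powr[OF l] by (simp add: w_def a_def)
    ultimately show ?thesis by presburger
  qed
  ultimately show ?thesis by simp
qed

lemma eq_\<psi>:
  assumes l: "l > 0" and v: "frac_deriv s v Z" and vq: "integrable lborel (\<lambda>x. \<bar>v x\<bar> powr crit_exp s)"
  shows "(LINT x|lborel. \<Psi> l x * Z x) = (LINT x|lborel. (w l x)\<^sup>2 * v x)"
proof -
  define v' where "v' x = 1 * v ((1 / l) *\<^sub>R x)" for x
  define Z' where "Z' x = 1 * (1 / l) powr s * Z ((1 / l) *\<^sub>R x)" for x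
  have [measurable]: "v \<in> borel_measurable borel" "Z \<in> borel_measurable borel" using frac_deriv_borel[OF v] by auto
  have v': "frac_deriv s v' Z'" unfolding v'_def[abs_def] Z'_def[abs_def] using l by (intro frac_deriv_dilate[OF v]) simp
  have [measurable]: "v' \<in> borel_measurable borel" "Z' \<in> borel_measurable borel" using frac_deriv_borel[OF v'] by auto
  have "integrable lborel (\<lambda>x. \<bar>v' x\<bar> powr crit_exp s)"
    using integrable_lborel_dilate_iff[of "\<lambda>x. \<bar>v x\<bar> powr crit_exp s" "1 / l"] vq l by (simp add: v'_def)
  note e = eq_\<phi>[OF v' this]
  have x: "v' (l *\<^sub>R x) = v x" "Z' (l *\<^sub>R x) = (1 / l) powr s * Z x" for x using l by (simp_all add: v'_def Z'_def)
  have "(LINT x|lborel. \<Phi> (l *\<^sub>R x) * Z' (l *\<^sub>R x)) = (LINT x|lborel. (u (l *\<^sub>R x))\<^sup>2 * v' (l *\<^sub>R x))"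
    using integral_lborel_dilate[of "\<lambda>x. \<Phi> x * Z' x" l] integral_lborel_dilate[of "\<lambda>x. (u x)\<^sup>2 * v' x" l] e l by simp
  then have "(LINT x|lborel. l powr (3 - 2 * s) * (\<Phi> (l *\<^sub>R x) * Z' (l *\<^sub>R x))) = (LINT x|lborel. l powr (3 - 2 * s) * ((u (l *\<^sub>R x))\<^sup>2 * v' (l *\<^sub>R x)))"
    by simp
  moreover have "l powr (3 - 2 * s) * (\<Phi> (l *\<^sub>R x) * Z' (l *\<^sub>R x)) = \<Psi> l x * Z x" for x
  proof -
    have "(1 / l) powr s = l powr (- s)" using l by (simp add: powr_minus powr_divide inverse_eq_divide)
    then have "l powr (3 - 2 * s) * (1 / l) powr s = l powr (3 - 2 * s + - s)" unfolding powr_add by simp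
    also have "3 - 2 * s + - s = 3 - 4 * s + s" by simp
    finally have "l powr (3 - 2 * s) * (1 / l) powr s = l powr (3 - 4 * s) * l powr s" unfolding powr_add .
    moreover have "l powr (3 - 2 * s) * (\<Phi> (l *\<^sub>R x) * Z' (l *\<^sub>R x)) = (l powr (3 - 2 * s) * (1 / l) powr s) * \<Phi> (l *\<^sub>R x) * Z x"
      unfolding x by simp
    ultimately show ?thesis by (simp add: \<Psi>_def)
  qed
  moreover have "l powr (3 - 2 * s) * ((u (l *\<^sub>R x))\<^sup>2 * v' (l *\<^sub>R x)) = (w l x)\<^sup>2 * v x" for x
  proof -
    have "(l powr ((3 - 2 * s) / 2))\<^sup>2 = l powr (3 - 2 * s)"
      unfolding power2_eq_square powr_add[symmetric] by simp
    then show ?thesis unfolding x w_def power_mult_distrib by simp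
  qed
  ultimately show ?thesis by simp
qed

section \<open>Estimates for the difference of a solution and its dilate\<close>

lemma weight_bound:
  assumes e: "e > 0"
  obtains K R where "K \<ge> 0" "R > 0" "\<And>f l. admissible s f \<Longrightarrow> l \<ge> 1 \<Longrightarrow>
    integrable lborel (\<lambda>x. weight l x * (f x)\<^sup>2) \<and>
    (LINT x|lborel. weight l x * (f x)\<^sup>2) \<le> e * mixed_size s f + K * (LINT x|lborel. indicator (ball 0 R) x * (f x)\<^sup>2)"
proof -
  have e4: "e / 4 > 0" using e by simp
  have "3 / (2 * s) \<le> 2" using s by (simp add: field_simps)
  then have q0: "crit_exp s \<ge> 3 / (2 * s)" using crit_exp_bounds(1) by simp
  obtain S where "S \<ge> 1" and S: "\<And>f F. frac_deriv s f F \<Longrightarrow> integrable lborel (\<lambda>x. (f x)\<^sup>2) \<Longrightarrow>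
    admissible s f \<and> mixed_size s f \<le> S * ((LINT x|lborel. (f x)\<^sup>2) + (LINT x|lborel. (F x)\<^sup>2))"
    by (rule mixed_size_Sobolev[OF s_range(1,2)]) (rule that)
  have "admissible s u" using S[OF u u2] by simp
  then have uq: "integrable lborel (\<lambda>x. (\<bar>u x\<bar> powr (crit_exp s - 2)) powr (3 / (2 * s)))"
  proof -
    have "(crit_exp s - 2) * (3 / (2 * s)) = crit_exp s" using s by (simp add: crit_exp_def field_simps)
    then have "(\<bar>u x\<bar> powr (crit_exp s - 2)) powr (3 / (2 * s)) = \<bar>u x\<bar> powr crit_exp s" for x unfolding powr_powr by simp
    then show ?thesis using \<open>admissible s u\<close> by (simp add: admissible_def)
  qed
  obtain K1 R1 where K1: "K1 \<ge> 0" "R1 > 0" and b1: "\<And>f l. f \<in> borel_measurable borel \<Longrightarrow> integrable lborel (\<lambda>x. (f x)\<^sup>2) \<Longrightarrow>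
      integrable lborel (\<lambda>x. \<bar>f x\<bar> powr crit_exp s) \<Longrightarrow> l \<ge> 1 \<Longrightarrow>
      integrable lborel (\<lambda>x. \<bar>\<phi> (l *\<^sub>R x)\<bar> * (f x)\<^sup>2) \<and>
      (LINT x|lborel. \<bar>\<phi> (l *\<^sub>R x)\<bar> * (f x)\<^sup>2) \<le> e / 4 * ((LINT x|lborel. (f x)\<^sup>2) + (LINT x|lborel. \<bar>f x\<bar> powr crit_exp s) powr (2 / crit_exp s))
        + K1 * (LINT x|lborel. indicator (ball 0 R1) x * (f x)\<^sup>2)"
    by (rule potential_bound[OF s_range(1,2) q0 _ _ \<phi>q e4]) auto
  obtain K2 R2 where K2: "K2 \<ge> 0" "R2 > 0" and b2: "\<And>f l. f \<in> borel_measurable borel \<Longrightarrow> integrable lborel (\<lambda>x. (f x)\<^sup>2) \<Longrightarrow>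
      integrable lborel (\<lambda>x. \<bar>f x\<bar> powr crit_exp s) \<Longrightarrow> l \<ge> 1 \<Longrightarrow>
      integrable lborel (\<lambda>x. \<bar>u (l *\<^sub>R x)\<bar> powr (crit_exp s - 2) * (f x)\<^sup>2) \<and>
      (LINT x|lborel. \<bar>u (l *\<^sub>R x)\<bar> powr (crit_exp s - 2) * (f x)\<^sup>2) \<le> e / 4 * ((LINT x|lborel. (f x)\<^sup>2) + (LINT x|lborel. \<bar>f x\<bar> powr crit_exp s) powr (2 / crit_exp s))
        + K2 * (LINT x|lborel. indicator (ball 0 R2) x * (f x)\<^sup>2)"
    by (rule potential_bound[OF s_range(1,2) order_refl _ _ uq e4]) auto
  show thesis
  proof (rule that[of "2 * K1 + 2 * K2" "R1 + R2"])
    show "0 \<le> 2 * K1 + 2 * K2" "0 < R1 + R2" using K1 K2 by auto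
    fix f and l :: real assume f: "admissible s f" and l: "l \<ge> 1"
    have ff: "f \<in> borel_measurable borel" "integrable lborel (\<lambda>x. (f x)\<^sup>2)" "integrable lborel (\<lambda>x. \<bar>f x\<bar> powr crit_exp s)"
      using f by (auto simp: admissible_def)
    define Y where "Y = mixed_size s f"
    define I where "I R = (LINT x|lborel. indicator (ball 0 R) x * (f x)\<^sup>2)" for R :: real
    have I: "I R \<le> I (R1 + R2)" if "R = R1 \<or> R = R2" for R
      unfolding I_def
      by (rule integral_mono[OF indicator_ball_integrable[OF ff(2)] indicator_ball_integrable[OF ff(2)]])
        (use that K1 K2 in \<open>auto simp: indicator_def\<close>)
    have I1: "K1 * I R1 \<le> K1 * I (R1 + R2)" and I2: "K2 * I R2 \<le> K2 * I (R1 + R2)"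
      using I K1 K2 by (auto intro!: mult_left_mono)
    note p1 = b1[OF ff, of 1, folded I_def mixed_size_def Y_def, simplified]
    note p2 = b1[OF ff l, folded I_def mixed_size_def Y_def]
    note p3 = b2[OF ff, of 1, folded I_def mixed_size_def Y_def, simplified]
    note p4 = b2[OF ff l, folded I_def mixed_size_def Y_def]
    have eq: "weight l x * (f x)\<^sup>2 = \<bar>\<phi> x\<bar> * (f x)\<^sup>2 + \<bar>\<phi> (l *\<^sub>R x)\<bar> * (f x)\<^sup>2 + \<bar>u x\<bar> powr (crit_exp s - 2) * (f x)\<^sup>2
        + \<bar>u (l *\<^sub>R x)\<bar> powr (crit_exp s - 2) * (f x)\<^sup>2" for x
      by (simp add: weight_def algebra_simps)
    have i: "integrable lborel (\<lambda>x. weight l x * (f x)\<^sup>2)" unfolding eq using p1 p2 p3 p4 by simp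
    have "(LINT x|lborel. weight l x * (f x)\<^sup>2) \<le> e * Y + (2 * K1 + 2 * K2) * I (R1 + R2)"
      unfolding eq using p1 p2 p3 p4 I1 I2 by (simp add: algebra_simps)
    with i show "integrable lborel (\<lambda>x. weight l x * (f x)\<^sup>2) \<and>
      (LINT x|lborel. weight l x * (f x)\<^sup>2) \<le> e * mixed_size s f + (2 * K1 + 2 * K2) * (LINT x|lborel. indicator (ball 0 (R1 + R2)) x * (f x)\<^sup>2)"
      by (simp add: Y_def I_def)
  qed
qed

lemma weight_bound_global:
  obtains P where "P \<ge> 0" "\<And>f l. admissible s f \<Longrightarrow> l \<ge> 1 \<Longrightarrow> (LINT x|lborel. weight l x * (f x)\<^sup>2) \<le> P * mixed_size s f"
proof -
  obtain K R where K: "K \<ge> 0" "R > 0" and b: "\<And>f l. admissible s f \<Longrightarrow> l \<ge> 1 \<Longrightarrow>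
    integrable lborel (\<lambda>x. weight l x * (f x)\<^sup>2) \<and>
    (LINT x|lborel. weight l x * (f x)\<^sup>2) \<le> 1 * mixed_size s f + K * (LINT x|lborel. indicator (ball 0 R) x * (f x)\<^sup>2)"
    by (rule weight_bound[of 1]) auto
  show thesis
  proof (rule that[of "1 + K"])
    show "0 \<le> 1 + K" using K by simp
    fix f and l :: real assume f: "admissible s f" and l: "l \<ge> 1"
    then have f2: "integrable lborel (\<lambda>x. (f x)\<^sup>2)" by (simp add: admissible_def)
    have "(LINT x|lborel. indicator (ball 0 R) x * (f x)\<^sup>2) \<le> (LINT x|lborel. (f x)\<^sup>2)"
      by (rule integral_mono[OF indicator_ball_integrable[OF f2] f2]) (auto simp: indicator_def)
    also have "\<dots> \<le> mixed_size s f" by (simp add: mixed_size_def)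
    finally have "K * (LINT x|lborel. indicator (ball 0 R) x * (f x)\<^sup>2) \<le> K * mixed_size s f" by (rule mult_left_mono[OF _ K(1)])
    then show "(LINT x|lborel. weight l x * (f x)\<^sup>2) \<le> (1 + K) * mixed_size s f"
      using b[OF f l] by (simp add: distrib_right)
  qed
qed

lemma weight_nonneg: "0 \<le> weight l x"
  by (simp add: weight_def)

lemma integrable_weight_dominated:
  assumes f: "admissible s f" and g: "admissible s g" and l: "l \<ge> 1"
    and km: "k \<in> borel_measurable borel" and k: "\<And>x. \<bar>k x\<bar> \<le> B * weight l x"
  shows "integrable lborel (\<lambda>x. k x * f x * g x)"
proof -
  obtain K R where b: "\<And>f l. admissible s f \<Longrightarrow> l \<ge> 1 \<Longrightarrow>
    integrable lborel (\<lambda>x. weight l x * (f x)\<^sup>2) \<and>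
    (LINT x|lborel. weight l x * (f x)\<^sup>2) \<le> 1 * mixed_size s f + K * (LINT x|lborel. indicator (ball 0 R) x * (f x)\<^sup>2)"
    by (rule weight_bound[of 1]) auto
  have [measurable]: "f \<in> borel_measurable borel" "g \<in> borel_measurable borel" "k \<in> borel_measurable borel"
    using f g km by (auto simp: admissible_def)
  have i: "integrable lborel (\<lambda>x. B * (weight l x * (f x)\<^sup>2) + B * (weight l x * (g x)\<^sup>2))"
    using b[OF f l] b[OF g l] by simp
  show ?thesis
  proof (rule Bochner_Integration.integrable_bound[OF i])
    show "AE x in lborel. norm (k x * f x * g x) \<le> norm (B * (weight l x * (f x)\<^sup>2) + B * (weight l x * (g x)\<^sup>2))"
    proof (rule AE_I2)
      fix x
      have "\<bar>f x * g x\<bar> \<le> (f x)\<^sup>2 + (g x)\<^sup>2"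
      proof -
        have "2 * (\<bar>f x\<bar> * \<bar>g x\<bar>) \<le> (f x)\<^sup>2 + (g x)\<^sup>2" using sum_squares_bound[of "\<bar>f x\<bar>" "\<bar>g x\<bar>"] by simp
        moreover have "0 \<le> \<bar>f x\<bar> * \<bar>g x\<bar>" by simp
        ultimately show ?thesis unfolding abs_mult by linarith
      qed
      then have "\<bar>k x\<bar> * \<bar>f x * g x\<bar> \<le> (B * weight l x) * ((f x)\<^sup>2 + (g x)\<^sup>2)"
        by (intro mult_mono k) (use k[of x] abs_ge_zero order_trans in auto)
      then show "norm (k x * f x * g x) \<le> norm (B * (weight l x * (f x)\<^sup>2) + B * (weight l x * (g x)\<^sup>2))"
        by (simp add: abs_mult algebra_simps)
    qed
  qed simp
qed

lemma weight_dominates: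
  assumes l: "1 \<le> l" "l \<le> 2"
  shows "\<bar>\<phi> x\<bar> \<le> 1 * weight l x" "\<bar>\<psi> l x\<bar> \<le> \<bar>\<phi> (l *\<^sub>R x)\<bar>" "\<bar>\<psi> l x\<bar> \<le> 1 * weight l x"
    "\<bar>\<bar>w l x\<bar> powr (crit_exp s - 2)\<bar> \<le> 4 * weight l x" "\<bar>\<bar>u x\<bar> powr (crit_exp s - 2)\<bar> \<le> 1 * weight l x"
    "\<bar>w l x\<bar> powr (crit_exp s - 2) + \<bar>u x\<bar> powr (crit_exp s - 2) \<le> 4 * weight l x" "\<bar>\<phi> x\<bar> + \<bar>\<psi> l x\<bar> \<le> weight l x"
proof -
  have l0: "l > 0" using l by simp
  have "l powr (3 - 4 * s) \<le> l powr 0" using l s by (intro powr_mono) auto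
  then have "l powr (3 - 4 * s) * \<bar>\<phi> (l *\<^sub>R x)\<bar> \<le> 1 * \<bar>\<phi> (l *\<^sub>R x)\<bar>" using l by (intro mult_right_mono) auto
  then show \<psi>: "\<bar>\<psi> l x\<bar> \<le> \<bar>\<phi> (l *\<^sub>R x)\<bar>" by (simp add: \<psi>_def abs_mult)
  have "l powr (2 * s) \<le> l powr 2" using l s by (intro powr_mono) auto
  also have "\<dots> \<le> 2 powr 2" using l by (intro powr_mono2) auto
  finally have "l powr (2 * s) * \<bar>u (l *\<^sub>R x)\<bar> powr (crit_exp s - 2) \<le> 4 * \<bar>u (l *\<^sub>R x)\<bar> powr (crit_exp s - 2)"
    by (intro mult_right_mono) auto
  then have w: "\<bar>w l x\<bar> powr (crit_exp s - 2) \<le> 4 * \<bar>u (l *\<^sub>R x)\<bar> powr (crit_exp s - 2)" unfolding w_powr[OF l0] .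
  have nn: "\<bar>\<phi> x\<bar> \<ge> 0" "\<bar>\<phi> (l *\<^sub>R x)\<bar> \<ge> 0" "\<bar>u x\<bar> powr (crit_exp s - 2) \<ge> 0" "\<bar>u (l *\<^sub>R x)\<bar> powr (crit_exp s - 2) \<ge> 0" by auto
  have gen: "a \<le> 1 * (a + b + c + d) \<and> p \<le> 1 * (a + b + c + d) \<and> v \<le> 4 * (a + b + c + d) \<and> c \<le> 1 * (a + b + c + d)
      \<and> v + c \<le> 4 * (a + b + c + d) \<and> a + p \<le> a + b + c + d"
    if "0 \<le> a" "0 \<le> b" "0 \<le> c" "0 \<le> d" "p \<le> b" "v \<le> 4 * d" for a b c d p v :: real
    using that by auto
  show "\<bar>\<phi> x\<bar> \<le> 1 * weight l x" "\<bar>\<psi> l x\<bar> \<le> 1 * weight l x"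
    "\<bar>\<bar>w l x\<bar> powr (crit_exp s - 2)\<bar> \<le> 4 * weight l x" "\<bar>\<bar>u x\<bar> powr (crit_exp s - 2)\<bar> \<le> 1 * weight l x"
    "\<bar>w l x\<bar> powr (crit_exp s - 2) + \<bar>u x\<bar> powr (crit_exp s - 2) \<le> 4 * weight l x" "\<bar>\<phi> x\<bar> + \<bar>\<psi> l x\<bar> \<le> weight l x"
    using gen[OF nn \<psi> w, folded weight_def] unfolding abs_of_nonneg[OF powr_ge_zero] by - ((elim conjE, assumption)+)
qed

end

lemma integrable_bounded_product:
  fixes f g k :: "real^3 \<Rightarrow> real"
  assumes m[measurable]: "k \<in> borel_measurable borel" "f \<in> borel_measurable borel" "g \<in> borel_measurable borel"
    and k: "\<And>x. \<bar>k x\<bar> \<le> B" and f: "integrable lborel (\<lambda>x. (f x)\<^sup>2)" and g: "integrable lborel (\<lambda>x. (g x)\<^sup>2)"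
  shows "integrable lborel (\<lambda>x. k x * f x * g x)"
proof -
  have "integrable lborel (\<lambda>x. f x * g x)" using f g by (intro integrable_mult_L2) auto
  then have i: "integrable lborel (\<lambda>x. B * (f x * g x))" by simp
  show ?thesis
  proof (rule Bochner_Integration.integrable_bound[OF i])
    have "\<bar>k x\<bar> * \<bar>f x * g x\<bar> \<le> \<bar>B\<bar> * \<bar>f x * g x\<bar>" for x
      using k[of x] by (intro mult_right_mono) auto
    then show "AE x in lborel. norm (k x * f x * g x) \<le> norm (B * (f x * g x))"
      by (intro AE_I2) (simp add: abs_mult mult.assoc)
  qed simp
qed

lemma abs_mult_le_weighted:
  fixes x y t :: real
  assumes t: "t > 0"
  shows "\<bar>x * y\<bar> \<le> t * x\<^sup>2 + y\<^sup>2 / t"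
proof -
  have "2 * (t * \<bar>x\<bar>) * \<bar>y\<bar> \<le> (t * \<bar>x\<bar>)\<^sup>2 + \<bar>y\<bar>\<^sup>2" by (rule sum_squares_bound)
  moreover have "0 \<le> (t * \<bar>x\<bar>) * \<bar>y\<bar>" using t by simp
  ultimately have "t * \<bar>x * y\<bar> \<le> t\<^sup>2 * x\<^sup>2 + y\<^sup>2" unfolding abs_mult by (simp add: power_mult_distrib)
  also have "\<dots> = t * (t * x\<^sup>2 + y\<^sup>2 / t)" using t by (simp add: field_simps power2_eq_square)
  finally show ?thesis using t by simp
qed

context weak_pair
begin

definition excess where "excess l x = l powr (2 * s) * V (l *\<^sub>R x) - V x"

lemma excess_borel [measurable]: "excess l \<in> borel_measurable borel"
  unfolding excess_def[abs_def] by measurable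

lemma V_bounds:
  obtains C c R where "\<And>x. \<bar>V x\<bar> \<le> C" "c > 0" "R > 0" "\<And>x. R \<le> norm x \<Longrightarrow> c \<le> V x"
  using potential_facts(3,4)[OF s V] by blast

lemma excess_nonneg: "l \<ge> 1 \<Longrightarrow> 0 \<le> excess l x"
proof -
  assume l: "l \<ge> 1"
  obtain C where C: "\<And>x. \<bar>V x\<bar> \<le> C" using potential_facts(3)[OF s V] by blast
  show ?thesis using dilated_potential(1)[OF s potential_facts(1,2)[OF s V] C l] by (simp add: excess_def)
qed

lemma excess_bound:
  obtains M where "M \<ge> 0" "\<And>f l. admissible s f \<Longrightarrow> 1 \<le> l \<Longrightarrow> l \<le> 2 \<Longrightarrow>
    (LINT x|lborel. excess l x * (f x)\<^sup>2) \<le> (l - 1) * (M * mixed_size s f)"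
proof -
  obtain C where C: "\<And>x. \<bar>V x\<bar> \<le> C" using potential_facts(3)[OF s V] by blast
  from dilated_potential(2)[OF s potential_facts(1,2)[OF s V] C]
  obtain M where "M \<ge> 0" and M: "\<And>f l. f \<in> borel_measurable borel \<Longrightarrow> integrable lborel (\<lambda>x. (f x)\<^sup>2) \<Longrightarrow>
      integrable lborel (\<lambda>x. \<bar>f x\<bar> powr crit_exp s) \<Longrightarrow> 1 \<le> l \<Longrightarrow> l \<le> 2 \<Longrightarrow>
      (LINT x|lborel. (l powr (2 * s) * V (l *\<^sub>R x) - V x) * (f x)\<^sup>2)
        \<le> (l - 1) * (M * ((LINT x|lborel. (f x)\<^sup>2) + (LINT x|lborel. \<bar>f x\<bar> powr crit_exp s) powr (2 / crit_exp s)))"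
    by blast
  show thesis
    by (rule that[OF \<open>M \<ge> 0\<close>]) (use M in \<open>simp add: excess_def admissible_def mixed_size_def\<close>)
qed

lemma excess_integrable:
  assumes "f \<in> borel_measurable borel" "integrable lborel (\<lambda>x. (f x)\<^sup>2)"
  shows "integrable lborel (\<lambda>x. excess l x * (f x)\<^sup>2)"
proof -
  obtain C where C: "\<And>x. \<bar>V x\<bar> \<le> C" using potential_facts(3)[OF s V] by blast
  have "\<bar>excess l x\<bar> \<le> l powr (2 * s) * C + C" for x
  proof -
    have "\<bar>excess l x\<bar> \<le> \<bar>l powr (2 * s) * V (l *\<^sub>R x)\<bar> + \<bar>V x\<bar>" unfolding excess_def by (rule abs_triangle_ineq4)
    also have "\<dots> \<le> l powr (2 * s) * C + C" using C by (intro add_mono) (auto simp: abs_mult intro!: mult_left_mono)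
    finally show ?thesis .
  qed
  from integrable_bounded_product[OF excess_borel assms(1,1) this assms(2,2)] show ?thesis
    by (simp add: power2_eq_square mult.assoc)
qed

lemma weight_integrable:
  assumes "admissible s f" "l \<ge> 1"
  shows "integrable lborel (\<lambda>x. weight l x * (f x)\<^sup>2)"
proof -
  have "integrable lborel (\<lambda>x. weight l x * f x * f x)"
    by (rule integrable_weight_dominated[OF assms(1,1,2), of "weight l" 1]) (auto simp: weight_nonneg)
  then show ?thesis by (simp add: power2_eq_square mult.assoc)
qed

lemma mu_bounds:
  assumes l: "1 < l" "l \<le> 2"
  shows "l - 1 \<le> l powr (6 * s - 3) - 1" "l powr (6 * s - 3) - 1 \<le> 7 * (l - 1)" "l powr (6 * s - 3) \<le> 8"
proof -
  have "l powr 1 \<le> l powr (6 * s - 3)" using l s by (intro powr_mono) auto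
  then show "l - 1 \<le> l powr (6 * s - 3) - 1" using l by simp
  have "l powr (6 * s - 3) \<le> l powr 3" using l s by (intro powr_mono) auto
  then have le: "l powr (6 * s - 3) \<le> l^3" using l by (simp add: powr_numeral)
  have "l * l \<le> 2 * 2" using l by (intro mult_mono) auto
  then have "(l - 1) * (l * l + l + 1) \<le> (l - 1) * 7" using l by (intro mult_left_mono) auto
  moreover have "l^3 - 1 = (l - 1) * (l * l + l + 1)" by (simp add: algebra_simps power3_eq_cube)
  ultimately show "l powr (6 * s - 3) - 1 \<le> 7 * (l - 1)" using le by simp
  then show "l powr (6 * s - 3) \<le> 8" using l by simp
qed

lemma admissible_of_deriv:
  assumes "frac_deriv s v Z" "integrable lborel (\<lambda>x. (v x)\<^sup>2)"
  shows "admissible s v"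
proof -
  obtain S where "S \<ge> 1" and S: "\<And>f F. frac_deriv s f F \<Longrightarrow> integrable lborel (\<lambda>x. (f x)\<^sup>2) \<Longrightarrow>
    admissible s f \<and> mixed_size s f \<le> S * ((LINT x|lborel. (f x)\<^sup>2) + (LINT x|lborel. (F x)\<^sup>2))"
    by (rule mixed_size_Sobolev[OF s_range(1,2)]) (rule that)
  show ?thesis using S[OF assms] by simp
qed

lemma w_admissible: "l > 0 \<Longrightarrow> admissible s (w l)"
  by (rule admissible_of_deriv[OF w_deriv w_square_integrable])

lemma u_admissible: "admissible s u"
  by (rule admissible_of_deriv[OF u u2])

lemma difference_deriv: "l > 0 \<Longrightarrow> frac_deriv s (\<lambda>x. w l x - u x) (\<lambda>x. W l x - U x)"
  using frac_deriv_lincomb[OF w_deriv u, of l 1 "-1"] by simp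

lemma difference_square_integrable: "l > 0 \<Longrightarrow> integrable lborel (\<lambda>x. (w l x - u x)\<^sup>2)"
proof -
  assume "l > 0"
  then have "integrable lborel (\<lambda>x. (1 * w l x + (- 1) * u x)\<^sup>2)"
    by (intro integrable_lincomb_L2 w_square_integrable u2) auto
  then show ?thesis by simp
qed

lemma difference_admissible: "l > 0 \<Longrightarrow> admissible s (\<lambda>x. w l x - u x)"
  by (rule admissible_of_deriv[OF difference_deriv difference_square_integrable])

lemma potential_difference_deriv: "l > 0 \<Longrightarrow> frac_deriv s (\<lambda>x. \<psi> l x - \<phi> x) (\<lambda>x. \<Psi> l x - \<Phi> x)"
  using frac_deriv_lincomb[OF \<psi>_deriv \<phi>, of l 1 "-1"] by simp

lemma potential_difference_integrable:
  assumes l: "l > 0"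
  shows "integrable lborel (\<lambda>x. \<bar>\<psi> l x - \<phi> x\<bar> powr crit_exp s)"
proof -
  have i: "integrable lborel (\<lambda>x. 2 powr crit_exp s * (\<bar>\<psi> l x\<bar> powr crit_exp s + \<bar>\<phi> x\<bar> powr crit_exp s))"
    using \<psi>_integrable[OF l] \<phi>q by simp
  show ?thesis
  proof (rule Bochner_Integration.integrable_bound[OF i])
    have "\<bar>a - b\<bar> powr crit_exp s \<le> 2 powr crit_exp s * (\<bar>a\<bar> powr crit_exp s + \<bar>b\<bar> powr crit_exp s)" for a b :: real
    proof -
      have "\<bar>a - b\<bar> powr crit_exp s \<le> (2 * max \<bar>a\<bar> \<bar>b\<bar>) powr crit_exp s"
        using crit_exp_bounds by (intro powr_mono2) auto
      also have "\<dots> = 2 powr crit_exp s * (max \<bar>a\<bar> \<bar>b\<bar>) powr crit_exp s" by (subst powr_mult) auto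
      also have "\<dots> \<le> 2 powr crit_exp s * (\<bar>a\<bar> powr crit_exp s + \<bar>b\<bar> powr crit_exp s)"
        by (intro mult_left_mono) (auto simp: max_def)
      finally show ?thesis .
    qed
    then show "AE x in lborel. norm (\<bar>\<psi> l x - \<phi> x\<bar> powr crit_exp s) \<le> norm (2 powr crit_exp s * (\<bar>\<psi> l x\<bar> powr crit_exp s + \<bar>\<phi> x\<bar> powr crit_exp s))"
      by (intro AE_I2) simp
  qed simp
qed

lemma deriv_product_integrable: "frac_deriv s f F \<Longrightarrow> frac_deriv s g G \<Longrightarrow> integrable lborel (\<lambda>x. F x * G x)"
  using frac_deriv_borel[of s f F] frac_deriv_borel[of s g G] by (intro integrable_mult_L2) auto

lemma eq_u_integrable:
  assumes v: "frac_deriv s v Z" and v2: "integrable lborel (\<lambda>x. (v x)\<^sup>2)"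
  shows "integrable lborel (\<lambda>x. U x * Z x + V x * u x * v x + \<phi> x * u x * v x - \<bar>u x\<bar> powr (crit_exp s - 2) * u x * v x)"
proof -
  note va = admissible_of_deriv[OF v v2]
  have vm: "v \<in> borel_measurable borel" using frac_deriv_borel[OF v] by simp
  obtain C where C: "\<And>x. \<bar>V x\<bar> \<le> C" using potential_facts(3)[OF s V] by blast
  have 1: "integrable lborel (\<lambda>x. U x * Z x)" by (rule deriv_product_integrable[OF u v])
  have 2: "integrable lborel (\<lambda>x. V x * u x * v x)" by (rule integrable_bounded_product[OF V_borel borel(1) vm C u2 v2])
  have 3: "integrable lborel (\<lambda>x. \<phi> x * u x * v x)"
    by (rule integrable_weight_dominated[OF u_admissible va order_refl borel(3)]) (rule weight_dominates(1); simp)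
  have um: "(\<lambda>x. \<bar>u x\<bar> powr (crit_exp s - 2)) \<in> borel_measurable borel" by measurable
  have 4: "integrable lborel (\<lambda>x. \<bar>u x\<bar> powr (crit_exp s - 2) * u x * v x)"
    by (rule integrable_weight_dominated[OF u_admissible va order_refl um]) (rule weight_dominates(5); simp)
  show ?thesis by (intro Bochner_Integration.integrable_add Bochner_Integration.integrable_diff 1 2 3 4)
qed

lemma eq_w_integrable:
  assumes l: "1 < l" "l \<le> 2" and v: "frac_deriv s v Z" and v2: "integrable lborel (\<lambda>x. (v x)\<^sup>2)"
  shows "integrable lborel (\<lambda>x. W l x * Z x + l powr (2 * s) * V (l *\<^sub>R x) * w l x * v x + l powr (6 * s - 3) * \<psi> l x * w l x * v x
      - \<bar>w l x\<bar> powr (crit_exp s - 2) * w l x * v x)"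
proof -
  have l0: "l > 0" "1 \<le> l" using l by auto
  note va = admissible_of_deriv[OF v v2]
  have vm: "v \<in> borel_measurable borel" using frac_deriv_borel[OF v] by simp
  obtain C where C: "\<And>x. \<bar>V x\<bar> \<le> C" using potential_facts(3)[OF s V] by blast
  have 1: "integrable lborel (\<lambda>x. W l x * Z x)" by (rule deriv_product_integrable[OF w_deriv[OF l0(1)] v])
  have C': "\<bar>l powr (2 * s) * V (l *\<^sub>R x)\<bar> \<le> l powr (2 * s) * C" for x
    using C by (auto simp: abs_mult intro!: mult_left_mono)
  have Vm: "(\<lambda>x. l powr (2 * s) * V (l *\<^sub>R x)) \<in> borel_measurable borel" by measurable
  have 2: "integrable lborel (\<lambda>x. l powr (2 * s) * V (l *\<^sub>R x) * w l x * v x)"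
    by (rule integrable_bounded_product[OF Vm dilated_borel(1) vm C' w_square_integrable[OF l0(1)] v2])
  have "integrable lborel (\<lambda>x. \<psi> l x * w l x * v x)"
    by (rule integrable_weight_dominated[OF w_admissible[OF l0(1)] va l0(2) dilated_borel(3) weight_dominates(3)[OF l0(2) l(2)]])
  then have "integrable lborel (\<lambda>x. l powr (6 * s - 3) * (\<psi> l x * w l x * v x))" by (rule integrable_mult_right)
  then have 3: "integrable lborel (\<lambda>x. l powr (6 * s - 3) * \<psi> l x * w l x * v x)" by (simp only: mult.assoc)
  have wm: "(\<lambda>x. \<bar>w l x\<bar> powr (crit_exp s - 2)) \<in> borel_measurable borel" by measurable
  have 4: "integrable lborel (\<lambda>x. \<bar>w l x\<bar> powr (crit_exp s - 2) * w l x * v x)"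
    by (rule integrable_weight_dominated[OF w_admissible[OF l0(1)] va l0(2) wm weight_dominates(4)[OF l0(2) l(2)]])
  show ?thesis by (intro Bochner_Integration.integrable_add Bochner_Integration.integrable_diff 1 2 3 4)
qed

lemma square_potential_integrable:
  assumes l: "1 < l" "l \<le> 2"
  shows "integrable lborel (\<lambda>x. (w l x)\<^sup>2 * \<psi> l x)" "integrable lborel (\<lambda>x. (w l x)\<^sup>2 * \<phi> x)"
    "integrable lborel (\<lambda>x. (u x)\<^sup>2 * \<psi> l x)" "integrable lborel (\<lambda>x. (u x)\<^sup>2 * \<phi> x)"
proof -
  have l0: "l > 0" "1 \<le> l" using l by auto
  note I = integrable_weight_dominated[OF _ _ l0(2)]
  have "integrable lborel (\<lambda>x. \<psi> l x * w l x * w l x)" "integrable lborel (\<lambda>x. \<phi> x * w l x * w l x)"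
    "integrable lborel (\<lambda>x. \<psi> l x * u x * u x)" "integrable lborel (\<lambda>x. \<phi> x * u x * u x)"
    by (rule I[OF w_admissible[OF l0(1)] w_admissible[OF l0(1)] dilated_borel(3) weight_dominates(3)[OF l0(2) l(2)]],
      rule I[OF w_admissible[OF l0(1)] w_admissible[OF l0(1)] borel(3) weight_dominates(1)[OF l0(2) l(2)]],
      rule I[OF u_admissible u_admissible dilated_borel(3) weight_dominates(3)[OF l0(2) l(2)]],
      rule I[OF u_admissible u_admissible borel(3) weight_dominates(1)[OF l0(2) l(2)]])
  then show "integrable lborel (\<lambda>x. (w l x)\<^sup>2 * \<psi> l x)" "integrable lborel (\<lambda>x. (w l x)\<^sup>2 * \<phi> x)"
    "integrable lborel (\<lambda>x. (u x)\<^sup>2 * \<psi> l x)" "integrable lborel (\<lambda>x. (u x)\<^sup>2 * \<phi> x)"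
    by (simp_all add: power2_eq_square mult_ac)
qed

lemma power_difference_le:
  assumes l: "1 \<le> l" "l \<le> 2"
  shows "(\<bar>w l x\<bar> powr (crit_exp s - 2) * w l x - \<bar>u x\<bar> powr (crit_exp s - 2) * u x) * (w l x - u x) \<le> 20 * (weight l x * (w l x - u x)\<^sup>2)"
    and "\<bar>w l x\<bar> powr (crit_exp s - 2) * w l x * u x - \<bar>u x\<bar> powr (crit_exp s - 2) * u x * w l x
      \<le> (crit_exp s - 2) / crit_exp s * (\<bar>w l x\<bar> powr crit_exp s - \<bar>u x\<bar> powr crit_exp s) + 24 * (weight l x * (w l x - u x)\<^sup>2)"
proof -
  have r: "crit_exp s - 2 \<ge> 1" using crit_exp_bounds by simp
  have "(\<bar>w l x\<bar> powr (crit_exp s - 2) + \<bar>u x\<bar> powr (crit_exp s - 2)) * (w l x - u x)\<^sup>2 \<le> 4 * weight l x * (w l x - u x)\<^sup>2"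
    by (rule mult_right_mono[OF weight_dominates(6)[OF l]]) simp
  note base = this
  have b: "k * ((\<bar>w l x\<bar> powr (crit_exp s - 2) + \<bar>u x\<bar> powr (crit_exp s - 2)) * (w l x - u x)\<^sup>2) \<le> K * (4 * weight l x * (w l x - u x)\<^sup>2)"
    if "0 \<le> k" "k \<le> K" for k K
    by (rule mult_mono[OF that(2) base]) (use that in auto)
  show "(\<bar>w l x\<bar> powr (crit_exp s - 2) * w l x - \<bar>u x\<bar> powr (crit_exp s - 2) * u x) * (w l x - u x) \<le> 20 * (weight l x * (w l x - u x)\<^sup>2)"
    using power_nonlinearity_diff_le[OF r, of "w l x" "u x"] b[of "crit_exp s - 2 + 1" 5] crit_exp_bounds by simp
  have "\<bar>w l x\<bar> powr (crit_exp s - 2) * w l x * u x - \<bar>u x\<bar> powr (crit_exp s - 2) * u x * w l x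
      - (crit_exp s - 2) / (crit_exp s - 2 + 2) * (\<bar>w l x\<bar> powr (crit_exp s - 2 + 2) - \<bar>u x\<bar> powr (crit_exp s - 2 + 2))
      \<le> 6 * (4 * weight l x * (w l x - u x)\<^sup>2)"
    using order_trans[OF abs_ge_self order_trans[OF power_nonlinearity_antisym_le[OF r, of "w l x" "u x"] b[of "crit_exp s - 2 + 2" 6]]] crit_exp_bounds by simp
  then show "\<bar>w l x\<bar> powr (crit_exp s - 2) * w l x * u x - \<bar>u x\<bar> powr (crit_exp s - 2) * u x * w l x
      \<le> (crit_exp s - 2) / crit_exp s * (\<bar>w l x\<bar> powr crit_exp s - \<bar>u x\<bar> powr crit_exp s) + 24 * (weight l x * (w l x - u x)\<^sup>2)"
    by simp
qed

text \<open>The equations of \<open>w\<close> and \<open>u\<close>, subtracted and tested with \<open>w - u\<close>.\<close>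

lemma difference_inequality:
  assumes l: "1 < l" "l \<le> 2" and t: "t > 0"
  defines "pot \<equiv> \<lambda>x. excess l x + 7 * (l - 1) * weight l x"
  shows "(LINT x|lborel. (W l x - U x)\<^sup>2) + (LINT x|lborel. V x * (w l x - u x)\<^sup>2) + (LINT x|lborel. (\<Psi> l x - \<Phi> x)\<^sup>2) / 2
    \<le> t * (LINT x|lborel. pot x * (w l x)\<^sup>2) + (LINT x|lborel. pot x * (w l x - u x)\<^sup>2) / t
      + 21 * (LINT x|lborel. weight l x * (w l x - u x)\<^sup>2)"
proof -
  have l0: "l > 0" "1 \<le> l" using l by auto
  define \<mu> where "\<mu> = l powr (6 * s - 3)"
  define r where "r = crit_exp s - 2"
  define h where "h x = w l x - u x" for x
  define H where "H x = W l x - U x" for x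
  note hd = difference_deriv[OF l0(1), folded h_def H_def]
  note h2 = difference_square_integrable[OF l0(1), folded h_def]
  note ha = difference_admissible[OF l0(1), folded h_def]
  have hm[measurable]: "h \<in> borel_measurable borel" using frac_deriv_borel[OF hd] by simp
  define Ia where "Ia x = U x * H x + V x * u x * h x + \<phi> x * u x * h x - \<bar>u x\<bar> powr r * u x * h x" for x
  define Ib where "Ib x = W l x * H x + l powr (2 * s) * V (l *\<^sub>R x) * w l x * h x + \<mu> * \<psi> l x * w l x * h x - \<bar>w l x\<bar> powr r * w l x * h x" for x
  have Ia: "integrable lborel Ia" "(LINT x|lborel. Ia x) = 0"
    using eq_u_integrable[OF hd h2] eq_u[OF hd h2] by (simp_all add: Ia_def[abs_def] r_def)
  have Ib: "integrable lborel Ib" "(LINT x|lborel. Ib x) = 0"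
    using eq_w_integrable[OF l hd h2] eq_w[OF l0(1) hd h2] by (simp_all add: Ib_def[abs_def] r_def \<mu>_def)
  define J where "J x = (w l x)\<^sup>2 * (\<psi> l x - \<phi> x) - (u x)\<^sup>2 * (\<psi> l x - \<phi> x)" for x
  have i: "integrable lborel (\<lambda>x. (w l x)\<^sup>2 * (\<psi> l x - \<phi> x))" "integrable lborel (\<lambda>x. (u x)\<^sup>2 * (\<psi> l x - \<phi> x))"
    using square_potential_integrable[OF l] by (simp_all add: right_diff_distrib)
  have Ji: "integrable lborel J" unfolding J_def[abs_def] using i by simp
  have J: "(LINT x|lborel. J x) = (LINT x|lborel. (\<Psi> l x - \<Phi> x)\<^sup>2)"
  proof -
    note pd = potential_difference_deriv[OF l0(1)] and pq = potential_difference_integrable[OF l0(1)]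
    have p: "integrable lborel (\<lambda>x. \<Psi> l x * (\<Psi> l x - \<Phi> x))" "integrable lborel (\<lambda>x. \<Phi> x * (\<Psi> l x - \<Phi> x))"
      by (rule deriv_product_integrable[OF \<psi>_deriv[OF l0(1)] pd], rule deriv_product_integrable[OF \<phi> pd])
    have "(LINT x|lborel. J x) = (LINT x|lborel. (w l x)\<^sup>2 * (\<psi> l x - \<phi> x)) - (LINT x|lborel. (u x)\<^sup>2 * (\<psi> l x - \<phi> x))"
      unfolding J_def using i by simp
    also have "\<dots> = (LINT x|lborel. \<Psi> l x * (\<Psi> l x - \<Phi> x)) - (LINT x|lborel. \<Phi> x * (\<Psi> l x - \<Phi> x))"
      unfolding eq_\<psi>[OF l0(1) pd pq] eq_\<phi>[OF pd pq] ..
    also have "\<dots> = (LINT x|lborel. \<Psi> l x * (\<Psi> l x - \<Phi> x) - \<Phi> x * (\<Psi> l x - \<Phi> x))" using p by simp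
    also have "\<dots> = (LINT x|lborel. (\<Psi> l x - \<Phi> x)\<^sup>2)"
      by (rule Bochner_Integration.integral_cong) (simp_all add: power2_eq_square algebra_simps)
    finally show ?thesis .
  qed
  have H2: "integrable lborel (\<lambda>x. (H x)\<^sup>2)" using frac_deriv_borel[OF hd] by simp
  obtain C where C: "\<And>x. \<bar>V x\<bar> \<le> C" using potential_facts(3)[OF s V] by blast
  have Vh: "integrable lborel (\<lambda>x. V x * (h x)\<^sup>2)"
    using integrable_bounded_product[OF V_borel hm hm C h2 h2] by (simp add: power2_eq_square mult.assoc)
  have pw: "integrable lborel (\<lambda>x. pot x * (f x)\<^sup>2)" if "admissible s f" for f
  proof -
    have "integrable lborel (\<lambda>x. excess l x * (f x)\<^sup>2 + 7 * (l - 1) * (weight l x * (f x)\<^sup>2))"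
      using excess_integrable[of f l] weight_integrable[OF that l0(2)] that by (simp add: admissible_def)
    then show ?thesis by (simp add: pot_def distrib_right mult.assoc)
  qed
  note pw = pw[OF w_admissible[OF l0(1)]] pw[OF ha] and wh = weight_integrable[OF ha l0(2)]
  have le: "(H x)\<^sup>2 + V x * (h x)\<^sup>2 + J x / 2 \<le> Ib x - Ia x + t * (pot x * (w l x)\<^sup>2) + pot x * (h x)\<^sup>2 / t + 21 * (weight l x * (h x)\<^sup>2)" for x
  proof -
    define A where "A = l powr (2 * s) * V (l *\<^sub>R x)"
    define y where "y = t * (w l x)\<^sup>2 + (h x)\<^sup>2 / t"
    have alg: "Ib x - Ia x = (H x)\<^sup>2 + V x * (h x)\<^sup>2 + J x / 2 + (A - V x) * (w l x * h x) + (\<mu> - 1) * (\<psi> l x * (w l x * h x))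
        + (\<phi> x + \<psi> l x) * (h x)\<^sup>2 / 2 - (\<bar>w l x\<bar> powr r * w l x - \<bar>u x\<bar> powr r * u x) * h x"
      unfolding Ib_def Ia_def J_def H_def h_def A_def[symmetric] by (simp add: power2_eq_square field_simps)
    have y: "\<bar>w l x * h x\<bar> \<le> y" unfolding y_def by (rule abs_mult_le_weighted[OF t])
    have A: "A - V x = excess l x" by (simp add: A_def excess_def)
    have 1: "- (excess l x * (w l x * h x)) \<le> excess l x * y"
    proof -
      have "excess l x * (- (w l x * h x)) \<le> excess l x * y"
        using y excess_nonneg[OF l0(2), of x] by (intro mult_left_mono) auto
      then show ?thesis by simp
    qed
    have 2: "- ((\<mu> - 1) * (\<psi> l x * (w l x * h x))) \<le> 7 * (l - 1) * weight l x * y"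
    proof -
      have "- ((\<mu> - 1) * (\<psi> l x * (w l x * h x))) \<le> \<bar>(\<mu> - 1) * (\<psi> l x * (w l x * h x))\<bar>" by simp
      also have "\<dots> = (\<mu> - 1) * (\<bar>\<psi> l x\<bar> * \<bar>w l x * h x\<bar>)"
        using mu_bounds(1)[OF l] l by (simp add: \<mu>_def abs_mult)
      also have "\<dots> \<le> (7 * (l - 1)) * (weight l x * y)"
        using mu_bounds(1,2)[OF l] l y weight_dominates(3)[OF l0(2) l(2), of x] weight_nonneg[of l x]
        by (intro mult_mono) (auto simp: \<mu>_def)
      finally show ?thesis by (simp add: mult.assoc)
    qed
    have 3: "- ((\<phi> x + \<psi> l x) * (h x)\<^sup>2 / 2) \<le> weight l x * (h x)\<^sup>2"
    proof -
      have "- (p + q) / 2 \<le> k" if "a + b \<le> k" "- p \<le> a" "- q \<le> b" "0 \<le> k" for p q a b k :: real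
        using that by (simp add: field_simps)
      from this[OF weight_dominates(7)[OF l0(2) l(2), of x] abs_ge_minus_self abs_ge_minus_self weight_nonneg] have "- (\<phi> x + \<psi> l x) / 2 \<le> weight l x" .
      then have "- (\<phi> x + \<psi> l x) / 2 * (h x)\<^sup>2 \<le> weight l x * (h x)\<^sup>2" by (rule mult_right_mono) simp
      moreover have "- ((\<phi> x + \<psi> l x) * (h x)\<^sup>2 / 2) = - (\<phi> x + \<psi> l x) / 2 * (h x)\<^sup>2" by (simp add: algebra_simps)
      ultimately show ?thesis by (simp only:)
    qed
    have 4: "(\<bar>w l x\<bar> powr r * w l x - \<bar>u x\<bar> powr r * u x) * h x \<le> 20 * (weight l x * (h x)\<^sup>2)"
      using power_difference_le(1)[OF l0(2) l(2), of x] by (simp add: r_def h_def)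
    have 5: "t * (pot x * (w l x)\<^sup>2) + pot x * (h x)\<^sup>2 / t = excess l x * y + 7 * (l - 1) * weight l x * y"
    proof -
      have "t * (pot x * (w l x)\<^sup>2) + pot x * (h x)\<^sup>2 / t = pot x * y" by (simp add: y_def distrib_left mult.left_commute)
      then show ?thesis by (simp only: pot_def distrib_right)
    qed
    from alg 1 2 3 4 5 show ?thesis unfolding A by linarith
  qed
  have "(LINT x|lborel. (H x)\<^sup>2 + V x * (h x)\<^sup>2 + J x / 2)
      \<le> (LINT x|lborel. Ib x - Ia x + t * (pot x * (w l x)\<^sup>2) + pot x * (h x)\<^sup>2 / t + 21 * (weight l x * (h x)\<^sup>2))"
    using H2 Vh Ji Ia Ib pw wh by (intro integral_mono le) auto
  then show ?thesis
    using H2 Vh Ji Ia Ib pw wh J by (simp add: h_def H_def)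
qed

text \<open>The equation of \<open>w\<close> tested with \<open>u\<close>, minus the equation of \<open>u\<close> tested with \<open>w\<close>: this is the
  finite-difference form of testing with the generator of the dilations.\<close>

lemma symmetric_inequality:
  assumes l: "1 < l" "l \<le> 2"
  shows "(l powr (6 * s - 3) - 1) / 4 * ((LINT x|lborel. (\<Phi> x)\<^sup>2) - (LINT x|lborel. (\<Psi> l x - \<Phi> x)\<^sup>2))
    \<le> (LINT x|lborel. excess l x * (w l x - u x)\<^sup>2) / 2 + 28 * (LINT x|lborel. weight l x * (w l x - u x)\<^sup>2)"
proof -
  have l0: "l > 0" "1 \<le> l" using l by auto
  define \<mu> where "\<mu> = l powr (6 * s - 3)"
  define r where "r = crit_exp s - 2"
  define h where "h x = w l x - u x" for x
  note h2 = difference_square_integrable[OF l0(1), folded h_def]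
  note ha = difference_admissible[OF l0(1), folded h_def]
  have hm[measurable]: "h \<in> borel_measurable borel" using ha by (simp add: admissible_def)
  note wd = w_deriv[OF l0(1)] and w2 = w_square_integrable[OF l0(1)]
  define Ia where "Ia x = U x * W l x + V x * u x * w l x + \<phi> x * u x * w l x - \<bar>u x\<bar> powr r * u x * w l x" for x
  define Ib where "Ib x = W l x * U x + l powr (2 * s) * V (l *\<^sub>R x) * w l x * u x + \<mu> * \<psi> l x * w l x * u x - \<bar>w l x\<bar> powr r * w l x * u x" for x
  have Ia: "integrable lborel Ia" "(LINT x|lborel. Ia x) = 0"
    using eq_u_integrable[OF wd w2] eq_u[OF wd w2] by (simp_all add: Ia_def[abs_def] r_def)
  have Ib: "integrable lborel Ib" "(LINT x|lborel. Ib x) = 0"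
    using eq_w_integrable[OF l u u2] eq_w[OF l0(1) u u2] by (simp_all add: Ib_def[abs_def] r_def \<mu>_def)
  define J where "J x = \<mu> * ((u x)\<^sup>2 * \<psi> l x + (w l x)\<^sup>2 * \<psi> l x) - ((u x)\<^sup>2 * \<phi> x + (w l x)\<^sup>2 * \<phi> x)" for x
  note sp = square_potential_integrable[OF l]
  have Ji: "integrable lborel J" unfolding J_def[abs_def] using sp by simp
  define X where "X = (LINT x|lborel. \<Phi> x * \<Psi> l x)"
  define D where "D = (LINT x|lborel. (\<Psi> l x - \<Phi> x)\<^sup>2)"
  define E where "E = (LINT x|lborel. (\<Phi> x)\<^sup>2)"
  define E' where "E' = (LINT x|lborel. (\<Psi> l x)\<^sup>2)"
  note \<psi>d = \<psi>_deriv[OF l0(1)] and \<psi>q = \<psi>_integrable[OF l0(1)]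
  have E': "\<mu> * E' = E" unfolding \<mu>_def E'_def E_def by (rule energy_\<psi>[OF l0(1)])
  have J: "(LINT x|lborel. J x) = (\<mu> - 1) * X"
  proof -
    have "(LINT x|lborel. (u x)\<^sup>2 * \<psi> l x) = X" using eq_\<phi>[OF \<psi>d \<psi>q] by (simp add: X_def)
    moreover have "(LINT x|lborel. (w l x)\<^sup>2 * \<psi> l x) = E'" using eq_\<psi>[OF l0(1) \<psi>d \<psi>q] by (simp add: E'_def power2_eq_square)
    moreover have "(LINT x|lborel. (u x)\<^sup>2 * \<phi> x) = E" using eq_\<phi>[OF \<phi> \<phi>q] by (simp add: E_def power2_eq_square)
    moreover have "(LINT x|lborel. (w l x)\<^sup>2 * \<phi> x) = X" using eq_\<psi>[OF l0(1) \<phi> \<phi>q] by (simp add: X_def mult.commute)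
    ultimately have "(LINT x|lborel. J x) = \<mu> * (X + E') - (E + X)" unfolding J_def using sp by simp
    then show ?thesis using E' by (simp add: algebra_simps)
  qed
  have X: "2 * X \<ge> E - D"
  proof -
    have i: "integrable lborel (\<lambda>x. \<Phi> x * \<Psi> l x)" "integrable lborel (\<lambda>x. (\<Phi> x)\<^sup>2)" "integrable lborel (\<lambda>x. (\<Psi> l x)\<^sup>2)"
      using deriv_product_integrable[OF \<phi> \<psi>d] frac_deriv_borel[OF \<phi>] frac_deriv_borel[OF \<psi>d] by auto
    have "D = (LINT x|lborel. (\<Psi> l x)\<^sup>2 + (\<Phi> x)\<^sup>2 - 2 * (\<Phi> x * \<Psi> l x))"
      unfolding D_def by (rule Bochner_Integration.integral_cong) (simp_all add: power2_eq_square algebra_simps)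
    also have "\<dots> = E' + E - 2 * X" unfolding E_def E'_def X_def using i by simp
    finally have "D = E' + E - 2 * X" .
    moreover have "E' \<ge> 0" by (simp add: E'_def)
    ultimately show ?thesis by simp
  qed
  have eh: "integrable lborel (\<lambda>x. excess l x * (h x)\<^sup>2)" by (rule excess_integrable[OF hm h2])
  have wh: "integrable lborel (\<lambda>x. weight l x * (h x)\<^sup>2)" by (rule weight_integrable[OF ha l0(2)])
  have q: "integrable lborel (\<lambda>x. \<bar>w l x\<bar> powr crit_exp s)" "integrable lborel (\<lambda>x. \<bar>u x\<bar> powr crit_exp s)"
    using w_admissible[OF l0(1)] u_admissible by (auto simp: admissible_def)
  define c where "c = (crit_exp s - 2) / crit_exp s"
  have le: "J x / 2 \<le> Ib x - Ia x + excess l x * (h x)\<^sup>2 / 2 + c * (\<bar>w l x\<bar> powr crit_exp s - \<bar>u x\<bar> powr crit_exp s) + 28 * (weight l x * (h x)\<^sup>2)" for x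
  proof -
    define A where "A = l powr (2 * s) * V (l *\<^sub>R x)"
    have alg: "Ib x - Ia x = J x / 2 + (A - V x) * (u x * w l x) - (\<mu> * \<psi> l x - \<phi> x) * (h x)\<^sup>2 / 2
        - (\<bar>w l x\<bar> powr r * w l x * u x - \<bar>u x\<bar> powr r * u x * w l x)"
      unfolding Ib_def Ia_def J_def h_def A_def[symmetric] by (simp add: power2_eq_square field_simps)
    have A: "A - V x = excess l x" by (simp add: A_def excess_def)
    have 1: "- (excess l x * (u x * w l x)) \<le> excess l x * (h x)\<^sup>2 / 2"
    proof -
      have "(h x)\<^sup>2 = (u x)\<^sup>2 + (w l x)\<^sup>2 - 2 * (u x * w l x)" by (simp add: h_def power2_eq_square algebra_simps)
      then have "- (u x * w l x) \<le> (h x)\<^sup>2 / 2" using zero_le_power2[of "u x"] zero_le_power2[of "w l x"] by linarith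
      then have "excess l x * (- (u x * w l x)) \<le> excess l x * ((h x)\<^sup>2 / 2)"
        using excess_nonneg[OF l0(2), of x] by (intro mult_left_mono) auto
      then show ?thesis by simp
    qed
    have 2: "(\<mu> * \<psi> l x - \<phi> x) * (h x)\<^sup>2 / 2 \<le> 4 * (weight l x * (h x)\<^sup>2)"
    proof -
      have "\<mu> * \<psi> l x \<le> \<mu> * \<bar>\<psi> l x\<bar>" by (intro mult_left_mono) (auto simp: \<mu>_def)
      also have "\<dots> \<le> 8 * \<bar>\<psi> l x\<bar>" using mu_bounds(3)[OF l] by (intro mult_right_mono) (auto simp: \<mu>_def)
      finally have le: "\<mu> * \<psi> l x \<le> 8 * \<bar>\<psi> l x\<bar>" .
      have "m - p \<le> 8 * (a + k)" if "m \<le> 8 * k" "- p \<le> a" "0 \<le> a" for m p k a :: real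
        using that by simp
      from this[OF le abs_ge_minus_self abs_ge_zero] have "\<mu> * \<psi> l x - \<phi> x \<le> 8 * (\<bar>\<phi> x\<bar> + \<bar>\<psi> l x\<bar>)" .
      also have "\<dots> \<le> 8 * weight l x" using weight_dominates(7)[OF l0(2) l(2), of x] by simp
      finally have "(\<mu> * \<psi> l x - \<phi> x) * (h x)\<^sup>2 \<le> (8 * weight l x) * (h x)\<^sup>2" by (rule mult_right_mono) simp
      then show ?thesis by simp
    qed
    have 3: "\<bar>w l x\<bar> powr r * w l x * u x - \<bar>u x\<bar> powr r * u x * w l x \<le> c * (\<bar>w l x\<bar> powr crit_exp s - \<bar>u x\<bar> powr crit_exp s) + 24 * (weight l x * (h x)\<^sup>2)"
      using power_difference_le(2)[OF l0(2) l(2), of x] by (simp add: r_def h_def c_def)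
    from alg 1 2 3 show ?thesis unfolding A by linarith
  qed
  have "(LINT x|lborel. J x / 2)
      \<le> (LINT x|lborel. Ib x - Ia x + excess l x * (h x)\<^sup>2 / 2 + c * (\<bar>w l x\<bar> powr crit_exp s - \<bar>u x\<bar> powr crit_exp s) + 28 * (weight l x * (h x)\<^sup>2))"
    using Ji Ia Ib eh wh q by (intro integral_mono le) auto
  also have "\<dots> = (LINT x|lborel. excess l x * (h x)\<^sup>2) / 2 + 28 * (LINT x|lborel. weight l x * (h x)\<^sup>2)"
    using Ji Ia Ib eh wh q integral_w_crit[OF l0(1)] by simp
  finally have "(\<mu> - 1) * X / 2 \<le> (LINT x|lborel. excess l x * (h x)\<^sup>2) / 2 + 28 * (LINT x|lborel. weight l x * (h x)\<^sup>2)"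
    using J by simp
  moreover have "(\<mu> - 1) * (E - D) \<le> (\<mu> - 1) * (2 * X)" using X mu_bounds(1)[OF l] l by (intro mult_left_mono) (auto simp: \<mu>_def)
  ultimately show ?thesis by (simp add: \<mu>_def E_def D_def h_def)
qed

end

section \<open>Vanishing of the solution\<close>

context weak_pair
begin

lemma local_estimate:
  assumes R: "R > 0"
  obtains L where "L \<ge> 0" "\<And>l. 1 < l \<Longrightarrow> l \<le> 2 \<Longrightarrow>
    (LINT x|lborel. indicator (ball 0 R) x * (w l x - u x)\<^sup>2) \<le> L * (l - 1) powr (2 * s)"
proof -
  define E0 where "E0 = (LINT x|lborel. (u x)\<^sup>2)"
  define E1 where "E1 = (LINT x|lborel. (U x)\<^sup>2)"
  have E: "E0 \<ge> 0" "E1 \<ge> 0" by (simp_all add: E0_def E1_def)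
  define L where "L = 8 * (264 * R powr (2 * s) * E1) + 2 * E0"
  show thesis
  proof (rule that[of L])
    show "L \<ge> 0" using E by (simp add: L_def)
    fix l :: real assume l: "1 < l" "l \<le> 2"
    define b where "b = l powr ((3 - 2 * s) / 2)"
    define d where "d x = u (l *\<^sub>R x) - u x" for x
    have "l powr 0 \<le> b" "b \<le> l powr 1" unfolding b_def by (rule powr_mono; use l s in simp)+
    then have b: "1 \<le> b" "b \<le> l" "b \<le> 2" using l by auto
    have "integrable lborel (\<lambda>x. (u (l *\<^sub>R x))\<^sup>2)"
      using integrable_lborel_dilate_iff[of "\<lambda>x. (u x)\<^sup>2" l] u2 l by simp
    then have "integrable lborel (\<lambda>x. (1 * u (l *\<^sub>R x) + (- 1) * u x)\<^sup>2)"
      by (intro integrable_lincomb_L2 u2) auto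
    then have d2: "integrable lborel (\<lambda>x. (d x)\<^sup>2)" by (simp add: d_def)
    note h2 = difference_square_integrable[of l]
    have le: "(w l x - u x)\<^sup>2 \<le> 8 * (d x)\<^sup>2 + 2 * (l - 1)\<^sup>2 * (u x)\<^sup>2" for x
    proof -
      have e: "w l x - u x = b * d x + (b - 1) * u x" by (simp add: w_def b_def d_def algebra_simps)
      have "(w l x - u x)\<^sup>2 \<le> 2 * (b * d x)\<^sup>2 + 2 * ((b - 1) * u x)\<^sup>2"
        using square_norm_add_le[of "b * d x" "(b - 1) * u x"] by (simp only: e real_norm_def power2_abs)
      also have "\<dots> = 2 * b\<^sup>2 * (d x)\<^sup>2 + 2 * (b - 1)\<^sup>2 * (u x)\<^sup>2" by (simp add: power_mult_distrib)
      also have "\<dots> \<le> 2 * 2\<^sup>2 * (d x)\<^sup>2 + 2 * (l - 1)\<^sup>2 * (u x)\<^sup>2"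
        using b by (intro add_mono mult_right_mono mult_left_mono power_mono) auto
      finally show ?thesis by simp
    qed
    have "(LINT x|lborel. indicator (ball 0 R) x * (w l x - u x)\<^sup>2)
        \<le> (LINT x|lborel. 8 * (indicator (ball 0 R) x * (d x)\<^sup>2) + 2 * (l - 1)\<^sup>2 * (u x)\<^sup>2)"
    proof (rule integral_mono)
      show "integrable lborel (\<lambda>x. indicator (ball 0 R) x * (w l x - u x)\<^sup>2)"
        using l h2 by (intro indicator_ball_integrable) auto
      show "integrable lborel (\<lambda>x. 8 * (indicator (ball 0 R) x * (d x)\<^sup>2) + 2 * (l - 1)\<^sup>2 * (u x)\<^sup>2)"
        using indicator_ball_integrable[OF d2] u2 by simp
      fix x show "indicator (ball 0 R) x * (w l x - u x)\<^sup>2 \<le> 8 * (indicator (ball 0 R) x * (d x)\<^sup>2) + 2 * (l - 1)\<^sup>2 * (u x)\<^sup>2"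
        using le[of x] by (auto simp: indicator_def)
    qed
    also have "\<dots> = 8 * (LINT x|lborel. indicator (ball 0 R) x * (d x)\<^sup>2) + 2 * (l - 1)\<^sup>2 * E0"
      using indicator_ball_integrable[OF d2] u2 by (simp add: E0_def)
    also have "\<dots> \<le> 8 * (264 * ((l - 1) * R) powr (2 * s) * E1) + 2 * (l - 1) powr (2 * s) * E0"
    proof (intro add_mono mult_left_mono mult_right_mono)
      show "(LINT x|lborel. indicator (ball 0 R) x * (d x)\<^sup>2) \<le> 264 * ((l - 1) * R) powr (2 * s) * E1"
        unfolding d_def E1_def using s by (intro dilation_estimate[OF u u2 _ _ R l(1)]) auto
      have "(l - 1) powr 2 \<le> (l - 1) powr (2 * s)" using l s by (intro powr_mono') auto
      then show "(l - 1)\<^sup>2 \<le> (l - 1) powr (2 * s)" using l by (simp add: powr_numeral)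
    qed (use E in auto)
    also have "\<dots> = L * (l - 1) powr (2 * s)"
    proof -
      have "((l - 1) * R) powr (2 * s) = (l - 1) powr (2 * s) * R powr (2 * s)" by (rule powr_mult)
      then show ?thesis unfolding L_def by (simp add: distrib_right)
    qed
    finally show "(LINT x|lborel. indicator (ball 0 R) x * (w l x - u x)\<^sup>2) \<le> L * (l - 1) powr (2 * s)" .
  qed
qed

definition deviation where
  "deviation l = (LINT x|lborel. (w l x - u x)\<^sup>2) + (LINT x|lborel. (W l x - U x)\<^sup>2) + (LINT x|lborel. (\<Psi> l x - \<Phi> x)\<^sup>2)"

lemma deviation_small:
  assumes e: "e > 0"
  obtains \<eta> where "\<eta> > 0" "\<eta> \<le> 1" "\<And>l. 1 < l \<Longrightarrow> l \<le> 1 + \<eta> \<Longrightarrow> deviation l \<le> e * (l - 1)"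
proof -
  obtain S where S1: "S \<ge> 1" and S: "\<And>f F. frac_deriv s f F \<Longrightarrow> integrable lborel (\<lambda>x. (f x)\<^sup>2) \<Longrightarrow>
    admissible s f \<and> mixed_size s f \<le> S * ((LINT x|lborel. (f x)\<^sup>2) + (LINT x|lborel. (F x)\<^sup>2))"
    by (rule mixed_size_Sobolev[OF s_range(1,2)]) (rule that)
  obtain M where M: "M \<ge> 0" and ex: "\<And>f l. admissible s f \<Longrightarrow> 1 \<le> l \<Longrightarrow> l \<le> 2 \<Longrightarrow>
    (LINT x|lborel. excess l x * (f x)\<^sup>2) \<le> (l - 1) * (M * mixed_size s f)"
    by (rule excess_bound) (rule that)
  obtain P where P: "P \<ge> 0" and wg: "\<And>f l. admissible s f \<Longrightarrow> l \<ge> 1 \<Longrightarrow> (LINT x|lborel. weight l x * (f x)\<^sup>2) \<le> P * mixed_size s f"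
    by (rule weight_bound_global) (rule that)
  obtain C c R0 where C: "\<And>x. \<bar>V x\<bar> \<le> C" and c: "c > 0" and R0: "R0 > 0" and Vc: "\<And>x. R0 \<le> norm x \<Longrightarrow> c \<le> V x"
    by (rule V_bounds) (rule that)
  define c1 where "c1 = min 1 c"
  have c1: "0 < c1" "c1 \<le> 1" "c1 \<le> c" using c by (auto simp: c1_def)
  define N where "N = M + 7 * P"
  have N: "N \<ge> 0" using M P by (simp add: N_def)
  define X0 where "X0 = (LINT x|lborel. (u x)\<^sup>2) + (LINT x|lborel. (U x)\<^sup>2)"
  have X0: "X0 \<ge> 0" by (simp add: X0_def)
  define Z where "Z = S * (N * X0)"
  have Z: "Z \<ge> 0" using S1 N X0 by (simp add: Z_def)
  \<comment> \<open>\<open>t\<close> absorbs the potential terms in \<open>w\<close>, and \<open>\<delta>\<close> those in \<open>w - u\<close>, into the left-hand side.\<close>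
  define t where "t = e * c1 / (8 * (Z + 1))"
  have t: "t > 0" using e c1 Z by (simp add: t_def)
  define \<delta> where "\<delta> = c1 / (4 * 21 * S)"
  have \<delta>: "\<delta> > 0" using c1 S1 by (simp add: \<delta>_def)
  obtain K R where K: "K \<ge> 0" and R: "R > 0" and wb: "\<And>f l. admissible s f \<Longrightarrow> l \<ge> 1 \<Longrightarrow>
    integrable lborel (\<lambda>x. weight l x * (f x)\<^sup>2) \<and>
    (LINT x|lborel. weight l x * (f x)\<^sup>2) \<le> \<delta> * mixed_size s f + K * (LINT x|lborel. indicator (ball 0 R) x * (f x)\<^sup>2)"
    by (rule weight_bound[OF \<delta>]) (rule that)
  obtain L1 where L1: "L1 \<ge> 0" and loc1: "\<And>l. 1 < l \<Longrightarrow> l \<le> 2 \<Longrightarrow>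
    (LINT x|lborel. indicator (ball 0 R) x * (w l x - u x)\<^sup>2) \<le> L1 * (l - 1) powr (2 * s)"
    by (rule local_estimate[OF R]) (rule that)
  obtain L2 where L2: "L2 \<ge> 0" and loc2: "\<And>l. 1 < l \<Longrightarrow> l \<le> 2 \<Longrightarrow>
    (LINT x|lborel. indicator (ball 0 R0) x * (w l x - u x)\<^sup>2) \<le> L2 * (l - 1) powr (2 * s)"
    by (rule local_estimate[OF R0]) (rule that)
  have C0: "C \<ge> 0" using C[of 0] abs_ge_zero order_trans by blast
  define B where "B = 21 * (K * L1) + (C + c) * L2"
  have B: "B \<ge> 0" using K L1 C0 c L2 by (simp add: B_def)
  define \<eta>1 where "\<eta>1 = c1 * t / (4 * (S * N + 1))"
  have \<eta>1: "\<eta>1 > 0" using c1 t S1 N by (simp add: \<eta>1_def add_nonneg_pos)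
  define \<eta>2 where "\<eta>2 = (e * c1 / (8 * (B + 1))) powr (1 / (2 * s - 1))"
  have \<eta>2: "\<eta>2 > 0" using e c1 B by (simp add: \<eta>2_def)
  define \<eta> where "\<eta> = min 1 (min \<eta>1 \<eta>2)"
  show thesis
  proof (rule that[of \<eta>])
    show "\<eta> > 0" "\<eta> \<le> 1" using \<eta>1 \<eta>2 by (auto simp: \<eta>_def)
    fix l assume l1: "1 < l" and l\<eta>: "l \<le> 1 + \<eta>"
    then have l2: "l \<le> 2" and k1: "l - 1 \<le> \<eta>1" and k2: "l - 1 \<le> \<eta>2" by (auto simp: \<eta>_def)
    have l0: "l > 0" "1 \<le> l" using l1 by auto
    define k where "k = l - 1"
    have k: "k > 0" "k \<le> \<eta>1" "k \<le> \<eta>2" using l1 k1 k2 by (auto simp: k_def)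
    define h where "h x = w l x - u x" for x
    note hd = difference_deriv[OF l0(1), folded h_def]
    note h2 = difference_square_integrable[OF l0(1), folded h_def]
    note ha = difference_admissible[OF l0(1), folded h_def]
    have hm: "h \<in> borel_measurable borel" using ha by (simp add: admissible_def)
    define Eh where "Eh = (LINT x|lborel. (W l x - U x)\<^sup>2)"
    define h0 where "h0 = (LINT x|lborel. (h x)\<^sup>2)"
    define D where "D = (LINT x|lborel. (\<Psi> l x - \<Phi> x)\<^sup>2)"
    have nn: "Eh \<ge> 0" "h0 \<ge> 0" "D \<ge> 0" by (simp_all add: Eh_def h0_def D_def)
    define pot where "pot x = excess l x + 7 * (l - 1) * weight l x" for x
    have pot: "(LINT x|lborel. pot x * (f x)\<^sup>2) \<le> k * (N * mixed_size s f)" if f: "admissible s f" for f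
    proof -
      have i: "integrable lborel (\<lambda>x. excess l x * (f x)\<^sup>2)" "integrable lborel (\<lambda>x. weight l x * (f x)\<^sup>2)"
        using excess_integrable[of f l] weight_integrable[OF f l0(2)] f by (simp_all add: admissible_def)
      have "(LINT x|lborel. pot x * (f x)\<^sup>2) = (LINT x|lborel. excess l x * (f x)\<^sup>2 + 7 * (l - 1) * (weight l x * (f x)\<^sup>2))"
        by (rule Bochner_Integration.integral_cong) (simp_all add: pot_def distrib_right mult.assoc)
      also have "\<dots> = (LINT x|lborel. excess l x * (f x)\<^sup>2) + 7 * k * (LINT x|lborel. weight l x * (f x)\<^sup>2)"
        using i by (simp add: k_def)
      also have "\<dots> \<le> k * (M * mixed_size s f) + 7 * k * (P * mixed_size s f)"
        using ex[OF f l0(2) l2] wg[OF f l0(2)] k by (intro add_mono mult_left_mono) (auto simp: k_def)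
      also have "\<dots> = k * (N * mixed_size s f)" by (simp add: N_def algebra_simps)
      finally show ?thesis .
    qed
    have Yh: "mixed_size s h \<le> S * (h0 + Eh)" using S[OF hd h2] by (simp add: h0_def Eh_def)
    have Yw: "mixed_size s (w l) \<le> S * X0"
    proof -
      have "mixed_size s (w l) \<le> S * ((LINT x|lborel. (w l x)\<^sup>2) + (LINT x|lborel. (W l x)\<^sup>2))"
        using S[OF w_deriv[OF l0(1)] w_square_integrable[OF l0(1)]] by simp
      also have "\<dots> \<le> S * X0" using S1 energy_w_le[OF l0(2)] by (intro mult_left_mono) (auto simp: X0_def)
      finally show ?thesis .
    qed
    define p where "p = k powr (2 * s)"
    have main: "Eh + (LINT x|lborel. V x * (h x)\<^sup>2) + D / 2
      \<le> t * (LINT x|lborel. pot x * (w l x)\<^sup>2) + (LINT x|lborel. pot x * (h x)\<^sup>2) / t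
        + 21 * (LINT x|lborel. weight l x * (h x)\<^sup>2)"
      unfolding Eh_def D_def h_def pot_def by (rule difference_inequality[OF l1 l2 t])
    have Vl: "c * h0 - (C + c) * (L2 * p) \<le> (LINT x|lborel. V x * (h x)\<^sup>2)"
    proof -
      have ih: "integrable lborel (\<lambda>x. indicator (ball 0 R0) x * (h x)\<^sup>2)" by (rule indicator_ball_integrable[OF h2])
      have iV: "integrable lborel (\<lambda>x. V x * (h x)\<^sup>2)"
        using integrable_bounded_product[OF V_borel hm hm C h2 h2] by (simp add: power2_eq_square mult.assoc)
      have "(LINT x|lborel. c * (h x)\<^sup>2 - (C + c) * (indicator (ball 0 R0) x * (h x)\<^sup>2)) \<le> (LINT x|lborel. V x * (h x)\<^sup>2)"
      proof (rule integral_mono[OF _ iV])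
        show "integrable lborel (\<lambda>x. c * (h x)\<^sup>2 - (C + c) * (indicator (ball 0 R0) x * (h x)\<^sup>2))" using h2 ih by simp
        fix x
        have "c - (C + c) * indicator (ball 0 R0) x \<le> V x"
        proof (cases "x \<in> ball 0 R0")
          case True
          have "- C \<le> V x" using C[of x] by (simp add: abs_le_iff)
          then show ?thesis using True by simp
        qed (use Vc[of x] in auto)
        then have "(c - (C + c) * indicator (ball 0 R0) x) * (h x)\<^sup>2 \<le> V x * (h x)\<^sup>2" by (rule mult_right_mono) simp
        then show "c * (h x)\<^sup>2 - (C + c) * (indicator (ball 0 R0) x * (h x)\<^sup>2) \<le> V x * (h x)\<^sup>2"
          by (simp add: left_diff_distrib mult.assoc)
      qed
      moreover have "(LINT x|lborel. c * (h x)\<^sup>2 - (C + c) * (indicator (ball 0 R0) x * (h x)\<^sup>2))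
          = c * h0 - (C + c) * (LINT x|lborel. indicator (ball 0 R0) x * (h x)\<^sup>2)"
        using h2 ih by (simp add: h0_def)
      moreover have "(C + c) * (LINT x|lborel. indicator (ball 0 R0) x * (h x)\<^sup>2) \<le> (C + c) * (L2 * p)"
        unfolding h_def p_def k_def using C0 c loc2[OF l1 l2] by (intro mult_left_mono) auto
      ultimately show ?thesis by linarith
    qed
    have A: "t * (LINT x|lborel. pot x * (w l x)\<^sup>2) \<le> e * c1 / 8 * k"
    proof -
      have "t * (LINT x|lborel. pot x * (w l x)\<^sup>2) \<le> t * (k * (N * (S * X0)))"
        using order_trans[OF pot[OF w_admissible[OF l0(1)]]] t k N Yw by (simp add: mult_left_mono)
      also have "\<dots> = e * c1 / 8 * k * (Z / (Z + 1))" by (simp add: t_def Z_def algebra_simps)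
      also have "\<dots> \<le> e * c1 / 8 * k * 1" using e c1 k Z by (intro mult_left_mono) auto
      finally show ?thesis by simp
    qed
    have B1: "(LINT x|lborel. pot x * (h x)\<^sup>2) / t \<le> c1 / 4 * (h0 + Eh)"
    proof -
      have "(LINT x|lborel. pot x * (h x)\<^sup>2) \<le> k * (N * (S * (h0 + Eh)))"
        using order_trans[OF pot[OF ha]] k N Yh by (simp add: mult_left_mono)
      also have "\<dots> \<le> \<eta>1 * ((S * N + 1) * (h0 + Eh))"
      proof (rule mult_mono)
        show "N * (S * (h0 + Eh)) \<le> (S * N + 1) * (h0 + Eh)" using nn by (simp add: algebra_simps)
        show "0 \<le> N * (S * (h0 + Eh))" using N S1 nn by simp
      qed (use k \<eta>1 in auto)
      also have "\<dots> = c1 / 4 * (h0 + Eh) * t"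
      proof -
        have "S * N + 1 > 0" using S1 N by (simp add: add_nonneg_pos)
        moreover have "c1 * t / (4 * G) * (G * y) = c1 / 4 * y * t" if "G > 0" for G y :: real
          using that by simp
        ultimately show ?thesis unfolding \<eta>1_def by blast
      qed
      finally show ?thesis using t by (simp add: divide_le_eq)
    qed
    have B2: "21 * (LINT x|lborel. weight l x * (h x)\<^sup>2) \<le> c1 / 4 * (h0 + Eh) + 21 * (K * L1) * p"
    proof -
      have "(LINT x|lborel. weight l x * (h x)\<^sup>2) \<le> \<delta> * mixed_size s h + K * (LINT x|lborel. indicator (ball 0 R) x * (h x)\<^sup>2)"
        using wb[OF ha l0(2)] by simp
      also have "\<dots> \<le> \<delta> * (S * (h0 + Eh)) + K * (L1 * p)"
        using \<delta> Yh K loc1[OF l1 l2] by (intro add_mono mult_left_mono) (auto simp: h_def p_def k_def)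
      also have "\<delta> * (S * (h0 + Eh)) = c1 / 84 * (h0 + Eh)" using S1 by (simp add: \<delta>_def)
      finally show ?thesis by simp
    qed
    have B3: "B * p \<le> e * c1 / 8 * k"
    proof -
      have "p = k powr (2 * s - 1) * k" using k powr_add[of k "2 * s - 1" 1] by (simp add: p_def)
      moreover have "k powr (2 * s - 1) \<le> \<eta>2 powr (2 * s - 1)" using k s by (intro powr_mono2) auto
      moreover have "\<eta>2 powr (2 * s - 1) = e * c1 / (8 * (B + 1))"
        unfolding \<eta>2_def powr_powr using s e c1 B by simp
      ultimately have "p = k powr (2 * s - 1) * k" "k powr (2 * s - 1) \<le> e * c1 / (8 * (B + 1))" by (simp_all only:)
      then have "p \<le> e * c1 / (8 * (B + 1)) * k" using mult_right_mono[of "k powr (2 * s - 1)" _ k] k by (simp only: less_imp_le)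
      then have "B * p \<le> B * (e * c1 / (8 * (B + 1)) * k)" using B by (rule mult_left_mono)
      also have "\<dots> = e * c1 / 8 * k * (B / (B + 1))" by simp
      also have "\<dots> \<le> e * c1 / 8 * k * 1" using e c1 k B by (intro mult_left_mono) auto
      finally show ?thesis by simp
    qed
    have "c1 * (h0 + Eh) + D / 2 \<le> Eh + c * h0 + D / 2"
      using c1 nn mult_right_mono[OF c1(3) nn(2)] mult_right_mono[OF c1(2) nn(1)] by (simp add: distrib_left)
    also have "\<dots> \<le> e * c1 / 8 * k + c1 / 4 * (h0 + Eh) + (c1 / 4 * (h0 + Eh) + 21 * (K * L1) * p) + (C + c) * (L2 * p)"
      using main Vl A B1 B2 by linarith
    also have "\<dots> = e * c1 / 8 * k + c1 / 2 * (h0 + Eh) + B * p" by (simp add: B_def algebra_simps)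
    also have "\<dots> \<le> e * c1 / 4 * k + c1 / 2 * (h0 + Eh)" using B3 by linarith
    finally have "c1 / 2 * (h0 + Eh) + D / 2 \<le> e * c1 / 4 * k" by (simp add: field_simps)
    moreover have "c1 / 2 * D \<le> D / 2" using mult_right_mono[OF c1(2) nn(3)] by simp
    moreover have "c1 / 2 * (h0 + Eh + D) = c1 / 2 * (h0 + Eh) + c1 / 2 * D" by (simp only: distrib_left)
    moreover have "c1 / 2 * (e / 2 * k) = e * c1 / 4 * k" by simp
    ultimately have "c1 / 2 * (h0 + Eh + D) \<le> c1 / 2 * (e / 2 * k)" by linarith
    then have "h0 + Eh + D \<le> e / 2 * k" using c1 by simp
    also have "\<dots> \<le> e * k" using e k by simp
    finally show "deviation l \<le> e * (l - 1)" by (simp add: deviation_def h0_def Eh_def D_def h_def k_def)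
  qed
qed

theorem potential_energy_zero: "(LINT x|lborel. (\<Phi> x)\<^sup>2) = 0"
proof -
  obtain S where S1: "S \<ge> 1" and S: "\<And>f F. frac_deriv s f F \<Longrightarrow> integrable lborel (\<lambda>x. (f x)\<^sup>2) \<Longrightarrow>
    admissible s f \<and> mixed_size s f \<le> S * ((LINT x|lborel. (f x)\<^sup>2) + (LINT x|lborel. (F x)\<^sup>2))"
    by (rule mixed_size_Sobolev[OF s_range(1,2)]) (rule that)
  obtain M where M: "M \<ge> 0" and ex: "\<And>f l. admissible s f \<Longrightarrow> 1 \<le> l \<Longrightarrow> l \<le> 2 \<Longrightarrow>
    (LINT x|lborel. excess l x * (f x)\<^sup>2) \<le> (l - 1) * (M * mixed_size s f)"
    by (rule excess_bound) (rule that)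
  obtain P where P: "P \<ge> 0" and wg: "\<And>f l. admissible s f \<Longrightarrow> l \<ge> 1 \<Longrightarrow> (LINT x|lborel. weight l x * (f x)\<^sup>2) \<le> P * mixed_size s f"
    by (rule weight_bound_global) (rule that)
  define E where "E = (LINT x|lborel. (\<Phi> x)\<^sup>2)"
  define N where "N = 4 * ((M / 2 + 28 * P) * S) + 7"
  have N: "N > 0" using M P S1 by (simp add: N_def add_nonneg_pos)
  have "E \<le> 0 + \<epsilon>" if \<epsilon>: "\<epsilon> > 0" for \<epsilon>
  proof -
    have e: "\<epsilon> / N > 0" using \<epsilon> N by simp
    obtain \<eta> where \<eta>: "\<eta> > 0" "\<eta> \<le> 1" and small: "\<And>l. 1 < l \<Longrightarrow> l \<le> 1 + \<eta> \<Longrightarrow> deviation l \<le> \<epsilon> / N * (l - 1)"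
      by (rule deviation_small[OF e]) (rule that)
    define l where "l = 1 + \<eta>"
    have l: "1 < l" "l \<le> 2" using \<eta> by (auto simp: l_def)
    have l0: "l > 0" "1 \<le> l" using l by auto
    define m where "m = l powr (6 * s - 3) - 1"
    have m: "\<eta> \<le> m" "m \<le> 7" using mu_bounds[OF l] \<eta> by (auto simp: m_def l_def)
    define h0 where "h0 = (LINT x|lborel. (w l x - u x)\<^sup>2)"
    define Eh where "Eh = (LINT x|lborel. (W l x - U x)\<^sup>2)"
    define D where "D = (LINT x|lborel. (\<Psi> l x - \<Phi> x)\<^sup>2)"
    have nn: "Eh \<ge> 0" "h0 \<ge> 0" "D \<ge> 0" "E \<ge> 0" by (simp_all add: Eh_def h0_def D_def E_def)
    note ha = difference_admissible[OF l0(1)]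
    define Y where "Y = mixed_size s (\<lambda>x. w l x - u x)"
    have Y0: "Y \<ge> 0" unfolding Y_def by (rule mixed_size_nonneg)
    have Y: "Y \<le> S * (h0 + Eh)"
      using S[OF difference_deriv[OF l0(1)] difference_square_integrable[OF l0(1)]] by (simp add: Y_def h0_def Eh_def)
    have dev: "h0 + Eh + D \<le> \<epsilon> / N * \<eta>" using small[of l] l by (simp add: deviation_def h0_def Eh_def D_def l_def)
    have "m / 4 * (E - D) \<le> (LINT x|lborel. excess l x * (w l x - u x)\<^sup>2) / 2 + 28 * (LINT x|lborel. weight l x * (w l x - u x)\<^sup>2)"
      unfolding m_def E_def D_def by (rule symmetric_inequality[OF l])
    also have "\<dots> \<le> (1 * (M * Y)) / 2 + 28 * (P * Y)"
    proof -
      have "(l - 1) * (M * Y) \<le> 1 * (M * Y)" using l M Y0 by (intro mult_right_mono) auto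
      then have "(LINT x|lborel. excess l x * (w l x - u x)\<^sup>2) \<le> 1 * (M * Y)"
        using ex[OF ha l0(2) l(2)] unfolding Y_def by (rule order_trans[rotated])
      moreover have "(LINT x|lborel. weight l x * (w l x - u x)\<^sup>2) \<le> P * Y" unfolding Y_def by (rule wg[OF ha l0(2)])
      ultimately show ?thesis by simp
    qed
    also have "\<dots> = (M / 2 + 28 * P) * Y" by (simp add: algebra_simps)
    also have "\<dots> \<le> (M / 2 + 28 * P) * (S * (h0 + Eh))" using M P Y by (intro mult_left_mono) auto
    finally have 1: "m * E \<le> 4 * ((M / 2 + 28 * P) * S) * (h0 + Eh) + m * D" by (simp add: algebra_simps)
    have "\<eta> * E \<le> m * E" using m nn by (intro mult_right_mono) auto
    also note 1
    also have "4 * ((M / 2 + 28 * P) * S) * (h0 + Eh) + m * D \<le> 4 * ((M / 2 + 28 * P) * S) * (h0 + Eh + D) + 7 * (h0 + Eh + D)"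
    proof (rule add_mono)
      show "m * D \<le> 7 * (h0 + Eh + D)" using m nn by (intro mult_mono) auto
      show "4 * ((M / 2 + 28 * P) * S) * (h0 + Eh) \<le> 4 * ((M / 2 + 28 * P) * S) * (h0 + Eh + D)"
        by (rule mult_left_mono) (use nn M P S1 in auto)
    qed
    also have "\<dots> = N * (h0 + Eh + D)" by (simp only: N_def distrib_right)
    also have "\<dots> \<le> N * (\<epsilon> / N * \<eta>)" using N dev by (intro mult_left_mono) auto
    also have "\<dots> = \<eta> * \<epsilon>" using N by simp
    finally show ?thesis using \<eta> by simp
  qed
  then have "E \<le> 0" by (rule field_le_epsilon)
  moreover have "E \<ge> 0" by (simp add: E_def)
  ultimately have "E = 0" by (rule order_antisym)
  then show ?thesis by (simp add: E_def)
qed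

lemma potential_zero: "AE x in lborel. \<phi> x = 0"
proof (rule frac_deriv_zero[OF \<phi>])
  have "integrable lborel (\<lambda>x. (\<Phi> x)\<^sup>2)" using frac_deriv_borel[OF \<phi>] by simp
  then show "AE x in lborel. \<Phi> x = 0"
    using potential_energy_zero integral_nonneg_eq_0_iff_AE[of lborel "\<lambda>x. (\<Phi> x)\<^sup>2"] by simp
qed

text \<open>As \<open>\<Phi> = 0\<close>, the second equation tested with a Gaussian gives \<open>u = 0\<close>.\<close>

lemma solution_zero: "AE x in lborel. u x = 0"
proof -
  define v :: "real^3 \<Rightarrow> real" where "v x = exp (- 1 * (norm x)\<^sup>2)" for x
  have vD: "v \<in> Dspace s" unfolding v_def[abs_def] by (rule gaussian_Dspace[OF s_range])
  have vm[measurable]: "v \<in> borel_measurable borel" unfolding v_def[abs_def] by measurable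
  obtain Z where Z: "frac_deriv s v Z"
    by (rule frac_deriv_exists[OF vm s_range(1) disjI2[OF vD]])
  have vq: "integrable lborel (\<lambda>x. \<bar>v x\<bar> powr crit_exp s)"
    using vD Lp_iff_borel[OF vm, of "crit_exp s"] by (simp add: Dspace_def)
  have "integrable lborel (\<lambda>x. (\<Phi> x)\<^sup>2)" using frac_deriv_borel[OF \<phi>] by simp
  then have "AE x in lborel. \<Phi> x = 0"
    using potential_energy_zero integral_nonneg_eq_0_iff_AE[of lborel "\<lambda>x. (\<Phi> x)\<^sup>2"] by simp
  then have "(LINT x|lborel. \<Phi> x * Z x) = (LINT x|(lborel :: (real^3) measure). 0)"
    using frac_deriv_borel[OF Z] by (intro integral_cong_AE) auto
  then have z: "(LINT x|lborel. (u x)\<^sup>2 * v x) = 0" using eq_\<phi>[OF Z vq] by simp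
  have i: "integrable lborel (\<lambda>x. (u x)\<^sup>2 * v x)"
  proof (rule Bochner_Integration.integrable_bound[OF u2])
    have "(u x)\<^sup>2 * v x \<le> (u x)\<^sup>2 * 1" for x by (intro mult_left_mono) (auto simp: v_def)
    then show "AE x in lborel. norm ((u x)\<^sup>2 * v x) \<le> norm ((u x)\<^sup>2)" by (simp add: v_def)
  qed simp
  have "AE x in lborel. (u x)\<^sup>2 * v x = 0"
    using z integral_nonneg_eq_0_iff_AE[OF i] by (simp add: v_def)
  then show ?thesis by eventually_elim (simp add: v_def)
qed

end

section \<open>From weak solutions to Borel representatives\<close>

lemma is_fourier_transform_AE_imp:
  assumes ft: "is_fourier_transform u g" and u': "u' \<in> borel_measurable lebesgue"
    and ae: "AE x in lebesgue. u x = u' x"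
  shows "is_fourier_transform u' g"
  unfolding is_fourier_transform_def
proof (intro conjI ballI u')
  show "g \<in> borel_measurable lebesgue" using ft by (simp add: is_fourier_transform_def)
  have um: "u \<in> borel_measurable lebesgue" using ft by (simp add: is_fourier_transform_def)
  fix \<psi> :: "real^3 \<Rightarrow> complex" assume \<psi>: "\<psi> \<in> schwartz"
  note \<psi>m = nice_borel[OF schwartz_nice[OF \<psi>]]
  have "fourier_schwartz \<psi> \<in> borel_measurable lebesgue"
    unfolding fourier_schwartz_eq_ft[OF \<psi>m, abs_def] by (rule borel_imp_lebesgue[OF ft_borel[OF \<psi>m]])
  note m = this
  have m1: "(\<lambda>x. complex_of_real (u x) * fourier_schwartz \<psi> x) \<in> borel_measurable lebesgue" using um m by measurable
  have m2: "(\<lambda>x. complex_of_real (u' x) * fourier_schwartz \<psi> x) \<in> borel_measurable lebesgue" using u' m by measurable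
  have e: "AE x in lebesgue. complex_of_real (u x) * fourier_schwartz \<psi> x = of_real (u' x) * fourier_schwartz \<psi> x"
    using ae by eventually_elim simp
  have I: "integrable lebesgue (\<lambda>x. of_real (u x) * fourier_schwartz \<psi> x)" "integrable lebesgue (\<lambda>\<xi>. g \<xi> * \<psi> \<xi>)"
    "(LINT x|lebesgue. of_real (u x) * fourier_schwartz \<psi> x) = (LINT \<xi>|lebesgue. g \<xi> * \<psi> \<xi>)"
    using ft \<psi> by (auto simp: is_fourier_transform_def)
  show "integrable lebesgue (\<lambda>x. of_real (u' x) * fourier_schwartz \<psi> x)" using I(1) integrable_cong_AE[OF m1 m2 e] by simp
  show "integrable lebesgue (\<lambda>\<xi>. g \<xi> * \<psi> \<xi>)" by (rule I)
  show "(LINT x|lebesgue. of_real (u' x) * fourier_schwartz \<psi> x) = (LINT \<xi>|lebesgue. g \<xi> * \<psi> \<xi>)"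
    using integral_cong_AE[OF m1 m2 e] I(3) by simp
qed

lemma is_fourier_transform_AE:
  assumes m: "u \<in> borel_measurable lebesgue" "u' \<in> borel_measurable lebesgue" and ae: "AE x in lebesgue. u x = u' x"
  shows "is_fourier_transform u = is_fourier_transform u'"
proof (rule ext, rule iffI)
  fix g
  have "AE x in lebesgue. u' x = u x" using ae by eventually_elim simp
  note ae' = this
  show "is_fourier_transform u' g \<Longrightarrow> is_fourier_transform u g" by (rule is_fourier_transform_AE_imp[OF _ m(1) ae'])
  show "is_fourier_transform u g \<Longrightarrow> is_fourier_transform u' g" by (rule is_fourier_transform_AE_imp[OF _ m(2) ae])
qed

lemma Lp_AE_real:
  fixes f g :: "real^3 \<Rightarrow> real"
  assumes f: "f \<in> Lp q" and g: "g \<in> borel_measurable lebesgue" and ae: "AE x in lebesgue. f x = g x"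
  shows "g \<in> Lp q"
proof -
  have fm: "f \<in> borel_measurable lebesgue" and fi: "integrable lebesgue (\<lambda>x. norm (f x) powr q)" using f by (auto simp: Lp_def)
  have m: "(\<lambda>x. norm (f x) powr q) \<in> borel_measurable lebesgue" "(\<lambda>x. norm (g x) powr q) \<in> borel_measurable lebesgue"
    using fm g by measurable
  have "AE x in lebesgue. norm (f x) powr q = norm (g x) powr q" using ae by eventually_elim simp
  then show ?thesis using integrable_cong_AE[OF m] fi g by (simp add: Lp_def)
qed

lemma integral_lebesgue_lborel:
  fixes f g :: "real^3 \<Rightarrow> real"
  assumes f: "f \<in> borel_measurable lebesgue" and g: "g \<in> borel_measurable borel" and ae: "AE x in lebesgue. f x = g x"
  shows "(LINT x|lebesgue. f x) = (LINT x|lborel. g x)"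
proof -
  have "(LINT x|lebesgue. f x) = (LINT x|lebesgue. g x)"
    by (rule integral_cong_AE[OF f borel_imp_lebesgue[OF g] ae])
  also have "\<dots> = (LINT x|lborel. g x)" using g by (intro integral_completion) simp
  finally show ?thesis .
qed

lemma weak_solution_weak_pair:
  assumes s: "3 / 4 < s" "s < 1" and p: "p = crit_exp s - 1"
    and V: "(\<exists>c>0. V = (\<lambda>_. c)) \<or> (V1 s V \<and> V2 V)" and sol: "weak_solution s p V u \<phi>"
  obtains u' \<phi>' U \<Phi> where "weak_pair s V u' \<phi>' U \<Phi>" "AE x in lborel. u x = u' x" "AE x in lborel. \<phi> x = \<phi>' x"
proof -
  have uH: "u \<in> Hspace s" and \<phi>D: "\<phi> \<in> Dspace s"
    and e1: "\<And>v. v \<in> Dspace s \<Longrightarrow> (LINT x|lebesgue. frac_laplacian (s / 2) \<phi> x * frac_laplacian (s / 2) v x) = (LINT x|lebesgue. (u x)\<^sup>2 * v x)"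
    and e2: "\<And>v. v \<in> Hspace s \<Longrightarrow> (LINT x|lebesgue. frac_laplacian (s / 2) u x * frac_laplacian (s / 2) v x
            + V x * u x * v x + \<phi> x * u x * v x - \<bar>u x\<bar> powr (p - 1) * u x * v x) = 0"
    using sol by (auto simp: weak_solution_def)
  have um: "u \<in> borel_measurable lebesgue" and \<phi>m: "\<phi> \<in> borel_measurable lebesgue"
    using uH \<phi>D by (auto simp: Hspace_def Dspace_def Lp_def)
  obtain u' where u'm: "u' \<in> borel_measurable borel" and u': "AE x in lborel. u x = u' x"
    by (rule borel_version_real[OF um])
  obtain \<phi>' where \<phi>'m: "\<phi>' \<in> borel_measurable borel" and \<phi>': "AE x in lborel. \<phi> x = \<phi>' x"
    by (rule borel_version_real[OF \<phi>m])
  note u'e = AE_completion[OF u'] and \<phi>'e = AE_completion[OF \<phi>']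
  note u'l = borel_imp_lebesgue[OF u'm] and \<phi>'l = borel_imp_lebesgue[OF \<phi>'m]
  note uft = is_fourier_transform_AE[OF um u'l u'e] and \<phi>ft = is_fourier_transform_AE[OF \<phi>m \<phi>'l \<phi>'e]
  have uL: "u \<in> Lp 2" and \<phi>L: "\<phi> \<in> Lp (crit_exp s)" using uH \<phi>D by (auto simp: Hspace_def Dspace_def)
  have u'H: "u' \<in> Hspace s" using uH Lp_AE_real[OF uL u'l u'e] by (simp add: Hspace_def uft)
  have \<phi>'D: "\<phi>' \<in> Dspace s" using \<phi>D Lp_AE_real[OF \<phi>L \<phi>'l \<phi>'e] by (simp add: Dspace_def \<phi>ft)
  have ul: "frac_laplacian (s / 2) u = frac_laplacian (s / 2) u'" unfolding frac_laplacian_def uft ..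
  have \<phi>l: "frac_laplacian (s / 2) \<phi> = frac_laplacian (s / 2) \<phi>'" unfolding frac_laplacian_def \<phi>ft ..
  have s0: "s > 0" "s < 2" using s by auto
  obtain U where U: "frac_deriv s u' U" by (rule frac_deriv_exists[OF u'm s0(1) disjI1[OF u'H]])
  obtain \<Phi> where \<Phi>: "frac_deriv s \<phi>' \<Phi>" by (rule frac_deriv_exists[OF \<phi>'m s0(1) disjI2[OF \<phi>'D]])
  note Um = frac_laplacian_AE(1)[OF U] and Ue = AE_completion[OF frac_laplacian_AE(2)[OF U]]
  note \<Phi>m = frac_laplacian_AE(1)[OF \<Phi>] and \<Phi>e = AE_completion[OF frac_laplacian_AE(2)[OF \<Phi>]]
  have Vm: "V \<in> borel_measurable borel"
    using potential_facts(2)[OF s V] by (rule borel_measurable_continuous_onI)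
  have "weak_pair s V u' \<phi>' U \<Phi>"
  proof
    show "3 / 4 < s" "s < 1" by (rule s)+
    show "(\<exists>c>0. V = (\<lambda>_. c)) \<or> (V1 s V \<and> V2 V)" by (rule V)
    show "frac_deriv s u' U" "frac_deriv s \<phi>' \<Phi>" by (rule U, rule \<Phi>)
    show "integrable lborel (\<lambda>x. (u' x)\<^sup>2)"
      using Lp_AE_real[OF uL u'l u'e] Lp_iff_borel[OF u'm, of 2] by (simp add: norm_powr_2)
    show "integrable lborel (\<lambda>x. \<bar>\<phi>' x\<bar> powr crit_exp s)"
      using Lp_AE_real[OF \<phi>L \<phi>'l \<phi>'e] Lp_iff_borel[OF \<phi>'m, of "crit_exp s"] by simp
  next
    fix v Z assume v: "frac_deriv s v Z" and vq: "integrable lborel (\<lambda>x. \<bar>v x\<bar> powr crit_exp s)"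
    note vm = frac_deriv_borel(1)[OF v] and Zm = frac_deriv_borel(2)[OF v]
    note lm = frac_laplacian_AE(1)[OF v] and le = AE_completion[OF frac_laplacian_AE(2)[OF v]]
    have "(LINT x|lborel. \<Phi> x * Z x) = (LINT x|lebesgue. frac_laplacian (s / 2) \<phi>' x * frac_laplacian (s / 2) v x)"
    proof (rule integral_lebesgue_lborel[symmetric])
      show "(\<lambda>x. frac_laplacian (s / 2) \<phi>' x * frac_laplacian (s / 2) v x) \<in> borel_measurable lebesgue"
        by (rule borel_measurable_times[OF \<Phi>m lm])
      show "(\<lambda>x. \<Phi> x * Z x) \<in> borel_measurable borel"
        by (rule borel_measurable_times[OF frac_deriv_borel(2)[OF \<Phi>] Zm])
      show "AE x in lebesgue. frac_laplacian (s / 2) \<phi>' x * frac_laplacian (s / 2) v x = \<Phi> x * Z x"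
        using \<Phi>e le by eventually_elim simp
    qed
    also have "\<dots> = (LINT x|lebesgue. (u x)\<^sup>2 * v x)"
      using e1[OF frac_deriv_Dspace[OF v vq]] unfolding \<phi>l .
    also have "\<dots> = (LINT x|lborel. (u' x)\<^sup>2 * v x)"
    proof (rule integral_lebesgue_lborel)
      show "(\<lambda>x. (u x)\<^sup>2 * v x) \<in> borel_measurable lebesgue"
        by (intro borel_measurable_times borel_measurable_power um borel_imp_lebesgue[OF vm])
      show "(\<lambda>x. (u' x)\<^sup>2 * v x) \<in> borel_measurable borel"
        by (intro borel_measurable_times borel_measurable_power u'm vm)
      show "AE x in lebesgue. (u x)\<^sup>2 * v x = (u' x)\<^sup>2 * v x" using u'e by eventually_elim simp
    qed
    finally show "(LINT x|lborel. \<Phi> x * Z x) = (LINT x|lborel. (u' x)\<^sup>2 * v x)" .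
  next
    fix v Z assume v: "frac_deriv s v Z" and v2: "integrable lborel (\<lambda>x. (v x)\<^sup>2)"
    note vm = frac_deriv_borel(1)[OF v] and Zm = frac_deriv_borel(2)[OF v] and Um' = frac_deriv_borel(2)[OF U]
    note lm = frac_laplacian_AE(1)[OF v] and le = AE_completion[OF frac_laplacian_AE(2)[OF v]]
    have r: "p - 1 = crit_exp s - 2" by (simp add: p)
    have "(LINT x|lebesgue. frac_laplacian (s / 2) u' x * frac_laplacian (s / 2) v x
            + V x * u x * v x + \<phi> x * u x * v x - \<bar>u x\<bar> powr (crit_exp s - 2) * u x * v x)
        = (LINT x|lborel. U x * Z x + V x * u' x * v x + \<phi>' x * u' x * v x - \<bar>u' x\<bar> powr (crit_exp s - 2) * u' x * v x)"
    proof (rule integral_lebesgue_lborel)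
      note [measurable] = Um lm um \<phi>m borel_imp_lebesgue[OF vm] borel_imp_lebesgue[OF Vm]
      show "(\<lambda>x. frac_laplacian (s / 2) u' x * frac_laplacian (s / 2) v x
            + V x * u x * v x + \<phi> x * u x * v x - \<bar>u x\<bar> powr (crit_exp s - 2) * u x * v x) \<in> borel_measurable lebesgue"
        by measurable
    next
      note [measurable] = Um' Zm u'm \<phi>'m vm Vm
      show "(\<lambda>x. U x * Z x + V x * u' x * v x + \<phi>' x * u' x * v x - \<bar>u' x\<bar> powr (crit_exp s - 2) * u' x * v x) \<in> borel_measurable borel"
        by measurable
    next
      show "AE x in lebesgue. frac_laplacian (s / 2) u' x * frac_laplacian (s / 2) v x
            + V x * u x * v x + \<phi> x * u x * v x - \<bar>u x\<bar> powr (crit_exp s - 2) * u x * v x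
          = U x * Z x + V x * u' x * v x + \<phi>' x * u' x * v x - \<bar>u' x\<bar> powr (crit_exp s - 2) * u' x * v x"
        using Ue le u'e \<phi>'e by eventually_elim simp
    qed
    then show "(LINT x|lborel. U x * Z x + V x * u' x * v x + \<phi>' x * u' x * v x - \<bar>u' x\<bar> powr (crit_exp s - 2) * u' x * v x) = 0"
      using e2[OF frac_deriv_Hspace[OF v v2 s0]] unfolding ul r by simp
  qed
  then show thesis using u' \<phi>' by (rule that)
qed

section \<open>Nonexistence of nontrivial solutions\<close>

theorem theorem1p7:
  fixes s p :: real and V u \<phi> :: "real^3 \<Rightarrow> real"
  assumes "3 / 4 < s" and "s < 1"
    and "p = crit_exp s - 1"
    and "(\<exists>c>0. V = (\<lambda>_. c)) \<or> (V1 s V \<and> V2 V)"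
    and "weak_solution s p V u \<phi>"
  shows "(AE x in lebesgue. u x = 0) \<and> (AE x in lebesgue. \<phi> x = 0)"
proof -
  obtain u' \<phi>' U \<Phi> where "weak_pair s V u' \<phi>' U \<Phi>"
    and u': "AE x in lborel. u x = u' x" and \<phi>': "AE x in lborel. \<phi> x = \<phi>' x"
    by (rule weak_solution_weak_pair[OF assms])
  then interpret weak_pair s V u' \<phi>' U \<Phi> by simp
  have "AE x in lborel. u x = 0" using u' solution_zero by eventually_elim simp
  moreover have "AE x in lborel. \<phi> x = 0" using \<phi>' potential_zero by eventually_elim simp
  ultimately show ?thesis by (blast intro: AE_completion)
qed

end
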